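(* The solutions $Y^\epsilon$ satisfy the weak large deviation principle with the rate function $\tilde I$ and speed $\log(1/\epsilon)$; that is, for every open set $G\subset\mathbb{D}$ and every compact set $K\subset\mathbb{D}$, $$-\inf_{x\in G}\tilde I(x)\le\liminf_{\epsilon\to0}\frac{\log\mathbb{P}(Y^\epsilon\in G)}{\log(1/\epsilon)},\qquad \limsup_{\epsilon\to0}\frac{\log\mathbb{P}(Y^\epsilon\in K)}{\log(1/\epsilon)}\le-\inf_{x\in K}\tilde I(x).$$
   Context: Skorokhod space: $\mathbb{D}=\mathbb{D}([0,1])$ is the space of real-valued right-continuous functions with left limits on $[0,1]$, with the Skorokhod $J_1$ metric $d(x,y)=\inf_{\lambda\in\Lambda}\|\lambda-e\|\vee\|x\circ\lambda-y\|$, where $\Lambda$ is the set of increasing homeomorphisms of $[0,1]$ onto itself, $e$ is the identity and $\|\cdot\|$ is the uniform norm. Open and compact are with respect to $d$. Noise and SDE: $\alpha,\beta>1$ are constants and $\nu$ is a L\'evy measure on $\mathbb{R}\setminus\{0\}$ with $\nu([x,\infty))=L_+(x)x^{-\alpha}$ and $\nu((-\infty,-x])=L_-(x)x^{-\beta}$ for all $x>0$, where $L_\pm>0$ are slowly varying: $\lim_{u\to\infty}L_\pm(\lambda u)/L_\pm(u)=1$ for every $\lambda>0$. For $\epsilon>0$, $\epsilon L^\epsilon_t=\sqrt\epsilon B_t+\epsilon\int_0^t\int_{\mathbb{R}\setminus\{0\}}z\,\widetilde N^{1/\epsilon}(ds,dz)$, where $B$ is a standard Brownian motion and $\widetilde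 N^{1/\epsilon}$ is a compensated Poisson random measure, independent of $B$, with compensator $\epsilon^{-1}ds\otimes\nu$, all defined on a complete probability space $(\Omega,\mathcal F,\mathbb{P})$. The function $b:\mathbb{R}\to\mathbb{R}$ is bounded and Lipschitz continuous, and $Y^\epsilon=(Y^\epsilon_t)_{t\in[0,1]}$ is the pathwise unique solution of $dY^\epsilon_t=b(Y^\epsilon_t)\,dt+\epsilon\,dL^\epsilon_t$, $t\in(0,1]$, $Y^\epsilon_0=0$. Solution map: $F:\mathbb{D}\to\mathbb{D}$ sends $g$ to the unique $f=F(g)\in\mathbb{D}$ with $f(t)=\int_0^t b(f(s))\,ds+g(t)$ for $t\in[0,1]$. Rate function: a rate function on $\mathbb{D}$ is a lower semicontinuous function $\mathbb{D}\to[0,\infty]$. The function $\tilde I:\mathbb{D}\to[0,\infty]$ is defined by $\tilde I(\xi)=(\alpha-1)\mathcal D_+(\xi)+(\beta-1)\mathcal D_-(\xi)$ if $\xi=F(\eta)$ for a step function $\eta$ (finitely many jumps) with $\eta(0)=0$, and $\tilde I(\xi)=\infty$ otherwise, where $\mathcal D_+(\xi)$ and $\mathcal D_-(\xi)$ count the upward and downward jumps of $\xi$. Convention: $\inf\emptyset=\infty$, $\log 0=-\infty$.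
   Formalization: In the rate function, step functions η may jump only at times in (0,1); a jump at time 1 gives rate ∞. With such jumps allowed the lower bound fails: for b=0 and G a small ball around 1_{t=1}, every path in G jumps at time 1, which has probability 0. *)

theory Defs
  imports "HOL-Probability.Probability"
begin

section \<open>The Skorokhod space\<close>

text \<open>
  Functions on \<open>[0,1]\<close> are represented by functions on \<^typ>\<open>real\<close> that are
  \<^const>\<open>undefined\<close> outside \<open>[0,1]\<close>, so that each one has exactly one representative.
\<close>

typedef skorokhod =
  "{f :: real \<Rightarrow> real. f \<in> extensional {0..1} \<and>
      (\<forall>t\<in>{0..<1}. (f \<longlongrightarrow> f t) (at_right t)) \<and>
      (\<forall>t\<in>{0<..1}. \<exists>l. (f \<longlongrightarrow> l) (at_left t))}"
  morphisms sk_fun Abs_skorokhod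
  by (rule exI[of _ "\<lambda>_. undefined"]) (auto simp: extensional_def)

definition unif_norm :: "(real \<Rightarrow> real) \<Rightarrow> real" where
  "unif_norm f = (SUP t\<in>{0..1}. \<bar>f t\<bar>)"

definition time_changes :: "(real \<Rightarrow> real) set" where
  "time_changes = {l. strict_mono_on {0..1} l \<and> (\<exists>k. homeomorphism {0..1} {0..1} l k)}"

definition J1_cost :: "(real \<Rightarrow> real) \<Rightarrow> skorokhod \<Rightarrow> skorokhod \<Rightarrow> real" where
  "J1_cost l x y =
     max (unif_norm (\<lambda>t. l t - t)) (unif_norm (\<lambda>t. sk_fun x (l t) - sk_fun y t))"

lemma sk_fun_right_tendsto: "0 \<le> t \<Longrightarrow> t < 1 \<Longrightarrow> (sk_fun x \<longlongrightarrow> sk_fun x t) (at_right t)"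
  using sk_fun[of x] by auto

lemma sk_fun_left_tendsto: "0 < t \<Longrightarrow> t \<le> 1 \<Longrightarrow> \<exists>l. (sk_fun x \<longlongrightarrow> l) (at_left t)"
  using sk_fun[of x] by auto

lemma sk_fun_eqI:
  assumes "\<And>t. t \<in> {0..1} \<Longrightarrow> sk_fun x t = sk_fun y t"
  shows "x = y"
proof -
  have "sk_fun x = sk_fun y"
    using sk_fun[of x] sk_fun[of y] assms by (intro extensionalityI[of _ "{0..1}"]) auto
  then show ?thesis by (simp add: sk_fun_inject)
qed

lemma sk_fun_bounded: "\<exists>C. \<forall>t\<in>{0..1}. \<bar>sk_fun x t\<bar> \<le> C"
proof -
  let ?f = "sk_fun x"
  have loc: "\<exists>d>0. \<exists>C. \<forall>s\<in>{0..1}. \<bar>s - t\<bar> < d \<longrightarrow> \<bar>?f s\<bar> \<le> C" if t: "t \<in> {0..1}" for t :: real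
  proof -
    have R: "\<exists>d>0. \<exists>C. \<forall>s\<in>{0..1}. t < s \<and> s < t + d \<longrightarrow> \<bar>?f s\<bar> \<le> C"
    proof (cases "t < 1")
      case True
      then have "(?f \<longlongrightarrow> ?f t) (at_right t)" using sk_fun_right_tendsto t by auto
      then have "\<forall>\<^sub>F s in at_right t. dist (?f s) (?f t) < 1" by (rule tendstoD) simp
      then obtain b where b: "b > t" "\<And>s. t < s \<Longrightarrow> s < b \<Longrightarrow> dist (?f s) (?f t) < 1"
        unfolding eventually_at_right[OF True] by blast
      show ?thesis
        by (rule exI[of _ "b - t"], rule conjI, use b in simp, rule exI[of _ "\<bar>?f t\<bar> + 1"])
          (use b in \<open>force simp: dist_real_def\<close>)
    qed (rule exI[of _ 1], auto)
    have L: "\<exists>d>0. \<exists>C. \<forall>s\<in>{0..1}. t - d < s \<and> s < t \<longrightarrow> \<bar>?f s\<bar> \<le> C"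
    proof (cases "0 < t")
      case True
      then obtain l where "(?f \<longlongrightarrow> l) (at_left t)" using sk_fun_left_tendsto t by auto
      then have "\<forall>\<^sub>F s in at_left t. dist (?f s) l < 1" by (rule tendstoD) simp
      then obtain b where b: "b < t" "\<And>s. b < s \<Longrightarrow> s < t \<Longrightarrow> dist (?f s) l < 1"
        unfolding eventually_at_left[OF True] by blast
      show ?thesis
        by (rule exI[of _ "t - b"], rule conjI, use b in simp, rule exI[of _ "\<bar>l\<bar> + 1"])
          (use b in \<open>force simp: dist_real_def\<close>)
    qed (rule exI[of _ 1], auto)
    from R obtain d1 C1 where 1: "d1 > 0" "\<And>s. s \<in> {0..1} \<Longrightarrow> t < s \<Longrightarrow> s < t + d1 \<Longrightarrow> \<bar>?f s\<bar> \<le> C1"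
      by blast
    from L obtain d2 C2 where 2: "d2 > 0" "\<And>s. s \<in> {0..1} \<Longrightarrow> t - d2 < s \<Longrightarrow> s < t \<Longrightarrow> \<bar>?f s\<bar> \<le> C2"
      by blast
    have "\<bar>?f s\<bar> \<le> max (max C1 C2) \<bar>?f t\<bar>" if "s \<in> {0..1}" "\<bar>s - t\<bar> < min d1 d2" for s
      using 1(2)[of s] 2(2)[of s] that by (cases s t rule: linorder_cases) auto
    then have "\<forall>s\<in>{0..1}. \<bar>s - t\<bar> < min d1 d2 \<longrightarrow> \<bar>?f s\<bar> \<le> max (max C1 C2) \<bar>?f t\<bar>" by blast
    moreover have "min d1 d2 > 0" using 1(1) 2(1) by simp
    ultimately show ?thesis by blast
  qed
  define U where "U = {V. open V \<and> (\<exists>C. \<forall>s\<in>V \<inter> {0..1}. \<bar>?f s\<bar> \<le> C)}"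
  have "{0..1} \<subseteq> \<Union>U"
  proof
    fix t :: real assume t: "t \<in> {0..1}"
    from loc[OF t] obtain d C where "d > 0" "\<forall>s\<in>{0..1}. \<bar>s - t\<bar> < d \<longrightarrow> \<bar>?f s\<bar> \<le> C" by blast
    then have "ball t d \<in> U" "t \<in> ball t d"
      by (auto simp: U_def dist_real_def abs_minus_commute intro!: exI[of _ C])
    then show "t \<in> \<Union>U" by blast
  qed
  then obtain W where W: "W \<subseteq> U" "finite W" "{0..1} \<subseteq> \<Union>W"
    using compactE[of "{0..1::real}" U] unfolding U_def by (metis (mono_tags, lifting) compact_Icc mem_Collect_eq)
  have "\<forall>V\<in>W. \<exists>C. \<forall>s\<in>V \<inter> {0..1}. \<bar>?f s\<bar> \<le> C" using W by (auto simp: U_def)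
  then obtain C where C: "\<And>V s. V \<in> W \<Longrightarrow> s \<in> V \<inter> {0..1} \<Longrightarrow> \<bar>?f s\<bar> \<le> C V" by metis
  have "\<bar>?f t\<bar> \<le> (\<Sum>V\<in>W. \<bar>C V\<bar>)" if "t \<in> {0..1}" for t
  proof -
    from that W obtain V where V: "V \<in> W" "t \<in> V" by blast
    then have "\<bar>?f t\<bar> \<le> \<bar>C V\<bar>" using C[of V t] that by auto
    also have "\<dots> \<le> (\<Sum>V\<in>W. \<bar>C V\<bar>)" using V W by (intro member_le_sum) auto
    finally show ?thesis .
  qed
  then show ?thesis by blast
qed

lemma time_changesD:
  assumes "l \<in> time_changes"
  shows "strict_mono_on {0..1} l" "l ` {0..1} = {0..1}" "\<And>t. t \<in> {0..1} \<Longrightarrow> l t \<in> {0..1}"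
  using assms by (auto simp: time_changes_def homeomorphism_def)

lemma id_time_change: "(\<lambda>t. t) \<in> time_changes"
  unfolding time_changes_def homeomorphism_def by (auto simp: strict_mono_on_def intro!: exI[of _ "\<lambda>t. t"])

lemma time_change_inverse:
  assumes "l \<in> time_changes"
  obtains k where "k \<in> time_changes" "\<And>t. t \<in> {0..1} \<Longrightarrow> k (l t) = t" "\<And>t. t \<in> {0..1} \<Longrightarrow> l (k t) = t"
proof -
  from assms obtain k where h: "homeomorphism {0..1} {0..1} l k" by (auto simp: time_changes_def)
  have sm: "strict_mono_on {0..1} l" using assms time_changesD by blast
  have "strict_mono_on {0..1} k"
  proof (rule strict_mono_onI)
    fix r s :: real assume rs: "r \<in> {0..1}" "s \<in> {0..1}" "r < s"
    have "k r \<in> {0..1}" "k s \<in> {0..1}" "l (k r) = r" "l (k s) = s"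
      using h rs by (auto simp: homeomorphism_def)
    then show "k r < k s"
      using sm rs by (metis linorder_neqE strict_mono_onD less_asym)
  qed
  moreover have "homeomorphism {0..1} {0..1} k l" using h by (rule homeomorphism_symD)
  ultimately have "k \<in> time_changes" by (auto simp: time_changes_def)
  then show ?thesis using that h by (auto simp: homeomorphism_def)
qed

lemma time_change_comp:
  assumes "l \<in> time_changes" "k \<in> time_changes"
  shows "(\<lambda>t. l (k t)) \<in> time_changes"
proof -
  from assms obtain l' k' where "homeomorphism {0..1} {0..1} l l'" "homeomorphism {0..1} {0..1} k k'"
    by (auto simp: time_changes_def)
  then have "homeomorphism {0..1} {0..1} (l \<circ> k) (k' \<circ> l')" by (rule homeomorphism_compose[rotated])
  moreover have "strict_mono_on {0..1} (l \<circ> k)"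
    using time_changesD[OF assms(1)] time_changesD[OF assms(2)]
    by (auto simp: strict_mono_on_def)
  ultimately show ?thesis by (auto simp: time_changes_def comp_def)
qed

lemma time_change_one:
  assumes "l \<in> time_changes" shows "l 1 = 1"
proof (rule ccontr)
  assume ne: "l 1 \<noteq> 1"
  have "1 \<in> l ` {0..1}" using time_changesD[OF assms] by simp
  then obtain s where s: "s \<in> {0..1}" "l s = 1" by auto
  then have "s < 1" using ne by (cases "s = 1") auto
  then have "l s < l 1" using s by (intro strict_mono_onD[OF time_changesD(1)[OF assms]]) auto
  then show False using s time_changesD(3)[OF assms, of 1] by auto
qed

lemma unif_norm_le_iff:
  assumes "\<And>t. t \<in> {0..1} \<Longrightarrow> \<bar>f t\<bar> \<le> C"
  shows "unif_norm f \<le> c \<longleftrightarrow> (\<forall>t\<in>{0..1}. \<bar>f t\<bar> \<le> c)"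
  unfolding unif_norm_def using assms
  by (subst cSUP_le_iff) (auto intro!: bdd_aboveI2[where M = C])

lemma J1_cost_le_iff:
  assumes "l \<in> time_changes"
  shows "J1_cost l x y \<le> c \<longleftrightarrow>
    (\<forall>t\<in>{0..1}. \<bar>l t - t\<bar> \<le> c \<and> \<bar>sk_fun x (l t) - sk_fun y t\<bar> \<le> c)"
proof -
  obtain C D where "\<And>t. t \<in> {0..1} \<Longrightarrow> \<bar>sk_fun x t\<bar> \<le> C" "\<And>t. t \<in> {0..1} \<Longrightarrow> \<bar>sk_fun y t\<bar> \<le> D"
    using sk_fun_bounded by metis
  then have 1: "\<bar>sk_fun x (l t) - sk_fun y t\<bar> \<le> C + D" if "t \<in> {0..1}" for t
    using time_changesD(3)[OF assms that] that by (smt (verit))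
  have 2: "\<bar>l t - t\<bar> \<le> 1" if "t \<in> {0..1}" for t
    using time_changesD(3)[OF assms that] that by auto
  show ?thesis
    unfolding J1_cost_def max.bounded_iff
    by (subst unif_norm_le_iff[OF 1], assumption, subst unif_norm_le_iff[OF 2], assumption) blast
qed

lemma J1_cost_nonneg:
  assumes "l \<in> time_changes" shows "0 \<le> J1_cost l x y"
  using J1_cost_le_iff[OF assms, of x y "J1_cost l x y"]
  by (meson abs_ge_zero atLeastAtMost_iff order.refl order.trans zero_le_one)

instantiation skorokhod :: metric_space
begin

definition dist_skorokhod :: "skorokhod \<Rightarrow> skorokhod \<Rightarrow> real" where
  "dist_skorokhod x y = (INF l\<in>time_changes. J1_cost l x y)"

definition uniformity_skorokhod :: "(skorokhod \<times> skorokhod) filter" where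
  "uniformity_skorokhod = (INF e\<in>{0<..}. principal {(x, y). dist x y < e})"

definition open_skorokhod :: "skorokhod set \<Rightarrow> bool" where
  "open_skorokhod U = (\<forall>x\<in>U. \<forall>\<^sub>F (x', y) in uniformity. x' = x \<longrightarrow> y \<in> U)"

instance
proof
  have bdd: "bdd_below ((\<lambda>l. J1_cost l x y) ` time_changes)" for x y
    using J1_cost_nonneg by (auto intro!: bdd_belowI2[where m = 0])
  have ne: "time_changes \<noteq> {}" using id_time_change by blast
  have less: "dist x y < r \<Longrightarrow> \<exists>l\<in>time_changes. J1_cost l x y < r" for x y :: skorokhod and r
    unfolding dist_skorokhod_def by (simp add: cINF_less_iff[OF ne bdd])
  have upper: "l \<in> time_changes \<Longrightarrow> dist x y \<le> J1_cost l x y" for x y :: skorokhod and l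
    unfolding dist_skorokhod_def by (rule cINF_lower[OF bdd])
  have nonneg: "0 \<le> dist x y" for x y :: skorokhod
    unfolding dist_skorokhod_def using J1_cost_nonneg by (intro cINF_greatest[OF ne])
  show "dist x y = 0 \<longleftrightarrow> x = y" for x y :: skorokhod
  proof
    assume "x = y"
    then have "J1_cost (\<lambda>t. t) x y \<le> 0" by (subst J1_cost_le_iff[OF id_time_change]) auto
    then show "dist x y = 0" using upper[OF id_time_change, of x y] nonneg[of x y] by linarith
  next
    assume d: "dist x y = 0"
    have near: "\<exists>l\<in>time_changes. \<forall>t\<in>{0..1}. \<bar>l t - t\<bar> \<le> e \<and> \<bar>sk_fun x (l t) - sk_fun y t\<bar> \<le> e"
      if "e > 0" for e
      using less[of x y e] d that J1_cost_le_iff[of _ x y e] by fastforce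
    show "x = y"
    proof (rule sk_fun_eqI)
      fix t :: real assume t: "t \<in> {0..1}"
      have "\<bar>sk_fun x t - sk_fun y t\<bar> \<le> e" if e: "e > 0" for e
      proof (cases "t = 1")
        case True
        then show ?thesis using near[OF e] time_change_one t by fastforce
      next
        case False
        then have t1: "t < 1" using t by auto
        have "\<forall>\<^sub>F s in at_right t. dist (sk_fun x s) (sk_fun x t) < e/3"
          using sk_fun_right_tendsto[of t x] t t1 e by (intro tendstoD) auto
        moreover have "\<forall>\<^sub>F s in at_right t. dist (sk_fun y s) (sk_fun y t) < e/3"
          using sk_fun_right_tendsto[of t y] t t1 e by (intro tendstoD) auto
        ultimately have "\<forall>\<^sub>F s in at_right t. dist (sk_fun x s) (sk_fun x t) < e/3 \<and> dist (sk_fun y s) (sk_fun y t) < e/3"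
          by eventually_elim auto
        then obtain b where b: "b > t" "\<And>s. t < s \<Longrightarrow> s < b \<Longrightarrow>
            \<bar>sk_fun x s - sk_fun x t\<bar> < e/3 \<and> \<bar>sk_fun y s - sk_fun y t\<bar> < e/3"
          unfolding eventually_at_right[OF t1] dist_real_def by blast
        define h where "h = (min b 1 - t) / 2"
        have h: "h > 0" "t + h < b" "t + h < 1" "t + 2 * h \<le> b" using b t1 by (auto simp: h_def min_def field_simps)
        obtain l where l: "\<forall>s\<in>{0..1}. \<bar>l s - s\<bar> \<le> min (e/3) (h/2) \<and> \<bar>sk_fun x (l s) - sk_fun y s\<bar> \<le> min (e/3) (h/2)"
          using near[of "min (e/3) (h/2)"] e h by auto
        have th: "t + h \<in> {0..1}" using t h by auto
        have "\<bar>l (t + h) - (t + h)\<bar> \<le> h/2" "\<bar>sk_fun x (l (t + h)) - sk_fun y (t + h)\<bar> \<le> e/3" using l th by auto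
        moreover from this have "t < l (t + h)" "l (t + h) < b" using h by linarith+
        ultimately show ?thesis using b(2)[of "l (t + h)"] b(2)[of "t + h"] h by linarith
      qed
      then show "sk_fun x t = sk_fun y t"
        by (metis abs_le_zero_iff dense_ge eq_iff_diff_eq_0)
    qed
  qed
  show "dist x y \<le> dist x z + dist y z" for x y z :: skorokhod
  proof (rule field_le_epsilon)
    fix e :: real assume e: "e > 0"
    obtain l1 where l1: "l1 \<in> time_changes" "J1_cost l1 x z < dist x z + e/2" using less e by (metis less_add_same_cancel1 half_gt_zero)
    obtain l2 where l2: "l2 \<in> time_changes" "J1_cost l2 y z < dist y z + e/2" using less e by (metis less_add_same_cancel1 half_gt_zero)
    obtain k where k: "k \<in> time_changes" "\<And>t. t \<in> {0..1} \<Longrightarrow> l2 (k t) = t"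
      using time_change_inverse[OF l2(1)] by metis
    have L1: "\<bar>l1 s - s\<bar> \<le> dist x z + e/2 \<and> \<bar>sk_fun x (l1 s) - sk_fun z s\<bar> \<le> dist x z + e/2" if "s \<in> {0..1}" for s
      using J1_cost_le_iff[OF l1(1), of x z] l1(2) that by (meson less_imp_le)
    have L2: "\<bar>l2 s - s\<bar> \<le> dist y z + e/2 \<and> \<bar>sk_fun y (l2 s) - sk_fun z s\<bar> \<le> dist y z + e/2" if "s \<in> {0..1}" for s
      using J1_cost_le_iff[OF l2(1), of y z] l2(2) that by (meson less_imp_le)
    have lk: "(\<lambda>t. l1 (k t)) \<in> time_changes" by (rule time_change_comp[OF l1(1) k(1)])
    have "J1_cost (\<lambda>t. l1 (k t)) x y \<le> dist x z + dist y z + e"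
      unfolding J1_cost_le_iff[OF lk]
    proof
      fix t :: real assume t: "t \<in> {0..1}"
      have kt: "k t \<in> {0..1}" using time_changesD(3)[OF k(1) t] .
      show "\<bar>l1 (k t) - t\<bar> \<le> dist x z + dist y z + e \<and> \<bar>sk_fun x (l1 (k t)) - sk_fun y t\<bar> \<le> dist x z + dist y z + e"
        using L1[OF kt] L2[OF kt] k(2)[OF t] by auto
    qed
    then show "dist x y \<le> dist x z + dist y z + e" using upper[OF lk, of x y] by linarith
  qed
qed (simp_all add: uniformity_skorokhod_def open_skorokhod_def)

end


section \<open>The driving noise\<close>

definition levy_measure :: "real measure \<Rightarrow> bool" where
  "levy_measure \<nu> \<longleftrightarrow> sets \<nu> = sets (restrict_space borel (- {0})) \<and>
     (\<integral>\<^sup>+ z. ennreal (min 1 (z\<^sup>2)) \<partial>\<nu>) < \<infinity>"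

definition slowly_varying :: "(real \<Rightarrow> real) \<Rightarrow> bool" where
  "slowly_varying f \<longleftrightarrow> (\<forall>u>0. f u > 0) \<and>
     (\<forall>c>0. ((\<lambda>u. f (c * u) / f u) \<longlongrightarrow> 1) at_top)"

definition brownian_motion :: "'w measure \<Rightarrow> (real \<Rightarrow> 'w \<Rightarrow> real) \<Rightarrow> bool" where
  "brownian_motion P B \<longleftrightarrow>
     (\<forall>t\<in>{0..1}. B t \<in> borel_measurable P) \<and>
     (AE \<omega> in P. B 0 \<omega> = 0) \<and>
     (AE \<omega> in P. continuous_on {0..1} (\<lambda>t. B t \<omega>)) \<and>
     (\<forall>s t. 0 \<le> s \<and> s < t \<and> t \<le> 1 \<longrightarrow>
        distributed P lborel (\<lambda>\<omega>. B t \<omega> - B s \<omega>) (normal_density 0 (sqrt (t - s)))) \<and>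
     (\<forall>n (\<tau> :: nat \<Rightarrow> real). \<tau> ` {..n} \<subseteq> {0..1} \<and> mono_on {..n} \<tau> \<longrightarrow>
        prob_space.indep_vars P (\<lambda>_. borel) (\<lambda>i \<omega>. B (\<tau> (Suc i)) \<omega> - B (\<tau> i) \<omega>) {..<n})"

definition poisson_random_measure ::
    "'w measure \<Rightarrow> ('w \<Rightarrow> 'e measure) \<Rightarrow> 'e measure \<Rightarrow> bool" where
  "poisson_random_measure P N \<mu> \<longleftrightarrow>
     (\<forall>\<omega>\<in>space P. sets (N \<omega>) = sets \<mu> \<and>
        (\<forall>A\<in>sets \<mu>. emeasure (N \<omega>) A \<in> insert \<infinity> (range of_nat))) \<and>
     (\<forall>A\<in>sets \<mu>. (\<lambda>\<omega>. emeasure (N \<omega>) A) \<in> borel_measurable P) \<and>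
     (\<forall>A\<in>sets \<mu>. emeasure \<mu> A < \<infinity> \<longrightarrow> (\<forall>n.
        measure P {\<omega> \<in> space P. emeasure (N \<omega>) A = of_nat n} =
          exp (- measure \<mu> A) * measure \<mu> A ^ n / fact n)) \<and>
     (\<forall>A\<in>sets \<mu>. emeasure \<mu> A = \<infinity> \<longrightarrow> (AE \<omega> in P. emeasure (N \<omega>) A = \<infinity>)) \<and>
     (\<forall>n (A :: nat \<Rightarrow> 'e set). A ` {..<n} \<subseteq> sets \<mu> \<and> disjoint_family_on A {..<n} \<longrightarrow>
        prob_space.indep_vars P (\<lambda>_. borel) (\<lambda>i \<omega>. emeasure (N \<omega>) (A i)) {..<n})"

definition jump_compensator :: "real \<Rightarrow> real measure \<Rightarrow> (real \<times> real) measure" where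
  "jump_compensator c \<nu> = scale_measure (ennreal c) (restrict_space lborel {0..1} \<Otimes>\<^sub>M \<nu>)"

definition indep_process_random_measure ::
    "'w measure \<Rightarrow> (real \<Rightarrow> 'w \<Rightarrow> real) \<Rightarrow> ('w \<Rightarrow> 'e measure) \<Rightarrow> 'e measure \<Rightarrow> bool" where
  "indep_process_random_measure P B N \<mu> \<longleftrightarrow> prob_space.indep_set P
     (sets (vimage_algebra (space P) (\<lambda>\<omega>. \<lambda>t\<in>{0..1}. B t \<omega>) (PiM {0..1} (\<lambda>_. borel))))
     (sets (vimage_algebra (space P) (\<lambda>\<omega>. \<lambda>A\<in>sets \<mu>. emeasure (N \<omega>) A) (PiM (sets \<mu>) (\<lambda>_. borel))))"

text \<open>
  \<open>X\<close> is a cadlag version of the integral of \<open>z\<close> over \<open>(0,t] \<times> (\<real> - {0})\<close> against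
  the compensated measure \<open>N - \<mu>\<close>. The compensated jumps larger than \<open>\<delta>\<close> are integrated
  pathwise. What remains is the martingale of the jumps of size at most \<open>\<delta>\<close>, which vanishes
  in \<open>L\<^sup>2\<close> as \<open>\<delta>\<close> tends to \<open>0\<close>, even if the large jumps are not square integrable.
  This determines \<open>X\<close> up to indistinguishability.
\<close>

definition compensated_jump_integral ::
    "'w measure \<Rightarrow> ('w \<Rightarrow> (real \<times> real) measure) \<Rightarrow> (real \<times> real) measure \<Rightarrow> ('w \<Rightarrow> skorokhod) \<Rightarrow> bool" where
  "compensated_jump_integral P N \<mu> X \<longleftrightarrow> (\<forall>t\<in>{0..1}.
     (\<lambda>\<omega>. sk_fun (X \<omega>) t) \<in> borel_measurable P \<and>
     ((\<lambda>\<delta>. \<integral>\<^sup>+ \<omega>. ennreal ((sk_fun (X \<omega>) t -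
          ((LINT p : {0<..t} \<times> {z. \<delta> < \<bar>z\<bar>} | N \<omega>. snd p)
            - (LINT p : {0<..t} \<times> {z. \<delta> < \<bar>z\<bar>} | \<mu>. snd p)))\<^sup>2) \<partial>P) \<longlongrightarrow> 0) (at_right 0))"


section \<open>The equation\<close>

text \<open>
  Since the noise is additive, \<open>dY = b(Y) dt + dZ\<close>, \<open>Y(0) = 0\<close> is a pathwise integral equation.
\<close>

definition additive_sde_solution ::
    "'w measure \<Rightarrow> (real \<Rightarrow> real) \<Rightarrow> (real \<Rightarrow> 'w \<Rightarrow> real) \<Rightarrow> ('w \<Rightarrow> skorokhod) \<Rightarrow> bool" where
  "additive_sde_solution P b Z Y \<longleftrightarrow>
     (\<forall>t\<in>{0..1}. (\<lambda>\<omega>. sk_fun (Y \<omega>) t) \<in> borel_measurable P) \<and>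
     (AE \<omega> in P. sk_fun (Y \<omega>) 0 = 0 \<and>
        (\<forall>t\<in>{0..1}. sk_fun (Y \<omega>) t =
           (LINT s : {0..t} | lborel. b (sk_fun (Y \<omega>) s)) + (Z t \<omega> - Z 0 \<omega>)))"

definition solution_map :: "(real \<Rightarrow> real) \<Rightarrow> skorokhod \<Rightarrow> skorokhod" where
  "solution_map b g = (THE f. \<forall>t\<in>{0..1}.
     sk_fun f t = (LINT s : {0..t} | lborel. b (sk_fun f s)) + sk_fun g t)"


section \<open>The rate function\<close>

text \<open>
  The jump times of a step function lie in the open interval \<open>(0,1)\<close>; in particular a step
  function has no jump at the endpoint \<open>1\<close>. Time changes fix \<open>1\<close>, so a function with a jump at
  \<open>1\<close> has a \<open>J\<^sub>1\<close>-neighbourhood of functions that jump at \<open>1\<close>, which \<open>Y\<close> almost surely does not.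
\<close>

definition step_path :: "skorokhod \<Rightarrow> bool" where
  "step_path x \<longleftrightarrow> (\<exists>S. finite S \<and> S \<subseteq> {0<..<1} \<and>
     (\<forall>s\<in>{0..1}. \<forall>t\<in>{0..1}. s < t \<and> S \<inter> {s<..t} = {} \<longrightarrow> sk_fun x s = sk_fun x t))"

definition up_jumps :: "skorokhod \<Rightarrow> nat" where
  "up_jumps x = card {t\<in>{0<..1}. Lim (at_left t) (sk_fun x) < sk_fun x t}"

definition down_jumps :: "skorokhod \<Rightarrow> nat" where
  "down_jumps x = card {t\<in>{0<..1}. sk_fun x t < Lim (at_left t) (sk_fun x)}"

definition jump_rate :: "real \<Rightarrow> real \<Rightarrow> (real \<Rightarrow> real) \<Rightarrow> skorokhod \<Rightarrow> ereal" where
  "jump_rate \<alpha> \<beta> b x =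
     (if \<exists>g. step_path g \<and> sk_fun g 0 = 0 \<and> x = solution_map b g
      then ereal ((\<alpha> - 1) * real (up_jumps x) + (\<beta> - 1) * real (down_jumps x))
      else \<infinity>)"


section \<open>Weak large deviation principle\<close>

definition rate_function :: "('x :: topological_space \<Rightarrow> ereal) \<Rightarrow> bool" where
  "rate_function I \<longleftrightarrow> (\<forall>x. 0 \<le> I x) \<and> (\<forall>a. closed {x. I x \<le> a})"

definition log_prob :: "'w measure \<Rightarrow> 'w set \<Rightarrow> ereal" where
  "log_prob P A = (if measure P A = 0 then -\<infinity> else ereal (ln (measure P A)))"

definition weak_LDP ::
    "'w measure \<Rightarrow> (real \<Rightarrow> 'w \<Rightarrow> 'x :: topological_space) \<Rightarrow> ('x \<Rightarrow> ereal) \<Rightarrow> (real \<Rightarrow> real) \<Rightarrow> bool" where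
  "weak_LDP P X I v \<longleftrightarrow> rate_function I \<and>
     (\<forall>G. open G \<longrightarrow> - (INF x\<in>G. I x) \<le>
        Liminf (at_right 0) (\<lambda>\<epsilon>. log_prob P {\<omega> \<in> space P. X \<epsilon> \<omega> \<in> G} / ereal (v \<epsilon>))) \<and>
     (\<forall>K. compact K \<longrightarrow>
        Limsup (at_right 0) (\<lambda>\<epsilon>. log_prob P {\<omega> \<in> space P. X \<epsilon> \<omega> \<in> K} / ereal (v \<epsilon>))
          \<le> - (INF x\<in>K. I x))"

end

theory Submission
  imports Defs "HOL-Real_Asymp.Real_Asymp"
begin

text \<open>
  The noise is additive, so the equation reads \<open>Y = F(Z)\<close> path by path, where \<open>Z\<close> is the scaled
  noise. The map \<open>F\<close> is a homeomorphism of the Skorokhod space: its inverse subtracts the drift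
  \<open>\<integral> b(x)\<close> from a path \<open>x\<close>. It neither creates nor cancels jumps. Both the rate function and the
  probabilities of small balls are therefore transported by \<open>remove_drift\<close>, and it is enough to
  study \<open>Z = sqrt \<epsilon> B + \<epsilon> J\<close>.

  Everything rests on one event (\<open>good_event\<close>): for every \<open>\<eta>\<close> and every power \<open>a\<close> there is a
  threshold \<open>\<theta>\<close> such that, outside an event of probability at most \<open>\<epsilon>\<close> to the power \<open>a\<close>, the path
  of \<open>Z\<close> stays within \<open>\<eta>\<close> of the sum of its jumps larger than \<open>\<theta>\<close>. The Brownian part
  exceeds \<open>\<eta>\<close> with exponentially small probability. The compensated jumps below \<open>\<theta>\<close>
  are controlled by an exponential maximal inequality, in which a low threshold buys a high power of
  \<open>\<epsilon>\<close>, because many small jumps are needed to move the path by \<open>\<eta>\<close>.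
  On the good event only the points of the Poisson measure beyond \<open>\<theta> / \<epsilon>\<close> matter, and by regular
  variation one such point costs \<open>\<epsilon>\<close> to the power \<open>\<alpha> - 1\<close> if it is positive and \<open>\<beta> - 1\<close> if it is
  negative, up to arbitrarily small powers that absorb the slowly varying factors.

  For the upper bound (\<open>local_upper_bound\<close>), let a path \<open>g\<close> have rate larger than \<open>a\<close>. Then \<open>g\<close>
  starts away from \<open>0\<close>, or jumps at time \<open>1\<close>, or visits successively different values so often that
  each path near \<open>g\<close> needs large jumps of total cost more than \<open>a\<close>. For the lower bound
  (\<open>local_lower_bound\<close>), put a small box in time and size around each jump of a step function and ask
  for exactly one point in every box and no further large points; a time change then aligns \<open>Z\<close> with
  the step function.

  These two estimates for small balls imply the weak large deviation principle
  (\<open>weak_LDP_from_local\<close>): open sets contain balls and compact sets are covered by finitely many of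
  them. The lower semicontinuity of the rate function follows as well, since a lower bound near a
  point of small rate contradicts the upper bound around a point of larger rate.
\<close>

section \<open>Distances and time changes in the Skorokhod space\<close>

lemma sk_dist_lessD:
  assumes "dist x y < r"
  shows "\<exists>l\<in>time_changes. \<forall>t\<in>{0..1}. \<bar>l t - t\<bar> < r \<and> \<bar>sk_fun x (l t) - sk_fun y t\<bar> < r"
proof -
  have bdd: "bdd_below ((\<lambda>l. J1_cost l x y) ` time_changes)"
    using J1_cost_nonneg by (auto intro!: bdd_belowI2[where m = 0])
  have ne: "time_changes \<noteq> {}" using id_time_change by blast
  obtain l where l: "l \<in> time_changes" "J1_cost l x y < r"
    using assms unfolding dist_skorokhod_def cINF_less_iff[OF ne bdd] by blast
  then show ?thesis
    using J1_cost_le_iff[OF l(1), of x y "J1_cost l x y"] by (meson l(1) order.refl order.strict_trans1)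
qed

lemma sk_dist_leI:
  assumes "l \<in> time_changes"
    and "\<And>t. t \<in> {0..1} \<Longrightarrow> \<bar>l t - t\<bar> \<le> c"
    and "\<And>t. t \<in> {0..1} \<Longrightarrow> \<bar>sk_fun x (l t) - sk_fun y t\<bar> \<le> c"
  shows "dist x y \<le> c"
proof -
  have bdd: "bdd_below ((\<lambda>l. J1_cost l x y) ` time_changes)"
    using J1_cost_nonneg by (auto intro!: bdd_belowI2[where m = 0])
  have "dist x y \<le> J1_cost l x y"
    unfolding dist_skorokhod_def by (rule cINF_lower[OF bdd assms(1)])
  also have "\<dots> \<le> c" using J1_cost_le_iff[OF assms(1)] assms(2,3) by blast
  finally show ?thesis .
qed

lemma time_change_zero:
  assumes "l \<in> time_changes" shows "l 0 = 0"
proof (rule ccontr)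
  assume ne: "l 0 \<noteq> 0"
  have "0 \<in> l ` {0..1}" using time_changesD[OF assms] by simp
  then obtain s where s: "s \<in> {0..1}" "l s = 0" by auto
  then have "s > 0" using ne by (cases "s = 0") auto
  then have "l 0 < l s" using s by (intro strict_mono_onD[OF time_changesD(1)[OF assms]]) auto
  then show False using s time_changesD(3)[OF assms, of 0] by auto
qed

lemma time_change_less_iff:
  assumes "l \<in> time_changes" "s \<in> {0..1}" "t \<in> {0..1}"
  shows "l s < l t \<longleftrightarrow> s < t"
proof -
  note sm = strict_mono_onD[OF time_changesD(1)[OF assms(1)]]
  show ?thesis using sm[of s t] sm[of t s] assms(2,3) by (cases s t rule: linorder_cases) auto
qed

text \<open>
  Every time has one-sided neighbourhoods on which the path oscillates by less than \<open>e\<close>, by right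
  continuity and by the existence of left limits; bisection glues them together. Time \<open>1\<close> is left
  out because a jump there cannot be cut off by a point of \<open>T \<subseteq> (0,1)\<close>.
\<close>

lemma cadlag_partition:
  assumes "e > 0"
  shows "\<exists>T. finite T \<and> T \<subseteq> {0<..<1} \<and>
    (\<forall>s t. 0 \<le> s \<longrightarrow> s < t \<longrightarrow> t < 1 \<longrightarrow> T \<inter> {s<..t} = {} \<longrightarrow> \<bar>sk_fun x s - sk_fun x t\<bar> < e)"
proof -
  let ?f = "sk_fun x"
  define Q where "Q a b \<longleftrightarrow> (\<exists>T. finite T \<and> T \<subseteq> {0<..<1} \<and>
    (\<forall>s t. 0 \<le> s \<and> a \<le> s \<and> s < t \<and> t < 1 \<and> t < b \<and> T \<inter> {s<..t} = {} \<longrightarrow> \<bar>?f s - ?f t\<bar> < e))"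
    for a b :: real
  have "Q 0 1"
  proof (rule Bolzano)
    fix a b c :: real assume "Q a b" "Q b c" "a \<le> b" "b \<le> c"
    then obtain T1 T2 where 1: "finite T1" "T1 \<subseteq> {0<..<1}"
      "\<forall>s t. 0 \<le> s \<and> a \<le> s \<and> s < t \<and> t < 1 \<and> t < b \<and> T1 \<inter> {s<..t} = {} \<longrightarrow> \<bar>?f s - ?f t\<bar> < e"
      and 2: "finite T2" "T2 \<subseteq> {0<..<1}"
      "\<forall>s t. 0 \<le> s \<and> b \<le> s \<and> s < t \<and> t < 1 \<and> t < c \<and> T2 \<inter> {s<..t} = {} \<longrightarrow> \<bar>?f s - ?f t\<bar> < e"
      unfolding Q_def by (elim exE conjE) (rule that)
    show "Q a c" unfolding Q_def
    proof (intro exI[of _ "T1 \<union> T2 \<union> ({b} \<inter> {0<..<1})"] conjI allI impI)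
      fix s t assume st: "0 \<le> s \<and> a \<le> s \<and> s < t \<and> t < 1 \<and> t < c \<and>
        (T1 \<union> T2 \<union> {b} \<inter> {0<..<1}) \<inter> {s<..t} = {}"
      show "\<bar>?f s - ?f t\<bar> < e"
      proof (cases "b \<le> s")
        case True then show ?thesis using st by (intro 2(3)[rule_format]) auto
      next
        case False
        then have "t < b" using st by (cases "b \<le> t") auto
        then show ?thesis using st by (intro 1(3)[rule_format]) auto
      qed
    qed (use 1 2 in auto)
  next
    fix z :: real assume z: "0 \<le> z" "z \<le> 1"
    have R: "\<exists>d>0. \<forall>s. z < s \<and> s < z + d \<and> s < 1 \<longrightarrow> \<bar>?f s - ?f z\<bar> < e/2"
    proof (cases "z < 1")
      case True
      then have "\<forall>\<^sub>F s in at_right z. dist (?f s) (?f z) < e/2"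
        using z assms by (intro tendstoD[OF sk_fun_right_tendsto]) auto
      then obtain b where "b > z" "\<And>s. z < s \<Longrightarrow> s < b \<Longrightarrow> dist (?f s) (?f z) < e/2"
        unfolding eventually_at_right[OF True] by blast
      then show ?thesis by (intro exI[of _ "b - z"]) (auto simp: dist_real_def)
    qed (auto intro!: exI[of _ 1])
    have L: "\<exists>d>0. \<exists>l. \<forall>s. z - d < s \<and> s < z \<and> 0 \<le> s \<longrightarrow> \<bar>?f s - l\<bar> < e/2"
    proof (cases "0 < z")
      case True
      then obtain l where "(?f \<longlongrightarrow> l) (at_left z)" using z sk_fun_left_tendsto by auto
      then have "\<forall>\<^sub>F s in at_left z. dist (?f s) l < e/2" using assms by (intro tendstoD) auto
      then obtain b where "b < z" "\<And>s. b < s \<Longrightarrow> s < z \<Longrightarrow> dist (?f s) l < e/2"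
        unfolding eventually_at_left[OF True] by blast
      then show ?thesis by (intro exI[of _ "z - b"] conjI exI[of _ l]) (auto simp: dist_real_def)
    qed (auto intro!: exI[of _ 1])
    from R obtain d1 where d1: "d1 > 0" and R1: "\<And>s. z < s \<Longrightarrow> s < z + d1 \<Longrightarrow> s < 1 \<Longrightarrow> \<bar>?f s - ?f z\<bar> < e/2" by blast
    from L obtain d2 l where d2: "d2 > 0" and L1: "\<And>s. z - d2 < s \<Longrightarrow> s < z \<Longrightarrow> 0 \<le> s \<Longrightarrow> \<bar>?f s - l\<bar> < e/2" by blast
    show "\<exists>d>0. \<forall>a b. a \<le> z \<and> z \<le> b \<and> b - a < d \<longrightarrow> Q a b"
    proof (intro exI[of _ "min d1 d2"] conjI allI impI)
      fix a b assume ab: "a \<le> z \<and> z \<le> b \<and> b - a < min d1 d2"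
      show "Q a b" unfolding Q_def
      proof (intro exI[of _ "{z} \<inter> {0<..<1}"] conjI allI impI)
        fix s t assume st: "0 \<le> s \<and> a \<le> s \<and> s < t \<and> t < 1 \<and> t < b \<and> {z} \<inter> {0<..<1} \<inter> {s<..t} = {}"
        then consider "z \<le> s" | "t < z" using z by fastforce
        then show "\<bar>?f s - ?f t\<bar> < e"
        proof cases
          case 1
          have "\<bar>?f t - ?f z\<bar> < e/2" using st ab 1 by (intro R1) auto
          moreover have "\<bar>?f s - ?f z\<bar> < e/2" if "s \<noteq> z"
            using st ab 1 that by (intro R1) auto
          moreover have "\<bar>?f s - ?f z\<bar> < e/2" if "s = z" using assms that by simp
          ultimately show ?thesis by linarith
        next
          case 2
          have "\<bar>?f s - l\<bar> < e/2" "\<bar>?f t - l\<bar> < e/2"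
            by (intro L1; use st ab 2 in simp)+
          then show ?thesis by linarith
        qed
      qed auto
    qed (use d1 d2 in auto)
  qed simp
  then show ?thesis unfolding Q_def by force
qed

lemma finite_separation:
  fixes T :: "real set"
  assumes "finite T"
  shows "\<exists>R>0. \<forall>s\<in>T. \<forall>t\<in>T. s \<noteq> t \<longrightarrow> R \<le> \<bar>s - t\<bar>"
proof -
  define D where "D = insert 1 ((\<lambda>p. \<bar>fst p - snd p\<bar>) ` (T \<times> T) - {0})"
  have fin: "finite D" using assms by (simp add: D_def)
  have "\<forall>d\<in>D. 0 < d" unfolding D_def by auto
  then have 1: "Min D > 0" using fin by (simp add: D_def)
  have "Min D \<le> \<bar>s - t\<bar>" if "s \<in> T" "t \<in> T" "s \<noteq> t" for s t
  proof (rule Min_le[OF fin])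
    have "\<bar>fst (s, t) - snd (s, t)\<bar> \<in> (\<lambda>p. \<bar>fst p - snd p\<bar>) ` (T \<times> T)"
      by (rule imageI) (use that in blast)
    then show "\<bar>s - t\<bar> \<in> D" using that(3) unfolding D_def by simp
  qed
  then show ?thesis using 1 by blast
qed

definition tent :: "real \<Rightarrow> real \<Rightarrow> real" where
  "tent R u = max 0 (1 - \<bar>u\<bar> / R)"

lemma tent_lipschitz: "R > 0 \<Longrightarrow> \<bar>tent R u - tent R v\<bar> \<le> \<bar>u - v\<bar> / R"
proof -
  assume R: "R > 0"
  have "\<bar>tent R u - tent R v\<bar> \<le> \<bar>\<bar>u\<bar> / R - \<bar>v\<bar> / R\<bar>"
    unfolding tent_def by (auto simp: max_def)
  also have "\<dots> = \<bar>\<bar>u\<bar> - \<bar>v\<bar>\<bar> / R" using R by (simp add: diff_divide_distrib[symmetric])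
  also have "\<dots> \<le> \<bar>u - v\<bar> / R" using R by (intro divide_right_mono) auto
  finally show ?thesis .
qed

lemma tent_zero [simp]: "tent R 0 = 1" by (simp add: tent_def)
lemma tent_far: "R > 0 \<Longrightarrow> R \<le> \<bar>u\<bar> \<Longrightarrow> tent R u = 0" by (simp add: tent_def max_def)
lemma tent_bounds: "R > 0 \<Longrightarrow> 0 \<le> tent R u \<and> tent R u \<le> 1" by (simp add: tent_def)

text \<open>
  Adding to the identity a multiple of a tent centred at each point \<open>t\<close> of \<open>T\<close> moves \<open>t\<close> to \<open>\<sigma> t\<close>. If
  the shifts are small compared with the gaps of \<open>T \<union> {0,1}\<close>, the correction vanishes at \<open>0\<close> and
  \<open>1\<close> and has Lipschitz constant at most \<open>1/2\<close>, so the sum is still strictly increasing.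
\<close>

lemma time_change_interpolating:
  assumes "finite T" "T \<subseteq> {0<..<1}" "e > 0"
  shows "\<exists>\<rho>>0. \<forall>\<sigma>. (\<forall>t\<in>T. \<bar>\<sigma> t - t\<bar> \<le> \<rho>) \<longrightarrow>
    (\<exists>l\<in>time_changes. (\<forall>t\<in>T. l t = \<sigma> t) \<and> (\<forall>t\<in>{0..1}. \<bar>l t - t\<bar> \<le> e))"
proof -
  obtain R where R0: "R > 0" "\<forall>s\<in>insert 0 (insert 1 T). \<forall>t\<in>insert 0 (insert 1 T). s \<noteq> t \<longrightarrow> R \<le> \<bar>s - t\<bar>"
    using finite_separation[of "insert 0 (insert 1 T)"] assms(1) by auto
  note R = R0(1) R0(2)[rule_format, OF _ insertI2[OF insertI2]]
  define m where "m = real (card T)"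
  \<comment> \<open>the first term keeps the Lipschitz constant of the correction below \<open>1/2\<close>, the second one its size below \<open>e\<close>\<close>
  define \<rho> where "\<rho> = min (R / (2 * (m + 1))) (e / (m + 1))"
  have m: "m \<ge> 0" by (simp add: m_def)
  have \<rho>: "\<rho> > 0" "m * \<rho> \<le> e" "m * \<rho> \<le> R / 2"
  proof -
    show "\<rho> > 0" using R assms m by (auto simp: \<rho>_def)
    have "m * \<rho> \<le> m * (e / (m + 1))" using m by (intro mult_left_mono) (auto simp: \<rho>_def)
    also have "\<dots> \<le> e" using m assms by (simp add: field_simps)
    finally show "m * \<rho> \<le> e" .
    have "m * \<rho> \<le> m * (R / (2 * (m + 1)))" using m by (intro mult_left_mono) (auto simp: \<rho>_def)
    also have "\<dots> \<le> R / 2" using m R by (simp add: field_simps)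
    finally show "m * \<rho> \<le> R / 2" .
  qed
  show ?thesis
  proof (intro exI[of _ \<rho>] conjI allI impI)
    fix \<sigma> assume \<sigma>: "\<forall>t\<in>T. \<bar>\<sigma> t - t\<bar> \<le> \<rho>"
    define h where "h u = (\<Sum>t\<in>T. (\<sigma> t - t) * tent R (u - t))" for u
    define l where "l u = u + h u" for u
    have hlip: "\<bar>h u - h v\<bar> \<le> \<bar>u - v\<bar> / 2" for u v
    proof -
      have "\<bar>h u - h v\<bar> = \<bar>\<Sum>t\<in>T. (\<sigma> t - t) * (tent R (u - t) - tent R (v - t))\<bar>"
        by (simp add: h_def sum_subtractf right_diff_distrib)
      also have "\<dots> \<le> (\<Sum>t\<in>T. \<rho> * (\<bar>u - v\<bar> / R))"
      proof (intro order_trans[OF sum_abs] sum_mono)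
        fix t assume "t \<in> T"
        then show "\<bar>(\<sigma> t - t) * (tent R (u - t) - tent R (v - t))\<bar> \<le> \<rho> * (\<bar>u - v\<bar> / R)"
          using \<sigma> tent_lipschitz[OF R(1), of "u - t" "v - t"] \<rho>(1)
          unfolding abs_mult by (intro mult_mono) auto
      qed
      also have "\<dots> = (m * \<rho>) * (\<bar>u - v\<bar> / R)" by (simp add: m_def)
      also have "\<dots> \<le> (R / 2) * (\<bar>u - v\<bar> / R)" using \<rho>(3) R(1) by (intro mult_right_mono) auto
      also have "\<dots> = \<bar>u - v\<bar> / 2" using R(1) by simp
      finally show ?thesis .
    qed
    have hb: "\<bar>h u\<bar> \<le> e" for u
    proof -
      have "\<bar>h u\<bar> \<le> (\<Sum>t\<in>T. \<rho> * 1)" unfolding h_def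
      proof (intro order_trans[OF sum_abs] sum_mono)
        fix t assume "t \<in> T"
        then show "\<bar>(\<sigma> t - t) * tent R (u - t)\<bar> \<le> \<rho> * 1"
          using \<sigma> tent_bounds[OF R(1), of "u - t"] \<rho>(1) unfolding abs_mult by (intro mult_mono) auto
      qed
      also have "\<dots> \<le> e" using \<rho>(2) by (simp add: m_def)
      finally show ?thesis .
    qed
    have lT: "l t = \<sigma> t" if "t \<in> T" for t
    proof -
      have "h t = (\<Sum>s\<in>T. if s = t then \<sigma> t - t else 0)"
        unfolding h_def using R that by (intro sum.cong refl) (auto intro!: tent_far)
      then show ?thesis using that assms(1) by (simp add: l_def)
    qed
    have l01: "l 0 = 0" "l 1 = 1"
    proof -
      have "tent R (0 - t) = 0" "tent R (1 - t) = 0" if "t \<in> T" for t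
        using R(2)[of 0 t] R(2)[of 1 t] assms(2) that by (auto intro!: tent_far[OF R(1)])
      then show "l 0 = 0" "l 1 = 1" by (simp_all add: l_def h_def)
    qed
    have sm: "strict_mono l"
    proof (rule strict_monoI)
      fix u v :: real assume uv: "u < v"
      have "h u - h v \<le> \<bar>u - v\<bar> / 2" using hlip[of u v] by (rule abs_le_D1)
      then show "l u < l v" using uv unfolding l_def by auto
    qed
    have cont: "continuous_on {0..1} l"
    proof -
      have "continuous_on {0..1} (\<lambda>u. tent R (u - t))" for t
        unfolding tent_def using R(1) by (intro continuous_intros) auto
      then show ?thesis unfolding l_def h_def by (intro continuous_intros) auto
    qed
    have im: "l ` {0..1} = {0..1}"
    proof
      show "l ` {0..1} \<subseteq> {0..1}" 
      proof
        fix y assume "y \<in> l ` {0..1}"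
        then obtain u where "0 \<le> u" "u \<le> 1" "y = l u" by auto
        then show "y \<in> {0..1}"
          using monoD[OF strict_mono_mono[OF sm], of 0 u] monoD[OF strict_mono_mono[OF sm], of u 1] l01 by simp
      qed
      show "{0..1} \<subseteq> l ` {0..1}"
      proof
        fix y :: real assume "y \<in> {0..1}"
        then obtain x where "0 \<le> x" "x \<le> 1" "l x = y"
          using IVT'[of l 0 y 1] cont l01 by auto
        then show "y \<in> l ` {0..1}" by auto
      qed
    qed
    have "inj_on l {0..1}" using sm by (simp add: strict_mono_imp_inj_on inj_on_subset)
    then obtain k where "homeomorphism {0..1} {0..1} l k"
      using homeomorphism_compact[OF compact_Icc cont im] by blast
    then have "l \<in> time_changes"
      using sm by (auto simp: time_changes_def strict_mono_on_def strict_mono_def)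
    moreover have "\<forall>t\<in>{0..1}. \<bar>l t - t\<bar> \<le> e" using hb by (simp add: l_def)
    ultimately show "\<exists>l\<in>time_changes. (\<forall>t\<in>T. l t = \<sigma> t) \<and> (\<forall>t\<in>{0..1}. \<bar>l t - t\<bar> \<le> e)"
      using lT by blast
  qed (use \<rho> in auto)
qed

section \<open>Sampled paths and measurability\<close>

lemma floor_grid_right:
  fixes t :: real assumes "n > 0"
  shows "\<forall>\<^sub>F s in at_right t. \<lfloor>real n * s\<rfloor> = \<lfloor>real n * t\<rfloor>"
proof -
  have "t < (\<lfloor>real n * t\<rfloor> + 1) / real n" using assms by (simp add: field_simps) linarith
  then have "\<forall>\<^sub>F s in at_right t. s \<in> {t<..<(\<lfloor>real n * t\<rfloor> + 1) / real n}"
    by (rule eventually_at_right_real)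
  then show ?thesis
  proof eventually_elim
    case (elim s)
    then have "real n * t \<le> real n * s" "real n * s < \<lfloor>real n * t\<rfloor> + 1" using assms by (auto simp: field_simps)
    then show ?case by (intro floor_unique) linarith+
  qed
qed

lemma floor_grid_left:
  fixes t :: real assumes "n > 0"
  shows "\<forall>\<^sub>F s in at_left t. \<lfloor>real n * s\<rfloor> = \<lceil>real n * t\<rceil> - 1"
proof -
  have "(\<lceil>real n * t\<rceil> - 1) / real n < t" using assms by (simp add: field_simps) linarith
  then have "\<forall>\<^sub>F s in at_left t. s \<in> {(\<lceil>real n * t\<rceil> - 1) / real n<..<t}"
    by (rule eventually_at_left_real)
  then show ?thesis
  proof eventually_elim
    case (elim s)
    then have "real n * s < real n * t" "\<lceil>real n * t\<rceil> - 1 < real n * s" using assms by (auto simp: field_simps)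
    then show ?case by (intro floor_unique) linarith+
  qed
qed

definition sk_of :: "(real \<Rightarrow> real) \<Rightarrow> skorokhod" where
  "sk_of f = Abs_skorokhod (restrict f {0..1})"

lemma sk_fun_sk_of:
  assumes "\<And>t. 0 \<le> t \<Longrightarrow> t < 1 \<Longrightarrow> (f \<longlongrightarrow> f t) (at_right t)"
    and "\<And>t. 0 < t \<Longrightarrow> t \<le> 1 \<Longrightarrow> \<exists>l. (f \<longlongrightarrow> l) (at_left t)"
  shows "sk_fun (sk_of f) = restrict f {0..1}"
  unfolding sk_of_def
proof (rule Abs_skorokhod_inverse, safe)
  fix t :: real assume t: "t \<in> {0..<1}"
  have "\<forall>\<^sub>F s in at_right t. s \<in> {t<..<1}" using t by (intro eventually_at_right_real) auto
  then have "\<forall>\<^sub>F s in at_right t. f s = restrict f {0..1} s"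
    using t by (auto elim!: eventually_mono)
  then show "(restrict f {0..1} \<longlongrightarrow> restrict f {0..1} t) (at_right t)"
    using assms(1)[of t] t by (auto intro: Lim_transform_eventually)
next
  fix t :: real assume t: "t \<in> {0<..1}"
  then obtain l where l: "(f \<longlongrightarrow> l) (at_left t)" using assms(2) by auto
  have "\<forall>\<^sub>F s in at_left t. s \<in> {0<..<t}" using t by (intro eventually_at_left_real) auto
  then have "\<forall>\<^sub>F s in at_left t. f s = restrict f {0..1} s"
    using t by (auto elim!: eventually_mono)
  from Lim_transform_eventually[OF l this] show "\<exists>l. (restrict f {0..1} \<longlongrightarrow> l) (at_left t)" ..
qed auto

lemma sk_fun_sk_of_grid:
  assumes "n > 0"
  shows "sk_fun (sk_of (\<lambda>t. h \<lfloor>real n * t\<rfloor>)) = restrict (\<lambda>t. h \<lfloor>real n * t\<rfloor>) {0..1}"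
proof (rule sk_fun_sk_of)
  fix t :: real
  have "\<forall>\<^sub>F s in at_right t. h \<lfloor>real n * t\<rfloor> = h \<lfloor>real n * s\<rfloor>"
    by (rule eventually_mono[OF floor_grid_right[OF assms]]) simp
  then show "((\<lambda>t. h \<lfloor>real n * t\<rfloor>) \<longlongrightarrow> h \<lfloor>real n * t\<rfloor>) (at_right t)"
    by (rule Lim_transform_eventually[OF tendsto_const])
  have "\<forall>\<^sub>F s in at_left t. h (\<lceil>real n * t\<rceil> - 1) = h \<lfloor>real n * s\<rfloor>"
    by (rule eventually_mono[OF floor_grid_left[OF assms]]) simp
  then show "\<exists>l. ((\<lambda>t. h \<lfloor>real n * t\<rfloor>) \<longlongrightarrow> l) (at_left t)"
    by (intro exI[of _ "h (\<lceil>real n * t\<rceil> - 1)"] Lim_transform_eventually[OF tendsto_const])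
qed

text \<open>By right continuity the path is the limit of its values at the next grid point to the right.\<close>

lemma sk_fun_borel [measurable]: "sk_fun x \<in> borel_measurable (restrict_space borel {0..1})"
proof (rule borel_measurable_LIMSEQ_real)
  fix t :: real assume t: "t \<in> space (restrict_space borel {0..1})"
  then have t01: "0 \<le> t" "t \<le> 1" by (auto simp: space_restrict_space)
  let ?g = "\<lambda>n. min 1 ((real_of_int \<lfloor>real (Suc n) * t\<rfloor> + 1) / real (Suc n))"
  show "(\<lambda>n. sk_fun x (?g n)) \<longlonglongrightarrow> sk_fun x t"
  proof (cases "t = 1")
    case True
    have "?g n = 1" for n
    proof -
      have "1 \<le> (real_of_int \<lfloor>real (Suc n) * t\<rfloor> + 1) / real (Suc n)" unfolding True by simp
      then show ?thesis by (rule min_absorb1)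
    qed
    then show ?thesis unfolding True by (simp only: tendsto_const)
  next
    case False
    then have t1: "t < 1" using t01 by simp
    have gt: "t < ?g n" for n
    proof -
      have "real (Suc n) * t < real_of_int \<lfloor>real (Suc n) * t\<rfloor> + 1" by linarith
      then have "t < (real_of_int \<lfloor>real (Suc n) * t\<rfloor> + 1) / real (Suc n)"
        by (subst pos_less_divide_eq) (simp_all only: of_nat_0_less_iff zero_less_Suc mult.commute)
      then show ?thesis using t1 by (simp only: min_less_iff_conj)
    qed
    have le: "?g n \<le> t + 1 / real (Suc n)" for n
    proof -
      have "(real_of_int \<lfloor>real (Suc n) * t\<rfloor> + 1) / real (Suc n) \<le> (real (Suc n) * t + 1) / real (Suc n)"
        by (intro divide_right_mono add_right_mono of_int_floor_le of_nat_0_le_iff)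
      also have "\<dots> = t + 1 / real (Suc n)"
        using nonzero_mult_div_cancel_left[of "real (Suc n)" t] by (simp add: add_divide_distrib del: of_nat_Suc)
      finally show ?thesis by (rule min.coboundedI2)
    qed
    have lim: "(\<lambda>n. t + 1 / real (Suc n)) \<longlonglongrightarrow> t"
      using tendsto_add[OF tendsto_const LIMSEQ_inverse_real_of_nat[unfolded inverse_eq_divide], of t] by simp
    have right: "filterlim g (at_right t) sequentially" if "\<And>n. t < g n" "g \<longlonglongrightarrow> t" for g :: "nat \<Rightarrow> real"
      using that by (auto simp: filterlim_at intro!: always_eventually less_imp_neq[THEN not_sym])
    have "?g \<longlonglongrightarrow> t"
      by (rule real_tendsto_sandwich[OF _ _ tendsto_const lim];
          intro always_eventually allI le less_imp_le[OF gt])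
    from filterlim_compose[OF sk_fun_right_tendsto[OF t01(1) t1] right[OF gt this]] show ?thesis .
  qed
next
  fix n
  have "(\<lambda>t::real. \<lfloor>real (Suc n) * t\<rfloor>) \<in> measurable (restrict_space borel {0..1}) (count_space UNIV)"
    by (intro measurable_restrict_space1) measurable
  moreover have "(\<lambda>k::int. sk_fun x (min 1 ((real_of_int k + 1) / real (Suc n)))) \<in> borel_measurable (count_space UNIV)"
    by simp
  ultimately show "(\<lambda>t. sk_fun x (min 1 ((real_of_int \<lfloor>real (Suc n) * t\<rfloor> + 1) / real (Suc n))))
      \<in> borel_measurable (restrict_space borel {0..1})"
    by (rule measurable_compose)
qed

text \<open>
  Sampling a path on the grid of mesh \<open>1/n\<close> delays its large jumps to the next grid point. The
  time change that sends each of these jump times to that grid point undoes the delay, and rounding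
  the values costs at most \<open>1/n\<close>.
\<close>

lemma sk_discretize_tendsto:
  "(\<lambda>n. sk_of (\<lambda>t. (\<lambda>k. real_of_int \<lfloor>real (Suc n) * sk_fun x (real_of_int k / real (Suc n))\<rfloor> / real (Suc n))
      \<lfloor>real (Suc n) * t\<rfloor>)) \<longlonglongrightarrow> x" (is "?X \<longlonglongrightarrow> x")
proof (rule metric_LIMSEQ_I)
  fix r :: real assume r: "r > 0"
  then have r4: "r / 4 > 0" and r2: "r / 2 > 0" by simp_all
  obtain T where T: "finite T" "T \<subseteq> {0<..<1}"
    and osc0: "\<forall>s t. 0 \<le> s \<longrightarrow> s < t \<longrightarrow> t < 1 \<longrightarrow> T \<inter> {s<..t} = {} \<longrightarrow> \<bar>sk_fun x s - sk_fun x t\<bar> < r / 4"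
    using cadlag_partition[OF r4, of x] by (elim exE conjE) (rule that)
  note osc = osc0[rule_format]
  obtain \<rho> where \<rho>: "\<rho> > 0" and tc0: "\<forall>\<sigma>. (\<forall>t\<in>T. \<bar>\<sigma> t - t\<bar> \<le> \<rho>) \<longrightarrow>
    (\<exists>l\<in>time_changes. (\<forall>t\<in>T. l t = \<sigma> t) \<and> (\<forall>t\<in>{0..1}. \<bar>l t - t\<bar> \<le> r / 2))"
    using time_change_interpolating[OF T r2] by (elim exE conjE) (rule that)
  note tc = tc0[rule_format]
  obtain N where N: "1 / real (Suc N) < min \<rho> (r / 4)"
    using nat_approx_posE[of "min \<rho> (r / 4)"] \<rho> r by auto
  show "\<exists>N. \<forall>n\<ge>N. dist (?X n) x < r"
  proof (intro exI[of _ N] allI impI)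
    fix n assume "N \<le> n"
    define m where "m = real (Suc n)"
    have m: "m > 0" by (simp add: m_def)
    have m1: "1 / m \<le> \<rho>" "1 / m \<le> r / 4"
    proof -
      have "1 / m \<le> 1 / real (Suc N)" using \<open>N \<le> n\<close> by (simp add: m_def frac_le)
      then show "1 / m \<le> \<rho>" "1 / m \<le> r / 4" using N by auto
    qed
    \<comment> \<open>the grid point at which the sampled path shows a jump at \<open>t\<close>\<close>
    define \<sigma> where "\<sigma> t = real_of_int \<lceil>m * t\<rceil> / m" for t
    have sg: "t \<le> \<sigma> t" "\<sigma> t < t + 1 / m" for t
      using m unfolding \<sigma>_def by (simp_all add: field_simps) (linarith+)
    have "\<bar>\<sigma> t - t\<bar> \<le> \<rho>" for t using sg[of t] m1 by linarith
    then obtain l where l: "l \<in> time_changes" "\<forall>t\<in>T. l t = \<sigma> t" "\<forall>t\<in>{0..1}. \<bar>l t - t\<bar> \<le> r / 2"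
      using tc[of \<sigma>] by blast
    have "dist (?X n) x \<le> r / 2"
    proof (rule sk_dist_leI[OF l(1)])
      fix t :: real assume t: "t \<in> {0..1}"
      show "\<bar>l t - t\<bar> \<le> r / 2" using l(3) t by blast
      have lt: "l t \<in> {0..1}" by (rule time_changesD(3)[OF l(1) t])
      define s where "s = real_of_int \<lfloor>m * l t\<rfloor> / m"
      have s: "s \<le> l t" "0 \<le> s" using m lt unfolding s_def by (simp_all add: field_simps)
      have X: "sk_fun (?X n) (l t) = real_of_int \<lfloor>m * sk_fun x s\<rfloor> / m"
        using sk_fun_sk_of_grid[of "Suc n" "\<lambda>k. real_of_int \<lfloor>real (Suc n) * sk_fun x (real_of_int k / real (Suc n))\<rfloor> / real (Suc n)"] lt
        by (simp add: s_def m_def del: of_nat_Suc)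
      have fl: "\<bar>real_of_int \<lfloor>m * sk_fun x s\<rfloor> / m - sk_fun x s\<bar> \<le> 1 / m"
      proof -
        have "\<bar>real_of_int \<lfloor>m * sk_fun x s\<rfloor> - m * sk_fun x s\<bar> \<le> 1" by linarith
        moreover have "real_of_int \<lfloor>m * sk_fun x s\<rfloor> / m - sk_fun x s = (real_of_int \<lfloor>m * sk_fun x s\<rfloor> - m * sk_fun x s) / m"
          using m by (simp add: diff_divide_distrib)
        ultimately show ?thesis using m by (simp add: divide_right_mono)
      qed
      have osc2: "\<bar>sk_fun x s - sk_fun x t\<bar> \<le> r / 4"
      proof (cases "t = 1")
        case True
        then have "l t = 1" using time_change_one[OF l(1)] by simp
        then have "s = 1" using m unfolding s_def m_def by simp
        then show ?thesis using True r by simp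
      next
        case False
        then have t1: "t < 1" using t by simp
        then have "l t < 1" using time_change_less_iff[OF l(1), of t 1] time_change_one[OF l(1)] t by simp
        then have s1: "s < 1" using s by simp
        \<comment> \<open>no jump time of the partition separates \<open>s\<close> and \<open>t\<close>\<close>
        have sep: "u \<le> s \<longleftrightarrow> u \<le> t" if u: "u \<in> T" for u
        proof -
          have u01: "u \<in> {0..1}" using u T(2) by auto
          have "u \<le> t \<longleftrightarrow> l u \<le> l t" using time_change_less_iff[OF l(1) t u01] by (simp add: linorder_not_less[symmetric])
          also have "\<dots> \<longleftrightarrow> \<sigma> u \<le> l t" using l(2) u by simp
          also have "\<dots> \<longleftrightarrow> real_of_int \<lceil>m * u\<rceil> \<le> m * l t" unfolding \<sigma>_def using m by (simp add: field_simps)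
          also have "\<dots> \<longleftrightarrow> \<lceil>m * u\<rceil> \<le> \<lfloor>m * l t\<rfloor>" by (simp add: le_floor_iff)
          also have "\<dots> \<longleftrightarrow> m * u \<le> real_of_int \<lfloor>m * l t\<rfloor>" by (simp add: ceiling_le_iff)
          also have "\<dots> \<longleftrightarrow> u \<le> s" unfolding s_def using m by (simp add: field_simps)
          finally show ?thesis by simp
        qed
        show ?thesis
        proof (cases s t rule: linorder_cases)
          case less
          have "T \<inter> {s<..t} = {}" using sep by force
          then show ?thesis using osc[of s t] s less t1 by simp
        next
          case greater
          have "T \<inter> {t<..s} = {}" using sep by force
          then show ?thesis using osc[of t s] t greater s1 by (simp add: abs_minus_commute)
        qed (use r in simp)
      qed
      show "\<bar>sk_fun (?X n) (l t) - sk_fun x t\<bar> \<le> r / 2"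
        unfolding X using fl osc2 m1(2) by linarith
    qed
    then show "dist (?X n) x < r" using r by simp
  qed
qed

text \<open>
  The sampled and rounded paths are functions of a list of integers, hence measurable as soon as the
  coordinates are; \<open>X\<close> is their pointwise limit.
\<close>

lemma measurable_skorokhod:
  assumes "\<And>t. t \<in> {0..1} \<Longrightarrow> (\<lambda>\<omega>. sk_fun (X \<omega>) t) \<in> borel_measurable M"
  shows "X \<in> borel_measurable M"
proof (rule borel_measurable_LIMSEQ_metric)
  fix n
  define m where "m = real (Suc n)"
  have m: "m > 0" by (simp add: m_def)
  define h where "h \<omega> k = (if 0 \<le> k \<and> k \<le> int (Suc n) then \<lfloor>m * sk_fun (X \<omega>) (real_of_int k / m)\<rfloor> else 0)" for \<omega> k
  define H where "H \<omega> = map (\<lambda>i. h \<omega> (int i)) [0..<n + 2]" for \<omega>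
  define S where "S ks = sk_of (\<lambda>t. real_of_int ((\<lambda>k. ks ! nat k) \<lfloor>real (Suc n) * t\<rfloor>) / m)" for ks :: "int list"
  have hm: "h' k \<in> measurable M (count_space UNIV)" if "h' = (\<lambda>k \<omega>. h \<omega> k)" for k h'
  proof (cases "0 \<le> k \<and> k \<le> int (Suc n)")
    case True
    then have "real_of_int k / m \<in> {0..1}" using m by (simp add: m_def field_simps)
    from assms[OF this] show ?thesis unfolding h_def that using True by simp
  qed (auto simp: h_def that)
  have "H \<in> measurable M (count_space UNIV)"
  proof (rule measurable_count_space_eq_countable[THEN iffD2])
    show "H \<in> space M \<rightarrow> UNIV \<and> (\<forall>a\<in>UNIV. H -` {a} \<inter> space M \<in> sets M)"
    proof (intro conjI ballI)
      fix a :: "int list"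
      show "H -` {a} \<inter> space M \<in> sets M"
      proof (cases "length a = n + 2")
        case True
        then have "H -` {a} \<inter> space M = {\<omega> \<in> space M. \<forall>i\<in>{..<n+2}. h \<omega> (int i) = a ! i}"
          by (auto simp: H_def list_eq_iff_nth_eq simp del: upt_Suc)
        also have "\<dots> \<in> sets M"
          using hm[OF refl] by measurable
        finally show ?thesis .
      next
        case False
        then have "H -` {a} \<inter> space M = {}" by (auto simp: H_def simp del: upt_Suc)
        then show ?thesis by simp
      qed
    qed simp
  qed simp
  moreover have "S \<in> measurable (count_space UNIV) borel" by simp
  ultimately have "(\<lambda>\<omega>. S (H \<omega>)) \<in> borel_measurable M" by (rule measurable_compose)
  moreover have "S (H \<omega>) = sk_of (\<lambda>t. (\<lambda>k. real_of_int \<lfloor>real (Suc n) * sk_fun (X \<omega>) (real_of_int k / real (Suc n))\<rfloor> / real (Suc n))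
      \<lfloor>real (Suc n) * t\<rfloor>)" for \<omega>
  proof -
    have "sk_of f = sk_of g" if "\<And>t. t \<in> {0..1} \<Longrightarrow> f t = g t" for f g
      unfolding sk_of_def using that by (metis restrict_ext)
    note sk_of_cong = this
    show ?thesis unfolding S_def
    proof (rule sk_of_cong)
      fix t :: real assume t: "t \<in> {0..1}"
      let ?k = "\<lfloor>real (Suc n) * t\<rfloor>"
      have k: "0 \<le> ?k" "?k \<le> int (Suc n)"
      proof -
        have "real (Suc n) * t \<le> real (Suc n) * 1" using t by (intro mult_left_mono) auto
        from floor_mono[OF this] show "?k \<le> int (Suc n)" by (simp only: mult_1_right floor_of_nat)
        show "0 \<le> ?k" using t by simp
      qed
      have "nat ?k < n + 2" using k by linarith
      then have "H \<omega> ! nat ?k = h \<omega> ?k" using k by (simp add: H_def del: upt_Suc of_nat_Suc)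
      then show "real_of_int (H \<omega> ! nat ?k) / m = real_of_int \<lfloor>real (Suc n) * sk_fun (X \<omega>) (real_of_int ?k / real (Suc n))\<rfloor> / real (Suc n)"
        using k by (simp add: h_def m_def del: of_nat_Suc)
    qed
  qed
  ultimately show "(\<lambda>\<omega>. sk_of (\<lambda>t. (\<lambda>k. real_of_int \<lfloor>real (Suc n) * sk_fun (X \<omega>) (real_of_int k / real (Suc n))\<rfloor> / real (Suc n))
      \<lfloor>real (Suc n) * t\<rfloor>)) \<in> borel_measurable M" by simp
qed (rule sk_discretize_tendsto)

section \<open>Integrals of paths and an inequality of Gronwall type\<close>

lemma sk_left_limit_right_cont:
  fixes c :: "real \<Rightarrow> real"
  assumes "continuous_on {0..1} c"
  shows "0 \<le> t \<Longrightarrow> t < 1 \<Longrightarrow> (c \<longlongrightarrow> c t) (at_right t)"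
    and "0 < t \<Longrightarrow> t \<le> 1 \<Longrightarrow> (c \<longlongrightarrow> c t) (at_left t)"
proof -
  have c: "(c \<longlongrightarrow> c t) (at t within {0..1})" if "0 \<le> t" "t \<le> 1" for t :: real
    using assms that by (auto simp: continuous_on_def)
  show "(c \<longlongrightarrow> c t) (at_right t)" if "0 \<le> t" "t < 1"
    using tendsto_mono[OF at_le c, of "{t..1}" t] that by (auto simp: at_within_Icc_at_right)
  show "(c \<longlongrightarrow> c t) (at_left t)" if "0 < t" "t \<le> 1"
    using tendsto_mono[OF at_le c, of "{0..t}" t] that by (auto simp: at_within_Icc_at_left)
qed

lemma sk_fun_sk_of_add:
  assumes "continuous_on {0..1} c"
  shows "sk_fun (sk_of (\<lambda>t. sk_fun x t + c t)) = restrict (\<lambda>t. sk_fun x t + c t) {0..1}"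
proof (rule sk_fun_sk_of)
  fix t :: real assume "0 \<le> t" "t < 1"
  then show "((\<lambda>t. sk_fun x t + c t) \<longlongrightarrow> sk_fun x t + c t) (at_right t)"
    by (intro tendsto_add sk_fun_right_tendsto sk_left_limit_right_cont(1)[OF assms])
next
  fix t :: real assume t: "0 < t" "t \<le> 1"
  then obtain l where "(sk_fun x \<longlongrightarrow> l) (at_left t)" using sk_fun_left_tendsto by blast
  then have "((\<lambda>t. sk_fun x t + c t) \<longlongrightarrow> l + c t) (at_left t)"
    by (intro tendsto_add sk_left_limit_right_cont(2)[OF assms] t)
  then show "\<exists>l. ((\<lambda>t. sk_fun x t + c t) \<longlongrightarrow> l) (at_left t)" ..
qed

lemma bounded_borel_integrable:
  fixes f :: "real \<Rightarrow> real"
  assumes "f \<in> borel_measurable (restrict_space borel {0..1})"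
    and "\<And>t. t \<in> {0..1} \<Longrightarrow> \<bar>f t\<bar> \<le> K" and "0 \<le> a" "b \<le> 1"
  shows "f integrable_on {a..b}" and "(LINT s : {a..b} | lborel. f s) = integral {a..b} f"
proof -
  have m: "(\<lambda>s. indicator {0..1} s *\<^sub>R f s) \<in> borel_measurable borel"
    by (rule iffD1[OF borel_measurable_restrict_space_iff assms(1)]) simp
  have "(\<lambda>s. indicator {a..b} s *\<^sub>R (indicator {0..1} s *\<^sub>R f s)) \<in> borel_measurable borel"
    by (rule borel_measurable_scaleR[OF _ m]) simp
  also have "(\<lambda>s. indicator {a..b} s *\<^sub>R (indicator {0..1} s *\<^sub>R f s)) = (\<lambda>s. indicator {a..b} s *\<^sub>R f s)"
    using assms(3,4) by (auto simp: indicator_def fun_eq_iff)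
  finally have m2: "(\<lambda>s. indicator {a..b} s *\<^sub>R f s) \<in> borel_measurable lborel" by simp
  have i: "set_integrable lborel {a..b} f"
    unfolding set_integrable_def
  proof (rule Bochner_Integration.integrable_bound[OF _ m2])
    show "integrable lborel (\<lambda>s. indicator {a..b} s *\<^sub>R K)"
      by (intro integrable_scaleR_left) (auto simp: emeasure_lborel_Icc_eq)
    show "AE s in lborel. norm (indicator {a..b} s *\<^sub>R f s) \<le> norm (indicator {a..b} s *\<^sub>R K)"
    proof (intro always_eventually allI)
      fix s show "norm (indicator {a..b} s *\<^sub>R f s) \<le> norm (indicator {a..b} s *\<^sub>R K)"
        using assms(2)[of s] assms(3,4) by (cases "s \<in> {a..b}") auto
    qed
  qed
  show "f integrable_on {a..b}" "(LINT s : {a..b} | lborel. f s) = integral {a..b} f"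
    using set_borel_integral_eq_integral[OF i] by auto
qed

text \<open>
  The function \<open>h\<close> is not continuous in the application (a distance of two paths), so the comparison
  is made for its primitive \<open>u\<close>: with \<open>U\<close> the primitive of \<open>u\<close>, the function
  \<open>exp (- C s) * U s - q * s\<close> is non-increasing.
\<close>

lemma gronwall_integral:
  fixes h k :: "real \<Rightarrow> real"
  assumes h: "h integrable_on {0..1}" and k: "k integrable_on {0..1}"
    and k0: "\<And>s. s \<in> {0..1} \<Longrightarrow> 0 \<le> k s" and C: "0 \<le> C"
    and le: "\<And>s. s \<in> {0..1} \<Longrightarrow> h s \<le> C * integral {0..s} h + k s"
    and t: "t \<in> {0..1}"
  shows "integral {0..t} h \<le> (1 + C * exp C) * integral {0..1} k"
proof -
  define u where "u s = integral {0..s} h" for s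
  define U where "U s = integral {0..s} u" for s
  define q where "q = integral {0..1} k"
  have cu: "continuous_on {0..1} u" unfolding u_def by (rule indefinite_integral_continuous_1[OF h])
  have ui: "u integrable_on {0..s}" if "s \<in> {0..1}" for s
    using cu that by (intro integrable_continuous_real) (auto elim: continuous_on_subset)
  have cU: "continuous_on {0..1} U" unfolding U_def by (rule indefinite_integral_continuous_1) (use ui in auto)
  have q0: "0 \<le> q" unfolding q_def using k0 by (intro integral_nonneg[OF k]) auto
  have ineq: "u s \<le> C * U s + q" if s: "s \<in> {0..1}" for s
  proof -
    have sub: "{0..s} \<subseteq> {0..1}" using s by auto
    have "integral {0..s} h \<le> integral {0..s} (\<lambda>r. C * u r + k r)"
      using le[folded u_def] sub by (intro integral_le integrable_add integrable_on_mult_right ui[OF s]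
          integrable_subinterval_real[OF h sub] integrable_subinterval_real[OF k sub]) auto
    also have "\<dots> = C * U s + integral {0..s} k" unfolding U_def
      using ui[OF s] integrable_subinterval_real[OF k sub]
      by (subst integral_add) (auto intro!: integrable_on_mult_right)
    also have "integral {0..s} k \<le> q" unfolding q_def
      using k0 by (intro integral_subset_le sub integrable_subinterval_real[OF k sub] k) auto
    finally show ?thesis by (simp add: u_def)
  qed
  define w where "w s = exp (- C * s) * U s - q * s" for s
  have "w t \<le> w 0"
  proof (cases "t = 0")
    case False
    have "\<exists>y. DERIV w s :> y \<and> y \<le> 0" if s: "0 < s" "s < t" for s
    proof -
      have s1: "s \<in> {0<..<1}" using s t by auto
      have "(U has_real_derivative u s) (at s within {0..1})"
        unfolding U_def using s1 by (intro integral_has_real_derivative cu) auto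
      then have dU: "DERIV U s :> u s" using s1 by (simp add: at_within_Icc_at)
      have "DERIV w s :> exp (- C * s) * (u s - C * U s) - q"
        unfolding w_def by (auto intro!: derivative_eq_intros dU simp: algebra_simps)
      moreover have "exp (- C * s) * (u s - C * U s) \<le> 1 * q"
      proof (cases "u s - C * U s \<ge> 0")
        case True
        then show ?thesis using ineq[of s] s1 C by (intro mult_mono) auto
      next
        case False
        then have "exp (- C * s) * (u s - C * U s) \<le> 0" by (simp add: mult_nonneg_nonpos)
        then show ?thesis using q0 by simp
      qed
      ultimately show ?thesis by (intro exI[of _ "exp (- C * s) * (u s - C * U s) - q"]) simp
    qed
    moreover have "continuous_on {0..t} w"
      unfolding w_def using t by (intro continuous_intros continuous_on_subset[OF cU]) auto
    ultimately show ?thesis using DERIV_nonpos_imp_decreasing_open[of 0 t w] False t by auto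
  qed simp
  also have "w 0 = 0" by (simp add: w_def U_def)
  finally have "exp (- C * t) * U t \<le> q * t" by (simp add: w_def)
  also have "\<dots> \<le> q" using t q0 by (simp add: mult_left_le)
  finally have "U t \<le> q * exp (C * t)" by (simp add: exp_minus field_simps)
  also have "\<dots> \<le> q * exp C" using q0 C t by (intro mult_left_mono) (auto simp: mult_left_le)
  finally have "C * U t \<le> C * (q * exp C)" using C by (rule mult_left_mono)
  then have "u t \<le> C * (q * exp C) + q" using ineq[OF t] by linarith
  then show ?thesis unfolding u_def q_def by (simp add: algebra_simps)
qed

text \<open>
  Integrals of \<open>b\<close> along paths are controlled by this distance, which, in contrast to the uniform
  distance, is continuous for the Skorokhod metric.
\<close>

definition L1_dist :: "skorokhod \<Rightarrow> skorokhod \<Rightarrow> real" where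
  "L1_dist x y = integral {0..1} (\<lambda>s. \<bar>sk_fun x s - sk_fun y s\<bar>)"

lemma abs_diff_sk_integrable:
  assumes "0 \<le> a" "b \<le> 1"
  shows "(\<lambda>s. \<bar>sk_fun x s - sk_fun y s\<bar>) integrable_on {a..b}"
proof -
  obtain C D where b: "\<And>t. t \<in> {0..1} \<Longrightarrow> \<bar>sk_fun x t\<bar> \<le> C" "\<And>t. t \<in> {0..1} \<Longrightarrow> \<bar>sk_fun y t\<bar> \<le> D"
    using sk_fun_bounded by metis
  show ?thesis
  proof (rule bounded_borel_integrable(1)[OF _ _ assms])
    show "(\<lambda>s. \<bar>sk_fun x s - sk_fun y s\<bar>) \<in> borel_measurable (restrict_space borel {0..1})"
      using sk_fun_borel[of x] sk_fun_borel[of y] by measurable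
    show "\<bar>\<bar>sk_fun x t - sk_fun y t\<bar>\<bar> \<le> C + D" if "t \<in> {0..1}" for t
      using b(1)[OF that] b(2)[OF that] by linarith
  qed
qed

text \<open>
  Away from the finitely many times at which \<open>x\<close> oscillates by more than \<open>e / 3\<close>, moving the time by
  less than \<open>r\<close> changes the values by little; near these times bounded values are integrated over a
  set whose length is of order \<open>r\<close>.
\<close>

lemma L1_dist_small:
  assumes e: "e > 0"
  shows "\<exists>r>0. \<forall>y. dist y x < r \<longrightarrow> L1_dist y x \<le> e"
proof -
  have e3: "e / 3 > 0" using e by simp
  obtain D where D: "\<And>t. t \<in> {0..1} \<Longrightarrow> \<bar>sk_fun x t\<bar> \<le> D" using sk_fun_bounded by metis
  have D0: "D \<ge> 0" using D[of 0] by simp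
  obtain T where T: "finite T" "T \<subseteq> {0<..<1}"
    and osc0: "\<forall>s t. 0 \<le> s \<longrightarrow> s < t \<longrightarrow> t < 1 \<longrightarrow> T \<inter> {s<..t} = {} \<longrightarrow> \<bar>sk_fun x s - sk_fun x t\<bar> < e / 3"
    using cadlag_partition[OF e3, of x] by (elim exE conjE) (rule that)
  note osc = osc0[rule_format]
  define n where "n = real (card T)"
  define r where "r = min 1 (min (e / 3) (e / (3 * (2 * n * (1 + 2 * D) + 1))))"
  have n: "n \<ge> 0" by (simp add: n_def)
  have q: "2 * n * (1 + 2 * D) \<ge> 0" using n D0 by simp
  have r: "r > 0" using e q by (simp add: r_def)
  have r1: "r \<le> 1" "r \<le> e / 3"
    unfolding r_def by (intro min.cobounded1, intro min.coboundedI2 min.cobounded1)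
  have r2: "2 * n * (1 + 2 * D) * r \<le> e / 3"
  proof -
    have "2 * n * (1 + 2 * D) * r \<le> (2 * n * (1 + 2 * D)) * (e / (3 * (2 * n * (1 + 2 * D) + 1)))"
      using q by (intro mult_left_mono) (auto simp: r_def)
    also have "\<dots> \<le> e / 3" using q e by (simp add: divide_simps)
    finally show ?thesis .
  qed
  have "L1_dist y x \<le> e" if d: "dist y x < r" for y
  proof -
    obtain l where l: "l \<in> time_changes" "\<forall>t\<in>{0..1}. \<bar>l t - t\<bar> < r \<and> \<bar>sk_fun y (l t) - sk_fun x t\<bar> < r"
      using sk_dist_lessD[OF d] by blast
    have pt: "\<bar>sk_fun y s - sk_fun x s\<bar> \<le> (r + e / 3) + (\<Sum>u\<in>T. (1 + 2 * D) * indicat_real {u - r..u + r} s)"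
      (is "_ \<le> _ + ?S") if s: "s \<in> {0..1}" for s
    proof -
      obtain t where t: "t \<in> {0..1}" "l t = s" using time_changesD(2)[OF l(1)] s by (metis imageE)
      have ts: "\<bar>s - t\<bar> < r" "\<bar>sk_fun y s - sk_fun x t\<bar> < r" using l(2) t by auto
      have S0: "0 \<le> ?S" using D0 by (intro sum_nonneg) auto
      show ?thesis
      proof (cases "\<exists>u\<in>T. \<bar>u - s\<bar> \<le> r")
        case True
        then obtain u where u: "u \<in> T" "\<bar>u - s\<bar> \<le> r" by blast
        have "\<bar>sk_fun x t - sk_fun x s\<bar> \<le> 2 * D" using D[OF t(1)] D[OF s] by linarith
        then have "\<bar>sk_fun y s - sk_fun x s\<bar> \<le> 1 + 2 * D" using ts r1 by linarith
        also have "\<dots> = (1 + 2 * D) * indicat_real {u - r..u + r} s" using u by (auto simp: indicator_def)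
        also have "\<dots> \<le> ?S" using u T(1) D0 by (intro member_le_sum) auto
        finally show ?thesis using r e by simp
      next
        case False
        have "\<bar>sk_fun x t - sk_fun x s\<bar> \<le> e / 3"
        proof (cases "s = 1")
          case True
          have "t = 1"
            using time_change_less_iff[OF l(1) t(1), of 1] time_change_one[OF l(1)] t True by force
          then show ?thesis using True e by simp
        next
          case s1: False
          have t1: "t < 1" using time_change_less_iff[OF l(1) t(1), of 1] time_change_one[OF l(1)] t(2) s s1 by simp
          show ?thesis
          proof (cases s t rule: linorder_cases)
            case less
            have "T \<inter> {s<..t} = {}" using False ts(1) by force
            then show ?thesis using osc[of s t] less s t1 by (simp add: abs_minus_commute)
          next
            case greater
            have "T \<inter> {t<..s} = {}" using False ts(1) by force
            then show ?thesis using osc[of t s] greater t s s1 by simp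
          qed (use e in simp)
        qed
        then show ?thesis using ts S0 by linarith
      qed
    qed
    have ii: "(\<lambda>s. (1 + 2 * D) * indicat_real {u - r..u + r} s) integrable_on {0..1}"
      "integral {0..1} (\<lambda>s. (1 + 2 * D) * indicat_real {u - r..u + r} s) \<le> (1 + 2 * D) * (2 * r)" for u
    proof -
      have "set_integrable lborel {0..1} (indicat_real {u - r..u + r})"
        unfolding set_integrable_def
        by (rule Bochner_Integration.integrable_bound[where f = "indicat_real {0..1::real}"])
           (auto simp: indicator_def emeasure_lborel_Icc_eq)
      from set_borel_integral_eq_integral[OF this]
      have i: "indicat_real {u - r..u + r} integrable_on {0..1}"
        and v: "integral {0..1} (indicat_real {u - r..u + r}) = (LINT s : {0..1} | lborel. indicat_real {u - r..u + r} s)"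
        by auto
      show "(\<lambda>s. (1 + 2 * D) * indicat_real {u - r..u + r} s) integrable_on {0..1}"
        using i by (rule integrable_on_mult_right)
      have "(LINT s : {0..1} | lborel. indicat_real {u - r..u + r} s) = measure lborel ({0..1} \<inter> {u - r..u + r})"
        unfolding set_lebesgue_integral_def by (simp add: indicator_inter_arith[symmetric])
      also have "\<dots> \<le> measure lborel {u - r..u + r}"
        by (intro measure_mono_fmeasurable) (auto simp: fmeasurable_def emeasure_lborel_Icc_eq)
      also have "\<dots> = 2 * r" using r by simp
      finally show "integral {0..1} (\<lambda>s. (1 + 2 * D) * indicat_real {u - r..u + r} s) \<le> (1 + 2 * D) * (2 * r)"
        using D0 v by (simp add: mult_left_mono)
    qed
    have "L1_dist y x \<le> integral {0..1} (\<lambda>s. (r + e / 3) + (\<Sum>u\<in>T. (1 + 2 * D) * indicat_real {u - r..u + r} s))"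
      unfolding L1_dist_def using pt ii(1) T(1)
      by (intro integral_le abs_diff_sk_integrable integrable_add integrable_sum) auto
    also have "\<dots> = (r + e / 3) + (\<Sum>u\<in>T. integral {0..1} (\<lambda>s. (1 + 2 * D) * indicat_real {u - r..u + r} s))"
      by (subst integral_add[OF integrable_const_ivl integrable_sum[OF T(1) ii(1)]], subst integral_sum[OF T(1) ii(1)]) simp
    also have "\<dots> \<le> (r + e / 3) + (\<Sum>u\<in>T. (1 + 2 * D) * (2 * r))"
      using ii(2) by (intro add_left_mono sum_mono)
    also have "\<dots> = (r + e / 3) + 2 * n * (1 + 2 * D) * r" by (simp add: n_def)
    also have "\<dots> \<le> e" using r1 r2 by linarith
    finally show ?thesis .
  qed
  then show ?thesis using r by blast
qed

section \<open>Removing the drift is a homeomorphism\<close>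

locale additive_drift =
  fixes b :: "real \<Rightarrow> real" and K C :: real
  assumes b_bound: "\<bar>b u\<bar> \<le> K" and b_lip: "\<bar>b u - b v\<bar> \<le> C * \<bar>u - v\<bar>" and C_pos: "0 < C"
begin

lemma K_nonneg: "0 \<le> K" using b_bound[of 0] by linarith

lemma b_cont: "continuous_on UNIV b"
proof -
  have "C-lipschitz_on UNIV b" using b_lip C_pos by (intro lipschitz_onI) (auto simp: dist_real_def)
  then show ?thesis by (rule lipschitz_on_continuous_on)
qed

lemma b_borel [measurable]: "b \<in> borel_measurable borel"
  using b_cont by (rule borel_measurable_continuous_onI)

definition drift :: "(real \<Rightarrow> real) \<Rightarrow> real \<Rightarrow> real" where
  "drift f t = integral {0..t} (\<lambda>s. b (f s))"

definition unit_borel :: "(real \<Rightarrow> real) \<Rightarrow> bool" where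
  "unit_borel f \<longleftrightarrow> f \<in> borel_measurable (restrict_space borel {0..1})"

lemma unit_borel_sk [simp]: "unit_borel (sk_fun x)"
  unfolding unit_borel_def by (rule sk_fun_borel)

lemma drift_integrable:
  assumes "unit_borel f" "0 \<le> r" "t \<le> 1"
  shows "(\<lambda>s. b (f s)) integrable_on {r..t}"
    and "(LINT s : {r..t} | lborel. b (f s)) = integral {r..t} (\<lambda>s. b (f s))"
proof -
  have "(\<lambda>s. b (f s)) \<in> borel_measurable (restrict_space borel {0..1})"
    using assms(1) unfolding unit_borel_def by measurable
  note * = bounded_borel_integrable[OF this b_bound assms(2,3)]
  show "(\<lambda>s. b (f s)) integrable_on {r..t}"
    "(LINT s : {r..t} | lborel. b (f s)) = integral {r..t} (\<lambda>s. b (f s))"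
    by (rule *)+
qed

lemma drift_lipschitz:
  assumes "unit_borel f" "s \<in> {0..1}" "t \<in> {0..1}"
  shows "\<bar>drift f t - drift f s\<bar> \<le> K * \<bar>t - s\<bar>"
proof -
  have *: "\<bar>drift f t - drift f s\<bar> \<le> K * \<bar>t - s\<bar>" if "0 \<le> s" "s \<le> t" "t \<le> 1" for s t
  proof -
    have "drift f s + integral {s..t} (\<lambda>s. b (f s)) = drift f t"
      unfolding drift_def using that assms(1)
      by (intro Henstock_Kurzweil_Integration.integral_combine drift_integrable) auto
    moreover have "norm (integral {s..t} (\<lambda>s. b (f s))) \<le> K * (t - s)"
      using integral_norm_bound_integral[of "\<lambda>s. b (f s)" "{s..t}" "\<lambda>_. K"] that b_bound
        drift_integrable(1)[OF assms(1), of s t] by (auto simp: mult.commute)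
    ultimately show ?thesis using that by auto
  qed
  show ?thesis using *[of s t] *[of t s] assms(2,3) by (cases "s \<le> t") (auto simp: abs_minus_commute)
qed

lemma drift_continuous:
  assumes "unit_borel f"
  shows "continuous_on {0..1} (drift f)"
proof -
  have "K-lipschitz_on {0..1} (drift f)"
    using drift_lipschitz[OF assms] K_nonneg by (intro lipschitz_onI) (auto simp: dist_real_def)
  then show ?thesis by (rule lipschitz_on_continuous_on)
qed

lemma drift_zero [simp]: "drift f 0 = 0" by (simp add: drift_def)

lemma drift_diff_local:
  assumes "t \<in> {0..1}"
  shows "\<bar>drift (sk_fun x) t - drift (sk_fun y) t\<bar> \<le> C * integral {0..t} (\<lambda>s. \<bar>sk_fun x s - sk_fun y s\<bar>)"
proof -
  have "drift (sk_fun x) t - drift (sk_fun y) t = integral {0..t} (\<lambda>s. b (sk_fun x s) - b (sk_fun y s))"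
    unfolding drift_def using assms by (subst integral_diff) (auto intro!: drift_integrable)
  also have "norm \<dots> \<le> integral {0..t} (\<lambda>s. C * \<bar>sk_fun x s - sk_fun y s\<bar>)"
    using assms b_lip by (intro integral_norm_bound_integral integrable_diff drift_integrable
        integrable_on_mult_right abs_diff_sk_integrable) auto
  finally show ?thesis by simp
qed

lemma drift_diff:
  assumes "t \<in> {0..1}"
  shows "\<bar>drift (sk_fun x) t - drift (sk_fun y) t\<bar> \<le> C * L1_dist x y"
proof -
  have "integral {0..t} (\<lambda>s. \<bar>sk_fun x s - sk_fun y s\<bar>) \<le> L1_dist x y"
    unfolding L1_dist_def using assms by (intro integral_subset_le abs_diff_sk_integrable) auto
  from mult_left_mono[OF this less_imp_le[OF C_pos]] drift_diff_local[OF assms, of x y]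
  show ?thesis by linarith
qed

text \<open>
  The inverse of the solution map: it recovers the driving path from the solution. In contrast to the
  solution map it is explicit, so that jumps can be read off directly.
\<close>

definition remove_drift :: "skorokhod \<Rightarrow> skorokhod" where
  "remove_drift x = sk_of (\<lambda>t. sk_fun x t + - drift (sk_fun x) t)"

lemma remove_drift:
  assumes "t \<in> {0..1}"
  shows "sk_fun (remove_drift x) t = sk_fun x t - drift (sk_fun x) t"
  unfolding remove_drift_def
  by (subst sk_fun_sk_of_add) (use assms in \<open>auto intro!: continuous_intros drift_continuous\<close>)

text \<open>
  Solutions are close in \<open>L1\<close> if their driving paths are. This gives the injectivity of
  \<open>remove_drift\<close> and the continuity of its inverse.
\<close>

lemma L1_dist_solution_le:
  "L1_dist x y \<le> (1 + C * exp C) * L1_dist (remove_drift x) (remove_drift y)"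
  unfolding L1_dist_def
proof (rule gronwall_integral)
  fix s :: real assume s: "s \<in> {0..1}"
  show "\<bar>sk_fun x s - sk_fun y s\<bar> \<le> C * integral {0..s} (\<lambda>s. \<bar>sk_fun x s - sk_fun y s\<bar>) +
      \<bar>sk_fun (remove_drift x) s - sk_fun (remove_drift y) s\<bar>"
    using drift_diff_local[OF s, of x y] unfolding remove_drift[OF s] by linarith
qed (use C_pos in \<open>auto intro!: abs_diff_sk_integrable\<close>)

lemma remove_drift_inj:
  assumes "remove_drift x = remove_drift y"
  shows "x = y"
proof (rule sk_fun_eqI)
  fix t :: real assume t: "t \<in> {0..1}"
  have "L1_dist (remove_drift x) (remove_drift y) = 0" using assms by (simp add: L1_dist_def)
  then have "L1_dist x y \<le> 0" using L1_dist_solution_le[of x y] by simp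
  then have "C * L1_dist x y \<le> 0" using C_pos by (simp add: mult_le_0_iff)
  then have "drift (sk_fun x) t = drift (sk_fun y) t" using drift_diff[OF t, of x y] by linarith
  then show "sk_fun x t = sk_fun y t"
    using remove_drift[OF t, of x] remove_drift[OF t, of y] assms by simp
qed

text \<open>
  Picard's fixed point argument. The unknown is the drift of the solution, which is a continuous
  function even if \<open>g\<close> jumps. With the weight \<open>exp (- 2 * C * t)\<close> the integral operator
  contracts by the factor \<open>1/2\<close>; clamping the time to \<open>[0,1]\<close> places it on the complete space of
  bounded continuous functions on the line.
\<close>

lemma remove_drift_surj: "\<exists>x. remove_drift x = g"
proof -
  define cl :: "real \<Rightarrow> real" where "cl t = max 0 (min 1 t)" for t
  have cl: "cl t \<in> {0..1}" "t \<in> {0..1} \<Longrightarrow> cl t = t" for t by (auto simp: cl_def)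
  have cl_cont: "continuous_on UNIV cl" unfolding cl_def by (intro continuous_intros)
  \<comment> \<open>\<open>v\<close> stands for the drift multiplied by \<open>exp (- 2 * C * t)\<close>\<close>
  define path where "path v s = exp (2 * C * s) * apply_bcontfun v s + sk_fun g s" for v s
  have ub: "unit_borel (path v)" for v
  proof -
    have "continuous_on UNIV (apply_bcontfun v)" using bcontfun_def apply_bcontfun[of v] by blast
    then have "apply_bcontfun v \<in> borel_measurable borel" by (rule borel_measurable_continuous_onI)
    then have [measurable]: "apply_bcontfun v \<in> borel_measurable (restrict_space borel {0..1})" by (rule measurable_restrict_space1)
    have [measurable]: "(\<lambda>s::real. s) \<in> borel_measurable (restrict_space borel {0..1})" by (rule measurable_restrict_space1) simp
    show ?thesis unfolding unit_borel_def path_def using sk_fun_borel[of g] by measurable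
  qed
  define T where "T v = Bcontfun (\<lambda>t. exp (- 2 * C * cl t) * drift (path v) (cl t))" for v
  have drift_b: "\<bar>drift (path v) t\<bar> \<le> K" if "t \<in> {0..1}" for v t
  proof -
    have "\<bar>drift (path v) t\<bar> \<le> K * \<bar>t\<bar>" using drift_lipschitz[OF ub, of 0 t v] that by simp
    also have "\<dots> \<le> K * 1" using that K_nonneg by (intro mult_left_mono) auto
    finally show ?thesis by simp
  qed
  have TB: "(\<lambda>t. exp (- 2 * C * cl t) * drift (path v) (cl t)) \<in> bcontfun" for v
  proof (rule bcontfun_normI)
    have "continuous_on UNIV (\<lambda>t. drift (path v) (cl t))"
      by (rule continuous_on_compose2[OF drift_continuous[OF ub] cl_cont]) (use cl in auto)
    then show "continuous_on UNIV (\<lambda>t. exp (- 2 * C * cl t) * drift (path v) (cl t))"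
      by (intro continuous_intros cl_cont)
    fix t
    have "exp (- 2 * C * cl t) * \<bar>drift (path v) (cl t)\<bar> \<le> 1 * K"
      using cl(1)[of t] C_pos by (intro mult_mono drift_b) auto
    then show "norm (exp (- 2 * C * cl t) * drift (path v) (cl t)) \<le> K" by (simp add: abs_mult)
  qed
  have Tap: "apply_bcontfun (T v) t = exp (- 2 * C * cl t) * drift (path v) (cl t)" for v t
    unfolding T_def by (subst Bcontfun_inverse[OF TB]) simp
  have "dist (T v) (T w) \<le> (1 / 2) * dist v w" for v w
  proof (rule dist_bound)
    fix t
    define D where "D = dist v w"
    let ?t = "cl t"
    have t: "0 \<le> ?t" "?t \<le> 1" using cl(1)[of t] by auto
    \<comment> \<open>the exponential weight turns the integral of the Lipschitz bound into the factor \<open>1/2\<close>\<close>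
    have i: "((\<lambda>s. C * (exp (2 * C * s) * D)) has_integral (exp (2 * C * ?t) * D / 2 - exp (2 * C * 0) * D / 2)) {0..?t}"
      using t C_pos by (intro fundamental_theorem_of_calculus)
        (auto intro!: derivative_eq_intros simp: has_real_derivative_iff_has_vector_derivative[symmetric])
    have "drift (path v) ?t - drift (path w) ?t = integral {0..?t} (\<lambda>s. b (path v s) - b (path w s))"
      unfolding drift_def using t by (subst integral_diff) (auto intro!: drift_integrable ub)
    also have "norm \<dots> \<le> integral {0..?t} (\<lambda>s. C * (exp (2 * C * s) * D))"
    proof (intro integral_norm_bound_integral integrable_diff drift_integrable ub t has_integral_integrable[OF i] order.refl)
      fix s assume "s \<in> {0..?t}"
      have "\<bar>b (path v s) - b (path w s)\<bar> \<le> C * \<bar>path v s - path w s\<bar>" by (rule b_lip)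
      also have "path v s - path w s = exp (2 * C * s) * (apply_bcontfun v s - apply_bcontfun w s)"
        by (simp add: path_def algebra_simps)
      also have "C * \<bar>\<dots>\<bar> \<le> C * (exp (2 * C * s) * D)"
        unfolding abs_mult D_def using dist_bounded[of v s w] C_pos
        by (intro mult_left_mono) (auto simp: dist_real_def)
      finally show "norm (b (path v s) - b (path w s)) \<le> C * (exp (2 * C * s) * D)" by simp
    qed
    also have "\<dots> \<le> exp (2 * C * ?t) * D / 2" using integral_unique[OF i] by (simp add: D_def)
    finally have "\<bar>drift (path v) ?t - drift (path w) ?t\<bar> \<le> exp (2 * C * ?t) * D / 2" by simp
    then have "exp (- 2 * C * ?t) * \<bar>drift (path v) ?t - drift (path w) ?t\<bar> \<le> exp (- 2 * C * ?t) * (exp (2 * C * ?t) * D / 2)"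
      by (intro mult_left_mono) auto
    also have "\<dots> = D / 2" by (simp add: exp_minus)
    finally have "\<bar>exp (- 2 * C * ?t) * (drift (path v) ?t - drift (path w) ?t)\<bar> \<le> D / 2"
      by (simp add: abs_mult)
    then show "dist (apply_bcontfun (T v) t) (apply_bcontfun (T w) t) \<le> (1 / 2) * dist v w"
      unfolding Tap dist_real_def D_def by (simp add: right_diff_distrib)
  qed
  then obtain v where v: "T v = v" using banach_fix_type[of "1 / 2" T] by auto
  define x where "x = sk_of (\<lambda>t. sk_fun g t + drift (path v) t)"
  have x: "sk_fun x t = sk_fun g t + drift (path v) t" if "t \<in> {0..1}" for t
    unfolding x_def using that by (subst sk_fun_sk_of_add[OF drift_continuous[OF ub]]) simp
  have xp: "sk_fun x t = path v t" if t: "t \<in> {0..1}" for t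
  proof -
    have "apply_bcontfun v t = exp (- 2 * C * t) * drift (path v) t"
      using Tap[of v t] v cl(2)[OF t] by simp
    then have "exp (2 * C * t) * apply_bcontfun v t = drift (path v) t" by (simp add: exp_minus)
    then show ?thesis using x[OF t] by (simp add: path_def)
  qed
  have "drift (sk_fun x) t = drift (path v) t" if "t \<in> {0..1}" for t
    unfolding drift_def using xp that by (intro integral_cong) auto
  then have "remove_drift x = g"
    using x by (intro sk_fun_eqI) (simp add: remove_drift)
  then show ?thesis ..
qed

text \<open>Existence and uniqueness turn the definite description of the solution map into an equation.\<close>

lemma solution_map_iff: "x = solution_map b g \<longleftrightarrow> remove_drift x = g"
proof -
  have "(\<forall>t\<in>{0..1}. sk_fun f t = (LINT s : {0..t} | lborel. b (sk_fun f s)) + sk_fun g t) \<longleftrightarrow> remove_drift f = g" for f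
  proof -
    have "remove_drift f = g \<longleftrightarrow> (\<forall>t\<in>{0..1}. sk_fun (remove_drift f) t = sk_fun g t)"
      using sk_fun_eqI by blast
    also have "\<dots> \<longleftrightarrow> (\<forall>t\<in>{0..1}. sk_fun f t = (LINT s : {0..t} | lborel. b (sk_fun f s)) + sk_fun g t)"
      by (intro ball_cong refl) (auto simp: remove_drift drift_integrable(2) drift_def)
    finally show ?thesis by simp
  qed
  then have e: "solution_map b g = (THE f. remove_drift f = g)" unfolding solution_map_def by simp
  obtain x0 where x0: "remove_drift x0 = g" using remove_drift_surj by blast
  have eq: "solution_map b g = x0" unfolding e
  proof (rule the_equality)
    show "remove_drift x0 = g" by (rule x0)
    fix f assume "remove_drift f = g"
    then show "f = x0" using x0 remove_drift_inj[of f x0] by simp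
  qed
  show ?thesis
  proof
    assume "x = solution_map b g" then show "remove_drift x = g" using x0 eq by simp
  next
    assume "remove_drift x = g"
    then have "x = x0" using x0 remove_drift_inj[of x x0] by simp
    then show "x = solution_map b g" using eq by simp
  qed
qed

lemma remove_drift_solution_map [simp]: "remove_drift (solution_map b g) = g"
  by (rule iffD1[OF solution_map_iff refl])

lemma solution_map_remove_drift [simp]: "solution_map b (remove_drift x) = x"
  by (rule iffD2[OF solution_map_iff refl, symmetric])

text \<open>
  One time change serves for the paths with and without drift: moving the time costs \<open>K * r\<close>, since
  the drift is \<open>K\<close>-Lipschitz in time, and exchanging the paths costs \<open>C\<close> times their \<open>L1\<close> distance. The
  sign \<open>\<sigma>\<close> covers both removing and restoring the drift.
\<close>

lemma dist_drift_le:
  assumes "dist y x < r" "0 < r" "\<bar>\<sigma>\<bar> = 1"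
    and "\<And>t. t \<in> {0..1} \<Longrightarrow> sk_fun y' t = sk_fun y t + \<sigma> * drift (sk_fun v) t"
    and "\<And>t. t \<in> {0..1} \<Longrightarrow> sk_fun x' t = sk_fun x t + \<sigma> * drift (sk_fun w) t"
  shows "dist y' x' \<le> r + K * r + C * L1_dist v w"
proof -
  obtain l where l: "l \<in> time_changes" "\<forall>t\<in>{0..1}. \<bar>l t - t\<bar> < r \<and> \<bar>sk_fun y (l t) - sk_fun x t\<bar> < r"
    using sk_dist_lessD[OF assms(1)] by blast
  have L0: "0 \<le> C * L1_dist v w" using C_pos
    unfolding L1_dist_def by (intro mult_nonneg_nonneg integral_nonneg abs_diff_sk_integrable) auto
  show ?thesis
  proof (rule sk_dist_leI[OF l(1)])
    fix t :: real assume t: "t \<in> {0..1}"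
    have lt: "l t \<in> {0..1}" by (rule time_changesD(3)[OF l(1) t])
    have r: "\<bar>l t - t\<bar> < r" "\<bar>sk_fun y (l t) - sk_fun x t\<bar> < r" using l(2) t by auto
    have Kr: "K * \<bar>l t - t\<bar> \<le> K * r" using r K_nonneg by (intro mult_left_mono) auto
    show "\<bar>l t - t\<bar> \<le> r + K * r + C * L1_dist v w"
      using r(1) L0 mult_nonneg_nonneg[OF K_nonneg less_imp_le[OF assms(2)]] by linarith
    have "\<bar>\<sigma> * (drift (sk_fun v) (l t) - drift (sk_fun w) t)\<bar> \<le> K * r + C * L1_dist v w"
      using drift_diff[OF lt, of v w] drift_lipschitz[OF unit_borel_sk t lt, of w] Kr assms(3)
      by (simp add: abs_mult)
    moreover have "sk_fun y' (l t) - sk_fun x' t = (sk_fun y (l t) - sk_fun x t) + \<sigma> * (drift (sk_fun v) (l t) - drift (sk_fun w) t)"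
      using assms(4)[OF lt] assms(5)[OF t] by (simp add: algebra_simps)
    ultimately show "\<bar>sk_fun y' (l t) - sk_fun x' t\<bar> \<le> r + K * r + C * L1_dist v w"
      using r(2) by linarith
  qed
qed

lemma continuous_by_L1:
  fixes \<psi> :: "skorokhod \<Rightarrow> skorokhod"
  assumes M: "0 < M" and le: "\<And>x y r. 0 < r \<Longrightarrow> dist y x < r \<Longrightarrow> dist (\<psi> y) (\<psi> x) \<le> r + K * r + M * L1_dist y x"
  shows "continuous_on UNIV \<psi>"
  unfolding continuous_on_iff
proof (intro ballI allI impI)
  fix x :: skorokhod and e :: real assume e: "0 < e"
  have "e / (3 * M) > 0" using e M by simp
  from L1_dist_small[OF this, of x] obtain r0 where r0: "r0 > 0" "\<forall>y. dist y x < r0 \<longrightarrow> L1_dist y x \<le> e / (3 * M)" by blast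
  define r where "r = min r0 (e / (3 * (K + 1)))"
  have K1: "K + 1 > 0" using K_nonneg by linarith
  have r: "r > 0" using r0 e K1 by (simp add: r_def)
  have "(K + 1) * r \<le> (K + 1) * (e / (3 * (K + 1)))" using K1 by (intro mult_left_mono) (auto simp: r_def)
  also have "\<dots> = e / 3"
    using nonzero_mult_divide_mult_cancel_left[of "K + 1" e 3] K1 by (simp add: mult.commute)
  finally have Kr: "r + K * r \<le> e / 3" by (simp add: algebra_simps)
  show "\<exists>d>0. \<forall>x'\<in>UNIV. dist x' x < d \<longrightarrow> dist (\<psi> x') (\<psi> x) < e"
  proof (intro exI[of _ r] conjI ballI impI r)
    fix y assume y: "dist y x < r"
    have "L1_dist y x \<le> e / (3 * M)" using y r0 by (simp add: r_def)
    then have "M * L1_dist y x \<le> M * (e / (3 * M))" using M by (intro mult_left_mono) auto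
    also have "\<dots> = e / 3" using M by simp
    finally show "dist (\<psi> y) (\<psi> x) < e" using le[OF r y] Kr e by linarith
  qed
qed

lemma remove_drift_continuous: "continuous_on UNIV remove_drift"
proof (rule continuous_by_L1[OF C_pos])
  fix x y :: skorokhod and r :: real assume "0 < r" "dist y x < r"
  then show "dist (remove_drift y) (remove_drift x) \<le> r + K * r + C * L1_dist y x"
    by (intro dist_drift_le[where \<sigma> = "-1"]) (auto simp: remove_drift)
qed

lemma solution_map_continuous: "continuous_on UNIV (solution_map b)"
proof (rule continuous_by_L1[of "C * (1 + C * exp C)"])
  show "0 < C * (1 + C * exp C)" using C_pos by (simp add: add_pos_pos)
  fix g h :: skorokhod and r :: real assume r: "0 < r" "dist h g < r"
  let ?x = "solution_map b g" and ?y = "solution_map b h"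
  have "dist ?y ?x \<le> r + K * r + C * L1_dist ?y ?x"
  proof (rule dist_drift_le[OF r(2,1), where \<sigma> = 1])
    fix t :: real assume t: "t \<in> {0..1}"
    show "sk_fun ?y t = sk_fun h t + 1 * drift (sk_fun ?y) t"
      using remove_drift[OF t, of ?y] by simp
    show "sk_fun ?x t = sk_fun g t + 1 * drift (sk_fun ?x) t"
      using remove_drift[OF t, of ?x] by simp
  qed simp
  also have "C * L1_dist ?y ?x \<le> C * ((1 + C * exp C) * L1_dist h g)"
    using L1_dist_solution_le[of ?y ?x] C_pos by (intro mult_left_mono) auto
  finally show "dist ?y ?x \<le> r + K * r + C * (1 + C * exp C) * L1_dist h g" by (simp add: mult.assoc)
qed

lemma left_limit_remove_drift:
  assumes "t \<in> {0<..1}"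
  shows "Lim (at_left t) (sk_fun (remove_drift x)) = Lim (at_left t) (sk_fun x) - drift (sk_fun x) t"
proof -
  obtain l where l: "(sk_fun x \<longlongrightarrow> l) (at_left t)" using sk_fun_left_tendsto[of t x] assms by auto
  have "((\<lambda>s. sk_fun x s - drift (sk_fun x) s) \<longlongrightarrow> l - drift (sk_fun x) t) (at_left t)"
    using assms by (intro tendsto_diff l sk_left_limit_right_cont(2) drift_continuous) auto
  moreover have "\<forall>\<^sub>F s in at_left t. sk_fun x s - drift (sk_fun x) s = sk_fun (remove_drift x) s"
  proof -
    have "\<forall>\<^sub>F s in at_left t. s \<in> {0<..<t}" using assms by (intro eventually_at_left_real) auto
    then show ?thesis by eventually_elim (use assms in \<open>auto simp: remove_drift\<close>)
  qed
  ultimately have "(sk_fun (remove_drift x) \<longlongrightarrow> l - drift (sk_fun x) t) (at_left t)"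
    by (rule Lim_transform_eventually)
  then have "Lim (at_left t) (sk_fun (remove_drift x)) = l - drift (sk_fun x) t"
    using assms by (intro tendsto_Lim) (auto simp: trivial_limit_at_left_real)
  moreover have "Lim (at_left t) (sk_fun x) = l" using l by (intro tendsto_Lim) auto
  ultimately show ?thesis by simp
qed

text \<open>The drift is continuous in time, so left limits and values are shifted by the same amount.\<close>

lemma jumps_remove_drift:
  "up_jumps (remove_drift x) = up_jumps x" "down_jumps (remove_drift x) = down_jumps x"
  unfolding up_jumps_def down_jumps_def
  by (rule arg_cong[where f = card], auto simp: left_limit_remove_drift remove_drift)+

end

section \<open>Chains of distinct values and step functions\<close>

text \<open>The rate function of the driving noise, that is, of the equation with \<open>b = 0\<close>.\<close>

definition step_rate :: "real \<Rightarrow> real \<Rightarrow> skorokhod \<Rightarrow> ereal" where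
  "step_rate \<alpha> \<beta> g = (if step_path g \<and> sk_fun g 0 = 0
     then ereal ((\<alpha> - 1) * real (up_jumps g) + (\<beta> - 1) * real (down_jumps g)) else \<infinity>)"

text \<open>
  A chain records a lower bound on the number of jumps of a path that is stable under small time
  changes and small uniform perturbations, and it makes sense for paths that are not step functions.
\<close>

definition chain :: "skorokhod \<Rightarrow> nat \<Rightarrow> (nat \<Rightarrow> real) \<Rightarrow> bool" where
  "chain g m u \<longleftrightarrow> u ` {..m} \<subseteq> {0..1} \<and> strict_mono_on {..m} u \<and> (\<forall>i<m. sk_fun g (u i) \<noteq> sk_fun g (u (Suc i)))"

definition ups :: "skorokhod \<Rightarrow> nat \<Rightarrow> (nat \<Rightarrow> real) \<Rightarrow> nat" where
  "ups g m u = card {i. i < m \<and> sk_fun g (u i) < sk_fun g (u (Suc i))}"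

definition downs :: "skorokhod \<Rightarrow> nat \<Rightarrow> (nat \<Rightarrow> real) \<Rightarrow> nat" where
  "downs g m u = card {i. i < m \<and> sk_fun g (u (Suc i)) < sk_fun g (u i)}"

lemma ups_plus_downs:
  assumes "chain g m u"
  shows "ups g m u + downs g m u = m"
proof -
  have "{i. i < m \<and> sk_fun g (u i) < sk_fun g (u (Suc i))} \<union> {i. i < m \<and> sk_fun g (u (Suc i)) < sk_fun g (u i)} = {..<m}"
    using assms by (auto simp: chain_def)
  then have "card ({i. i < m \<and> sk_fun g (u i) < sk_fun g (u (Suc i))} \<union> {i. i < m \<and> sk_fun g (u (Suc i)) < sk_fun g (u i)}) = m"
    by simp
  then show ?thesis unfolding ups_def downs_def by (subst card_Un_disjoint[symmetric]) auto
qed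

lemma chain_extend:
  assumes c: "chain g m u" and t: "u m < t" "t \<le> 1" and ne: "sk_fun g (u m) \<noteq> sk_fun g t"
  shows "chain g (Suc m) (u(Suc m := t))"
proof -
  have mono: "u i \<le> u m" if "i \<le> m" for i
  proof (cases "i = m")
    case False
    have "strict_mono_on {..m} u" using c by (simp add: chain_def)
    then have "u i < u m" using that False by (intro strict_mono_onD[of "{..m}" u]) auto
    then show ?thesis by simp
  qed simp
  have um: "0 \<le> u m" using c by (auto simp: chain_def)
  show ?thesis unfolding chain_def
  proof (intro conjI allI impI)
    show "(u(Suc m := t)) ` {..Suc m} \<subseteq> {0..1}"
      using c t um by (auto simp: chain_def atMost_Suc)
    show "strict_mono_on {..Suc m} (u(Suc m := t))"
    proof (rule strict_mono_onI)
      fix i j assume ij: "i \<in> {..Suc m}" "j \<in> {..Suc m}" "i < j"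
      then have i: "i \<le> m" by simp
      show "(u(Suc m := t)) i < (u(Suc m := t)) j"
      proof (cases "j = Suc m")
        case True
        then show ?thesis using mono[OF i] t i by simp
      next
        case False
        then have jm: "j \<le> m" using ij by simp
        have "strict_mono_on {..m} u" using c by (simp add: chain_def)
        then have "u i < u j" using ij i jm by (intro strict_mono_onD[of "{..m}" u]) auto
        then show ?thesis using False i jm by simp
      qed
    qed
    fix i assume "i < Suc m"
    then show "sk_fun g ((u(Suc m := t)) i) \<noteq> sk_fun g ((u(Suc m := t)) (Suc i))"
      using c ne by (cases "i = m") (auto simp: chain_def)
  qed
qed

text \<open>
  A gap to the left of time \<open>1\<close> that is uniform near \<open>1\<close>. Time changes fix \<open>1\<close>, so all paths near
  \<open>g\<close> inherit it.
\<close>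

definition jump_at_one :: "skorokhod \<Rightarrow> bool" where
  "jump_at_one g \<longleftrightarrow> (\<exists>e>0. \<exists>c<1. 0 < c \<and> (\<forall>t. c < t \<and> t < 1 \<longrightarrow> e \<le> \<bar>sk_fun g 1 - sk_fun g t\<bar>))"

lemma not_jump_at_one:
  assumes "\<not> jump_at_one g"
  shows "(sk_fun g \<longlongrightarrow> sk_fun g 1) (at_left 1)"
proof -
  obtain l where l: "(sk_fun g \<longlongrightarrow> l) (at_left 1)" using sk_fun_left_tendsto[of 1 g] by auto
  have "l = sk_fun g 1"
  proof (rule ccontr)
    assume ne: "l \<noteq> sk_fun g 1"
    define e where "e = \<bar>sk_fun g 1 - l\<bar> / 2"
    have e: "0 < e" using ne by (simp add: e_def)
    have "\<forall>\<^sub>F s in at_left 1. dist (sk_fun g s) l < e" by (rule tendstoD[OF l e])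
    then obtain c where c: "c < 1" "\<forall>s. c < s \<longrightarrow> s < 1 \<longrightarrow> dist (sk_fun g s) l < e"
      unfolding eventually_at_left[of 0 1, OF zero_less_one] by blast
    have "jump_at_one g" unfolding jump_at_one_def
    proof (rule exI[of _ e], rule conjI[OF e], rule exI[of _ "max c (1/2)"], intro conjI allI impI)
      fix t assume "max c (1/2) < t \<and> t < (1::real)"
      then have "\<bar>sk_fun g t - l\<bar> < e" using c(2) by (auto simp: dist_real_def)
      moreover have "\<bar>sk_fun g 1 - l\<bar> \<le> \<bar>sk_fun g 1 - sk_fun g t\<bar> + \<bar>sk_fun g t - l\<bar>" by linarith
      moreover have "\<bar>sk_fun g 1 - l\<bar> = 2 * e" by (simp add: e_def)
      ultimately show "e \<le> \<bar>sk_fun g 1 - sk_fun g t\<bar>" by linarith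
    qed (use c in auto)
    then show False using assms by contradiction
  qed
  then show ?thesis using l by simp
qed

text \<open>
  Let \<open>V t\<close> be the largest length of a chain up to time \<open>t\<close>. It is non-decreasing with finitely many
  values, and the path is constant where \<open>V\<close> is: a change of value would prolong a longest chain.
  Right continuity covers an increase of \<open>V\<close> immediately after a time, and continuity at \<open>1\<close> covers
  the end point.
\<close>

lemma bounded_chains_imp_step_path:
  assumes bound: "\<And>m u. chain g m u \<Longrightarrow> m \<le> K" and j1: "\<not> jump_at_one g"
  shows "step_path g"
proof -
  let ?f = "sk_fun g"
  define W where "W t = {m. \<exists>u. chain g m u \<and> u m \<le> t}" for t
  define V where "V t = Max (W t)" for t
  have Wfin: "finite (W t)" for t
    by (rule finite_subset[of _ "{..K}"]) (auto simp: W_def dest: bound)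
  have W0: "0 \<in> W t" if "0 \<le> t" for t
  proof -
    have "chain g 0 (\<lambda>_. 0)" by (auto simp: chain_def strict_mono_on_def)
    then show ?thesis using that unfolding W_def by (intro CollectI exI[of _ "\<lambda>_. 0"]) auto
  qed
  have Vin: "V t \<in> W t" if "0 \<le> t" for t unfolding V_def using Wfin W0[OF that] by (intro Max_in) auto
  have Vle: "V t \<le> K" if "0 \<le> t" for t using Vin[OF that] bound by (auto simp: W_def)
  have Vge: "m \<le> V t" if "m \<in> W t" for m t unfolding V_def using Wfin that by (rule Max_ge)
  have Vmono: "V s \<le> V t" if "0 \<le> s" "s \<le> t" for s t
  proof (rule Vge)
    show "V s \<in> W t" using Vin[OF that(1)] that(2) unfolding W_def by force
  qed
  have const: "?f s = ?f t" if st: "0 \<le> s" "s \<le> t" "t \<le> 1" and V: "V s = V t" for s t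
  proof (rule ccontr)
    assume ne: "?f s \<noteq> ?f t"
    obtain u where u: "chain g (V s) u" "u (V s) \<le> s" using Vin[OF st(1)] unfolding W_def by blast
    show False
    proof (cases "?f (u (V s)) = ?f t")
      case True
      then have ne': "?f (u (V s)) \<noteq> ?f s" using ne by simp
      then have "u (V s) < s" using u(2) by (cases "u (V s) = s") auto
      then have "chain g (Suc (V s)) (u(Suc (V s) := s))" using st by (intro chain_extend u ne') auto
      then have "Suc (V s) \<in> W s" unfolding W_def by (intro CollectI exI[of _ "u(Suc (V s) := s)"]) simp
      then show False using Vge by fastforce
    next
      case False
      have "s \<noteq> t" using ne by auto
      then have "u (V s) < t" using u(2) st by simp
      then have "chain g (Suc (V s)) (u(Suc (V s) := t))" using st by (intro chain_extend u False) auto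
      then have "Suc (V s) \<in> W t" unfolding W_def by (intro CollectI exI[of _ "u(Suc (V s) := t)"]) simp
      then have "Suc (V s) \<le> V t" by (rule Vge)
      then show False using V by simp
    qed
  qed
  define I where "I k = {t\<in>{0..1}. V t = k}" for k
  define S where "S = Sup ` (I ` {..K}) \<inter> {0<..<1}"
  have Ibd: "bdd_above (I k)" for k
    unfolding I_def by (auto intro!: bdd_aboveI[of _ 1])
  \<comment> \<open>every increase of \<open>V\<close> strictly inside \<open>(s,1)\<close> is recorded in \<open>S\<close>\<close>
  have Vconst: "V x = V y" if "0 \<le> s" "s < x" "x \<le> y" "y < 1" "S \<inter> {s<..y} = {}" for s x y
  proof (rule ccontr)
    assume "V x \<noteq> V y"
    then have lt: "V x < V y" using Vmono[of x y] that by simp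
    define e where "e = Sup (I (V x))"
    have xI: "x \<in> I (V x)" using that by (auto simp: I_def)
    have xe: "x \<le> e" unfolding e_def by (rule cSup_upper[OF xI Ibd])
    have ey: "e \<le> y" unfolding e_def
    proof (rule cSup_least)
      show "I (V x) \<noteq> {}" using xI by blast
      fix w assume w: "w \<in> I (V x)"
      show "w \<le> y"
      proof (rule ccontr)
        assume "\<not> w \<le> y"
        then have "V y \<le> V w" using that by (intro Vmono) auto
        then show False using w lt by (simp add: I_def)
      qed
    qed
    have "V x \<le> K" using Vle[of x] that by simp
    then have "e \<in> S" unfolding S_def e_def using xe ey that unfolding e_def by auto
    then show False using xe ey that by auto
  qed
  have fconst: "?f s = ?f y" if sy: "0 \<le> s" "s < y" "y < 1" "S \<inter> {s<..y} = {}" for s y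
  proof -
    have right: "?f x = ?f y" if "s < x" "x \<le> y" for x
      using that sy Vconst[of s x y] by (intro const) auto
    have "\<forall>\<^sub>F x in at_right s. x \<in> {s<..<y}" using sy by (intro eventually_at_right_real) simp
    then have "\<forall>\<^sub>F x in at_right s. ?f x = ?f y" by eventually_elim (auto intro: right)
    then have l: "(?f \<longlongrightarrow> ?f y) (at_right s)" by (rule tendsto_eventually)
    have "(?f \<longlongrightarrow> ?f s) (at_right s)" using sy by (intro sk_fun_right_tendsto) auto
    from tendsto_unique[OF _ this l] show ?thesis by (simp add: trivial_limit_at_right_real)
  qed
  show ?thesis unfolding step_path_def
  proof (intro exI[of _ S] conjI ballI impI)
    show "finite S" unfolding S_def by simp
    show "S \<subseteq> {0<..<1}" unfolding S_def by blast
    fix s t :: real assume s: "s \<in> {0..1}" and t: "t \<in> {0..1}" and st: "s < t \<and> S \<inter> {s<..t} = {}"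
    show "?f s = ?f t"
    proof (cases "t = 1")
      case False
      then show ?thesis using s t st by (intro fconst) auto
    next
      case True
      have "\<forall>\<^sub>F x in at_left 1. x \<in> {s<..<1}" using st True by (intro eventually_at_left_real) simp
      then have "\<forall>\<^sub>F x in at_left 1. ?f x = ?f s"
      proof eventually_elim
        case (elim x)
        have "S \<inter> {s<..x} = {}" using st elim True by auto
        then show ?case using fconst[of s x] elim s by simp
      qed
      then have l: "(?f \<longlongrightarrow> ?f s) (at_left 1)" by (rule tendsto_eventually)
      from tendsto_unique[OF _ l not_jump_at_one[OF j1]] show ?thesis
        using True by (simp add: trivial_limit_at_left_real)
    qed
  qed
qed

locale steps =
  fixes g :: skorokhod and S :: "real set"
  assumes fin: "finite S" and S01: "S \<subseteq> {0<..<1}"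
    and const: "\<And>s t. s \<in> {0..1} \<Longrightarrow> t \<in> {0..1} \<Longrightarrow> s < t \<Longrightarrow> S \<inter> {s<..t} = {} \<Longrightarrow> sk_fun g s = sk_fun g t"
begin

text \<open>
  The last possible jump time before \<open>t\<close>, or \<open>0\<close> if there is none; the path has its left limit at \<open>t\<close>
  as its value there.
\<close>

definition before :: "real \<Rightarrow> real" where "before t = Max (insert 0 {s\<in>S. s < t})"

lemma before:
  assumes "0 < t"
  shows "0 \<le> before t" "before t < t" "S \<inter> {before t<..<t} = {}"
    and "before t = 0 \<or> before t \<in> S"
proof -
  let ?A = "insert 0 {s\<in>S. s < t}"
  have f: "finite ?A" using fin by simp
  have "before t \<in> ?A" unfolding before_def by (rule Max_in[OF f]) simp
  then show "before t < t" "before t = 0 \<or> before t \<in> S" using assms by auto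
  show "0 \<le> before t" unfolding before_def by (rule Max_ge[OF f]) simp
  have "s \<le> before t" if "s \<in> S" "s < t" for s unfolding before_def using that by (intro Max_ge[OF f]) auto
  then show "S \<inter> {before t<..<t} = {}" by force
qed

definition jump :: "real \<Rightarrow> real" where "jump t = sk_fun g t - sk_fun g (before t)"

lemma left_limit:
  assumes "0 < t" "t \<le> 1"
  shows "Lim (at_left t) (sk_fun g) = sk_fun g (before t)"
proof -
  note b = before[OF assms(1)]
  have "\<forall>\<^sub>F x in at_left t. x \<in> {before t<..<t}" using b by (intro eventually_at_left_real) simp
  then have "\<forall>\<^sub>F x in at_left t. sk_fun g x = sk_fun g (before t)"
  proof eventually_elim
    case (elim x)
    have "S \<inter> {before t<..x} = {}" using b(3) elim by auto
    then show ?case using const[of "before t" x] elim b assms by auto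
  qed
  then have "(sk_fun g \<longlongrightarrow> sk_fun g (before t)) (at_left t)" by (rule tendsto_eventually)
  then show ?thesis by (intro tendsto_Lim) (auto simp: trivial_limit_at_left_real)
qed

lemma jump_outside:
  assumes "0 < t" "t \<le> 1" "t \<notin> S"
  shows "jump t = 0"
proof -
  note b = before[OF assms(1)]
  have "S \<inter> {before t<..t} = {}" using b(3) assms(3) by (force simp: less_le)
  then show ?thesis using const[of "before t" t] b assms unfolding jump_def by simp
qed

lemma up_jumps_eq: "up_jumps g = card {t\<in>S. 0 < jump t}"
  and down_jumps_eq: "down_jumps g = card {t\<in>S. jump t < 0}"
proof -
  have "{t\<in>{0<..1}. Lim (at_left t) (sk_fun g) < sk_fun g t} = {t\<in>S. 0 < jump t}"
  proof (intro set_eqI iffI)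
    fix t assume t: "t \<in> {t\<in>{0<..1}. Lim (at_left t) (sk_fun g) < sk_fun g t}"
    then have "0 < jump t" using left_limit[of t] by (simp add: jump_def)
    moreover from this have "t \<in> S" using jump_outside[of t] t by force
    ultimately show "t \<in> {t\<in>S. 0 < jump t}" by simp
  next
    fix t assume t: "t \<in> {t\<in>S. 0 < jump t}"
    then have "t \<in> {0<..<1}" using S01 by blast
    then show "t \<in> {t\<in>{0<..1}. Lim (at_left t) (sk_fun g) < sk_fun g t}" using t left_limit[of t] by (simp add: jump_def)
  qed
  then show "up_jumps g = card {t\<in>S. 0 < jump t}" unfolding up_jumps_def by simp
  have "{t\<in>{0<..1}. sk_fun g t < Lim (at_left t) (sk_fun g)} = {t\<in>S. jump t < 0}"
  proof (intro set_eqI iffI)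
    fix t assume t: "t \<in> {t\<in>{0<..1}. sk_fun g t < Lim (at_left t) (sk_fun g)}"
    then have "jump t < 0" using left_limit[of t] by (simp add: jump_def)
    moreover from this have "t \<in> S" using jump_outside[of t] t by force
    ultimately show "t \<in> {t\<in>S. jump t < 0}" by simp
  next
    fix t assume t: "t \<in> {t\<in>S. jump t < 0}"
    then have "t \<in> {0<..<1}" using S01 by blast
    then show "t \<in> {t\<in>{0<..1}. sk_fun g t < Lim (at_left t) (sk_fun g)}" using t left_limit[of t] by (simp add: jump_def)
  qed
  then show "down_jumps g = card {t\<in>S. jump t < 0}" unfolding down_jumps_def by simp
qed

definition jump_times :: "real set" where "jump_times = {t\<in>S. jump t \<noteq> 0}"

lemma jump_times: "finite jump_times" "jump_times \<subseteq> {0<..<1}"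
  using fin S01 by (auto simp: jump_times_def)

lemma value_telescope:
  "t \<in> {0..1} \<Longrightarrow> sk_fun g t = sk_fun g 0 + (\<Sum>s\<in>{s\<in>S. s \<le> t}. jump s)"
proof (induction "card {s\<in>S. s \<le> t}" arbitrary: t rule: less_induct)
  case less
  have f: "finite {s\<in>S. s \<le> t}" using fin by simp
  show ?case
  proof (cases "{s\<in>S. s \<le> t} = {}")
    case True
    then have "S \<inter> {0<..t} = {}" by auto
    then have "sk_fun g 0 = sk_fun g t" using const[of 0 t] less.prems by (cases "t = 0") auto
    then show ?thesis unfolding True by simp
  next
    case False
    define r where "r = Max {s\<in>S. s \<le> t}"
    have r: "r \<in> S" "r \<le> t" using Max_in[OF f False] by (auto simp: r_def)
    have r0: "0 < r" "r \<le> 1" using r S01 by force+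
    have rmax: "s \<le> r" if "s \<in> S" "s \<le> t" for s unfolding r_def using that by (intro Max_ge[OF f]) auto
    note b = before[OF r0(1)]
    have "S \<inter> {r<..t} = {}" using rmax by force
    then have 1: "sk_fun g t = sk_fun g r" using const[of r t] r r0 less.prems by (cases "r = t") auto
    have set: "{s\<in>S. s \<le> t} = insert r {s\<in>S. s \<le> before r}" (is "_ = insert r ?B")
    proof (intro set_eqI iffI)
      fix s assume s: "s \<in> {s\<in>S. s \<le> t}"
      show "s \<in> insert r ?B"
      proof (rule ccontr)
        assume c: "s \<notin> insert r ?B"
        then have "s \<in> S \<inter> {before r<..<r}" using s rmax[of s] by force
        then show False using b(3) by blast
      qed
    qed (use r b in auto)
    have nin: "r \<notin> ?B" using b by auto
    have fB: "finite ?B" using fin by simp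
    have "card ?B < card {s\<in>S. s \<le> t}" unfolding set using nin fB by simp
    then have 2: "sk_fun g (before r) = sk_fun g 0 + (\<Sum>s\<in>?B. jump s)" using b r0 by (intro less.hyps) auto
    have "sk_fun g t = sk_fun g (before r) + jump r" using 1 by (simp add: jump_def)
    then show ?thesis unfolding set using nin fB 2 by simp
  qed
qed

lemma value_jump_times:
  assumes "t \<in> {0..1}"
  shows "sk_fun g t = sk_fun g 0 + (\<Sum>s\<in>jump_times. if s \<le> t then jump s else 0)"
proof -
  have "(\<Sum>s\<in>{s\<in>S. s \<le> t}. jump s) = (\<Sum>s\<in>S. if s \<le> t then jump s else 0)"
    using fin by (simp add: sum.If_cases Int_def)
  also have "\<dots> = (\<Sum>s\<in>jump_times. if s \<le> t then jump s else 0)"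
    using fin by (intro sum.mono_neutral_right) (auto simp: jump_times_def)
  finally show ?thesis using value_telescope[OF assms] by simp
qed

lemma jump_counts:
  "up_jumps g = card {t\<in>jump_times. 0 < jump t}" "down_jumps g = card {t\<in>jump_times. jump t < 0}"
  unfolding up_jumps_eq down_jumps_eq jump_times_def by (rule arg_cong[where f = card], auto)+

text \<open>Time \<open>0\<close> followed by the jump times is a chain whose increments are the jumps.\<close>

lemma jump_chain:
  "\<exists>u. chain g (card jump_times) u \<and> ups g (card jump_times) u = up_jumps g \<and> downs g (card jump_times) u = down_jumps g"
proof -
  define xs where "xs = sorted_list_of_set jump_times"
  define m where "m = card jump_times"
  define u where "u i = (if i = 0 then 0 else xs ! (i - 1))" for i :: nat
  have xs: "length xs = m" "set xs = jump_times" "sorted_wrt (<) xs"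
    using jump_times by (simp_all add: xs_def m_def)
  have xin: "xs ! i \<in> jump_times" if "i < m" for i using that xs by (metis nth_mem)
  have uS: "u (Suc i) \<in> jump_times" if "i < m" for i using xin[OF that] by (simp add: u_def)
  have u01: "0 < u (Suc i)" "u (Suc i) < 1" if "i < m" for i using uS[OF that] jump_times by force+
  have inc: "u i < u (Suc i)" if "i < m" for i
  proof (cases i)
    case 0
    then show ?thesis using u01[OF that] by (simp add: u_def)
  next
    case (Suc k)
    then have "xs ! k < xs ! i" using xs that by (auto simp: sorted_wrt_iff_nth_less)
    then show ?thesis using Suc by (simp add: u_def)
  qed
  have gap: "jump_times \<inter> {u i<..<u (Suc i)} = {}" if i: "i < m" for i
  proof (rule ccontr)
    assume "jump_times \<inter> {u i<..<u (Suc i)} \<noteq> {}"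
    then obtain t where t: "t \<in> jump_times" "u i < t" "t < u (Suc i)" by auto
    then obtain j where j: "j < m" "t = xs ! j" using xs by (metis in_set_conv_nth)
    have "xs ! j < xs ! i" using t j by (simp add: u_def)
    then have "j < i" 
    proof -
      have mono: "xs ! k < xs ! n" if "k < n" "n < m" for k n using xs that by (simp add: sorted_wrt_iff_nth_less)
      show ?thesis using mono[of i j] j(1) \<open>xs ! j < xs ! i\<close> by (cases i j rule: linorder_cases) auto
    qed
    then have "u (Suc j) \<le> u i"
    proof -
      have "j = i - 1 \<or> j < i - 1" using \<open>j < i\<close> by auto
      then have "xs ! j \<le> xs ! (i - 1)"
      proof
        assume "j < i - 1"
        moreover have "i - 1 < length xs" using xs i by simp
        ultimately have "xs ! j < xs ! (i - 1)" using xs(3) by (simp add: sorted_wrt_iff_nth_less)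
        then show ?thesis by simp
      qed simp
      then show ?thesis using \<open>j < i\<close> by (simp add: u_def)
    qed
    then show False using t j by (simp add: u_def)
  qed
  have ui: "u i \<in> {0..1}" if "i \<le> m" for i
    using that u01[of "i - 1"] by (cases i) (auto simp: u_def[of 0])
  have val: "sk_fun g (u (Suc i)) - sk_fun g (u i) = jump (u (Suc i))" if i: "i < m" for i
  proof -
    let ?r = "u (Suc i)"
    have "sk_fun g ?r - sk_fun g (u i) = (\<Sum>s\<in>jump_times. (if s \<le> ?r then jump s else 0) - (if s \<le> u i then jump s else 0))"
      using value_jump_times[OF ui[of "Suc i"]] value_jump_times[OF ui[of i]] i by (simp add: sum_subtractf)
    also have "\<dots> = (\<Sum>s\<in>jump_times. if s = ?r then jump ?r else 0)"
    proof (intro sum.cong refl)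
      fix s assume s: "s \<in> jump_times"
      have "s \<le> u i \<or> s = ?r \<or> ?r < s" using gap[OF i] s by force
      then show "(if s \<le> ?r then jump s else 0) - (if s \<le> u i then jump s else 0) = (if s = ?r then jump ?r else 0)"
        using inc[OF i] by auto
    qed
    also have "\<dots> = jump ?r" using uS[OF i] jump_times by simp
    finally show ?thesis .
  qed
  have bij: "bij_betw (\<lambda>i. u (Suc i)) {..<m} jump_times"
  proof -
    have "bij_betw ((!) xs) {..<length xs} (set xs)" using xs by (intro bij_betw_nth) (auto simp: strict_sorted_iff)
    then show ?thesis using xs by (simp add: u_def)
  qed
  have cnt: "card {i. i < m \<and> P (jump (u (Suc i)))} = card {t\<in>jump_times. P (jump t)}" for P
  proof -
    have "bij_betw (\<lambda>i. u (Suc i)) {i. i < m \<and> P (jump (u (Suc i)))} {t\<in>jump_times. P (jump t)}"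
    proof (rule bij_betw_subset[OF bij])
      show "{i. i < m \<and> P (jump (u (Suc i)))} \<subseteq> {..<m}" by auto
      have im: "(\<lambda>i. u (Suc i)) ` {..<m} = jump_times" using bij by (simp add: bij_betw_def)
      show "(\<lambda>i. u (Suc i)) ` {i. i < m \<and> P (jump (u (Suc i)))} = {t\<in>jump_times. P (jump t)}"
        unfolding im[symmetric] by blast
    qed
    then show ?thesis by (rule bij_betw_same_card)
  qed
  have "chain g m u" unfolding chain_def
  proof (intro conjI allI impI)
    show "u ` {..m} \<subseteq> {0..1}" using ui by auto
    have "u i < u j" if "i < j" "j \<le> m" for i j
      using that
    proof (induction j)
      case (Suc j)
      show ?case
      proof (cases "i = j")
        case True then show ?thesis using inc[of j] Suc.prems by simp
      next
        case False
        then have "u i < u j" using Suc by simp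
        then show ?thesis using inc[of j] Suc.prems by simp
      qed
    qed simp
    then show "strict_mono_on {..m} u" by (intro strict_mono_onI) auto
    fix i assume i: "i < m"
    have "jump (u (Suc i)) \<noteq> 0" using uS[OF i] by (simp add: jump_times_def)
    then show "sk_fun g (u i) \<noteq> sk_fun g (u (Suc i))" using val[OF i] by simp
  qed
  moreover have "ups g m u = up_jumps g"
  proof -
    have "{i. i < m \<and> sk_fun g (u i) < sk_fun g (u (Suc i))} = {i. i < m \<and> 0 < jump (u (Suc i))}"
    proof -
      have "sk_fun g (u i) < sk_fun g (u (Suc i)) \<longleftrightarrow> 0 < jump (u (Suc i))" if "i < m" for i
        unfolding val[OF that, symmetric] by auto
      then show ?thesis by blast
    qed
    then show ?thesis unfolding ups_def jump_counts using cnt[of "\<lambda>x. 0 < x"] by simp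
  qed
  moreover have "downs g m u = down_jumps g"
  proof -
    have "{i. i < m \<and> sk_fun g (u (Suc i)) < sk_fun g (u i)} = {i. i < m \<and> jump (u (Suc i)) < 0}"
    proof -
      have "sk_fun g (u (Suc i)) < sk_fun g (u i) \<longleftrightarrow> jump (u (Suc i)) < 0" if "i < m" for i
        unfolding val[OF that, symmetric] by auto
      then show ?thesis by blast
    qed
    then show ?thesis unfolding downs_def jump_counts using cnt[of "\<lambda>x. x < 0"] by simp
  qed
  ultimately show ?thesis unfolding m_def by blast
qed

end

lemma step_path_steps: "step_path g \<Longrightarrow> \<exists>S. steps g S"
proof -
  assume "step_path g"
  then obtain S where S: "finite S" "S \<subseteq> {0<..<1}"
    "\<forall>s\<in>{0..1}. \<forall>t\<in>{0..1}. s < t \<and> S \<inter> {s<..t} = {} \<longrightarrow> sk_fun g s = sk_fun g t"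
    unfolding step_path_def by (elim exE conjE) (rule that)
  have "steps g S"
  proof
    fix s t :: real assume "s \<in> {0..1}" "t \<in> {0..1}" "s < t" "S \<inter> {s<..t} = {}"
    then show "sk_fun g s = sk_fun g t" using S(3) by simp
  qed (rule S)+
  then show ?thesis ..
qed

text \<open>
  The reasons for which a path is expensive. A step function that starts at \<open>0\<close> has its jump chain,
  whose cost is the rate. A path that starts at \<open>0\<close>, does not jump at \<open>1\<close> and is not a step
  function has arbitrarily long chains, and each step of a chain costs at least
  \<open>min \<alpha> \<beta> - 1 > 0\<close>.
\<close>

lemma step_rate_obstruction:
  assumes ab: "1 < \<alpha>" "1 < \<beta>" and a: "ereal a < step_rate \<alpha> \<beta> g"
  shows "sk_fun g 0 \<noteq> 0 \<or> jump_at_one g \<or>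
    (\<exists>m u. chain g m u \<and> a < (\<alpha> - 1) * real (ups g m u) + (\<beta> - 1) * real (downs g m u))"
proof (cases "step_path g \<and> sk_fun g 0 = 0")
  case True
  then obtain S where "steps g S" using step_path_steps by blast
  then interpret steps g S .
  obtain u where u: "chain g (card jump_times) u" "ups g (card jump_times) u = up_jumps g" "downs g (card jump_times) u = down_jumps g"
    using jump_chain by blast
  have "a < (\<alpha> - 1) * real (up_jumps g) + (\<beta> - 1) * real (down_jumps g)" using a True by (simp add: step_rate_def)
  then have "a < (\<alpha> - 1) * real (ups g (card jump_times) u) + (\<beta> - 1) * real (downs g (card jump_times) u)"
    unfolding u(2,3) .
  with u(1) show ?thesis by (intro disjI2 exI conjI)
next
  case False
  show ?thesis
  proof (rule ccontr)
    assume c: "\<not> ?thesis"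
    then have np: "\<not> step_path g" and j: "\<not> jump_at_one g" using False by auto
    define w where "w = min (\<alpha> - 1) (\<beta> - 1)"
    have w: "0 < w" using ab by (simp add: w_def)
    have "m \<le> nat \<lceil>\<bar>a\<bar> / w\<rceil>" if ch: "chain g m u" for m u
    proof -
      have "w * real m = w * real (ups g m u + downs g m u)" by (simp only: ups_plus_downs[OF ch])
      also have "\<dots> = w * real (ups g m u) + w * real (downs g m u)" by (simp add: distrib_left)
      also have "\<dots> \<le> (\<alpha> - 1) * real (ups g m u) + (\<beta> - 1) * real (downs g m u)"
        by (intro add_mono mult_right_mono) (auto simp: w_def)
      also have "\<dots> \<le> a" using c ch by (auto simp: not_less)
      finally have "real m \<le> \<bar>a\<bar> / w" using w by (simp add: field_simps)
      then show ?thesis by linarith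
    qed
    then have "step_path g" by (rule bounded_chains_imp_step_path[OF _ j])
    then show False using np by contradiction
  qed
qed

section \<open>An exponential maximal inequality\<close>

lemma (in prob_space) indep_var_nn_integral_mult:
  fixes G H :: "'a \<Rightarrow> ennreal"
  assumes "indep_var borel G borel H"
  shows "(\<integral>\<^sup>+ \<omega>. G \<omega> * H \<omega> \<partial>M) = (\<integral>\<^sup>+ \<omega>. G \<omega> \<partial>M) * (\<integral>\<^sup>+ \<omega>. H \<omega> \<partial>M)"
proof -
  have "case_bool borel borel = (\<lambda>_. borel :: ennreal measure)" by (auto simp: fun_eq_iff split: bool.split)
  then have "indep_vars (\<lambda>_. borel) (case_bool G H) UNIV"
    using assms unfolding indep_var_def by simp
  from indep_vars_nn_integral[OF _ this] show ?thesis by (simp add: UNIV_bool mult.commute)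
qed

definition crossed :: "real \<Rightarrow> real \<Rightarrow> nat \<Rightarrow> (nat \<Rightarrow> real) \<Rightarrow> bool" where
  "crossed a u k x \<longleftrightarrow> (\<exists>j\<le>k. a \<le> u * (\<Sum>i<j. x i))"

text \<open>The exponential supermartingale of the partial sums, frozen once \<open>u\<close> times the sum has reached \<open>a\<close>.\<close>

primrec stopped_exp :: "real \<Rightarrow> real \<Rightarrow> (nat \<Rightarrow> real) \<Rightarrow> nat \<Rightarrow> (nat \<Rightarrow> real) \<Rightarrow> real" where
  "stopped_exp a u c 0 x = 1"
| "stopped_exp a u c (Suc k) x =
     (if crossed a u k x then stopped_exp a u c k x else stopped_exp a u c k x * exp (u * x k - c k))"

lemma stopped_exp_nonneg: "0 \<le> stopped_exp a u c k x"
  by (induction k) auto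

lemma stopped_exp_cong:
  "(\<And>i. i < k \<Longrightarrow> x i = y i) \<Longrightarrow> stopped_exp a u c k x = stopped_exp a u c k y"
proof (induction k)
  case (Suc k)
  have "(\<Sum>i<j. x i) = (\<Sum>i<j. y i)" if "j \<le> k" for j
    using that Suc.prems by (intro sum.cong) auto
  then have "crossed a u k x = crossed a u k y" by (auto simp: crossed_def)
  then show ?case using Suc by simp
qed simp

lemma crossed_cong:
  "(\<And>i. i < k \<Longrightarrow> x i = y i) \<Longrightarrow> crossed a u k x = crossed a u k y"
proof -
  assume *: "\<And>i. i < k \<Longrightarrow> x i = y i"
  have "(\<Sum>i<j. x i) = (\<Sum>i<j. y i)" if "j \<le> k" for j
    using that * by (intro sum.cong) auto
  then show ?thesis by (auto simp: crossed_def)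
qed

lemma stopped_exp_not_crossed:
  "(\<forall>j<k. \<not> a \<le> u * (\<Sum>i<j. x i)) \<Longrightarrow> stopped_exp a u c k x = exp (u * (\<Sum>i<k. x i) - (\<Sum>i<k. c i))"
proof (induction k)
  case (Suc k)
  then have "\<not> crossed a u k x" by (auto simp: crossed_def)
  then show ?case using Suc by (simp add: exp_add[symmetric] algebra_simps)
qed simp

lemma stopped_exp_crossed:
  assumes "\<And>i. i < n \<Longrightarrow> 0 \<le> c i" "k \<le> n" "crossed a u k x"
  shows "exp (a - (\<Sum>i<n. c i)) \<le> stopped_exp a u c k x"
  using assms(2,3)
proof (induction k)
  case 0
  then have "a \<le> 0" by (simp add: crossed_def)
  moreover have "0 \<le> (\<Sum>i<n. c i)" using assms(1) by (intro sum_nonneg) auto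
  ultimately show ?case by simp
next
  case (Suc k)
  show ?case
  proof (cases "crossed a u k x")
    case True
    then show ?thesis using Suc by simp
  next
    case False
    then have nc: "\<forall>j<Suc k. \<not> a \<le> u * (\<Sum>i<j. x i)" by (auto simp: crossed_def less_Suc_eq_le)
    then have a: "a \<le> u * (\<Sum>i<Suc k. x i)"
    proof -
      obtain j where j: "j \<le> Suc k" "a \<le> u * (\<Sum>i<j. x i)" using Suc.prems(2) unfolding crossed_def by blast
      then have "j = Suc k" using nc by (cases "j = Suc k") auto
      then show ?thesis using j(2) by simp
    qed
    have "(\<Sum>i<Suc k. c i) \<le> (\<Sum>i<n. c i)"
      using Suc.prems(1) assms(1) by (intro sum_mono2) auto
    then show ?thesis unfolding stopped_exp_not_crossed[OF nc] using a by simp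
  qed
qed

lemma crossed_measurable:
  assumes "k \<le> m"
  shows "Measurable.pred (PiM {..<m} (\<lambda>_. borel)) (crossed a u k)"
proof -
  let ?P = "PiM {..<m} (\<lambda>_. borel) :: (nat \<Rightarrow> real) measure"
  have "Measurable.pred ?P (\<lambda>x. a \<le> u * (\<Sum>i<j. x i))" if "j \<le> k" for j
  proof -
    have "(\<lambda>x. \<Sum>i<j. x i) \<in> borel_measurable ?P"
      using that assms by (intro borel_measurable_sum measurable_component_singleton) auto
    then show ?thesis by measurable
  qed
  then have "Measurable.pred ?P (\<lambda>x. \<exists>j\<in>{..k}. a \<le> u * (\<Sum>i<j. x i))"
    by (intro pred_intros_finite) auto
  moreover have "crossed a u k = (\<lambda>x. \<exists>j\<in>{..k}. a \<le> u * (\<Sum>i<j. x i))"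
    by (auto simp: crossed_def fun_eq_iff)
  ultimately show ?thesis by simp
qed

lemma stopped_exp_measurable:
  "k \<le> m \<Longrightarrow> stopped_exp a u c k \<in> borel_measurable (PiM {..<m} (\<lambda>_. borel))"
proof (induction k)
  case (Suc k)
  have [measurable]: "stopped_exp a u c k \<in> borel_measurable (PiM {..<m} (\<lambda>_. borel))"
    "Measurable.pred (PiM {..<m} (\<lambda>_. borel)) (crossed a u k)"
    using Suc by (auto intro: crossed_measurable)
  have [measurable]: "(\<lambda>x. x k) \<in> borel_measurable (PiM {..<m} (\<lambda>_. borel))"
    using Suc by (intro measurable_component_singleton) auto
  have "stopped_exp a u c (Suc k) = (\<lambda>x. if crossed a u k x then stopped_exp a u c k x
      else stopped_exp a u c k x * exp (u * x k - c k))"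
    by (simp add: fun_eq_iff)
  also have "\<dots> \<in> borel_measurable (PiM {..<m} (\<lambda>_. borel))" by measurable
  finally show ?case .
next
  case 0
  have "stopped_exp a u c 0 = (\<lambda>_. 1)" by (simp add: fun_eq_iff)
  then show ?case by simp
qed

context prob_space
begin

text \<open>
  Each factor of the frozen product is independent of the past and has expectation at most \<open>1\<close>, so the
  product has expectation at most \<open>1\<close>; on the event in question it is at least
  \<open>exp (a - (\<Sum>i<n. c i))\<close>, and Markov's inequality concludes.
\<close>

lemma exponential_maximal_inequality:
  fixes X :: "nat \<Rightarrow> 'a \<Rightarrow> real"
  assumes indep: "indep_vars (\<lambda>_. borel) X {..<n}"
    and mgf: "\<And>i. i < n \<Longrightarrow> (\<integral>\<^sup>+ \<omega>. ennreal (exp (u * X i \<omega>)) \<partial>M) \<le> ennreal (exp (c i))"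
    and c: "\<And>i. i < n \<Longrightarrow> 0 \<le> c i"
  shows "prob {\<omega> \<in> space M. \<exists>k\<le>n. a \<le> u * (\<Sum>i<k. X i \<omega>)} \<le> exp ((\<Sum>i<n. c i) - a)"
proof -
  have rv: "random_variable borel (X i)" if "i < n" for i
    using indep that by (auto simp: indep_vars_def)
  define XX where "XX k \<omega> = restrict (\<lambda>i. X i \<omega>) {..<k}" for k \<omega>
  have XXm: "XX k \<in> measurable M (PiM {..<k} (\<lambda>_. borel))" if "k \<le> n" for k
    unfolding XX_def using that rv by (intro measurable_restrict) auto
  let ?V = "\<lambda>k \<omega>. stopped_exp a u c k (XX n \<omega>)"
  have Vm: "?V k \<in> borel_measurable M" if "k \<le> n" for k
    by (rule measurable_compose[OF XXm[OF order.refl] stopped_exp_measurable[OF that]])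
  have "(\<integral>\<^sup>+ \<omega>. ennreal (?V k \<omega>) \<partial>M) \<le> 1" if "k \<le> n" for k
    using that
  proof (induction k)
    case 0
    then show ?case by (simp add: emeasure_space_1)
  next
    case (Suc k)
    then have k: "k < n" "k \<le> n" by auto
    define g where "g x = (if crossed a u k x then 0 else ennreal (stopped_exp a u c k x))" for x
    define G where "G \<omega> = g (XX k \<omega>)" for \<omega>
    define H where "H \<omega> = ennreal (exp (u * X k \<omega> - c k))" for \<omega>
    have same: "crossed a u k (XX n \<omega>) = crossed a u k (XX k \<omega>)" "?V k \<omega> = stopped_exp a u c k (XX k \<omega>)" for \<omega>
      using k by (auto intro!: crossed_cong stopped_exp_cong simp: XX_def)
    have gm: "g \<in> borel_measurable (PiM {..<k} (\<lambda>_. borel))"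
    proof -
      have [measurable]: "stopped_exp a u c k \<in> borel_measurable (PiM {..<k} (\<lambda>_. borel))"
        "Measurable.pred (PiM {..<k} (\<lambda>_. borel)) (crossed a u k)"
        by (auto intro: stopped_exp_measurable crossed_measurable)
      show ?thesis unfolding g_def by measurable
    qed
    have "indep_var (PiM {..<k} (\<lambda>_. borel)) (\<lambda>\<omega>. restrict (\<lambda>i. X i \<omega>) {..<k}) (PiM {k} (\<lambda>_. borel)) (\<lambda>\<omega>. restrict (\<lambda>i. X i \<omega>) {k})"
      using k by (intro indep_var_restrict[OF indep]) auto
    moreover have "(\<lambda>x. ennreal (exp (u * x k - c k))) \<in> borel_measurable (PiM {k} (\<lambda>_. borel))"
    proof -
      have [measurable]: "(\<lambda>x. x k :: real) \<in> borel_measurable (PiM {k} (\<lambda>_. borel))"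
        by (intro measurable_component_singleton) auto
      show ?thesis by measurable
    qed
    ultimately have "indep_var borel (g \<circ> (\<lambda>\<omega>. restrict (\<lambda>i. X i \<omega>) {..<k})) borel
        ((\<lambda>x. ennreal (exp (u * x k - c k))) \<circ> (\<lambda>\<omega>. restrict (\<lambda>i. X i \<omega>) {k}))"
      using gm by (intro indep_var_compose) auto
    then have ind: "indep_var borel G borel H" by (simp add: G_def[abs_def] H_def[abs_def] XX_def comp_def)
    have "(\<integral>\<^sup>+ \<omega>. H \<omega> \<partial>M) = (\<integral>\<^sup>+ \<omega>. ennreal (exp (- c k)) * ennreal (exp (u * X k \<omega>)) \<partial>M)"
      by (intro nn_integral_cong) (simp add: H_def ennreal_mult'[symmetric] exp_add[symmetric])
    also have "\<dots> = ennreal (exp (- c k)) * (\<integral>\<^sup>+ \<omega>. ennreal (exp (u * X k \<omega>)) \<partial>M)"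
      using rv[OF k(1)] by (intro nn_integral_cmult) measurable
    also have "\<dots> \<le> ennreal (exp (- c k)) * ennreal (exp (c k))"
      using mgf[OF k(1)] by (intro mult_left_mono) auto
    also have "\<dots> = 1" by (simp add: ennreal_mult'[symmetric] exp_add[symmetric])
    finally have H1: "(\<integral>\<^sup>+ \<omega>. H \<omega> \<partial>M) \<le> 1" .
    define Z where "Z \<omega> = (if crossed a u k (XX n \<omega>) then ennreal (?V k \<omega>) else 0)" for \<omega>
    have Gm: "G \<in> borel_measurable M" unfolding G_def by (rule measurable_compose[OF XXm[OF k(2)] gm])
    have Hm: "H \<in> borel_measurable M" unfolding H_def using rv[OF k(1)] by measurable
    have cm: "Measurable.pred M (\<lambda>\<omega>. crossed a u k (XX n \<omega>))"
      by (rule measurable_compose[OF XXm[OF order.refl] crossed_measurable[OF k(2)]])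
    have Zm: "Z \<in> borel_measurable M" unfolding Z_def using Vm[OF k(2)] cm by measurable
    have "(\<integral>\<^sup>+ \<omega>. ennreal (?V (Suc k) \<omega>) \<partial>M) = (\<integral>\<^sup>+ \<omega>. Z \<omega> + G \<omega> * H \<omega> \<partial>M)"
    proof (intro nn_integral_cong)
      fix \<omega> assume "\<omega> \<in> space M"
      have "XX n \<omega> k = X k \<omega>" using k by (simp add: XX_def)
      then show "ennreal (?V (Suc k) \<omega>) = Z \<omega> + G \<omega> * H \<omega>"
        unfolding stopped_exp.simps Z_def G_def g_def H_def same
        by (auto simp: ennreal_mult' stopped_exp_nonneg)
    qed
    also have "\<dots> = (\<integral>\<^sup>+ \<omega>. Z \<omega> \<partial>M) + (\<integral>\<^sup>+ \<omega>. G \<omega> \<partial>M) * (\<integral>\<^sup>+ \<omega>. H \<omega> \<partial>M)"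
      using Zm Gm Hm by (subst nn_integral_add) (auto simp: indep_var_nn_integral_mult[OF ind])
    also have "\<dots> \<le> (\<integral>\<^sup>+ \<omega>. Z \<omega> \<partial>M) + (\<integral>\<^sup>+ \<omega>. G \<omega> \<partial>M) * 1"
      using H1 by (intro add_left_mono mult_left_mono) auto
    also have "\<dots> = (\<integral>\<^sup>+ \<omega>. Z \<omega> + G \<omega> \<partial>M)"
      using Zm Gm by (subst nn_integral_add) auto
    also have "\<dots> = (\<integral>\<^sup>+ \<omega>. ennreal (?V k \<omega>) \<partial>M)"
      by (intro nn_integral_cong) (auto simp: Z_def G_def g_def same)
    also have "\<dots> \<le> 1" using Suc.IH k by simp
    finally show ?case .
  qed
  then have V1: "(\<integral>\<^sup>+ \<omega>. ennreal (?V n \<omega>) \<partial>M) \<le> 1" by simp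
  define \<kappa> where "\<kappa> = exp (a - (\<Sum>i<n. c i))"
  have \<kappa>: "\<kappa> > 0" by (simp add: \<kappa>_def)
  let ?E = "{\<omega> \<in> space M. \<exists>k\<le>n. a \<le> u * (\<Sum>i<k. X i \<omega>)}"
  have Ec: "?E = {\<omega> \<in> space M. crossed a u n (XX n \<omega>)}"
  proof -
    have "(\<Sum>i<k. X i \<omega>) = (\<Sum>i<k. XX n \<omega> i)" if "k \<le> n" for k \<omega>
      using that by (intro sum.cong) (auto simp: XX_def)
    then show ?thesis by (auto simp: crossed_def)
  qed
  have Em: "?E \<in> events"
    unfolding Ec by (rule predE[OF measurable_compose[OF XXm[OF order.refl] crossed_measurable[OF order.refl]]])
  have "ennreal \<kappa> * emeasure M ?E = (\<integral>\<^sup>+ \<omega>. ennreal \<kappa> * indicator ?E \<omega> \<partial>M)"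
    by (rule nn_integral_cmult_indicator[OF Em, symmetric])
  also have "\<dots> \<le> (\<integral>\<^sup>+ \<omega>. ennreal (?V n \<omega>) \<partial>M)"
  proof (intro nn_integral_mono)
    fix \<omega>
    show "ennreal \<kappa> * indicator ?E \<omega> \<le> ennreal (?V n \<omega>)"
    proof (cases "\<omega> \<in> ?E")
      case True
      then have "crossed a u n (XX n \<omega>)" unfolding Ec by blast
      from stopped_exp_crossed[OF c order.refl this] have "\<kappa> \<le> ?V n \<omega>" by (simp add: \<kappa>_def)
      then show ?thesis unfolding indicator_simps(1)[OF True] by (simp add: ennreal_leI)
    next
      case False
      show ?thesis unfolding indicator_simps(2)[OF False] by simp
    qed
  qed
  also have "\<dots> \<le> 1" by (rule V1)
  finally have "ennreal (\<kappa> * prob ?E) \<le> 1"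
    using \<kappa> unfolding emeasure_eq_measure by (subst ennreal_mult) auto
  then have "\<kappa> * prob ?E \<le> 1" by simp
  then have "prob ?E \<le> 1 / \<kappa>" using \<kappa> by (simp add: field_simps)
  also have "1 / \<kappa> = exp ((\<Sum>i<n. c i) - a)" by (simp add: \<kappa>_def exp_diff)
  finally show ?thesis .
qed

lemma exponential_maximal_inequality_abs:
  fixes X :: "nat \<Rightarrow> 'a \<Rightarrow> real"
  assumes indep: "indep_vars (\<lambda>_. borel) X {..<n}" and u: "0 < u"
    and mgf: "\<And>i. i < n \<Longrightarrow> (\<integral>\<^sup>+ \<omega>. ennreal (exp (u * X i \<omega>)) \<partial>M) \<le> ennreal (exp (c i))"
    and mgf': "\<And>i. i < n \<Longrightarrow> (\<integral>\<^sup>+ \<omega>. ennreal (exp (- u * X i \<omega>)) \<partial>M) \<le> ennreal (exp (c i))"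
    and c: "\<And>i. i < n \<Longrightarrow> 0 \<le> c i"
  shows "prob {\<omega> \<in> space M. \<exists>k\<le>n. \<eta> \<le> \<bar>\<Sum>i<k. X i \<omega>\<bar>} \<le> 2 * exp ((\<Sum>i<n. c i) - u * \<eta>)"
    and "{\<omega> \<in> space M. \<exists>k\<le>n. \<eta> \<le> \<bar>\<Sum>i<k. X i \<omega>\<bar>} \<in> events"
proof -
  have rv: "random_variable borel (X i)" if "i < n" for i
    using indep that by (auto simp: indep_vars_def)
  have Sm: "(\<lambda>\<omega>. \<Sum>i<k. X i \<omega>) \<in> borel_measurable M" if "k \<le> n" for k
    using that rv by (intro borel_measurable_sum) auto
  let ?E = "\<lambda>w. {\<omega> \<in> space M. \<exists>k\<le>n. u * \<eta> \<le> w * (\<Sum>i<k. X i \<omega>)}"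
  have Em: "?E w \<in> events" for w
  proof -
    have "?E w = (\<Union>k\<in>{..n}. {\<omega> \<in> space M. u * \<eta> \<le> w * (\<Sum>i<k. X i \<omega>)})" by auto
    also have "\<dots> \<in> events" using Sm by (intro sets.finite_UN borel_measurable_le borel_measurable_times) auto
    finally show ?thesis .
  qed
  have eq: "{\<omega> \<in> space M. \<exists>k\<le>n. \<eta> \<le> \<bar>\<Sum>i<k. X i \<omega>\<bar>} = ?E u \<union> ?E (- u)"
  proof -
    have "\<eta> \<le> \<bar>s\<bar> \<longleftrightarrow> u * \<eta> \<le> u * s \<or> u * \<eta> \<le> - u * s" for s
    proof -
      have "u * \<eta> \<le> u * s \<longleftrightarrow> \<eta> \<le> s" "u * \<eta> \<le> u * (- s) \<longleftrightarrow> \<eta> \<le> - s"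
        using u by (simp_all only: mult_le_cancel_left_pos)
      then show ?thesis by auto
    qed
    then show ?thesis by blast
  qed
  show "{\<omega> \<in> space M. \<exists>k\<le>n. \<eta> \<le> \<bar>\<Sum>i<k. X i \<omega>\<bar>} \<in> events" unfolding eq by (rule sets.Un[OF Em Em])
  have "prob (?E u \<union> ?E (- u)) \<le> prob (?E u) + prob (?E (- u))"
    by (rule measure_Un_le[OF Em Em])
  also have "\<dots> \<le> 2 * exp ((\<Sum>i<n. c i) - u * \<eta>)"
    unfolding mult_2
    by (intro add_mono exponential_maximal_inequality[OF indep mgf c] exponential_maximal_inequality[OF indep mgf' c])
  finally show "prob {\<omega> \<in> space M. \<exists>k\<le>n. \<eta> \<le> \<bar>\<Sum>i<k. X i \<omega>\<bar>} \<le> 2 * exp ((\<Sum>i<n. c i) - u * \<eta>)"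
    unfolding eq .
qed

end

section \<open>Poisson counts\<close>

lemma exp_taylor2_le: "exp x - 1 - x \<le> x\<^sup>2 * exp \<bar>x\<bar>" for x :: real
proof -
  have "exp x * (1 - x) \<le> exp x * exp (- x)" using exp_ge_add_one_self[of "- x"] by (intro mult_left_mono) auto
  then have e: "exp x - 1 \<le> x * exp x" by (simp add: exp_minus algebra_simps)
  show ?thesis
  proof (cases "0 \<le> x")
    case True
    have "exp x - 1 - x \<le> x * (exp x - 1)" using e by (simp add: algebra_simps)
    also have "\<dots> \<le> x * (x * exp x)" using e True by (intro mult_left_mono) auto
    finally show ?thesis using True by (simp add: power2_eq_square)
  next
    case False
    have "exp x - 1 - x \<le> x * (exp x - 1)" using e by (simp add: algebra_simps)
    also have "\<dots> \<le> x * x" using exp_ge_add_one_self[of x] False by (intro mult_left_mono_neg) linarith+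
    also have "\<dots> \<le> x * x * exp \<bar>x\<bar>" by (simp add: mult_le_cancel_left1)
    finally show ?thesis by (simp add: power2_eq_square)
  qed
qed

locale poisson_points = prob_space M for M :: "'w measure" +
  fixes N :: "'w \<Rightarrow> 'e measure" and \<mu> :: "'e measure"
  assumes prm: "poisson_random_measure M N \<mu>"
begin

abbreviation cnt :: "'e set \<Rightarrow> 'w \<Rightarrow> real" where "cnt A \<omega> \<equiv> measure (N \<omega>) A"

lemma sets_N: "\<omega> \<in> space M \<Longrightarrow> sets (N \<omega>) = sets \<mu>"
  using prm unfolding poisson_random_measure_def by blast

lemma N_values: "\<omega> \<in> space M \<Longrightarrow> A \<in> sets \<mu> \<Longrightarrow> emeasure (N \<omega>) A \<noteq> \<infinity> \<Longrightarrow> \<exists>n::nat. emeasure (N \<omega>) A = of_nat n"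
  using prm unfolding poisson_random_measure_def by blast

lemma N_meas: "A \<in> sets \<mu> \<Longrightarrow> (\<lambda>\<omega>. emeasure (N \<omega>) A) \<in> borel_measurable M"
  using prm unfolding poisson_random_measure_def by blast

lemma cnt_meas: "A \<in> sets \<mu> \<Longrightarrow> cnt A \<in> borel_measurable M"
  unfolding measure_def using N_meas by measurable

lemma N_prob: "A \<in> sets \<mu> \<Longrightarrow> emeasure \<mu> A < \<infinity> \<Longrightarrow>
   prob {\<omega> \<in> space M. emeasure (N \<omega>) A = of_nat n} = exp (- measure \<mu> A) * measure \<mu> A ^ n / fact n"
  using prm unfolding poisson_random_measure_def by blast

lemma N_indep: 
  fixes n :: nat
  assumes "\<And>i. i < n \<Longrightarrow> A i \<in> sets \<mu>" "disjoint_family_on A {..<n}"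
  shows "indep_vars (\<lambda>_. borel) (\<lambda>i \<omega>. emeasure (N \<omega>) (A i)) {..<n}"
proof -
  have "A ` {..<n} \<subseteq> sets \<mu>" using assms(1) by auto
  moreover have "\<forall>n (A :: nat \<Rightarrow> 'e set). A ` {..<n} \<subseteq> sets \<mu> \<and> disjoint_family_on A {..<n} \<longrightarrow>
        indep_vars (\<lambda>_. borel) (\<lambda>i \<omega>. emeasure (N \<omega>) (A i)) {..<n}"
    using prm unfolding poisson_random_measure_def by (elim conjE)
  ultimately show ?thesis using assms(2) by simp
qed

lemma cnt_indep:
  fixes n :: nat
  assumes "\<And>i. i < n \<Longrightarrow> A i \<in> sets \<mu>" "disjoint_family_on A {..<n}"
  shows "indep_vars (\<lambda>_. borel) (\<lambda>i \<omega>. cnt (A i) \<omega>) {..<n}"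
  unfolding measure_def by (rule indep_vars_compose2[OF N_indep[OF assms]]) auto

context
  fixes A assumes A: "A \<in> sets \<mu>" and fin: "emeasure \<mu> A < \<infinity>"
begin

definition level :: "nat \<Rightarrow> 'w set" where "level n = {\<omega> \<in> space M. emeasure (N \<omega>) A = of_nat n}"

lemma level_events: "level n \<in> events"
  unfolding level_def using N_meas[OF A] by measurable

lemma level_prob: "prob (level n) = exp (- measure \<mu> A) * measure \<mu> A ^ n / fact n"
  unfolding level_def by (rule N_prob[OF A fin])

lemma level_disjoint: "disjoint_family level"
  by (auto simp: disjoint_family_on_def level_def)

lemma poisson_sums: "(\<lambda>n. exp (- x) * x ^ n / fact n) sums (1 :: real)"
proof -
  have "(\<lambda>n. exp (- x) * (x ^ n / fact n)) sums (exp (- x) * exp x)"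
    using exp_converges[of x] by (intro sums_mult) (simp add: scaleR_conv_of_real divide_inverse mult.commute)
  then show ?thesis by (simp add: exp_minus)
qed

lemma AE_level: "AE \<omega> in M. \<omega> \<in> (\<Union>n. level n)"
proof (rule AE_prob_1)
  have "(\<lambda>n. prob (level n)) sums prob (\<Union>n. level n)"
    using level_events level_disjoint by (intro finite_measure_UNION) auto
  moreover have "(\<lambda>n. prob (level n)) sums 1" unfolding level_prob by (rule poisson_sums)
  ultimately show "prob (\<Union>n. level n) = 1" by (rule sums_unique2)
qed

lemma AE_N_finite: "AE \<omega> in M. emeasure (N \<omega>) A < \<infinity>"
  using AE_level by eventually_elim (auto simp: level_def of_nat_less_top)

text \<open>The weight of \<open>k + p\<close> is at most \<open>measure \<mu> A ^ p\<close> times the weight of \<open>k\<close>.\<close>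

lemma poisson_tail: "prob {\<omega> \<in> space M. of_nat p \<le> emeasure (N \<omega>) A} \<le> measure \<mu> A ^ p"
proof -
  let ?m = "measure \<mu> A"
  have "prob {\<omega> \<in> space M. of_nat p \<le> emeasure (N \<omega>) A} \<le> prob (\<Union>k. level (k + p))"
  proof (rule finite_measure_mono_AE)
    show "AE \<omega> in M. \<omega> \<in> {\<omega> \<in> space M. of_nat p \<le> emeasure (N \<omega>) A} \<longrightarrow> \<omega> \<in> (\<Union>k. level (k + p))"
      using AE_level
    proof eventually_elim
      case (elim \<omega>)
      then obtain n where n: "\<omega> \<in> level n" by blast
      show ?case
      proof
        assume "\<omega> \<in> {\<omega> \<in> space M. of_nat p \<le> emeasure (N \<omega>) A}"
        then have "(of_nat p :: ennreal) \<le> of_nat n" using n by (simp add: level_def)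
        then have "p \<le> n" by simp
        then show "\<omega> \<in> (\<Union>k. level (k + p))" using n by (intro UN_I[of "n - p"]) auto
      qed
    qed
    show "(\<Union>k. level (k + p)) \<in> events" using level_events by auto
  qed
  also have "\<dots> \<le> ?m ^ p"
  proof -
    have s: "(\<lambda>k. prob (level (k + p))) sums prob (\<Union>k. level (k + p))"
      using level_events level_disjoint by (intro finite_measure_UNION) (auto simp: disjoint_family_on_def)
    have t: "(\<lambda>k. ?m ^ p * (exp (- ?m) * ?m ^ k / fact k)) sums (?m ^ p * 1)"
      by (intro sums_mult poisson_sums)
    have "prob (level (k + p)) \<le> ?m ^ p * (exp (- ?m) * ?m ^ k / fact k)" for k
    proof -
      have "prob (level (k + p)) = (?m ^ p * (exp (- ?m) * ?m ^ k)) / fact (k + p)"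
        unfolding level_prob by (simp add: power_add mult_ac)
      also have "\<dots> \<le> (?m ^ p * (exp (- ?m) * ?m ^ k)) / fact k"
        by (intro divide_left_mono fact_mono) auto
      finally show ?thesis by simp
    qed
    from sums_le[OF this s t] show ?thesis by simp
  qed
  finally show ?thesis .
qed

lemma prob_no_points: "prob {\<omega> \<in> space M. emeasure (N \<omega>) A = 0} = exp (- measure \<mu> A)"
  using level_prob[of 0] by (simp add: level_def)

lemma prob_one_point: "prob {\<omega> \<in> space M. emeasure (N \<omega>) A = 1} = exp (- measure \<mu> A) * measure \<mu> A"
  using level_prob[of 1] by (simp add: level_def)

lemma poisson_mgf: "(\<integral>\<^sup>+ \<omega>. ennreal (exp (u * cnt A \<omega>)) \<partial>M) = ennreal (exp (measure \<mu> A * (exp u - 1)))"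
proof -
  let ?m = "measure \<mu> A"
  have "(\<integral>\<^sup>+ \<omega>. ennreal (exp (u * cnt A \<omega>)) \<partial>M) = (\<integral>\<^sup>+ \<omega>. (\<Sum>n. ennreal (exp (u * real n)) * indicator (level n) \<omega>) \<partial>M)"
  proof (rule nn_integral_cong_AE)
    show "AE \<omega> in M. ennreal (exp (u * cnt A \<omega>)) = (\<Sum>n. ennreal (exp (u * real n)) * indicator (level n) \<omega>)"
      using AE_level
    proof eventually_elim
      case (elim \<omega>)
      then obtain k where k: "\<omega> \<in> level k" by blast
      have c: "cnt A \<omega> = real k" using k by (simp add: level_def measure_def)
      have "(\<Sum>n. ennreal (exp (u * real n)) * indicator (level n) \<omega>) = (\<Sum>n\<in>{k}. ennreal (exp (u * real n)) * indicator (level n) \<omega>)"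
        using k by (intro suminf_finite) (auto simp: level_def indicator_def)
      then show ?case using k c by simp
    qed
  qed
  also have "\<dots> = (\<Sum>n. \<integral>\<^sup>+ \<omega>. ennreal (exp (u * real n)) * indicator (level n) \<omega> \<partial>M)"
    using level_events by (intro nn_integral_suminf) auto
  also have "\<dots> = (\<Sum>n. ennreal (exp (u * real n) * prob (level n)))"
    by (intro suminf_cong) (simp add: nn_integral_cmult_indicator level_events emeasure_eq_measure ennreal_mult')
  also have "\<dots> = ennreal (exp (?m * (exp u - 1)))"
  proof -
    have "(\<lambda>n. exp (?m * exp u - ?m) * (exp (- (?m * exp u)) * (?m * exp u) ^ n / fact n)) sums (exp (?m * exp u - ?m) * 1)"
      by (intro sums_mult poisson_sums)
    moreover have "exp (?m * exp u - ?m) * (exp (- (?m * exp u)) * (?m * exp u) ^ n / fact n) = exp (u * real n) * prob (level n)" for n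
    proof -
      have "exp (u * real n) = exp u ^ n" by (simp add: exp_of_nat2_mult mult.commute exp_of_nat_mult)
      moreover have "exp (?m * exp u - ?m) * exp (- (?m * exp u)) = exp (- ?m)" by (simp add: exp_add[symmetric])
      ultimately show ?thesis unfolding level_prob by (simp add: power_mult_distrib)
    qed
    ultimately have "(\<lambda>n. exp (u * real n) * prob (level n)) sums exp (?m * exp u - ?m)" by simp
    then show ?thesis
      by (subst suminf_ennreal_eq) (auto simp: algebra_simps)
  qed
  finally show ?thesis .
qed

lemma compensated_mgf:
  assumes "\<bar>u * c\<bar> \<le> m"
  shows "(\<integral>\<^sup>+ \<omega>. ennreal (exp (u * (c * (cnt A \<omega> - measure \<mu> A)))) \<partial>M) \<le> ennreal (exp (measure \<mu> A * ((u * c)\<^sup>2 * exp m)))"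
proof -
  let ?m = "measure \<mu> A"
  have "(\<integral>\<^sup>+ \<omega>. ennreal (exp (u * (c * (cnt A \<omega> - ?m)))) \<partial>M) =
      (\<integral>\<^sup>+ \<omega>. ennreal (exp (- (u * c * ?m))) * ennreal (exp ((u * c) * cnt A \<omega>)) \<partial>M)"
    by (intro nn_integral_cong) (simp add: ennreal_mult'[symmetric] exp_add[symmetric] algebra_simps)
  also have "\<dots> = ennreal (exp (- (u * c * ?m))) * ennreal (exp (?m * (exp (u * c) - 1)))"
    using cnt_meas[OF A] by (subst nn_integral_cmult) (auto simp: poisson_mgf)
  also have "\<dots> = ennreal (exp (?m * (exp (u * c) - 1 - u * c)))"
    by (simp add: ennreal_mult'[symmetric] exp_add[symmetric] algebra_simps)
  also have "\<dots> \<le> ennreal (exp (?m * ((u * c)\<^sup>2 * exp m)))"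
  proof (intro ennreal_leI, simp only: exp_le_cancel_iff, intro mult_left_mono)
    have "exp (u * c) - 1 - u * c \<le> (u * c)\<^sup>2 * exp \<bar>u * c\<bar>" by (rule exp_taylor2_le)
    also have "\<dots> \<le> (u * c)\<^sup>2 * exp m" using assms by (intro mult_left_mono) auto
    finally show "exp (u * c) - 1 - u * c \<le> (u * c)\<^sup>2 * exp m" .
  qed simp
  finally show ?thesis .
qed

end

text \<open>
  The partial sums are compensated integrals of a simple function over a growing set. The bound sees
  the function only through its maximum \<open>m\<close> and its second moment, and not through the number \<open>n\<close> of
  cells, so that it survives a refinement of the cells.
\<close>

lemma compensated_maximal_inequality:
  fixes n :: nat and \<eta> :: real
  assumes A: "\<And>i. i < n \<Longrightarrow> A i \<in> sets \<mu>" "\<And>i. i < n \<Longrightarrow> emeasure \<mu> (A i) < \<infinity>"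
    and disj: "disjoint_family_on A {..<n}"
    and c: "\<And>i. i < n \<Longrightarrow> \<bar>c i\<bar> \<le> m" and u: "0 < u"
  defines "E \<equiv> {\<omega> \<in> space M. \<exists>k\<le>n. \<eta> \<le> \<bar>\<Sum>i<k. c i * (cnt (A i) \<omega> - measure \<mu> (A i))\<bar>}"
  shows "prob E \<le> 2 * exp (u\<^sup>2 * exp (u * m) * (\<Sum>i<n. (c i)\<^sup>2 * measure \<mu> (A i)) - u * \<eta>)"
    and "E \<in> events"
proof -
  define K where "K i = measure \<mu> (A i) * ((u * c i)\<^sup>2 * exp (u * m))" for i
  have "indep_vars (\<lambda>_. borel) (\<lambda>i \<omega>. (\<lambda>i x. c i * (x - measure \<mu> (A i))) i (cnt (A i) \<omega>)) {..<n}"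
    by (rule indep_vars_compose2[OF cnt_indep[OF A(1) disj]]) auto
  then have ind: "indep_vars (\<lambda>_. borel) (\<lambda>i \<omega>. c i * (cnt (A i) \<omega> - measure \<mu> (A i))) {..<n}" by simp
  have mgf: "(\<integral>\<^sup>+ \<omega>. ennreal (exp (w * (c i * (cnt (A i) \<omega> - measure \<mu> (A i))))) \<partial>M) \<le> ennreal (exp (K i))"
    if i: "i < n" and w: "w = u \<or> w = - u" for i w
  proof -
    have "\<bar>w * c i\<bar> = u * \<bar>c i\<bar>" using w u by (auto simp: abs_mult)
    also have "\<dots> \<le> u * m" using c[OF i] u by (intro mult_left_mono) auto
    finally have "\<bar>w * c i\<bar> \<le> u * m" .
    from compensated_mgf[OF A(1)[OF i] A(2)[OF i] this]
    show ?thesis using w by (auto simp: K_def power_mult_distrib)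
  qed
  have K: "0 \<le> K i" for i by (simp add: K_def)
  have sum: "(\<Sum>i<n. K i) = u\<^sup>2 * exp (u * m) * (\<Sum>i<n. (c i)\<^sup>2 * measure \<mu> (A i))"
    unfolding sum_distrib_left by (intro sum.cong refl) (simp add: K_def power_mult_distrib mult_ac)
  show "prob E \<le> 2 * exp (u\<^sup>2 * exp (u * m) * (\<Sum>i<n. (c i)\<^sup>2 * measure \<mu> (A i)) - u * \<eta>)"
    unfolding E_def sum[symmetric]
    by (rule exponential_maximal_inequality_abs(1)[OF ind u mgf mgf K]) auto
  show "E \<in> events"
    unfolding E_def by (rule exponential_maximal_inequality_abs(2)[OF ind u mgf mgf K]) auto
qed

lemma two_tails:
  fixes p q :: nat
  assumes "A \<in> sets \<mu>" "B \<in> sets \<mu>" "A \<inter> B = {}" "emeasure \<mu> A < \<infinity>" "emeasure \<mu> B < \<infinity>"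
  defines "E \<equiv> {\<omega> \<in> space M. of_nat p \<le> emeasure (N \<omega>) A \<and> of_nat q \<le> emeasure (N \<omega>) B}"
  shows "prob E \<le> measure \<mu> A ^ p * measure \<mu> B ^ q" and "E \<in> events"
proof -
  define F where "F i = (if i = 0 then A else B)" for i :: nat
  have "indep_vars (\<lambda>_. borel) (\<lambda>i \<omega>. emeasure (N \<omega>) (F i)) {..<2}"
    by (rule N_indep) (use assms in \<open>auto simp: F_def disjoint_family_on_def\<close>)
  then have iv: "indep_vars (\<lambda>_. borel) (\<lambda>i \<omega>. emeasure (N \<omega>) (F i)) {0, 1}"
    by (simp add: lessThan_nat_numeral lessThan_Suc insert_commute numeral_2_eq_2)
  have "prob (\<Inter>i\<in>{0, 1}. (\<lambda>\<omega>. emeasure (N \<omega>) (F i)) -` (if i = 0 then {of_nat p..} else {of_nat q..}) \<inter> space M) =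
      (\<Prod>i\<in>{0, 1}. prob ((\<lambda>\<omega>. emeasure (N \<omega>) (F i)) -` (if i = 0 then {of_nat p..} else {of_nat q..}) \<inter> space M))"
    by (rule indep_varsD[OF iv]) auto
  also have "(\<Inter>i\<in>{0, 1}. (\<lambda>\<omega>. emeasure (N \<omega>) (F i)) -` (if i = 0 then {of_nat p..} else {of_nat q..}) \<inter> space M) = E"
    unfolding E_def F_def by auto
  also have "(\<Prod>i\<in>{0, 1}. prob ((\<lambda>\<omega>. emeasure (N \<omega>) (F i)) -` (if i = 0 then {of_nat p..} else {of_nat q..}) \<inter> space M)) =
      prob {\<omega> \<in> space M. of_nat p \<le> emeasure (N \<omega>) A} * prob {\<omega> \<in> space M. of_nat q \<le> emeasure (N \<omega>) B}"
    unfolding F_def by (simp add: vimage_def Int_def conj_commute)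
  finally have "prob E = prob {\<omega> \<in> space M. of_nat p \<le> emeasure (N \<omega>) A} * prob {\<omega> \<in> space M. of_nat q \<le> emeasure (N \<omega>) B}" .
  also have "\<dots> \<le> measure \<mu> A ^ p * measure \<mu> B ^ q"
    by (intro mult_mono poisson_tail assms) auto
  finally show "prob E \<le> measure \<mu> A ^ p * measure \<mu> B ^ q" .
  show "E \<in> events" unfolding E_def using N_meas[OF assms(1)] N_meas[OF assms(2)] by measurable
qed

end

section \<open>Integrals against the jump measure\<close>

definition far :: "real \<Rightarrow> real set" where "far d = {z. d < \<bar>z\<bar>}"
definition band :: "real \<Rightarrow> real \<Rightarrow> real set" where "band d T = {z. d < \<bar>z\<bar> \<and> \<bar>z\<bar> \<le> T}"

locale levy_tails =
  fixes \<nu> :: "real measure"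
  assumes levy: "levy_measure \<nu>"
    and mean: "(\<integral>\<^sup>+ z. ennreal \<bar>z\<bar> * indicator (far 1) z \<partial>\<nu>) < \<infinity>"
begin

lemma sets_nu: "sets \<nu> = sets (restrict_space borel (- {0}))"
  using levy by (simp add: levy_measure_def)

lemma space_nu: "space \<nu> = - {0}"
  using sets_eq_imp_space_eq[OF sets_nu] by (simp add: space_restrict_space)

lemma borel_sets_nu: "A \<in> sets borel \<Longrightarrow> 0 \<notin> A \<Longrightarrow> A \<in> sets \<nu>"
  unfolding sets_nu by (subst sets_restrict_space_iff) auto

lemma borel_measurable_nu: "f \<in> borel_measurable borel \<Longrightarrow> f \<in> borel_measurable \<nu>"
  unfolding measurable_cong_sets[OF sets_nu refl] by (rule measurable_restrict_space1)

lemma id_measurable_nu: "(\<lambda>z. z) \<in> measurable \<nu> borel"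
  by (rule borel_measurable_nu) simp

lemma far_sets: "0 \<le> d \<Longrightarrow> far d \<in> sets \<nu>"
  unfolding far_def by (intro borel_sets_nu) auto

lemma band_sets: "0 \<le> d \<Longrightarrow> band d T \<in> sets \<nu>"
  unfolding band_def by (intro borel_sets_nu) auto

lemma far_finite: "0 < d \<Longrightarrow> emeasure \<nu> (far d) < \<infinity>"
proof -
  assume d: "0 < d"
  define k where "k = min 1 (d\<^sup>2)"
  have k: "0 < k" using d by (simp add: k_def)
  have "ennreal k * emeasure \<nu> (far d) = (\<integral>\<^sup>+ z. ennreal k * indicator (far d) z \<partial>\<nu>)"
    using d by (intro nn_integral_cmult_indicator[symmetric] far_sets) auto
  also have "\<dots> \<le> (\<integral>\<^sup>+ z. ennreal (min 1 (z\<^sup>2)) \<partial>\<nu>)"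
  proof (intro nn_integral_mono)
    fix z
    have "min 1 (d\<^sup>2) \<le> min 1 (z\<^sup>2)" if "z \<in> far d"
    proof -
      have "d\<^sup>2 \<le> z\<^sup>2" using that d by (auto simp: far_def abs_le_square_iff[symmetric])
      then show ?thesis by (auto simp: min_def)
    qed
    then show "ennreal k * indicator (far d) z \<le> ennreal (min 1 (z\<^sup>2))"
      by (auto simp: indicator_def k_def intro!: ennreal_leI)
  qed
  also have "\<dots> < \<infinity>" using levy by (simp add: levy_measure_def)
  finally show ?thesis using k by (auto simp: ennreal_mult_less_top)
qed

lemma band_finite: "0 < d \<Longrightarrow> emeasure \<nu> (band d T) < \<infinity>"
  by (rule le_less_trans[OF emeasure_mono far_finite]) (auto simp: far_def band_def intro!: far_sets[unfolded far_def])

lemma sigma_finite_nu: "sigma_finite_measure \<nu>"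
proof
  show "\<exists>A. countable A \<and> A \<subseteq> sets \<nu> \<and> \<Union>A = space \<nu> \<and> (\<forall>a\<in>A. emeasure \<nu> a \<noteq> \<infinity>)"
  proof (intro exI[of _ "range (\<lambda>n. far (1 / real (Suc n)))"] conjI)
    show "range (\<lambda>n. far (1 / real (Suc n))) \<subseteq> sets \<nu>" using far_sets by auto
    show "\<forall>a\<in>range (\<lambda>n. far (1 / real (Suc n))). emeasure \<nu> a \<noteq> \<infinity>"
      using far_finite[of "1 / real (Suc n)" for n] by (auto simp: less_top)
    show "\<Union> (range (\<lambda>n. far (1 / real (Suc n)))) = space \<nu>"
    proof
      show "\<Union> (range (\<lambda>n. far (1 / real (Suc n)))) \<subseteq> space \<nu>"
        unfolding space_nu by (auto simp: far_def)
      show "space \<nu> \<subseteq> \<Union> (range (\<lambda>n. far (1 / real (Suc n))))"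
      proof
        fix z assume "z \<in> space \<nu>"
        then have "0 < \<bar>z\<bar>" by (simp add: space_nu)
        then obtain n where "1 / real (Suc n) < \<bar>z\<bar>" using nat_approx_posE by blast
        then show "z \<in> \<Union> (range (\<lambda>n. far (1 / real (Suc n))))" by (auto simp: far_def)
      qed
    qed
  qed auto
qed

lemma far_mean: "0 < d \<Longrightarrow> (\<integral>\<^sup>+ z. ennreal \<bar>z\<bar> * indicator (far d) z \<partial>\<nu>) < \<infinity>"
proof -
  assume d: "0 < d"
  have m: "(\<lambda>z. ennreal \<bar>z\<bar>) \<in> borel_measurable \<nu>" by (rule borel_measurable_nu) simp
  have "(\<integral>\<^sup>+ z. ennreal \<bar>z\<bar> * indicator (far d) z \<partial>\<nu>)
      \<le> (\<integral>\<^sup>+ z. ennreal \<bar>z\<bar> * indicator (far 1) z + 1 * indicator (far d) z \<partial>\<nu>)"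
    by (intro nn_integral_mono) (auto simp: indicator_def far_def)
  also have "\<dots> = (\<integral>\<^sup>+ z. ennreal \<bar>z\<bar> * indicator (far 1) z \<partial>\<nu>) + emeasure \<nu> (far d)"
    using far_sets[of d] far_sets[of 1] d m by (subst nn_integral_add) auto
  also have "\<dots> < \<infinity>" using mean far_finite[OF d] by (simp add: less_top)
  finally show ?thesis .
qed

end

locale jump_points = poisson_points M N "jump_compensator c \<nu>" + levy_tails \<nu>
  for M :: "'w measure" and N and c :: real and \<nu> +
  assumes c_pos: "0 < c"
begin

abbreviation \<mu> :: "(real \<times> real) measure" where "\<mu> \<equiv> jump_compensator c \<nu>"

interpretation nu: sigma_finite_measure \<nu> by (rule sigma_finite_nu)

lemma sets_mu: "sets \<mu> = sets (restrict_space lborel {0..1} \<Otimes>\<^sub>M \<nu>)"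
  unfolding jump_compensator_def by simp

lemma time_sets: "I \<in> sets borel \<Longrightarrow> I \<subseteq> {0..1} \<Longrightarrow> I \<in> sets (restrict_space lborel {0..1::real})"
  by (subst sets_restrict_space_iff) auto

lemma slab_sets: "I \<in> sets borel \<Longrightarrow> I \<subseteq> {0..1} \<Longrightarrow> A \<in> sets \<nu> \<Longrightarrow> I \<times> A \<in> sets \<mu>"
  unfolding sets_mu by (intro pair_measureI time_sets)

lemma emeasure_slab:
  assumes "I \<in> sets borel" "I \<subseteq> {0..1}" "A \<in> sets \<nu>"
  shows "emeasure \<mu> (I \<times> A) = ennreal c * (emeasure lborel I * emeasure \<nu> A)"
  unfolding jump_compensator_def
  by (simp add: nu.emeasure_pair_measure_Times time_sets assms emeasure_restrict_space)

lemma slab_finite: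
  assumes "I \<in> sets borel" "I \<subseteq> {0..1}" "A \<in> sets \<nu>" "emeasure \<nu> A < \<infinity>"
  shows "emeasure \<mu> (I \<times> A) < \<infinity>"
proof -
  have "emeasure lborel I \<le> emeasure lborel {0..1::real}" using assms by (intro emeasure_mono) auto
  then have "emeasure lborel I < \<infinity>" by (auto simp: less_top[symmetric] top_unique)
  then show ?thesis using assms by (simp add: emeasure_slab ennreal_mult_less_top)
qed

lemma slab_measure:
  assumes "I \<in> sets borel" "I \<subseteq> {0..1}" "A \<in> sets \<nu>"
  shows "measure \<mu> (I \<times> A) = c * (measure lborel I * measure \<nu> A)"
  using emeasure_slab[OF assms] c_pos by (simp add: measure_def enn2real_mult)

lemma snd_measurable_mu: "snd \<in> measurable \<mu> borel"
  unfolding measurable_cong_sets[OF sets_mu refl]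
  by (rule measurable_compose[OF measurable_snd id_measurable_nu])

lemma fst_measurable_mu: "fst \<in> measurable \<mu> borel"
  unfolding measurable_cong_sets[OF sets_mu refl]
proof (rule measurable_compose[OF measurable_fst])
  show "(\<lambda>x. x) \<in> measurable (restrict_space lborel {0..1}) borel"
    by (rule measurable_restrict_space1) simp
qed

lemma nn_integral_mu:
  assumes f: "f \<in> borel_measurable \<nu>"
  shows "(\<integral>\<^sup>+ p. f (snd p) \<partial>\<mu>) = ennreal c * (\<integral>\<^sup>+ z. f z \<partial>\<nu>)"
proof -
  let ?L = "restrict_space lborel {0..1::real}"
  have fm: "(\<lambda>p. f (snd p)) \<in> borel_measurable (?L \<Otimes>\<^sub>M \<nu>)" by (rule measurable_compose[OF measurable_snd f])
  have "(\<integral>\<^sup>+ p. f (snd p) \<partial>\<mu>) = ennreal c * (\<integral>\<^sup>+ p. f (snd p) \<partial>(?L \<Otimes>\<^sub>M \<nu>))"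
    unfolding jump_compensator_def using fm by (rule nn_integral_scale_measure)
  also have "(\<integral>\<^sup>+ p. f (snd p) \<partial>(?L \<Otimes>\<^sub>M \<nu>)) = (\<integral>\<^sup>+ t. \<integral>\<^sup>+ z. f z \<partial>\<nu> \<partial>?L)"
    using nu.nn_integral_fst[OF fm] by simp
  also have "\<dots> = (\<integral>\<^sup>+ z. f z \<partial>\<nu>)"
    by (simp add: emeasure_restrict_space)
  finally show ?thesis .
qed

lemma snd_integrable_mu:
  assumes "0 < d" "I \<in> sets borel" "I \<subseteq> {0..1}"
  shows "set_integrable \<mu> (I \<times> far d) snd"
    and "\<bar>LINT p : I \<times> far d | \<mu>. snd p\<bar> \<le> c * enn2real (\<integral>\<^sup>+ z. ennreal \<bar>z\<bar> * indicator (far d) z \<partial>\<nu>)"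
proof -
  have S: "I \<times> far d \<in> sets \<mu>" using assms far_sets by (intro slab_sets) auto
  have m: "(\<lambda>p. indicator (I \<times> far d) p *\<^sub>R snd p) \<in> borel_measurable \<mu>"
    using S snd_measurable_mu by (intro borel_measurable_scaleR borel_measurable_indicator)
  have fm: "(\<lambda>z. ennreal \<bar>z\<bar> * indicator (far d) z) \<in> borel_measurable \<nu>"
    using far_sets[of d] assms(1) by (intro borel_measurable_times_ennreal borel_measurable_indicator borel_measurable_nu) auto
  have le: "(\<integral>\<^sup>+ p. ennreal (norm (indicator (I \<times> far d) p *\<^sub>R snd p)) \<partial>\<mu>)
      \<le> ennreal c * (\<integral>\<^sup>+ z. ennreal \<bar>z\<bar> * indicator (far d) z \<partial>\<nu>)"
    unfolding nn_integral_mu[OF fm, symmetric]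
    by (intro nn_integral_mono) (auto simp: indicator_def)
  also have "\<dots> < \<infinity>" using far_mean[OF assms(1)] by (simp add: ennreal_mult_less_top)
  finally have i: "integrable \<mu> (\<lambda>p. indicator (I \<times> far d) p *\<^sub>R snd p)" by (rule integrableI_bounded[OF m])
  then show "set_integrable \<mu> (I \<times> far d) snd" by (simp add: set_integrable_def)
  have "ennreal \<bar>LINT p : I \<times> far d | \<mu>. snd p\<bar> \<le> (\<integral>\<^sup>+ p. ennreal (norm (indicator (I \<times> far d) p *\<^sub>R snd p)) \<partial>\<mu>)"
    unfolding set_lebesgue_integral_def using integral_norm_bound_ennreal[OF i] by simp
  also note le
  also have "ennreal c * (\<integral>\<^sup>+ z. ennreal \<bar>z\<bar> * indicator (far d) z \<partial>\<nu>) =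
      ennreal (c * enn2real (\<integral>\<^sup>+ z. ennreal \<bar>z\<bar> * indicator (far d) z \<partial>\<nu>))"
    using far_mean[OF assms(1)] c_pos by (subst ennreal_mult') (auto simp: ennreal_enn2real)
  finally show "\<bar>LINT p : I \<times> far d | \<mu>. snd p\<bar> \<le> c * enn2real (\<integral>\<^sup>+ z. ennreal \<bar>z\<bar> * indicator (far d) z \<partial>\<nu>)"
    using c_pos by (subst (asm) ennreal_le_iff) auto
qed

lemma snd_measurable_N: "\<omega> \<in> space M \<Longrightarrow> snd \<in> measurable (N \<omega>) borel"
  using snd_measurable_mu by (simp add: measurable_cong_sets[OF sets_N refl])

lemma AE_snd_integrable:
  assumes d: "0 < d"
  shows "AE \<omega> in M. emeasure (N \<omega>) ({0<..1} \<times> far d) < \<infinity> \<and> set_integrable (N \<omega>) ({0<..1} \<times> far d) snd"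
proof -
  let ?E = "\<lambda>n::nat. {0<..1::real} \<times> far (d + real n)"
  have S: "?E n \<in> sets \<mu>" for n using d far_sets by (intro slab_sets) auto
  have fin: "emeasure \<mu> (?E 0) < \<infinity>" using d far_sets far_finite by (intro slab_finite) auto
  have dec: "decseq ?E" by (auto simp: decseq_def far_def)
  have emp: "(\<Inter>n. ?E n) = {}"
  proof -
    have "False" if "p \<in> (\<Inter>n. ?E n)" for p
    proof -
      obtain n where "\<bar>snd p\<bar> < real n" using reals_Archimedean2 by blast
      moreover have "d + real n < \<bar>snd p\<bar>" using that by (auto simp: far_def)
      ultimately show False using d by simp
    qed
    then show ?thesis by blast
  qed
  from AE_N_finite[OF S fin] AE_space show ?thesis
  proof eventually_elim
    case (elim \<omega>)
    have sN: "sets (N \<omega>) = sets \<mu>" by (rule sets_N[OF elim(2)])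
    have SN: "?E n \<in> sets (N \<omega>)" for n using S sN by simp
    have finn: "emeasure (N \<omega>) (?E n) < \<infinity>" for n
    proof -
      have "emeasure (N \<omega>) (?E n) \<le> emeasure (N \<omega>) (?E 0)"
        by (intro emeasure_mono decseqD[OF dec] SN) simp
      then show ?thesis using elim(1) by (rule le_less_trans)
    qed
    have "(\<lambda>n. emeasure (N \<omega>) (?E n)) \<longlonglongrightarrow> emeasure (N \<omega>) (\<Inter>n. ?E n)"
      using SN dec finn by (intro Lim_emeasure_decseq) (auto simp: less_top[symmetric])
    then have "(\<lambda>n. emeasure (N \<omega>) (?E n)) \<longlonglongrightarrow> 0" by (simp only: emp emeasure_empty)
    then have "\<forall>\<^sub>F n in sequentially. emeasure (N \<omega>) (?E n) < 1" by (rule order_tendstoD) simp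
    then obtain n where n: "emeasure (N \<omega>) (?E n) < 1" by (meson eventually_sequentially order.refl)
    obtain k :: nat where k: "emeasure (N \<omega>) (?E n) = of_nat k"
      using N_values[OF elim(2) S, of n] finn[of n] by (auto simp: less_top)
    have "(of_nat k :: ennreal) < of_nat 1" using n k by simp
    then have "k < 1" by (simp only: of_nat_less_iff)
    then have z: "emeasure (N \<omega>) (?E n) = 0" using k by simp
    have m: "(\<lambda>p. indicator (?E 0) p *\<^sub>R snd p) \<in> borel_measurable (N \<omega>)"
      using SN[of 0] snd_measurable_N[OF elim(2)] by (intro borel_measurable_scaleR borel_measurable_indicator)
    have "AE p in N \<omega>. p \<notin> ?E n" using z SN[of n] by (intro AE_not_in null_setsI)
    then have bd: "AE p in N \<omega>. norm (indicator (?E 0) p *\<^sub>R snd p) \<le> norm (indicator (?E 0) p *\<^sub>R (d + real n))"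
    proof eventually_elim
      case (elim p)
      then show ?case using d by (cases "p \<in> ?E 0") (auto simp: far_def mem_Times_iff)
    qed
    have ib: "integrable (N \<omega>) (\<lambda>p. indicator (?E 0) p *\<^sub>R (d + real n))"
      using SN[of 0] finn[of 0] by (intro integrable_scaleR_left) (auto simp: less_top)
    have "integrable (N \<omega>) (\<lambda>p. indicator (?E 0) p *\<^sub>R snd p)"
      by (rule Bochner_Integration.integrable_bound[OF ib m bd])
    then show ?case using elim(1) unfolding set_integrable_def by (simp only: of_nat_0 add_0_right)
  qed
qed

lemma nn_integral_N_measurable:
  assumes "f \<in> borel_measurable \<mu>"
  shows "(\<lambda>\<omega>. \<integral>\<^sup>+ p. f p \<partial>N \<omega>) \<in> borel_measurable M"
  using assms
proof (induction rule: borel_measurable_induct)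
  case (cong f g)
  have "(\<integral>\<^sup>+ p. f p \<partial>N \<omega>) = (\<integral>\<^sup>+ p. g p \<partial>N \<omega>)" if "\<omega> \<in> space M" for \<omega>
    using cong.hyps(3) sets_eq_imp_space_eq[OF sets_N[OF that]] by (intro nn_integral_cong) auto
  then show ?case using cong.IH by (simp cong: measurable_cong)
next
  case (set A)
  have "(\<integral>\<^sup>+ p. indicator A p \<partial>N \<omega>) = emeasure (N \<omega>) A" if "\<omega> \<in> space M" for \<omega>
    using set sets_N[OF that] by simp
  then show ?case using N_meas[OF set] by (simp cong: measurable_cong)
next
  case (mult u a)
  have "(\<integral>\<^sup>+ p. a * u p \<partial>N \<omega>) = a * (\<integral>\<^sup>+ p. u p \<partial>N \<omega>)" if "\<omega> \<in> space M" for \<omega>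
    using mult.hyps(2) by (intro nn_integral_cmult) (simp add: measurable_cong_sets[OF sets_N[OF that] refl])
  then show ?case using mult.IH by (simp cong: measurable_cong)
next
  case (add u v)
  have "(\<integral>\<^sup>+ p. v p + u p \<partial>N \<omega>) = (\<integral>\<^sup>+ p. v p \<partial>N \<omega>) + (\<integral>\<^sup>+ p. u p \<partial>N \<omega>)" if "\<omega> \<in> space M" for \<omega>
    using add.hyps(1,3) by (intro nn_integral_add) (simp_all add: measurable_cong_sets[OF sets_N[OF that] refl])
  then show ?case using add.IH by (simp cong: measurable_cong)
next
  case (seq U)
  have "(\<integral>\<^sup>+ p. (SUP i. U i) p \<partial>N \<omega>) = (SUP i. \<integral>\<^sup>+ p. U i p \<partial>N \<omega>)" if "\<omega> \<in> space M" for \<omega>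
    unfolding SUP_apply using seq.hyps(1,3)
    by (intro nn_integral_monotone_convergence_SUP) (simp_all add: measurable_cong_sets[OF sets_N[OF that] refl])
  then show ?case using seq.IH by (simp cong: measurable_cong)
qed

text \<open>
  Both parts of the integral are taken in \<open>[0,\<infinity>]\<close>, which makes it a measurable function of \<open>\<omega>\<close> for an
  arbitrary random measure; where the jump size is integrable it is the Bochner integral.
\<close>

definition jump_sum :: "(real \<times> real) set \<Rightarrow> 'w \<Rightarrow> real" where
  "jump_sum E \<omega> = enn2real (\<integral>\<^sup>+ p. ennreal (indicator E p *\<^sub>R snd p) \<partial>N \<omega>)
    - enn2real (\<integral>\<^sup>+ p. ennreal (- (indicator E p *\<^sub>R snd p)) \<partial>N \<omega>)"

lemma jump_sum_measurable: "E \<in> sets \<mu> \<Longrightarrow> jump_sum E \<in> borel_measurable M"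
proof -
  assume E: "E \<in> sets \<mu>"
  have "(\<lambda>p. indicator E p *\<^sub>R snd p) \<in> borel_measurable \<mu>"
    using E snd_measurable_mu by (intro borel_measurable_scaleR borel_measurable_indicator)
  then have [measurable]: "(\<lambda>\<omega>. \<integral>\<^sup>+ p. ennreal (indicator E p *\<^sub>R snd p) \<partial>N \<omega>) \<in> borel_measurable M"
    "(\<lambda>\<omega>. \<integral>\<^sup>+ p. ennreal (- (indicator E p *\<^sub>R snd p)) \<partial>N \<omega>) \<in> borel_measurable M"
    by (auto intro!: nn_integral_N_measurable)
  show ?thesis unfolding jump_sum_def[abs_def] by measurable
qed

lemma jump_sum_eq: "set_integrable (N \<omega>) E snd \<Longrightarrow> (LINT p : E | N \<omega>. snd p) = jump_sum E \<omega>"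
  unfolding set_integrable_def set_lebesgue_integral_def jump_sum_def by (rule real_lebesgue_integral_def)

end

section \<open>Rounding the jumps to finitely many sizes\<close>

text \<open>
  On a set of finite measure a uniform error \<open>\<kappa>\<close> of the approximation by the constants \<open>cc i\<close> on the
  cells \<open>idx = i\<close> becomes an error of the integral.
\<close>

lemma quantization:
  fixes f :: "'b \<Rightarrow> real" and idx :: "'b \<Rightarrow> nat" and cc :: "nat \<Rightarrow> real"
  assumes E: "E \<in> sets m" "emeasure m E < \<infinity>"
    and idx: "idx \<in> measurable m (count_space UNIV)" and idxn: "\<And>p. p \<in> E \<Longrightarrow> idx p < n"
    and f: "f \<in> borel_measurable m" and err: "\<And>p. p \<in> E \<Longrightarrow> \<bar>f p - cc (idx p)\<bar> \<le> \<kappa>"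
  shows "set_integrable m E f"
    and "\<bar>(LINT p : E | m. f p) - (\<Sum>i<n. cc i * measure m (E \<inter> idx -` {i}))\<bar> \<le> \<kappa> * measure m E"
    and "(\<Sum>i<n. (cc i)\<^sup>2 * measure m (E \<inter> idx -` {i})) = (LINT p : E | m. (cc (idx p))\<^sup>2)"
    and "E \<inter> idx -` {i} \<in> sets m"
proof -
  have Esp: "E \<subseteq> space m" using E(1) by (rule sets.sets_into_space)
  have A: "E \<inter> idx -` {i} \<in> sets m" for i
  proof -
    have "idx -` {i} \<inter> space m \<in> sets m" using idx by (rule measurable_sets) simp
    from sets.Int[OF E(1) this] have "E \<inter> (idx -` {i} \<inter> space m) \<in> sets m" .
    also have "E \<inter> (idx -` {i} \<inter> space m) = E \<inter> idx -` {i}" using Esp by auto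
    finally show ?thesis .
  qed
  then show "E \<inter> idx -` {i} \<in> sets m" .
  have Afin: "emeasure m (E \<inter> idx -` {i}) < \<infinity>" for i
    by (rule le_less_trans[OF emeasure_mono E(2)]) (auto simp: E(1))
  have expand: "indicator E p *\<^sub>R h (idx p) = (\<Sum>i<n. h i * indicator (E \<inter> idx -` {i}) p)" for h :: "nat \<Rightarrow> real" and p
  proof (cases "p \<in> E")
    case True
    have "(\<Sum>i<n. h i * indicator (E \<inter> idx -` {i}) p) = (\<Sum>i<n. if i = idx p then h (idx p) else 0)"
      using True by (intro sum.cong refl) (auto simp: indicator_def)
    then show ?thesis using True idxn[OF True] by simp
  qed simp
  have hi: "set_integrable m E (\<lambda>p. h (idx p))" "(LINT p : E | m. h (idx p)) = (\<Sum>i<n. h i * measure m (E \<inter> idx -` {i}))" for h :: "nat \<Rightarrow> real"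
  proof -
    have i: "integrable m (\<lambda>p. h i * indicator (E \<inter> idx -` {i}) p)" for i
      using A[of i] Afin[of i] by (intro integrable_mult_right) auto
    show "set_integrable m E (\<lambda>p. h (idx p))"
      unfolding set_integrable_def expand by (intro Bochner_Integration.integrable_sum i)
    have "(LINT p : E | m. h (idx p)) = (\<Sum>i<n. LINT p | m. h i * indicator (E \<inter> idx -` {i}) p)"
      unfolding set_lebesgue_integral_def expand by (intro Bochner_Integration.integral_sum i)
    also have "\<dots> = (\<Sum>i<n. h i * measure m (E \<inter> idx -` {i}))"
    proof (intro sum.cong refl)
      fix i
      have "E \<inter> idx -` {i} \<inter> space m = E \<inter> idx -` {i}" using Esp by auto
      then show "(LINT p | m. h i * indicator (E \<inter> idx -` {i}) p) = h i * measure m (E \<inter> idx -` {i})" by simp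
    qed
    finally show "(LINT p : E | m. h (idx p)) = (\<Sum>i<n. h i * measure m (E \<inter> idx -` {i}))" .
  qed
  show "(\<Sum>i<n. (cc i)\<^sup>2 * measure m (E \<inter> idx -` {i})) = (LINT p : E | m. (cc (idx p))\<^sup>2)"
    using hi(2)[of "\<lambda>i. (cc i)\<^sup>2"] by simp
  have ik: "integrable m (\<lambda>p. indicator E p *\<^sub>R k)" for k :: real
    using E by (intro integrable_scaleR_left) auto
  have ccm: "(\<lambda>p. cc (idx p)) \<in> borel_measurable m" by (rule measurable_compose[OF idx]) simp
  have dm: "(\<lambda>p. indicator E p *\<^sub>R (f p - cc (idx p))) \<in> borel_measurable m"
    using E(1) f ccm by (intro borel_measurable_scaleR borel_measurable_indicator borel_measurable_diff)
  have bd: "norm (indicator E p *\<^sub>R (f p - cc (idx p))) \<le> norm (indicator E p *\<^sub>R \<kappa>)" for p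
    using err[of p] by (cases "p \<in> E") auto
  have di: "set_integrable m E (\<lambda>p. f p - cc (idx p))"
    unfolding set_integrable_def by (rule Bochner_Integration.integrable_bound[OF ik[of \<kappa>] dm]) (intro always_eventually allI bd)
  have "set_integrable m E (\<lambda>p. (f p - cc (idx p)) + cc (idx p))"
    by (rule set_integral_add(1)[OF di hi(1)])
  then show fi: "set_integrable m E f" by simp
  have "(LINT p : E | m. f p) - (\<Sum>i<n. cc i * measure m (E \<inter> idx -` {i})) = (LINT p : E | m. f p - cc (idx p))"
    unfolding hi(2)[symmetric] using set_integral_diff(2)[OF fi hi(1)] by simp
  also have "\<bar>\<dots>\<bar> \<le> (LINT p : E | m. \<kappa>)"
    unfolding set_lebesgue_integral_def
  proof (rule order_trans[OF integral_abs_bound], intro integral_mono)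
    show "integrable m (\<lambda>p. \<bar>indicator E p *\<^sub>R (f p - cc (idx p))\<bar>)"
      using di unfolding set_integrable_def by (rule integrable_abs)
    show "integrable m (\<lambda>p. indicator E p *\<^sub>R \<kappa>)" by (rule ik)
    fix p show "\<bar>indicator E p *\<^sub>R (f p - cc (idx p))\<bar> \<le> indicator E p *\<^sub>R \<kappa>"
      using err[of p] by (cases "p \<in> E") auto
  qed
  also have "\<dots> = \<kappa> * measure m E"
    unfolding set_lebesgue_integral_def using E(1) Esp by (simp add: Int_absorb2 mult.commute)
  finally show "\<bar>(LINT p : E | m. f p) - (\<Sum>i<n. cc i * measure m (E \<inter> idx -` {i}))\<bar> \<le> \<kappa> * measure m E" .
qed

text \<open>
  Rounding towards zero to a multiple of \<open>1 / K\<close>; in this direction rounding does not increase second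
  moments.
\<close>

definition rtz :: "real \<Rightarrow> real \<Rightarrow> int" where
  "rtz K z = (if 0 \<le> z then \<lfloor>K * z\<rfloor> else \<lceil>K * z\<rceil>)"

lemma rtz_error: "0 < K \<Longrightarrow> \<bar>z - rtz K z / K\<bar> \<le> 1 / K"
proof -
  assume K: "0 < K"
  have "\<bar>K * z - rtz K z\<bar> \<le> 1" unfolding rtz_def by (auto; linarith)
  then have "\<bar>K * z - rtz K z\<bar> / K \<le> 1 / K" using K by (intro divide_right_mono) auto
  moreover have "z - rtz K z / K = (K * z - rtz K z) / K" using K by (simp add: diff_divide_distrib)
  ultimately show ?thesis using K by simp
qed

lemma rtz_le: "0 < K \<Longrightarrow> \<bar>real_of_int (rtz K z)\<bar> \<le> K * \<bar>z\<bar>"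
proof (cases "0 \<le> z")
  case True
  assume K: "0 < K"
  have "0 \<le> K * z" using True K by simp
  then show ?thesis using True unfolding rtz_def by simp
next
  case False
  assume K: "0 < K"
  have "K * z \<le> 0" using False K by (simp add: mult_le_0_iff)
  then have "\<lceil>K * z\<rceil> \<le> 0" by (simp add: ceiling_le_iff)
  then have "\<bar>real_of_int \<lceil>K * z\<rceil>\<bar> \<le> - (K * z)" by linarith
  then show ?thesis using False unfolding rtz_def by simp
qed

lemma rtz_measurable: "rtz K \<in> measurable borel (count_space UNIV)"
  unfolding rtz_def[abs_def] by measurable

context jump_points
begin

context
  fixes d T \<eta> :: real and G :: nat
begin

definition block :: "nat \<Rightarrow> (real \<times> real) set" where "block l = {0<..real l / real G} \<times> band d T"

definition width :: "nat \<Rightarrow> nat" where "width K = nat \<lfloor>real (Suc K) * T\<rfloor>"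

text \<open>
  Numbers the pairs of a time slot and a rounded size with the time slot as the leading digit. The cells
  with number below \<open>l * (2 * width K + 1)\<close> are then those up to time \<open>l / G\<close>, and a maximum over
  partial sums of cells dominates a maximum over grid times.
\<close>

definition cell :: "nat \<Rightarrow> real \<times> real \<Rightarrow> nat" where
  "cell K p = nat (\<lceil>real G * fst p\<rceil> - 1) * (2 * width K + 1) + nat (rtz (Suc K) (snd p) + int (width K))"

text \<open>The rounded size, read off from the last digit of the number of the cell.\<close>

definition val :: "nat \<Rightarrow> nat \<Rightarrow> real" where
  "val K i = real_of_int (int (i mod (2 * width K + 1)) - int (width K)) / real (Suc K)"

definition piece :: "nat \<Rightarrow> nat \<Rightarrow> (real \<times> real) set" where "piece K i = block G \<inter> cell K -` {i}"

definition block_dev :: "nat \<Rightarrow> 'w \<Rightarrow> real" where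
  "block_dev l \<omega> = jump_sum (block l) \<omega> - (LINT p : block l | \<mu>. snd p)"

definition block_exceeds :: "'w set" where "block_exceeds = {\<omega> \<in> space M. \<exists>l\<le>G. 2 * \<eta> \<le> \<bar>block_dev l \<omega>\<bar>}"

context
  fixes u \<sigma> :: real
  assumes d: "0 < d" and dT: "d < T" and u: "0 < u" and \<eta>: "0 < \<eta>" and G: "0 < G" and \<sigma>: "0 \<le> \<sigma>"
    and second_moment: "(\<integral>\<^sup>+ z. ennreal (z\<^sup>2) * indicator (band 0 T) z \<partial>\<nu>) \<le> ennreal \<sigma>"
begin

lemma block_times: "l \<le> G \<Longrightarrow> {0<..real l / real G} \<subseteq> {0..1}"
proof
  fix x assume l: "l \<le> G" and x: "x \<in> {0<..real l / real G}"
  have "real l / real G \<le> 1" using l G by simp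
  then show "x \<in> {0..1}" using x by auto
qed

lemma block_sets: "l \<le> G \<Longrightarrow> block l \<in> sets \<mu>"
  unfolding block_def using d by (intro slab_sets band_sets block_times) auto

lemma block_finite: "l \<le> G \<Longrightarrow> emeasure \<mu> (block l) < \<infinity>"
  unfolding block_def using d by (intro slab_finite band_sets band_finite block_times) auto

lemma block_mono: "l \<le> l' \<Longrightarrow> block l \<subseteq> block l'"
  unfolding block_def using G by (auto simp: field_simps intro: order_trans)

lemma cell_measurable: "sets m = sets \<mu> \<Longrightarrow> cell K \<in> measurable m (count_space UNIV)"
proof -
  assume s: "sets m = sets \<mu>"
  have [measurable]: "fst \<in> measurable m borel" "snd \<in> measurable m borel"
    unfolding measurable_cong_sets[OF s refl] by (rule fst_measurable_mu, rule snd_measurable_mu)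
  have [measurable]: "(\<lambda>p. rtz (Suc K) (snd p)) \<in> measurable m (count_space UNIV)"
    by (rule measurable_compose[OF _ rtz_measurable]) measurable
  show ?thesis unfolding cell_def[abs_def] by measurable
qed

lemma width_le: "real (width K) \<le> real (Suc K) * T"
proof -
  have "0 \<le> real (Suc K) * T" using d dT by simp
  then show ?thesis unfolding width_def by linarith
qed

lemma rtz_width:
  assumes "\<bar>z\<bar> \<le> T"
  shows "\<bar>rtz (Suc K) z\<bar> \<le> int (width K)"
proof -
  have "\<bar>real_of_int (rtz (Suc K) z)\<bar> \<le> real (Suc K) * \<bar>z\<bar>" by (rule rtz_le) simp
  also have "\<dots> \<le> real (Suc K) * T" using assms by (intro mult_left_mono) auto
  finally have "\<bar>rtz (Suc K) z\<bar> \<le> \<lfloor>real (Suc K) * T\<rfloor>" by (simp add: le_floor_iff)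
  then show ?thesis unfolding width_def by linarith
qed

lemma cell_props:
  assumes "p \<in> block G"
  shows "val K (cell K p) = real_of_int (rtz (Suc K) (snd p)) / real (Suc K)"
    and "cell K p < l * (2 * width K + 1) \<longleftrightarrow> fst p \<le> real l / real G"
proof -
  have p: "0 < fst p" "fst p \<le> 1" "\<bar>snd p\<bar> \<le> T"
    using assms G by (auto simp: block_def band_def mem_Times_iff)
  define r where "r = nat (rtz (Suc K) (snd p) + int (width K))"
  define s where "s = nat (\<lceil>real G * fst p\<rceil> - 1)"
  let ?W = "2 * width K + 1"
  have w: "\<bar>rtz (Suc K) (snd p)\<bar> \<le> int (width K)" by (rule rtz_width[OF p(3)])
  have r: "r < ?W" "int r - int (width K) = rtz (Suc K) (snd p)" using w unfolding r_def by linarith+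
  have c: "cell K p = s * ?W + r" by (simp add: cell_def s_def r_def)
  have "(s * W + r) mod W = r" if "r < W" for W :: nat using that by simp
  from this[OF r(1)] have "cell K p mod ?W = r" unfolding c .
  then show "val K (cell K p) = real_of_int (rtz (Suc K) (snd p)) / real (Suc K)"
    unfolding val_def using r(2) by simp
  have "cell K p < l * ?W \<longleftrightarrow> s < l"
  proof
    assume "s < l"
    then have "(s + 1) * ?W \<le> l * ?W" by (intro mult_right_mono) auto
    then show "cell K p < l * ?W" using r(1) unfolding c by simp
  next
    assume a: "cell K p < l * ?W"
    show "s < l"
    proof (rule ccontr)
      assume "\<not> s < l"
      then have "l * ?W \<le> s * ?W" by (intro mult_right_mono) auto
      then show False using a unfolding c by linarith
    qed
  qed
  also have "\<dots> \<longleftrightarrow> \<lceil>real G * fst p\<rceil> \<le> int l"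
  proof -
    have "0 < \<lceil>real G * fst p\<rceil>" using p G by simp
    then show ?thesis unfolding s_def by linarith
  qed
  also have "\<dots> \<longleftrightarrow> fst p \<le> real l / real G" using G by (simp add: ceiling_le_iff field_simps)
  finally show "cell K p < l * ?W \<longleftrightarrow> fst p \<le> real l / real G" .
qed

lemma piece_block: "l \<le> G \<Longrightarrow> i < l * (2 * width K + 1) \<Longrightarrow> block l \<inter> cell K -` {i} = piece K i"
proof -
  assume l: "l \<le> G" and i: "i < l * (2 * width K + 1)"
  have "p \<in> block l" if "p \<in> block G" "cell K p = i" for p
    using cell_props(2)[OF that(1), of K l] that i by (auto simp: block_def mem_Times_iff)
  then show ?thesis using block_mono[OF l] by (auto simp: piece_def)
qed

lemma block_cell_less: "l \<le> G \<Longrightarrow> p \<in> block l \<Longrightarrow> cell K p < l * (2 * width K + 1)"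
  using cell_props(2)[of p K l] block_mono[of l G] by (auto simp: block_def mem_Times_iff)

lemma block_quantization:
  assumes s: "sets m = sets \<mu>" and fin: "emeasure m (block G) < \<infinity>" and l: "l \<le> G"
  shows "set_integrable m (block l) snd"
    and "\<bar>(LINT p : block l | m. snd p) - (\<Sum>i<l * (2 * width K + 1). val K i * measure m (piece K i))\<bar> \<le> measure m (block G) / real (Suc K)"
proof -
  have S: "block l \<in> sets m" "block G \<in> sets m" using block_sets[OF l] block_sets[of G] s by auto
  have f: "emeasure m (block l) < \<infinity>"
    by (rule le_less_trans[OF emeasure_mono[OF block_mono[OF l] S(2)] fin])
  have sm: "snd \<in> borel_measurable m" unfolding measurable_cong_sets[OF s refl] by (rule snd_measurable_mu)
  have e: "\<bar>snd p - val K (cell K p)\<bar> \<le> 1 / real (Suc K)" if "p \<in> block l" for p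
  proof -
    have "p \<in> block G" using that block_mono[OF l] by blast
    from cell_props(1)[OF this, of K] show ?thesis using rtz_error[of "real (Suc K)" "snd p"] by simp
  qed
  note q = quantization[OF S(1) f cell_measurable[OF s, of K] block_cell_less[OF l] sm e]
  show "set_integrable m (block l) snd" by (rule q(1))
  have "(\<Sum>i<l * (2 * width K + 1). val K i * measure m (block l \<inter> cell K -` {i})) = (\<Sum>i<l * (2 * width K + 1). val K i * measure m (piece K i))"
    by (intro sum.cong refl) (simp add: piece_block[OF l])
  with q(2) have "\<bar>(LINT p : block l | m. snd p) - (\<Sum>i<l * (2 * width K + 1). val K i * measure m (piece K i))\<bar> \<le> 1 / real (Suc K) * measure m (block l)"
    by simp
  also have "\<dots> \<le> 1 / real (Suc K) * measure m (block G)"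
    using fin S block_mono[OF l] by (intro mult_left_mono measure_mono_fmeasurable) (auto simp: fmeasurable_def)
  finally show "\<bar>(LINT p : block l | m. snd p) - (\<Sum>i<l * (2 * width K + 1). val K i * measure m (piece K i))\<bar> \<le> measure m (block G) / real (Suc K)"
    by simp
qed

lemma piece_sets: "piece K i \<in> sets \<mu>"
proof -
  have "cell K -` {i} \<inter> space \<mu> \<in> sets \<mu>" using cell_measurable[OF refl] by (rule measurable_sets) simp
  from sets.Int[OF block_sets[OF order.refl] this] have "block G \<inter> (cell K -` {i} \<inter> space \<mu>) \<in> sets \<mu>" .
  also have "block G \<inter> (cell K -` {i} \<inter> space \<mu>) = piece K i"
    using sets.sets_into_space[OF block_sets[of G]] by (auto simp: piece_def)
  finally show ?thesis .
qed

lemma piece_finite: "emeasure \<mu> (piece K i) < \<infinity>"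
  by (rule le_less_trans[OF emeasure_mono block_finite[of G]]) (auto simp: piece_def block_sets)

lemma piece_disjoint: "disjoint_family (piece K)"
  by (auto simp: disjoint_family_on_def piece_def)

lemma val_abs_le: "\<bar>val K i\<bar> \<le> T"
proof -
  have "i mod (2 * width K + 1) < 2 * width K + 1" by simp
  then have "\<bar>int (i mod (2 * width K + 1)) - int (width K)\<bar> \<le> int (width K)" by linarith
  then have "\<bar>real_of_int (int (i mod (2 * width K + 1)) - int (width K))\<bar> \<le> real (width K)" by linarith
  then have "\<bar>val K i\<bar> \<le> real (width K) / real (Suc K)" unfolding val_def abs_divide by (intro divide_mono) auto
  also have "\<dots> \<le> real (Suc K) * T / real (Suc K)" by (intro divide_right_mono width_le) simp
  also have "\<dots> = T" by simp
  finally show ?thesis .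
qed

lemma sum_val_sq: "(\<Sum>i<G * (2 * width K + 1). (val K i)\<^sup>2 * measure \<mu> (piece K i)) \<le> c * \<sigma>"
proof -
  let ?E = "block G"
  have S: "?E \<in> sets \<mu>" by (rule block_sets) simp
  have F: "emeasure \<mu> ?E < \<infinity>" by (rule block_finite) simp
  have e: "\<bar>snd p - val K (cell K p)\<bar> \<le> 1 / real (Suc K)" if "p \<in> ?E" for p
    using cell_props(1)[OF that, of K] rtz_error[of "real (Suc K)" "snd p"] by simp
  have cl: "cell K p < G * (2 * width K + 1)" if "p \<in> ?E" for p
    using block_cell_less[OF order.refl that] .
  have "(\<Sum>i<G * (2 * width K + 1). (val K i)\<^sup>2 * measure \<mu> (piece K i)) = (LINT p : ?E | \<mu>. (val K (cell K p))\<^sup>2)"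
    unfolding piece_def by (rule quantization(3)[OF S F cell_measurable[OF refl] cl snd_measurable_mu e])
  also have "\<dots> \<le> c * \<sigma>"
  proof -
    have vm: "(\<lambda>p. indicator ?E p *\<^sub>R (val K (cell K p))\<^sup>2) \<in> borel_measurable \<mu>"
    proof -
      have "(\<lambda>p. (val K (cell K p))\<^sup>2) \<in> borel_measurable \<mu>" by (rule measurable_compose[OF cell_measurable[OF refl]]) simp
      then show ?thesis using S by (intro borel_measurable_scaleR borel_measurable_indicator)
    qed
    have fm: "(\<lambda>z. ennreal (z\<^sup>2) * indicator (band 0 T) z) \<in> borel_measurable \<nu>"
      using band_sets[of 0 T] by (intro borel_measurable_times_ennreal borel_measurable_indicator borel_measurable_nu) auto
    have "(\<integral>\<^sup>+ p. ennreal (indicator ?E p *\<^sub>R (val K (cell K p))\<^sup>2) \<partial>\<mu>)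
        \<le> (\<integral>\<^sup>+ p. ennreal ((snd p)\<^sup>2) * indicator (band 0 T) (snd p) \<partial>\<mu>)"
    proof (intro nn_integral_mono)
      fix p
      show "ennreal (indicator ?E p *\<^sub>R (val K (cell K p))\<^sup>2) \<le> ennreal ((snd p)\<^sup>2) * indicator (band 0 T) (snd p)"
      proof (cases "p \<in> ?E")
        case True
        have b: "snd p \<in> band 0 T" using True d by (auto simp: block_def band_def mem_Times_iff)
        have "\<bar>val K (cell K p)\<bar> = \<bar>real_of_int (rtz (Suc K) (snd p))\<bar> / real (Suc K)"
          unfolding cell_props(1)[OF True] by simp
        also have "\<dots> \<le> (real (Suc K) * \<bar>snd p\<bar>) / real (Suc K)" by (intro divide_right_mono rtz_le) auto
        also have "\<dots> = \<bar>snd p\<bar>" by simp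
        finally have "(val K (cell K p))\<^sup>2 \<le> (snd p)\<^sup>2" by (simp add: abs_le_square_iff)
        then show ?thesis using True b by (simp add: ennreal_leI)
      qed simp
    qed
    also have "\<dots> = ennreal c * (\<integral>\<^sup>+ z. ennreal (z\<^sup>2) * indicator (band 0 T) z \<partial>\<nu>)" by (rule nn_integral_mu[OF fm])
    also have "\<dots> \<le> ennreal c * ennreal \<sigma>" by (intro mult_left_mono second_moment) simp
    also have "\<dots> = ennreal (c * \<sigma>)" using c_pos by (simp add: ennreal_mult')
    finally show ?thesis
      unfolding set_lebesgue_integral_def using c_pos \<sigma> vm
      by (subst integral_eq_nn_integral) (auto intro!: enn2real_leI)
  qed
  finally show ?thesis .
qed

lemma block_dev_measurable: "l \<le> G \<Longrightarrow> block_dev l \<in> borel_measurable M"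
  unfolding block_dev_def[abs_def] using jump_sum_measurable[OF block_sets] by measurable

lemma block_exceeds_events: "block_exceeds \<in> events"
proof -
  have "block_exceeds = (\<Union>l\<in>{..G}. {\<omega> \<in> space M. 2 * \<eta> \<le> \<bar>block_dev l \<omega>\<bar>})"
    by (auto simp: block_exceeds_def)
  also have "\<dots> \<in> events" using block_dev_measurable
    by (intro sets.finite_UN borel_measurable_le borel_measurable_abs) auto
  finally show ?thesis .
qed

text \<open>
  For each rounding level \<open>K\<close> the rounded sums satisfy the maximal inequality with a bound that does not
  depend on \<open>K\<close>. The rounding error is the number of points plus its expectation, divided by
  \<open>Suc K\<close>; the probability that it reaches \<open>\<eta>\<close> tends to \<open>0\<close> as \<open>K\<close> grows.
\<close>

lemma block_maximal: "prob block_exceeds \<le> 2 * exp (u\<^sup>2 * exp (u * T) * (c * \<sigma>) - u * \<eta>)"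
proof -
  let ?R = "2 * exp (u\<^sup>2 * exp (u * T) * (c * \<sigma>) - u * \<eta>)"
  define B where "B K = {\<omega> \<in> space M. ennreal (\<eta> * real (Suc K)) \<le> emeasure (N \<omega>) (block G) + emeasure \<mu> (block G)}" for K
  define P where "P K = {\<omega> \<in> space M. \<exists>k\<le>G * (2 * width K + 1). \<eta> \<le> \<bar>\<Sum>i<k. val K i * (cnt (piece K i) \<omega> - measure \<mu> (piece K i))\<bar>}" for K
  have SG: "block G \<in> sets \<mu>" and FG: "emeasure \<mu> (block G) < \<infinity>" by (rule block_sets block_finite, simp)+
  have Bm: "B K \<in> events" for K unfolding B_def using N_meas[OF SG] by measurable
  have PP: "prob (P K) \<le> ?R" "P K \<in> events" for K
  proof -
    have dj: "disjoint_family_on (piece K) {..<G * (2 * width K + 1)}"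
      using piece_disjoint by (auto simp: disjoint_family_on_def)
    note * = compensated_maximal_inequality[where A = "piece K" and c = "val K" and m = T and \<eta> = \<eta>, OF piece_sets piece_finite dj val_abs_le u]
    show "P K \<in> events" unfolding P_def by (rule *(2))
    have "prob (P K) \<le> 2 * exp (u\<^sup>2 * exp (u * T) * (\<Sum>i<G * (2 * width K + 1). (val K i)\<^sup>2 * measure \<mu> (piece K i)) - u * \<eta>)"
      unfolding P_def by (rule *(1))
    also have "\<dots> \<le> ?R"
    proof -
      have "u\<^sup>2 * exp (u * T) * (\<Sum>i<G * (2 * width K + 1). (val K i)\<^sup>2 * measure \<mu> (piece K i)) \<le> u\<^sup>2 * exp (u * T) * (c * \<sigma>)"
        by (intro mult_left_mono sum_val_sq) auto
      then show ?thesis by simp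
    qed
    finally show "prob (P K) \<le> ?R" .
  qed
  have le: "prob block_exceeds \<le> ?R + prob (B K)" for K
  proof -
    have "prob block_exceeds \<le> prob (P K \<union> B K)"
    proof (rule finite_measure_mono_AE)
      show "P K \<union> B K \<in> events" using PP(2) Bm by blast
      show "AE \<omega> in M. \<omega> \<in> block_exceeds \<longrightarrow> \<omega> \<in> P K \<union> B K"
        using AE_N_finite[OF SG FG] AE_space
      proof eventually_elim
        case (elim \<omega>)
        show ?case
        proof (intro impI, rule ccontr)
          assume ex: "\<omega> \<in> block_exceeds" and no: "\<omega> \<notin> P K \<union> B K"
          from ex obtain l where l: "l \<le> G" "2 * \<eta> \<le> \<bar>block_dev l \<omega>\<bar>" by (auto simp: block_exceeds_def)
          have sN: "sets (N \<omega>) = sets \<mu>" by (rule sets_N[OF elim(2)])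
          note qN = block_quantization[OF sN elim(1) l(1)]
          note qM = block_quantization[OF refl FG l(1)]
          have js: "(LINT p : block l | N \<omega>. snd p) = jump_sum (block l) \<omega>" by (rule jump_sum_eq[OF qN(1)])
          define s1 where "s1 = (\<Sum>i<l * (2 * width K + 1). val K i * cnt (piece K i) \<omega>)"
          define s2 where "s2 = (\<Sum>i<l * (2 * width K + 1). val K i * measure \<mu> (piece K i))"
          have d: "(\<Sum>i<l * (2 * width K + 1). val K i * (cnt (piece K i) \<omega> - measure \<mu> (piece K i))) = s1 - s2"
            by (simp add: s1_def s2_def right_diff_distrib sum_subtractf)
          have "\<not> ennreal (\<eta> * real (Suc K)) \<le> emeasure (N \<omega>) (block G) + emeasure \<mu> (block G)"
            using no elim(2) by (auto simp: B_def)
          moreover have "emeasure (N \<omega>) (block G) + emeasure \<mu> (block G) = ennreal (cnt (block G) \<omega> + measure \<mu> (block G))"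
            using elim(1) FG by (simp add: emeasure_eq_ennreal_measure less_top)
          ultimately have "cnt (block G) \<omega> + measure \<mu> (block G) < \<eta> * real (Suc K)"
            by (metis ennreal_leI linorder_not_less)
          then have small: "cnt (block G) \<omega> / real (Suc K) + measure \<mu> (block G) / real (Suc K) < \<eta>"
            by (simp add: add_divide_distrib[symmetric] pos_divide_less_eq)
          have "l * (2 * width K + 1) \<le> G * (2 * width K + 1)" using l(1) by (intro mult_right_mono) auto
          then have "\<not> \<eta> \<le> \<bar>s1 - s2\<bar>" using no elim(2) d by (auto simp: P_def)
          then show False
            using l(2) qN(2)[of K] qM(2)[of K] small unfolding block_dev_def js s1_def[symmetric] s2_def[symmetric]
            by linarith
        qed
      qed
    qed
    also have "\<dots> \<le> prob (P K) + prob (B K)" by (rule measure_Un_le[OF PP(2) Bm])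
    also have "\<dots> \<le> ?R + prob (B K)" using PP(1) by (rule add_right_mono)
    finally show ?thesis .
  qed
  have "(\<lambda>K. prob (B K)) \<longlonglongrightarrow> prob (\<Inter>K. B K)"
  proof (rule finite_Lim_measure_decseq)
    show "range B \<subseteq> events" using Bm by blast
    show "decseq B"
    proof (rule decseq_SucI)
      fix K
      have "ennreal (\<eta> * real (Suc K)) \<le> ennreal (\<eta> * real (Suc (Suc K)))"
        using \<eta> by (intro ennreal_leI mult_left_mono) auto
      then show "B (Suc K) \<subseteq> B K" by (auto simp: B_def simp del: of_nat_Suc intro: order_trans)
    qed
  qed
  moreover have "prob (\<Inter>K. B K) = 0"
  proof (subst prob_eq_0)
    show "(\<Inter>K. B K) \<in> events" using Bm by blast
    show "AE \<omega> in M. \<omega> \<notin> (\<Inter>K. B K)"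
      using AE_N_finite[OF SG FG]
    proof eventually_elim
      case (elim \<omega>)
      define x where "x = cnt (block G) \<omega> + measure \<mu> (block G)"
      have x: "emeasure (N \<omega>) (block G) + emeasure \<mu> (block G) = ennreal x"
        using elim FG by (simp add: x_def emeasure_eq_ennreal_measure less_top)
      have x0: "0 \<le> x" by (simp add: x_def)
      obtain n :: nat where n: "x / \<eta> < real n" using reals_Archimedean2 by blast
      then have "x < \<eta> * real (Suc n)" using \<eta> by (simp add: field_simps)
      have "\<omega> \<notin> B n"
      proof
        assume "\<omega> \<in> B n"
        then have "ennreal (\<eta> * real (Suc n)) \<le> ennreal x" unfolding B_def x[symmetric] by blast
        then show False using x0 \<open>x < \<eta> * real (Suc n)\<close> by (simp add: ennreal_le_iff)
      qed
      then show ?case by blast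
    qed
  qed
  ultimately have "(\<lambda>K. ?R + prob (B K)) \<longlonglongrightarrow> ?R + 0" by (intro tendsto_add tendsto_const) simp
  then show ?thesis using le by (intro LIMSEQ_le_const[of _ "?R"]) auto
qed

end

end

end

section \<open>The compensated small jumps\<close>

lemma dyadic_from_right:
  fixes t :: real
  assumes "0 \<le> t" "t < 1"
  shows "\<exists>\<tau> :: nat \<Rightarrow> real. (\<forall>n. t < \<tau> n) \<and> (\<forall>n. \<tau> n \<le> 1) \<and> \<tau> \<longlonglongrightarrow> t \<and>
    (\<forall>n. \<exists>l\<le>2 ^ n. \<tau> n = real l / real (2 ^ n))"
proof -
  define \<tau> where "\<tau> n = (real_of_int \<lfloor>2 ^ n * t\<rfloor> + 1) / 2 ^ n" for n :: nat
  have gt: "t < \<tau> n" for n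
  proof -
    have "2 ^ n * t < real_of_int \<lfloor>2 ^ n * t\<rfloor> + 1" by linarith
    then show ?thesis unfolding \<tau>_def by (simp add: pos_less_divide_eq mult.commute)
  qed
  have dy: "\<exists>l\<le>2 ^ n. \<tau> n = real l / real (2 ^ n)" for n
  proof (intro exI conjI)
    let ?l = "nat (\<lfloor>2 ^ n * t\<rfloor> + 1)"
    have f0: "0 \<le> \<lfloor>2 ^ n * t\<rfloor>" using assms by simp
    have "2 ^ n * t < 2 ^ n" using assms by simp
    then have "\<lfloor>2 ^ n * t\<rfloor> < 2 ^ n" by (simp add: floor_less_iff)
    then show "?l \<le> 2 ^ n" by (simp add: nat_le_iff)
    show "\<tau> n = real ?l / real (2 ^ n)" unfolding \<tau>_def using f0 by simp
  qed
  have le1: "\<tau> n \<le> 1" for n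
  proof -
    obtain l where l: "l \<le> 2 ^ n" "\<tau> n = real l / real (2 ^ n)" using dy by blast
    have "real l \<le> real (2 ^ n)" using l(1) by (rule of_nat_mono)
    then show ?thesis unfolding l(2) by simp
  qed
  have up: "\<tau> n \<le> t + (1 / 2) ^ n" for n
  proof -
    have "(real_of_int \<lfloor>2 ^ n * t\<rfloor> + 1) / 2 ^ n \<le> (2 ^ n * t + 1) / 2 ^ n" by (intro divide_right_mono) auto
    also have "\<dots> = t + (1 / 2) ^ n" by (simp add: add_divide_distrib power_divide)
    finally show ?thesis by (simp add: \<tau>_def)
  qed
  have "(\<lambda>n. t + (1 / 2) ^ n) \<longlonglongrightarrow> t + 0" by (intro tendsto_add tendsto_const LIMSEQ_power_zero) auto
  then have up_lim: "(\<lambda>n. t + (1 / 2) ^ n) \<longlonglongrightarrow> t" by simp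
  have "\<tau> \<longlonglongrightarrow> t"
    by (rule real_tendsto_sandwich[OF _ _ tendsto_const up_lim]; intro always_eventually allI up less_imp_le[OF gt])
  then show ?thesis using gt le1 dy by (intro exI[of _ \<tau>]) blast
qed

lemma set_integral_time_right_continuous:
  fixes f :: "real \<times> 'b \<Rightarrow> real"
  assumes i: "set_integrable m ({0<..1} \<times> F) f"
    and S: "\<And>s. s \<le> 1 \<Longrightarrow> {0<..s} \<times> F \<in> sets m"
    and \<tau>: "\<And>n. t < \<tau> n" "\<And>n. \<tau> n \<le> 1" "\<tau> \<longlonglongrightarrow> t"
  shows "(\<lambda>n. LINT p : {0<..\<tau> n} \<times> F | m. f p) \<longlonglongrightarrow> (LINT p : {0<..t} \<times> F | m. f p)"
  unfolding set_lebesgue_integral_def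
proof (rule integral_dominated_convergence)
  let ?w = "\<lambda>p. norm (indicator ({0<..1} \<times> F) p *\<^sub>R f p)"
  have t1: "t \<le> 1" using \<tau>(1,2)[of 0] by linarith
  show "integrable m ?w" using i unfolding set_integrable_def by (rule integrable_norm)
  have "set_integrable m ({0<..s} \<times> F) f" if "s \<le> 1" for s
    by (rule set_integrable_subset[OF i S[OF that]]) (use that in auto)
  then show "(\<lambda>p. indicator ({0<..t} \<times> F) p *\<^sub>R f p) \<in> borel_measurable m"
    "(\<lambda>p. indicator ({0<..\<tau> n} \<times> F) p *\<^sub>R f p) \<in> borel_measurable m" for n
    using t1 \<tau>(2)[of n] unfolding set_integrable_def by auto
  show "AE p in m. (\<lambda>n. indicator ({0<..\<tau> n} \<times> F) p *\<^sub>R f p) \<longlonglongrightarrow> indicator ({0<..t} \<times> F) p *\<^sub>R f p"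
  proof (intro always_eventually allI)
    fix p :: "real \<times> 'b"
    have "\<forall>\<^sub>F n in sequentially. indicator ({0<..\<tau> n} \<times> F) p *\<^sub>R f p = indicator ({0<..t} \<times> F) p *\<^sub>R f p"
    proof (cases "fst p \<le> t")
      case True
      then have "fst p \<le> \<tau> n" for n using \<tau>(1)[of n] by linarith
      then show ?thesis using True by (auto simp: indicator_def mem_Times_iff)
    next
      case False
      then have "\<forall>\<^sub>F n in sequentially. \<tau> n < fst p" using order_tendstoD(2)[OF \<tau>(3)] by simp
      then show ?thesis by eventually_elim (use False in \<open>auto simp: indicator_def mem_Times_iff\<close>)
    qed
    then show "(\<lambda>n. indicator ({0<..\<tau> n} \<times> F) p *\<^sub>R f p) \<longlonglongrightarrow> indicator ({0<..t} \<times> F) p *\<^sub>R f p"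
      by (rule tendsto_eventually)
  qed
  show "AE p in m. norm (indicator ({0<..\<tau> n} \<times> F) p *\<^sub>R f p) \<le> ?w p" for n
    by (intro always_eventually allI) (use \<tau>(2)[of n] in \<open>auto simp: indicator_def\<close>)
qed

locale compensated_jumps = jump_points M N c \<nu> for M :: "'w measure" and N c \<nu> +
  fixes J :: "'w \<Rightarrow> skorokhod"
  assumes comp_int: "compensated_jump_integral M N (jump_compensator c \<nu>) J"
begin

definition large_sum :: "real \<Rightarrow> real \<Rightarrow> 'w \<Rightarrow> real" where
  "large_sum d t \<omega> = jump_sum ({0<..t} \<times> far d) \<omega> - (LINT p : {0<..t} \<times> far d | \<mu>. snd p)"

text \<open>What is left of \<open>J\<close> after the compensated jumps larger than \<open>d\<close> have been taken away.\<close>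

definition remainder :: "real \<Rightarrow> real \<Rightarrow> 'w \<Rightarrow> real" where
  "remainder d t \<omega> = sk_fun (J \<omega>) t - large_sum d t \<omega>"

lemma large_sets: "0 \<le> d \<Longrightarrow> t \<le> 1 \<Longrightarrow> {0<..t} \<times> far d \<in> sets \<mu>"
  by (intro slab_sets far_sets) auto

lemma J_measurable: "t \<in> {0..1} \<Longrightarrow> (\<lambda>\<omega>. sk_fun (J \<omega>) t) \<in> borel_measurable M"
  using comp_int unfolding compensated_jump_integral_def by blast

lemma remainder_measurable: "0 < d \<Longrightarrow> t \<in> {0..1} \<Longrightarrow> remainder d t \<in> borel_measurable M"
  unfolding remainder_def[abs_def] large_sum_def[abs_def]
  using J_measurable[of t] jump_sum_measurable[OF large_sets, of d t] by auto

lemma integrable_upto: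
  assumes "\<omega> \<in> space M" "0 < d" "set_integrable (N \<omega>) ({0<..1} \<times> far d) snd" "t \<le> 1"
  shows "set_integrable (N \<omega>) ({0<..t} \<times> far d) snd"
proof (rule set_integrable_subset[OF assms(3)])
  show "{0<..t} \<times> far d \<in> sets (N \<omega>)" using large_sets[of d t] assms sets_N[OF assms(1)] by simp
qed (use assms(4) in auto)

lemma remainder_eq:
  assumes "\<omega> \<in> space M" "0 < d" "set_integrable (N \<omega>) ({0<..1} \<times> far d) snd" "t \<le> 1"
  shows "remainder d t \<omega> = sk_fun (J \<omega>) t - ((LINT p : {0<..t} \<times> far d | N \<omega>. snd p) - (LINT p : {0<..t} \<times> far d | \<mu>. snd p))"
  unfolding remainder_def large_sum_def jump_sum_eq[OF integrable_upto[OF assms]] ..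

lemma remainder_L2:
  assumes t: "t \<in> {0..1}"
  shows "((\<lambda>d. \<integral>\<^sup>+ \<omega>. ennreal ((remainder d t \<omega>)\<^sup>2) \<partial>M) \<longlongrightarrow> 0) (at_right 0)"
proof (rule Lim_transform_eventually)
  let ?R = "\<lambda>d \<omega>. sk_fun (J \<omega>) t - ((LINT p : {0<..t} \<times> {z. d < \<bar>z\<bar>} | N \<omega>. snd p) - (LINT p : {0<..t} \<times> {z. d < \<bar>z\<bar>} | \<mu>. snd p))"
  show "((\<lambda>d. \<integral>\<^sup>+ \<omega>. ennreal ((?R d \<omega>)\<^sup>2) \<partial>M) \<longlongrightarrow> 0) (at_right 0)"
    using comp_int t unfolding compensated_jump_integral_def by blast
  have "\<forall>\<^sub>F d in at_right (0::real). 0 < d" by (rule eventually_at_right_less)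
  then show "\<forall>\<^sub>F d in at_right 0. (\<integral>\<^sup>+ \<omega>. ennreal ((?R d \<omega>)\<^sup>2) \<partial>M) = (\<integral>\<^sup>+ \<omega>. ennreal ((remainder d t \<omega>)\<^sup>2) \<partial>M)"
  proof eventually_elim
    case (elim d)
    show ?case
    proof (rule nn_integral_cong_AE)
      show "AE \<omega> in M. ennreal ((?R d \<omega>)\<^sup>2) = ennreal ((remainder d t \<omega>)\<^sup>2)"
        using AE_snd_integrable[OF elim] AE_space
      proof eventually_elim
        case (elim \<omega>)
        then have "remainder d t \<omega> = ?R d \<omega>" using remainder_eq[of \<omega> d t] \<open>0 < d\<close> t by (simp add: far_def)
        then show ?case by simp
      qed
    qed
  qed
qed

lemma remainder_markov:
  assumes "0 < d" "t \<in> {0..1}" "0 < h"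
  shows "ennreal (prob {\<omega> \<in> space M. h \<le> \<bar>remainder d t \<omega>\<bar>}) \<le> ennreal (1 / h\<^sup>2) * (\<integral>\<^sup>+ \<omega>. ennreal ((remainder d t \<omega>)\<^sup>2) \<partial>M)"
proof -
  let ?A = "{\<omega> \<in> space M. h \<le> \<bar>remainder d t \<omega>\<bar>}"
  have A: "?A \<in> events" using remainder_measurable[OF assms(1,2)] by measurable
  have "ennreal (prob ?A) = (\<integral>\<^sup>+ \<omega>. indicator ?A \<omega> \<partial>M)" using A by (simp add: emeasure_eq_measure)
  also have "\<dots> \<le> (\<integral>\<^sup>+ \<omega>. ennreal (1 / h\<^sup>2) * ennreal ((remainder d t \<omega>)\<^sup>2) \<partial>M)"
  proof (intro nn_integral_mono)
    fix \<omega>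
    show "(indicator ?A \<omega> :: ennreal) \<le> ennreal (1 / h\<^sup>2) * ennreal ((remainder d t \<omega>)\<^sup>2)"
    proof (cases "\<omega> \<in> ?A")
      case True
      then have "h\<^sup>2 \<le> (remainder d t \<omega>)\<^sup>2" using assms(3) by (auto simp: abs_le_square_iff[symmetric])
      then have "1 \<le> 1 / h\<^sup>2 * (remainder d t \<omega>)\<^sup>2" using assms(3) by (simp add: field_simps)
      then have "ennreal 1 \<le> ennreal (1 / h\<^sup>2 * (remainder d t \<omega>)\<^sup>2)" by (rule ennreal_leI)
      then show ?thesis unfolding indicator_simps(1)[OF True] by (subst ennreal_mult'[symmetric]) simp_all
    next
      case False then show ?thesis unfolding indicator_simps(2)[OF False] by simp
    qed
  qed
  also have "\<dots> = ennreal (1 / h\<^sup>2) * (\<integral>\<^sup>+ \<omega>. ennreal ((remainder d t \<omega>)\<^sup>2) \<partial>M)"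
    using remainder_measurable[OF assms(1,2)] by (intro nn_integral_cmult) auto
  finally show ?thesis .
qed

lemma remainder_diff:
  assumes w: "\<omega> \<in> space M" and d: "0 < d" "d < T" and G: "0 < G" and l: "l \<le> G"
    and i: "set_integrable (N \<omega>) ({0<..1} \<times> far d) snd"
  shows "remainder T (real l / real G) \<omega> = remainder d (real l / real G) \<omega> + block_dev d T G l \<omega>"
proof -
  define t where "t = real l / real G"
  have t: "0 \<le> t" "t \<le> 1" using l G by (auto simp: t_def)
  let ?F = "{0<..t} \<times> far T" and ?D = "{0<..t} \<times> far d" and ?B = "{0<..t} \<times> band d T"
  have B: "block d T G l = ?B" by (simp add: block_def t_def)
  have un: "?D = ?B \<union> ?F" "?B \<inter> ?F = {}" using d by (auto simp: far_def band_def)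
  have S: "?F \<in> sets \<mu>" "?D \<in> sets \<mu>" "?B \<in> sets \<mu>"
    using d t by (auto intro!: slab_sets far_sets band_sets)
  have split: "(LINT p : ?D | m. snd p) = (LINT p : ?B | m. snd p) + (LINT p : ?F | m. snd p)"
    "set_integrable m ?F snd" "set_integrable m ?B snd"
    if "sets m = sets \<mu>" "set_integrable m ?D snd" for m
  proof -
    show F: "set_integrable m ?F snd" by (rule set_integrable_subset[OF that(2)]) (use S that(1) un in auto)
    show B: "set_integrable m ?B snd" by (rule set_integrable_subset[OF that(2)]) (use S that(1) un in auto)
    show "(LINT p : ?D | m. snd p) = (LINT p : ?B | m. snd p) + (LINT p : ?F | m. snd p)"
      unfolding un(1) by (rule set_integral_Un[OF un(2) B F])
  qed
  have iN: "set_integrable (N \<omega>) ?D snd" by (rule integrable_upto[OF w d(1) i t(2)])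
  have iM: "set_integrable \<mu> ?D snd" using d t by (intro snd_integrable_mu) auto
  note N = split[OF sets_N[OF w] iN] and M = split[OF refl iM]
  have "jump_sum ?D \<omega> = jump_sum ?B \<omega> + jump_sum ?F \<omega>"
    using N(1) unfolding jump_sum_eq[OF iN] jump_sum_eq[OF N(2)] jump_sum_eq[OF N(3)] .
  then show ?thesis
    unfolding remainder_def large_sum_def block_dev_def B t_def[symmetric] using M(1) by simp
qed

context
  fixes T u \<eta> \<sigma> :: real
  assumes T: "0 < T" and u: "0 < u" and \<eta>: "0 < \<eta>" and \<sigma>: "0 \<le> \<sigma>"
    and second_moment: "(\<integral>\<^sup>+ z. ennreal (z\<^sup>2) * indicator (band 0 T) z \<partial>\<nu>) \<le> ennreal \<sigma>"
begin

text \<open>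
  The remainder for the threshold \<open>T\<close> consists of the compensated jumps with sizes between \<open>d\<close> and \<open>T\<close>, for
  which \<open>block_maximal\<close> has a bound that does not depend on \<open>d\<close>, and the remainder for \<open>d\<close>, which for
  small \<open>d\<close> is negligible at finitely many times by Chebyshev's inequality.
\<close>

lemma remainder_grid:
  assumes G: "0 < G"
  shows "prob {\<omega> \<in> space M. \<exists>l\<le>G. 4 * \<eta> \<le> \<bar>remainder T (real l / real G) \<omega>\<bar>} \<le> 2 * exp (u\<^sup>2 * exp (u * T) * (c * \<sigma>) - u * \<eta>)"
    and "{\<omega> \<in> space M. \<exists>l\<le>G. 4 * \<eta> \<le> \<bar>remainder T (real l / real G) \<omega>\<bar>} \<in> events"
proof -
  let ?R = "2 * exp (u\<^sup>2 * exp (u * T) * (c * \<sigma>) - u * \<eta>)"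
  define A where "A = {\<omega> \<in> space M. \<exists>l\<le>G. 4 * \<eta> \<le> \<bar>remainder T (real l / real G) \<omega>\<bar>}"
  have t: "real l / real G \<in> {0..1}" if "l \<le> G" for l using that G by auto
  have "A = (\<Union>l\<in>{..G}. {\<omega> \<in> space M. 4 * \<eta> \<le> \<bar>remainder T (real l / real G) \<omega>\<bar>})" by (auto simp: A_def)
  also have "\<dots> \<in> events" using remainder_measurable[OF T t]
    by (intro sets.finite_UN borel_measurable_le borel_measurable_abs) auto
  finally have A: "A \<in> events" .
  then show "{\<omega> \<in> space M. \<exists>l\<le>G. 4 * \<eta> \<le> \<bar>remainder T (real l / real G) \<omega>\<bar>} \<in> events" by (simp only: A_def)
  have "prob A \<le> ?R + e" if e: "0 < e" for e
  proof -
    \<comment> \<open>there are \<open>G + 1\<close> grid times\<close>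
    define e1 where "e1 = e / (real G + 1)"
    have e1: "0 < e1" using e by (simp add: e1_def)
    let ?I = "\<lambda>d l. \<integral>\<^sup>+ \<omega>. ennreal ((remainder d (real l / real G) \<omega>)\<^sup>2) \<partial>M"
    have "\<forall>\<^sub>F d in at_right (0::real). \<forall>l\<in>{..G}. ?I d l < ennreal ((2 * \<eta>)\<^sup>2 * e1)"
    proof (intro eventually_ball_finite ballI order_tendstoD(2)[OF remainder_L2])
      fix l assume "l \<in> {..G}" then show "real l / real G \<in> {0..1}" using t by simp
      show "0 < ennreal ((2 * \<eta>)\<^sup>2 * e1)" using \<eta> e1 by simp
    qed simp
    moreover have "\<forall>\<^sub>F d in at_right (0::real). d \<in> {0<..<T}" using T by (rule eventually_at_right_real)
    ultimately have "\<forall>\<^sub>F d in at_right (0::real). d \<in> {0<..<T} \<and> (\<forall>l\<in>{..G}. ?I d l < ennreal ((2 * \<eta>)\<^sup>2 * e1))"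
      by eventually_elim blast
    then obtain d where d0: "d \<in> {0<..<T}" and dI: "\<forall>l\<in>{..G}. ?I d l < ennreal ((2 * \<eta>)\<^sup>2 * e1)"
      using eventually_happens[of _ "at_right (0::real)"] trivial_limit_at_right_real[of "0::real"] by blast
    have d: "0 < d" "d < T" using d0 by auto
    define Q where "Q l = {\<omega> \<in> space M. 2 * \<eta> \<le> \<bar>remainder d (real l / real G) \<omega>\<bar>}" for l
    have Q: "Q l \<in> events" if "l \<le> G" for l
      unfolding Q_def using remainder_measurable[OF d(1) t[OF that]] by measurable
    have Qp: "prob (Q l) \<le> e1" if l: "l \<le> G" for l
    proof -
      have "ennreal (prob (Q l)) \<le> ennreal (1 / (2 * \<eta>)\<^sup>2) * ?I d l"
        unfolding Q_def using \<eta> by (intro remainder_markov d t l) auto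
      also have "\<dots> \<le> ennreal (1 / (2 * \<eta>)\<^sup>2) * ennreal ((2 * \<eta>)\<^sup>2 * e1)"
        using dI l by (intro mult_left_mono) (auto simp: less_imp_le)
      also have "\<dots> = ennreal e1" using \<eta> by (simp add: ennreal_mult'[symmetric])
      finally show ?thesis using e1 by (simp add: ennreal_le_iff)
    qed
    let ?X = "block_exceeds d T \<eta> G"
    have X: "?X \<in> events" "prob ?X \<le> ?R"
      by (rule block_exceeds_events[OF d u \<eta> G \<sigma> second_moment], rule block_maximal[OF d u \<eta> G \<sigma> second_moment])
    have QU: "(\<Union>l\<in>{..G}. Q l) \<in> events" using Q by (intro sets.finite_UN) auto
    have "prob A \<le> prob (?X \<union> (\<Union>l\<in>{..G}. Q l))"
    proof (rule finite_measure_mono_AE)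
      show "?X \<union> (\<Union>l\<in>{..G}. Q l) \<in> events" by (rule sets.Un[OF X(1) QU])
      show "AE \<omega> in M. \<omega> \<in> A \<longrightarrow> \<omega> \<in> ?X \<union> (\<Union>l\<in>{..G}. Q l)"
        using AE_snd_integrable[OF d(1)] AE_space
      proof eventually_elim
        case (elim \<omega>)
        show ?case
        proof
          assume "\<omega> \<in> A"
          then obtain l where l: "l \<le> G" "4 * \<eta> \<le> \<bar>remainder T (real l / real G) \<omega>\<bar>" by (auto simp: A_def)
          have "remainder T (real l / real G) \<omega> = remainder d (real l / real G) \<omega> + block_dev d T G l \<omega>"
            using elim by (intro remainder_diff d G l) auto
          then have "2 * \<eta> \<le> \<bar>remainder d (real l / real G) \<omega>\<bar> \<or> 2 * \<eta> \<le> \<bar>block_dev d T G l \<omega>\<bar>"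
            using l(2) by linarith
          then show "\<omega> \<in> ?X \<union> (\<Union>l\<in>{..G}. Q l)"
          proof
            assume "2 * \<eta> \<le> \<bar>remainder d (real l / real G) \<omega>\<bar>"
            then have "\<omega> \<in> Q l" using elim by (simp add: Q_def)
            then show ?thesis using l(1) by blast
          next
            assume "2 * \<eta> \<le> \<bar>block_dev d T G l \<omega>\<bar>"
            then have "\<omega> \<in> ?X" using elim l(1) unfolding block_exceeds_def by blast
            then show ?thesis by blast
          qed
        qed
      qed
    qed
    also have "\<dots> \<le> prob ?X + prob (\<Union>l\<in>{..G}. Q l)" by (rule measure_Un_le[OF X(1) QU])
    also have "\<dots> \<le> ?R + (\<Sum>l\<in>{..G}. e1)"
    proof (intro add_mono X(2))
      have "prob (\<Union>l\<in>{..G}. Q l) \<le> (\<Sum>l\<in>{..G}. prob (Q l))" using Q by (intro finite_measure_subadditive_finite) auto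
      also have "\<dots> \<le> (\<Sum>l\<in>{..G}. e1)" using Qp by (intro sum_mono) auto
      finally show "prob (\<Union>l\<in>{..G}. Q l) \<le> (\<Sum>l\<in>{..G}. e1)" .
    qed
    also have "(\<Sum>l\<in>{..G}. e1) = e" by (simp add: e1_def field_simps)
    finally show ?thesis .
  qed
  then have "prob A \<le> ?R" by (rule field_le_epsilon)
  then show "prob {\<omega> \<in> space M. \<exists>l\<le>G. 4 * \<eta> \<le> \<bar>remainder T (real l / real G) \<omega>\<bar>} \<le> ?R" by (simp only: A_def)
qed

text \<open>The dyadic grids increase to a dense set of times, and all terms are right-continuous in time.\<close>

lemma small_jumps:
  "\<exists>Bad\<in>events. prob Bad \<le> 2 * exp (u\<^sup>2 * exp (u * T) * (c * \<sigma>) - u * \<eta>) \<and>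
    (\<forall>\<omega>\<in>space M - Bad. emeasure (N \<omega>) ({0<..1} \<times> far T) < \<infinity> \<and> set_integrable (N \<omega>) ({0<..1} \<times> far T) snd \<and>
      (\<forall>t\<in>{0..1}. \<bar>sk_fun (J \<omega>) t - ((LINT p : {0<..t} \<times> far T | N \<omega>. snd p) - (LINT p : {0<..t} \<times> far T | \<mu>. snd p))\<bar> \<le> 4 * \<eta>))"
proof -
  let ?R = "2 * exp (u\<^sup>2 * exp (u * T) * (c * \<sigma>) - u * \<eta>)"
  define A where "A n = {\<omega> \<in> space M. \<exists>l\<le>2 ^ n. 4 * \<eta> \<le> \<bar>remainder T (real l / real (2 ^ n)) \<omega>\<bar>}" for n :: nat
  have A: "A n \<in> events" "prob (A n) \<le> ?R" for n
    unfolding A_def by (rule remainder_grid(2), simp, rule remainder_grid(1), simp)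
  have inc: "incseq A"
  proof (rule incseq_SucI, rule subsetI)
    fix n \<omega> assume "\<omega> \<in> A n"
    then obtain l where l: "\<omega> \<in> space M" "l \<le> 2 ^ n" "4 * \<eta> \<le> \<bar>remainder T (real l / real (2 ^ n)) \<omega>\<bar>" by (auto simp: A_def)
    have e: "real (2 * l) / real (2 ^ Suc n) = real l / real (2 ^ n)" by simp
    have "\<exists>l\<le>2 ^ Suc n. 4 * \<eta> \<le> \<bar>remainder T (real l / real (2 ^ Suc n)) \<omega>\<bar>"
      by (rule exI[of _ "2 * l"]) (use l in \<open>simp only: e, simp\<close>)
    then show "\<omega> \<in> A (Suc n)" using l(1) unfolding A_def by blast
  qed
  have UA: "(\<Union>n. A n) \<in> events" using A(1) by blast
  have "(\<lambda>n. prob (A n)) \<longlonglongrightarrow> prob (\<Union>n. A n)"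
    using A(1) inc by (intro finite_Lim_measure_incseq) auto
  then have UR: "prob (\<Union>n. A n) \<le> ?R" by (rule LIMSEQ_le_const2) (use A(2) in blast)
  obtain Z where Z: "{\<omega> \<in> space M. \<not> (emeasure (N \<omega>) ({0<..1} \<times> far T) < \<infinity> \<and> set_integrable (N \<omega>) ({0<..1} \<times> far T) snd)} \<subseteq> Z"
    "emeasure M Z = 0" "Z \<in> events"
    by (rule AE_E[OF AE_snd_integrable[OF T]]) (rule that)
  show ?thesis
  proof (intro bexI[of _ "(\<Union>n. A n) \<union> Z"] conjI ballI)
    show "(\<Union>n. A n) \<union> Z \<in> events" by (rule sets.Un[OF UA Z(3)])
    have "prob ((\<Union>n. A n) \<union> Z) \<le> prob (\<Union>n. A n) + prob Z" by (rule measure_Un_le[OF UA Z(3)])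
    then show "prob ((\<Union>n. A n) \<union> Z) \<le> ?R" using UR Z(2) by (simp add: measure_def)
    fix \<omega> assume w: "\<omega> \<in> space M - ((\<Union>n. A n) \<union> Z)"
    then have ws: "\<omega> \<in> space M" by blast
    have good: "emeasure (N \<omega>) ({0<..1} \<times> far T) < \<infinity>" "set_integrable (N \<omega>) ({0<..1} \<times> far T) snd"
    proof -
      have "\<not> (\<omega> \<in> space M \<and> \<not> (emeasure (N \<omega>) ({0<..1} \<times> far T) < \<infinity> \<and> set_integrable (N \<omega>) ({0<..1} \<times> far T) snd))"
        using w Z(1) by blast
      then show "emeasure (N \<omega>) ({0<..1} \<times> far T) < \<infinity>" "set_integrable (N \<omega>) ({0<..1} \<times> far T) snd"
        using ws by simp_all
    qed
    show "emeasure (N \<omega>) ({0<..1} \<times> far T) < \<infinity>" "set_integrable (N \<omega>) ({0<..1} \<times> far T) snd" by (rule good)+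
    have dy: "\<bar>remainder T (real l / real (2 ^ n)) \<omega>\<bar> \<le> 4 * \<eta>" if "l \<le> 2 ^ n" for l n
    proof -
      have "\<omega> \<notin> A n" using w by blast
      then have "\<not> (\<exists>l\<le>2 ^ n. 4 * \<eta> \<le> \<bar>remainder T (real l / real (2 ^ n)) \<omega>\<bar>)" using ws unfolding A_def by blast
      then have "\<not> 4 * \<eta> \<le> \<bar>remainder T (real l / real (2 ^ n)) \<omega>\<bar>" using that by blast
      then show ?thesis by linarith
    qed
    let ?S = "\<lambda>t. sk_fun (J \<omega>) t - ((LINT p : {0<..t} \<times> far T | N \<omega>. snd p) - (LINT p : {0<..t} \<times> far T | \<mu>. snd p))"
    have S: "remainder T t \<omega> = ?S t" if "t \<le> 1" for t by (rule remainder_eq[OF ws T good(2) that])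
    fix t :: real assume t: "t \<in> {0..1}"
    show "\<bar>?S t\<bar> \<le> 4 * \<eta>"
    proof (cases "t = 1")
      case True
      then show ?thesis using dy[of 1 0] S[of 1] by simp
    next
      case False
      then have t1: "0 \<le> t" "t < 1" using t by auto
      obtain \<tau> where \<tau>0: "\<forall>n. t < \<tau> n" "\<forall>n. \<tau> n \<le> 1" "\<tau> \<longlonglongrightarrow> t"
        and \<tau>d: "\<forall>n. \<exists>l\<le>2 ^ n. \<tau> n = real l / real (2 ^ n)"
        using dyadic_from_right[OF t1] by (elim exE conjE) (rule that)
      note \<tau> = \<tau>0(1)[rule_format] \<tau>0(2)[rule_format] \<tau>0(3)
      have "filterlim \<tau> (at_right t) sequentially"
        using \<tau>0 by (auto simp: filterlim_at intro!: always_eventually less_imp_neq[THEN not_sym])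
      then have lJ: "(\<lambda>n. sk_fun (J \<omega>) (\<tau> n)) \<longlonglongrightarrow> sk_fun (J \<omega>) t"
        by (rule filterlim_compose[OF sk_fun_right_tendsto[OF t1]])
      have lN: "(\<lambda>n. LINT p : {0<..\<tau> n} \<times> far T | N \<omega>. snd p) \<longlonglongrightarrow> (LINT p : {0<..t} \<times> far T | N \<omega>. snd p)"
        using large_sets[of T] T sets_N[OF ws] by (intro set_integral_time_right_continuous good \<tau>) auto
      have lM: "(\<lambda>n. LINT p : {0<..\<tau> n} \<times> far T | \<mu>. snd p) \<longlonglongrightarrow> (LINT p : {0<..t} \<times> far T | \<mu>. snd p)"
        using large_sets[of T] T by (intro set_integral_time_right_continuous snd_integrable_mu \<tau>) auto
      have "(\<lambda>n. \<bar>?S (\<tau> n)\<bar>) \<longlonglongrightarrow> \<bar>?S t\<bar>" by (intro tendsto_rabs tendsto_diff lJ lN lM)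
      moreover have "\<bar>?S (\<tau> n)\<bar> \<le> 4 * \<eta>" for n
      proof -
        obtain l where l: "l \<le> 2 ^ n" "\<tau> n = real l / real (2 ^ n)" using \<tau>d by blast
        show ?thesis using dy[OF l(1)] S[OF \<tau>(2)[of n]] l(2) by simp
      qed
      ultimately show ?thesis by (intro LIMSEQ_le_const2) auto
    qed
  qed
qed

end
end

section \<open>The Brownian part\<close>

lemma normal_mgf:
  assumes "0 < s"
  shows "(\<integral>\<^sup>+ x. ennreal (normal_density 0 s x) * ennreal (exp (w * x)) \<partial>lborel) = ennreal (exp (w\<^sup>2 * s\<^sup>2 / 2))"
proof -
  have "normal_density 0 s x * exp (w * x) = exp (w\<^sup>2 * s\<^sup>2 / 2) * normal_density (w * s\<^sup>2) s x" for x
  proof -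
    have "- (x - 0)\<^sup>2 / (2 * s\<^sup>2) + w * x = w\<^sup>2 * s\<^sup>2 / 2 + - (x - w * s\<^sup>2)\<^sup>2 / (2 * s\<^sup>2)"
      using assms by (simp add: field_simps power2_eq_square)
    then show ?thesis unfolding normal_density_def by (simp add: exp_add[symmetric] mult.assoc mult.left_commute)
  qed
  then have "(\<integral>\<^sup>+ x. ennreal (normal_density 0 s x) * ennreal (exp (w * x)) \<partial>lborel) =
      (\<integral>\<^sup>+ x. ennreal (exp (w\<^sup>2 * s\<^sup>2 / 2)) * ennreal (normal_density (w * s\<^sup>2) s x) \<partial>lborel)"
    by (intro nn_integral_cong) (simp add: ennreal_mult'[symmetric])
  also have "\<dots> = ennreal (exp (w\<^sup>2 * s\<^sup>2 / 2)) * (\<integral>\<^sup>+ x. ennreal (normal_density (w * s\<^sup>2) s x) \<partial>lborel)"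
    by (rule nn_integral_cmult) simp
  also have "(\<integral>\<^sup>+ x. ennreal (normal_density (w * s\<^sup>2) s x) \<partial>lborel) = 1"
  proof -
    interpret prob_space "density lborel (normal_density (w * s\<^sup>2) s)" by (rule prob_space_normal_density[OF assms])
    show ?thesis using emeasure_space_1 by (simp add: emeasure_density)
  qed
  finally show ?thesis by simp
qed

context prob_space
begin

context
  fixes B :: "real \<Rightarrow> 'a \<Rightarrow> real" and u \<eta> :: real
  assumes bm: "brownian_motion M B" and u: "0 < u"
begin

lemma brownian_grid:
  assumes G: "0 < G"
  shows "prob {\<omega> \<in> space M. \<exists>l\<le>G. \<eta> \<le> \<bar>B (real l / real G) \<omega> - B 0 \<omega>\<bar>} \<le> 2 * exp (u\<^sup>2 / 2 - u * \<eta>)"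
    and "{\<omega> \<in> space M. \<exists>l\<le>G. \<eta> \<le> \<bar>B (real l / real G) \<omega> - B 0 \<omega>\<bar>} \<in> events"
proof -
  define X where "X i \<omega> = B (real (Suc i) / real G) \<omega> - B (real i / real G) \<omega>" for i \<omega>
  define v where "v = u\<^sup>2 * (1 / real G) / 2"
  have mono: "real i / real G \<le> real j / real G" if "i \<le> j" for i j using that G by (simp add: divide_right_mono)
  have t01: "real i / real G \<in> {0..1}" if "i \<le> G" for i using that G by simp
  have ind: "indep_vars (\<lambda>_. borel) X {..<G}"
  proof -
    have "(\<lambda>i. real i / real G) ` {..G} \<subseteq> {0..1}" using t01 by blast
    moreover have "mono_on {..G} (\<lambda>i. real i / real G)" using mono by (intro mono_onI) auto
    ultimately show ?thesis using bm unfolding brownian_motion_def X_def by blast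
  qed
  have mgf: "(\<integral>\<^sup>+ \<omega>. ennreal (exp (w * X i \<omega>)) \<partial>M) \<le> ennreal (exp v)" if i: "i < G" and w: "w\<^sup>2 = u\<^sup>2" for i w
  proof -
    have diff: "real (Suc i) / real G - real i / real G = 1 / real G" by (simp add: diff_divide_distrib[symmetric])
    have "0 \<le> real i / real G \<and> real i / real G < real (Suc i) / real G \<and> real (Suc i) / real G \<le> 1"
      using i G by (auto simp: divide_strict_right_mono)
    then have "distributed M lborel (X i) (normal_density 0 (sqrt (1 / real G)))"
      using bm unfolding brownian_motion_def X_def diff[symmetric] by blast
    then have "(\<integral>\<^sup>+ \<omega>. ennreal (exp (w * X i \<omega>)) \<partial>M) = (\<integral>\<^sup>+ x. ennreal (normal_density 0 (sqrt (1 / real G)) x) * ennreal (exp (w * x)) \<partial>lborel)"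
      by (intro distributed_nn_integral[symmetric]) auto
    also have "\<dots> = ennreal (exp (w\<^sup>2 * (sqrt (1 / real G))\<^sup>2 / 2))" using G by (intro normal_mgf) auto
    finally show ?thesis unfolding w v_def by simp
  qed
  have tel: "(\<Sum>i<l. X i \<omega>) = B (real l / real G) \<omega> - B 0 \<omega>" for l \<omega>
    unfolding X_def by (subst sum_lessThan_telescope) simp
  have "(\<Sum>i<G. v) = u\<^sup>2 / 2" using G by (simp add: v_def)
  moreover have v0: "0 \<le> v" by (simp add: v_def)
  ultimately show "prob {\<omega> \<in> space M. \<exists>l\<le>G. \<eta> \<le> \<bar>B (real l / real G) \<omega> - B 0 \<omega>\<bar>} \<le> 2 * exp (u\<^sup>2 / 2 - u * \<eta>)"
    "{\<omega> \<in> space M. \<exists>l\<le>G. \<eta> \<le> \<bar>B (real l / real G) \<omega> - B 0 \<omega>\<bar>} \<in> events"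
    using exponential_maximal_inequality_abs[OF ind u mgf mgf, of \<eta>] by (simp_all only: tel power2_minus) 
qed

text \<open>The maximal inequality on dyadic grids, followed by the continuity of the paths.\<close>

lemma brownian_sup:
  "\<exists>Bad\<in>events. prob Bad \<le> 2 * exp (u\<^sup>2 / 2 - u * \<eta>) \<and>
    (\<forall>\<omega>\<in>space M - Bad. \<forall>t\<in>{0..1}. \<bar>B t \<omega> - B 0 \<omega>\<bar> \<le> \<eta>)"
proof -
  let ?R = "2 * exp (u\<^sup>2 / 2 - u * \<eta>)"
  define A where "A n = {\<omega> \<in> space M. \<exists>l\<le>2 ^ n. \<eta> \<le> \<bar>B (real l / real (2 ^ n)) \<omega> - B 0 \<omega>\<bar>}" for n :: nat
  have A: "A n \<in> events" "prob (A n) \<le> ?R" for n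
    unfolding A_def by (rule brownian_grid(2), simp, rule brownian_grid(1), simp)
  have inc: "incseq A"
  proof (rule incseq_SucI, rule subsetI)
    fix n \<omega> assume "\<omega> \<in> A n"
    then obtain l where l: "\<omega> \<in> space M" "l \<le> 2 ^ n" "\<eta> \<le> \<bar>B (real l / real (2 ^ n)) \<omega> - B 0 \<omega>\<bar>" by (auto simp: A_def)
    have e: "real (2 * l) / real (2 ^ Suc n) = real l / real (2 ^ n)" by simp
    have "\<exists>l\<le>2 ^ Suc n. \<eta> \<le> \<bar>B (real l / real (2 ^ Suc n)) \<omega> - B 0 \<omega>\<bar>"
      by (rule exI[of _ "2 * l"]) (use l in \<open>simp only: e, simp\<close>)
    then show "\<omega> \<in> A (Suc n)" using l(1) unfolding A_def by blast
  qed
  have UA: "(\<Union>n. A n) \<in> events" using A(1) by blast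
  have "(\<lambda>n. prob (A n)) \<longlonglongrightarrow> prob (\<Union>n. A n)"
    using A(1) inc by (intro finite_Lim_measure_incseq) auto
  then have UR: "prob (\<Union>n. A n) \<le> ?R" by (rule LIMSEQ_le_const2) (use A(2) in blast)
  have cont: "AE \<omega> in M. continuous_on {0..1} (\<lambda>t. B t \<omega>)" using bm unfolding brownian_motion_def by blast
  obtain Z where Z: "{\<omega> \<in> space M. \<not> continuous_on {0..1} (\<lambda>t. B t \<omega>)} \<subseteq> Z" "emeasure M Z = 0" "Z \<in> events"
    by (rule AE_E[OF cont]) (rule that)
  show ?thesis
  proof (intro bexI[of _ "(\<Union>n. A n) \<union> Z"] conjI ballI)
    show "(\<Union>n. A n) \<union> Z \<in> events" by (rule sets.Un[OF UA Z(3)])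
    have "prob ((\<Union>n. A n) \<union> Z) \<le> prob (\<Union>n. A n) + prob Z" by (rule measure_Un_le[OF UA Z(3)])
    then show "prob ((\<Union>n. A n) \<union> Z) \<le> ?R" using UR Z(2) by (simp add: measure_def)
    fix \<omega> t assume w: "\<omega> \<in> space M - ((\<Union>n. A n) \<union> Z)" and t: "t \<in> {0..1::real}"
    have ws: "\<omega> \<in> space M" using w by blast
    have c: "continuous_on {0..1} (\<lambda>t. B t \<omega>)" using w Z(1) by blast
    have dy: "\<bar>B (real l / real (2 ^ n)) \<omega> - B 0 \<omega>\<bar> \<le> \<eta>" if "l \<le> 2 ^ n" for l n
    proof -
      have "\<omega> \<notin> A n" using w by blast
      then have "\<not> (\<exists>l\<le>2 ^ n. \<eta> \<le> \<bar>B (real l / real (2 ^ n)) \<omega> - B 0 \<omega>\<bar>)" using ws unfolding A_def by blast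
      then have "\<not> \<eta> \<le> \<bar>B (real l / real (2 ^ n)) \<omega> - B 0 \<omega>\<bar>" using that by blast
      then show ?thesis by linarith
    qed
    show "\<bar>B t \<omega> - B 0 \<omega>\<bar> \<le> \<eta>"
    proof (cases "t = 1")
      case True
      then show ?thesis using dy[of 1 0] by simp
    next
      case False
      then have t1: "0 \<le> t" "t < 1" using t by auto
      obtain \<tau> where \<tau>: "\<forall>n. t < \<tau> n" "\<forall>n. \<tau> n \<le> 1" "\<tau> \<longlonglongrightarrow> t"
        and \<tau>d: "\<forall>n. \<exists>l\<le>2 ^ n. \<tau> n = real l / real (2 ^ n)"
        using dyadic_from_right[OF t1] by (elim exE conjE) (rule that)
      have "\<tau> n \<in> {0..1}" for n using \<tau>(1,2)[rule_format, of n] t1 by simp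
      then have "(\<lambda>n. B (\<tau> n) \<omega>) \<longlonglongrightarrow> B t \<omega>"
        using c \<tau>(3) t unfolding continuous_on_sequentially comp_def by blast
      then have "(\<lambda>n. \<bar>B (\<tau> n) \<omega> - B 0 \<omega>\<bar>) \<longlonglongrightarrow> \<bar>B t \<omega> - B 0 \<omega>\<bar>" by (intro tendsto_intros)
      moreover have "\<bar>B (\<tau> n) \<omega> - B 0 \<omega>\<bar> \<le> \<eta>" for n
      proof -
        obtain l where l: "l \<le> 2 ^ n" "\<tau> n = real l / real (2 ^ n)" using \<tau>d by blast
        show ?thesis using dy[OF l(1)] l(2) by simp
      qed
      ultimately show ?thesis by (intro LIMSEQ_le_const2) auto
    qed
  qed
qed

end
end

section \<open>Regularly varying tails\<close>

text \<open>
  Along \<open>x0\<close>, \<open>2 * x0\<close>, \<open>4 * x0\<close>, ... the ratio assumption bounds \<open>f\<close> by geometric sequences, and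
  monotonicity fills the gaps.
\<close>

lemma monotone_potter_bounds:
  fixes f :: "real \<Rightarrow> real"
  assumes pos: "\<And>x. x > 0 \<Longrightarrow> f x > 0"
    and anti: "\<And>x y. 0 < x \<Longrightarrow> x \<le> y \<Longrightarrow> f y \<le> f x"
    and lim: "((\<lambda>x. f (2 * x) / f x) \<longlongrightarrow> 2 powr - a) at_top"
    and "d > 0" "d < a"
  shows "\<exists>x0>0. \<exists>c>0. \<exists>C>0. \<forall>x\<ge>x0. c * x powr (- a - d) \<le> f x \<and> f x \<le> C * x powr (- a + d)"
proof -
  have "2 powr (- a - d) < 2 powr - a" "2 powr - a < 2 powr (- a + d)" using assms(4) by auto
  then have "\<forall>\<^sub>F x in at_top. 2 powr (- a - d) < f (2 * x) / f x" "\<forall>\<^sub>F x in at_top. f (2 * x) / f x < 2 powr (- a + d)"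
    using order_tendstoD[OF lim] by auto
  then have "\<forall>\<^sub>F x in at_top. x > 0 \<and> 2 powr (- a - d) < f (2 * x) / f x \<and> f (2 * x) / f x < 2 powr (- a + d)"
    using eventually_gt_at_top[of 0] by eventually_elim auto
  then obtain x0 where x0': "\<And>x. x \<ge> x0 \<Longrightarrow> x > 0 \<and> 2 powr (- a - d) < f (2 * x) / f x \<and> f (2 * x) / f x < 2 powr (- a + d)"
    unfolding eventually_at_top_linorder by blast
  have x0: "x0 > 0" using x0'[of x0] by simp
  have step: "2 powr (- a - d) * f x \<le> f (2 * x)" "f (2 * x) \<le> 2 powr (- a + d) * f x" if "x \<ge> x0" for x
    using x0'[OF that] pos[of x] by (auto simp: field_simps)
  have ge: "2 ^ n * x0 \<ge> x0" for n using x0 by (simp add: mult_le_cancel_right1)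
  have it: "(2 powr (- a - d)) ^ n * f x0 \<le> f (2 ^ n * x0) \<and> f (2 ^ n * x0) \<le> (2 powr (- a + d)) ^ n * f x0" for n
  proof (induction n)
    case (Suc n)
    have "(2 powr (- a - d)) ^ Suc n * f x0 \<le> 2 powr (- a - d) * f (2 ^ n * x0)"
      using Suc by simp
    also have "\<dots> \<le> f (2 * (2 ^ n * x0))" by (rule step(1)[OF ge])
    finally have 1: "(2 powr (- a - d)) ^ Suc n * f x0 \<le> f (2 ^ Suc n * x0)" by (simp add: mult.assoc)
    have "f (2 * (2 ^ n * x0)) \<le> 2 powr (- a + d) * f (2 ^ n * x0)" by (rule step(2)[OF ge])
    also have "\<dots> \<le> (2 powr (- a + d)) ^ Suc n * f x0"
      using Suc by simp
    finally show ?case using 1 by (simp add: mult.assoc)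
  qed simp
  define c where "c = f x0 * (2 / x0) powr (- a - d)"
  define C where "C = f x0 * (1 / (2 * x0)) powr (- a + d)"
  have "c > 0" "C > 0" using pos[OF x0] x0 by (auto simp: c_def C_def)
  moreover have "c * x powr (- a - d) \<le> f x \<and> f x \<le> C * x powr (- a + d)" if x: "x \<ge> x0" for x
  proof -
    define n where "n = nat \<lfloor>log 2 (x / x0)\<rfloor>"
    have xp: "x > 0" "x / x0 \<ge> 1" using x x0 by auto
    have l0: "log 2 (x / x0) \<ge> 0" using xp by simp
    have n: "real n \<le> log 2 (x / x0)" "log 2 (x / x0) < real n + 1"
      using l0 unfolding n_def by auto
    have p: "2 powr real n \<le> x / x0" "x / x0 \<le> 2 powr (real n + 1)"
      using n xp by (auto simp: le_log_iff log_le_iff log_less_iff less_imp_le)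
    have low: "2 ^ n * x0 \<le> x" using p(1) x0 by (simp add: powr_realpow field_simps)
    have up: "x \<le> 2 ^ Suc n * x0" using p(2) x0 by (simp add: powr_realpow powr_add field_simps)
    have "c * x powr (- a - d) = f x0 * (2 * (x / x0)) powr (- a - d)"
      using x0 xp unfolding c_def by (simp add: powr_mult powr_divide)
    also have "\<dots> \<le> f x0 * (2 powr (real n + 1)) powr (- a - d)"
    proof (intro mult_left_mono)
      have "2 powr (real n + 1) = 2 * 2 powr real n" by (simp add: powr_add)
      also have "\<dots> \<le> 2 * (x / x0)" using p(1) by simp
      finally show "(2 * (x / x0)) powr (- a - d) \<le> (2 powr (real n + 1)) powr (- a - d)"
        using assms(4,5) by (intro powr_mono2') auto
    qed (rule less_imp_le[OF pos[OF x0]])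
    also have "\<dots> = (2 powr (- a - d)) ^ Suc n * f x0"
      by (simp add: powr_powr powr_realpow[symmetric] mult.commute add.commute del: power_Suc of_nat_Suc) (simp add: algebra_simps)
    also have "\<dots> \<le> f (2 ^ Suc n * x0)" using it[of "Suc n"] by blast
    also have "\<dots> \<le> f x" by (rule anti) (use xp up in auto)
    finally have 1: "c * x powr (- a - d) \<le> f x" .
    have "f x \<le> f (2 ^ n * x0)" by (rule anti) (use x0 low in auto)
    also have "\<dots> \<le> (2 powr (- a + d)) ^ n * f x0" using it by blast
    also have "\<dots> = f x0 * (2 powr real n) powr (- a + d)"
      by (simp add: powr_powr powr_realpow[symmetric] mult.commute)
    also have "\<dots> \<le> f x0 * (x / x0 / 2) powr (- a + d)"
    proof (intro mult_left_mono powr_mono2')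
      have "x / x0 \<le> 2 * 2 powr real n" using p(2) by (simp add: powr_add)
      then show "x / x0 / 2 \<le> 2 powr real n" by simp
    qed (use assms(4,5) xp x0 less_imp_le[OF pos[OF x0]] in auto)
    also have "\<dots> = C * x powr (- a + d)"
      using x0 xp unfolding C_def by (simp add: powr_mult powr_divide)
    finally show ?thesis using 1 by blast
  qed
  ultimately show ?thesis using x0 by blast
qed

text \<open>
  Regular variation with index \<open>- a\<close> of a non-increasing function, stated without its slowly varying
  factor.
\<close>

locale regular_tail =
  fixes f :: "real \<Rightarrow> real" and a :: real
  assumes pos: "\<And>x. 0 < x \<Longrightarrow> 0 < f x"
    and anti: "\<And>x y. 0 < x \<Longrightarrow> x \<le> y \<Longrightarrow> f y \<le> f x"
    and ratio: "\<And>r. 0 < r \<Longrightarrow> ((\<lambda>x. f (r * x) / f x) \<longlongrightarrow> r powr - a) at_top"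
    and index: "1 < a"
begin

lemma potter:
  assumes "0 < d" "d < a"
  shows "\<exists>x0>0. \<exists>c>0. \<exists>C>0. \<forall>x\<ge>x0. c * x powr (- a - d) \<le> f x \<and> f x \<le> C * x powr (- a + d)"
  by (rule monotone_potter_bounds[OF pos anti ratio assms]) auto

lemma power_bound:
  assumes "0 < k" "k < a"
  shows "\<exists>C>0. \<forall>x\<ge>1. f x \<le> C * x powr - k"
proof -
  obtain x0 C where x0: "0 < x0" and C: "0 < C" and le: "\<forall>x\<ge>x0. f x \<le> C * x powr (- a + (a - k))"
    using potter[of "a - k"] assms by auto
  define D where "D = max C (f 1 / x0 powr - k)"
  have D: "0 < D" using C by (simp add: D_def)
  have "f x \<le> D * x powr - k" if x: "1 \<le> x" for x
  proof (cases "x0 \<le> x")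
    case True
    then have "f x \<le> C * x powr - k" using le by simp
    also have "\<dots> \<le> D * x powr - k" by (intro mult_right_mono) (auto simp: D_def)
    finally show ?thesis .
  next
    case False
    have "f x \<le> f 1" using x by (intro anti) auto
    also have "\<dots> = (f 1 / x0 powr - k) * x0 powr - k" using x0 by simp
    also have "\<dots> \<le> D * x0 powr - k" by (intro mult_right_mono) (auto simp: D_def)
    also have "\<dots> \<le> D * x powr - k" using False x D assms by (intro mult_left_mono powr_mono2') auto
    finally show ?thesis .
  qed
  then show ?thesis using D by blast
qed

lemma scaled_filterlim:
  assumes "0 < th"
  shows "filterlim (\<lambda>e::real. th / e) at_top (at_right 0)"
  using assms by real_asymp

text \<open>
  A Poisson measure of intensity \<open>1 / e\<close> has on average \<open>f (th / e) / e\<close> jumps beyond \<open>th / e\<close>. On a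
  logarithmic scale this is \<open>e powr (a - 1)\<close>: the slowly varying factor is absorbed by the small
  power \<open>d\<close>.
\<close>

lemma scaled_tail_upper:
  assumes "0 < th" "0 < d"
  shows "\<forall>\<^sub>F e in at_right 0. f (th / e) / e \<le> e powr (a - 1 - d)"
proof -
  define d1 where "d1 = min (d / 2) (a / 2)"
  have d1: "0 < d1" "d1 < a" "d1 < d" using assms index by (auto simp: d1_def min_def)
  obtain x0 C where x0: "0 < x0" and C: "0 < C" and le: "\<forall>x\<ge>x0. f x \<le> C * x powr (- a + d1)"
    using potter[OF d1(1,2)] by blast
  have "\<forall>\<^sub>F e in at_right (0::real). x0 \<le> th / e"
    using scaled_filterlim[OF assms(1)] by (simp add: filterlim_at_top)
  moreover have "\<forall>\<^sub>F e in at_right (0::real). C * th powr (- a + d1) * e powr (d - d1) \<le> 1"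
  proof -
    have "((\<lambda>e::real. C * th powr (- a + d1) * e powr (d - d1)) \<longlongrightarrow> 0) (at_right 0)"
      using d1(3) by real_asymp
    then have "\<forall>\<^sub>F e in at_right (0::real). C * th powr (- a + d1) * e powr (d - d1) < 1"
      by (rule order_tendstoD) simp
    then show ?thesis by eventually_elim simp
  qed
  moreover have "\<forall>\<^sub>F e in at_right (0::real). 0 < e" by (rule eventually_at_right_less)
  ultimately show ?thesis
  proof eventually_elim
    case (elim e)
    have "f (th / e) \<le> C * (th / e) powr (- a + d1)" using le elim by blast
    also have "\<dots> = C * th powr (- a + d1) * e powr (a - d1)"
      using elim assms by (simp add: powr_divide powr_diff powr_minus powr_add field_simps)
    finally have "f (th / e) / e \<le> C * th powr (- a + d1) * e powr (a - d1) / e"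
      using elim by (intro divide_right_mono) auto
    also have "\<dots> = (C * th powr (- a + d1) * e powr (d - d1)) * e powr (a - 1 - d)"
    proof -
      have "e powr (a - d1) / e = e powr (a - d1 - 1)" using elim by (simp add: powr_diff)
      also have "a - d1 - 1 = (d - d1) + (a - 1 - d)" by simp
      also have "e powr \<dots> = e powr (d - d1) * e powr (a - 1 - d)" by (rule powr_add)
      finally have eq: "e powr (a - d1) / e = e powr (d - d1) * e powr (a - 1 - d)" .
      show ?thesis unfolding times_divide_eq_right[symmetric] eq by (simp only: mult_ac)
    qed
    also have "\<dots> \<le> 1 * e powr (a - 1 - d)" using elim by (intro mult_right_mono) auto
    finally show ?case by simp
  qed
qed

text \<open>
  The ratio of the two tails tends to \<open>(c2 / c1) powr - a < 1\<close>, so a fixed fraction of the tail lies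
  between \<open>c1 / e\<close> and \<open>c2 / e\<close>.
\<close>

lemma scaled_gap_lower:
  assumes "0 < c1" "c1 < c2" "0 < d"
  shows "\<forall>\<^sub>F e in at_right 0. e powr (a - 1 + d) \<le> (f (c1 / e) - f (c2 / e)) / e"
proof -
  define d1 where "d1 = min (d / 2) (a / 2)"
  have d1: "0 < d1" "d1 < a" "d1 < d" using assms index by (auto simp: d1_def min_def)
  obtain x0 c where x0: "0 < x0" and c: "0 < c" and le: "\<forall>x\<ge>x0. c * x powr (- a - d1) \<le> f x"
    using potter[OF d1(1,2)] by blast
  define r where "r = c2 / c1"
  have r: "1 < r" using assms by (simp add: r_def)
  have r1: "r powr - a < 1" using r index powr_less_mono2_neg[of "- a" 1 r] by simp
  define k where "k = (1 - r powr - a) / 2"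
  have k: "0 < k" using r1 by (simp add: k_def)
  have "((\<lambda>e. f (r * (c1 / e)) / f (c1 / e)) \<longlongrightarrow> r powr - a) (at_right 0)"
    by (rule filterlim_compose[OF ratio scaled_filterlim[OF assms(1)]]) (use r in simp)
  moreover have "r powr - a < 1 - k" using r1 unfolding k_def by (simp add: field_simps)
  ultimately have "\<forall>\<^sub>F e in at_right (0::real). f (r * (c1 / e)) / f (c1 / e) < 1 - k"
    by (rule order_tendstoD)
  moreover have "\<forall>\<^sub>F e in at_right (0::real). x0 \<le> c1 / e"
    using scaled_filterlim[OF assms(1)] by (simp add: filterlim_at_top)
  moreover have "\<forall>\<^sub>F e in at_right (0::real). e powr (d - d1) \<le> k * c * c1 powr (- a - d1)"
  proof -
    have "((\<lambda>e::real. e powr (d - d1)) \<longlongrightarrow> 0) (at_right 0)"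
      using d1(3) by real_asymp
    moreover have "0 < k * c * c1 powr (- a - d1)" using k c assms by simp
    ultimately have "\<forall>\<^sub>F e in at_right (0::real). e powr (d - d1) < k * c * c1 powr (- a - d1)"
      by (rule order_tendstoD)
    then show ?thesis by eventually_elim simp
  qed
  moreover have "\<forall>\<^sub>F e in at_right (0::real). 0 < e" by (rule eventually_at_right_less)
  ultimately show ?thesis
  proof eventually_elim
    case (elim e)
    have p: "0 < f (c1 / e)" using elim assms by (intro pos) auto
    have eq: "r * (c1 / e) = c2 / e" using assms by (simp add: r_def)
    have "f (c2 / e) < (1 - k) * f (c1 / e)" using elim(1) p unfolding eq by (simp only: pos_divide_less_eq)
    then have "f (c2 / e) \<le> (1 - k) * f (c1 / e)" by (rule less_imp_le)
    then have "k * f (c1 / e) \<le> f (c1 / e) - f (c2 / e)" by (simp add: algebra_simps)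
    moreover have "c * (c1 / e) powr (- a - d1) \<le> f (c1 / e)" using le elim by blast
    ultimately have "k * (c * (c1 / e) powr (- a - d1)) \<le> f (c1 / e) - f (c2 / e)"
      using mult_left_mono[of "c * (c1 / e) powr (- a - d1)" "f (c1 / e)" k] k by linarith
    then have "k * (c * (c1 / e) powr (- a - d1)) / e \<le> (f (c1 / e) - f (c2 / e)) / e"
      using elim by (intro divide_right_mono) auto
    moreover have "k * (c * (c1 / e) powr (- a - d1)) / e = (k * c * c1 powr (- a - d1)) * e powr (a - 1 + d1)"
      using elim assms by (simp add: powr_divide powr_diff powr_minus powr_add field_simps)
    moreover have "e powr (a - 1 + d) \<le> (k * c * c1 powr (- a - d1)) * e powr (a - 1 + d1)"
    proof -
      have "a - 1 + d = (d - d1) + (a - 1 + d1)" by simp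
      then have "e powr (a - 1 + d) = e powr (d - d1) * e powr (a - 1 + d1)" by (simp only: powr_add)
      also have "\<dots> \<le> (k * c * c1 powr (- a - d1)) * e powr (a - 1 + d1)" using elim by (intro mult_right_mono) auto
      finally show ?thesis .
    qed
    ultimately show ?case by linarith
  qed
qed

lemma scaled_tail_tendsto_0:
  assumes "0 < th"
  shows "((\<lambda>e. f (th / e) / e) \<longlongrightarrow> 0) (at_right 0)"
proof -
  have U: "\<forall>\<^sub>F e in at_right 0. f (th / e) / e \<le> e powr ((a - 1) / 2)"
    using scaled_tail_upper[OF assms, of "(a - 1) / 2"] index by (simp add: field_simps)
  have L: "\<forall>\<^sub>F e in at_right (0::real). 0 \<le> f (th / e) / e"
    using eventually_at_right_less[of "0::real"]
  proof eventually_elim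
    case (elim e)
    then show ?case using pos[of "th / e"] assms by simp
  qed
  have Z: "((\<lambda>e::real. e powr ((a - 1) / 2)) \<longlongrightarrow> 0) (at_right 0)" using index by real_asymp
  show ?thesis by (rule real_tendsto_sandwich[OF L U tendsto_const Z])
qed

end

lemma regular_tailI:
  assumes f: "\<And>x. 0 < x \<Longrightarrow> f x = L x * x powr - a" and L: "slowly_varying L" and a: "1 < a"
    and anti: "\<And>x y. 0 < x \<Longrightarrow> x \<le> y \<Longrightarrow> f y \<le> f x"
  shows "regular_tail f a"
proof
  have Lp: "0 < L x" if "0 < x" for x using L that by (simp add: slowly_varying_def)
  show "0 < f x" if "0 < x" for x using f[OF that] Lp[OF that] that by simp
  show "f y \<le> f x" if "0 < x" "x \<le> y" for x y by (rule anti[OF that])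
  show "1 < a" by (rule a)
  fix r :: real assume r: "0 < r"
  have "((\<lambda>x. L (r * x) / L x * r powr - a) \<longlongrightarrow> 1 * r powr - a) at_top"
    using L r by (intro tendsto_mult tendsto_const) (auto simp: slowly_varying_def)
  moreover have "\<forall>\<^sub>F x in at_top. L (r * x) / L x * r powr - a = f (r * x) / f x"
    using eventually_gt_at_top[of 0]
  proof eventually_elim
    case (elim x)
    then have "x powr - a > 0" by simp
    then show ?case using elim r f[of x] f[of "r * x"] by (simp add: powr_mult)
  qed
  ultimately have "((\<lambda>x. f (r * x) / f x) \<longlongrightarrow> 1 * r powr - a) at_top"
    by (rule Lim_transform_eventually)
  then show "((\<lambda>x. f (r * x) / f x) \<longlongrightarrow> r powr - a) at_top" by simp
qed

lemma tail_moment_finite: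
  fixes \<nu> :: "real measure"
  assumes sets: "\<And>x. 0 < x \<Longrightarrow> {z. x \<le> \<bar>z\<bar>} \<in> sets \<nu>"
    and tail: "\<And>x. 1 \<le> x \<Longrightarrow> emeasure \<nu> {z. x \<le> \<bar>z\<bar>} \<le> ennreal (C * x powr - k)"
    and C: "0 \<le> C" and q: "0 < q" "q < k"
  shows "(\<integral>\<^sup>+ z. ennreal (\<bar>z\<bar> powr q) * indicator (far 1) z \<partial>\<nu>) < \<infinity>"
proof -
  define w where "w n = (2 ^ Suc n :: real) powr q" for n :: nat
  have "(\<integral>\<^sup>+ z. ennreal (\<bar>z\<bar> powr q) * indicator (far 1) z \<partial>\<nu>)
      \<le> (\<integral>\<^sup>+ z. (\<Sum>n. ennreal (w n) * indicator {z. 2 ^ n \<le> \<bar>z\<bar>} z) \<partial>\<nu>)"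
  proof (intro nn_integral_mono)
    fix z
    show "ennreal (\<bar>z\<bar> powr q) * indicator (far 1) z \<le> (\<Sum>n. ennreal (w n) * indicator {z. 2 ^ n \<le> \<bar>z\<bar>} z)"
    proof (cases "z \<in> far 1")
      case True
      then have z: "1 < \<bar>z\<bar>" by (simp add: far_def)
      define n where "n = nat \<lfloor>log 2 \<bar>z\<bar>\<rfloor>"
      have l0: "0 \<le> log 2 \<bar>z\<bar>" using z by simp
      have n: "real n \<le> log 2 \<bar>z\<bar>" "log 2 \<bar>z\<bar> < real n + 1" using l0 unfolding n_def by auto
      have "2 powr real n \<le> \<bar>z\<bar>" using n(1) z by (simp add: le_log_iff)
      then have low: "2 ^ n \<le> \<bar>z\<bar>" by (simp add: powr_realpow)
      have "\<bar>z\<bar> \<le> 2 powr (real n + 1)" using n(2) z by (simp add: log_less_iff less_imp_le)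
      also have "2 powr (real n + 1) = 2 ^ Suc n" by (simp add: powr_add powr_realpow)
      finally have "\<bar>z\<bar> powr q \<le> w n" unfolding w_def using q by (intro powr_mono2) auto
      then have "ennreal (\<bar>z\<bar> powr q) * indicator (far 1) z \<le> ennreal (w n) * indicator {z. 2 ^ n \<le> \<bar>z\<bar>} z"
        using True low by (simp add: ennreal_leI)
      also have "\<dots> \<le> (\<Sum>n. ennreal (w n) * indicator {z. 2 ^ n \<le> \<bar>z\<bar>} z)"
      proof -
        have "F n \<le> suminf F" for F :: "nat \<Rightarrow> ennreal" using sum_le_suminf[of F "{n}"] by simp
        then show ?thesis .
      qed
      finally show ?thesis .
    qed simp
  qed
  also have "\<dots> = (\<Sum>n. \<integral>\<^sup>+ z. ennreal (w n) * indicator {z. 2 ^ n \<le> \<bar>z\<bar>} z \<partial>\<nu>)"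
    using sets by (intro nn_integral_suminf) auto
  also have "\<dots> = (\<Sum>n. ennreal (w n) * emeasure \<nu> {z. 2 ^ n \<le> \<bar>z\<bar>})"
    using sets by (simp add: nn_integral_cmult_indicator)
  also have "\<dots> \<le> (\<Sum>n. ennreal (2 powr q * C * (2 powr (q - k)) ^ n))"
  proof (intro suminf_le allI summableI)
    fix n :: nat
    have "ennreal (w n) * emeasure \<nu> {z. 2 ^ n \<le> \<bar>z\<bar>} \<le> ennreal (w n) * ennreal (C * (2 ^ n) powr - k)"
      by (intro mult_left_mono tail) auto
    also have "\<dots> = ennreal (w n * (C * (2 ^ n) powr - k))" by (simp add: ennreal_mult' w_def)
    also have "w n * (C * (2 ^ n) powr - k) = 2 powr q * C * (2 powr (q - k)) ^ n"
    proof -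
      have "w n = 2 powr q * (2 ^ n) powr q" by (simp add: w_def powr_mult)
      moreover have "(2 powr (q - k)) ^ n = (2 ^ n) powr q * (2 ^ n :: real) powr - k"
        by (simp add: powr_realpow[symmetric] powr_powr powr_add[symmetric] algebra_simps)
      ultimately show ?thesis by simp
    qed
    finally show "ennreal (w n) * emeasure \<nu> {z. 2 ^ n \<le> \<bar>z\<bar>} \<le> ennreal (2 powr q * C * (2 powr (q - k)) ^ n)" .
  qed
  also have "\<dots> = ennreal (\<Sum>n. 2 powr q * C * (2 powr (q - k)) ^ n)"
  proof (rule suminf_ennreal2)
    show "0 \<le> 2 powr q * C * (2 powr (q - k)) ^ n" for n using C by simp
    have "2 powr (q - k) < (1::real)" using q powr_less_mono[of "q - k" 0 "2::real"] by simp
    then show "summable (\<lambda>n. 2 powr q * C * (2 powr (q - k)) ^ n)" by (intro summable_mult summable_geometric) simp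
  qed
  also have "\<dots> < \<infinity>" by simp
  finally show ?thesis .
qed

locale heavy_tails =
  fixes \<nu> :: "real measure" and \<alpha> \<beta> :: real
  assumes levy0: "levy_measure \<nu>"
    and up: "regular_tail (\<lambda>x. measure \<nu> {x..}) \<alpha>"
    and down: "regular_tail (\<lambda>x. measure \<nu> {..- x}) \<beta>"
    and up_finite: "\<And>x. 0 < x \<Longrightarrow> emeasure \<nu> {x..} < \<infinity>"
    and down_finite: "\<And>x. 0 < x \<Longrightarrow> emeasure \<nu> {..- x} < \<infinity>"
begin

lemma sets0: "A \<in> sets borel \<Longrightarrow> 0 \<notin> A \<Longrightarrow> A \<in> sets \<nu>"
  using levy0 unfolding levy_measure_def by (auto simp: sets_restrict_space_iff)

lemma moment_exponent: "\<exists>q>1. q < 2 \<and> (\<integral>\<^sup>+ z. ennreal (\<bar>z\<bar> powr q) * indicator (far 1) z \<partial>\<nu>) < \<infinity>"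
proof -
  define k where "k = (1 + min (min \<alpha> \<beta>) 2) / 2"
  have ab: "1 < \<alpha>" "1 < \<beta>" using up down by (auto simp: regular_tail_def)
  have k: "1 < k" "k < \<alpha>" "k < \<beta>" "k < 2" using ab by (auto simp: k_def min_def)
  obtain C1 where C1: "0 < C1" "\<forall>x\<ge>1. measure \<nu> {x..} \<le> C1 * x powr - k"
    using regular_tail.power_bound[OF up, of k] k by auto
  obtain C2 where C2: "0 < C2" "\<forall>x\<ge>1. measure \<nu> {..- x} \<le> C2 * x powr - k"
    using regular_tail.power_bound[OF down, of k] k by auto
  have "(\<integral>\<^sup>+ z. ennreal (\<bar>z\<bar> powr ((1 + k) / 2)) * indicator (far 1) z \<partial>\<nu>) < \<infinity>"
  proof (rule tail_moment_finite)
    show "{z. x \<le> \<bar>z\<bar>} \<in> sets \<nu>" if "0 < x" for x :: real using that by (intro sets0) auto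
    fix x :: real assume x: "1 \<le> x"
    have "{z. x \<le> \<bar>z\<bar>} = {x..} \<union> {..- x}" using x by auto
    then have "emeasure \<nu> {z. x \<le> \<bar>z\<bar>} \<le> emeasure \<nu> {x..} + emeasure \<nu> {..- x}"
      using x by (simp only:) (intro emeasure_subadditive sets0, auto)
    also have "\<dots> = ennreal (measure \<nu> {x..}) + ennreal (measure \<nu> {..- x})"
      using up_finite[of x] down_finite[of x] x by (simp add: emeasure_eq_ennreal_measure less_top)
    also have "\<dots> \<le> ennreal (C1 * x powr - k) + ennreal (C2 * x powr - k)"
      using C1(2) C2(2) x by (intro add_mono ennreal_leI) auto
    also have "\<dots> = ennreal ((C1 + C2) * x powr - k)" using C1(1) C2(1) by (simp add: ennreal_plus[symmetric] algebra_simps del: ennreal_plus)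
    finally show "emeasure \<nu> {z. x \<le> \<bar>z\<bar>} \<le> ennreal ((C1 + C2) * x powr - k)" .
  qed (use C1 C2 k in auto)
  then show ?thesis using k by (intro exI[of _ "(1 + k) / 2"]) auto
qed

text \<open>
  A moment of the large jumps that is finite because both tails have an index above \<open>1\<close>. From \<open>q > 1\<close>
  the compensator of the large jumps becomes negligible, and \<open>q < 2\<close> bounds the second moment of jumps
  truncated at \<open>T\<close> by a power of \<open>T\<close>.
\<close>

definition q :: real where "q = (SOME q. q > 1 \<and> q < 2 \<and> (\<integral>\<^sup>+ z. ennreal (\<bar>z\<bar> powr q) * indicator (far 1) z \<partial>\<nu>) < \<infinity>)"

lemma q: "1 < q" "q < 2" "(\<integral>\<^sup>+ z. ennreal (\<bar>z\<bar> powr q) * indicator (far 1) z \<partial>\<nu>) < \<infinity>"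
  using someI_ex[OF moment_exponent] unfolding q_def[symmetric] by auto

end

sublocale heavy_tails \<subseteq> levy_tails
proof
  show "levy_measure \<nu>" by (rule levy0)
  have "(\<integral>\<^sup>+ z. ennreal \<bar>z\<bar> * indicator (far 1) z \<partial>\<nu>) \<le> (\<integral>\<^sup>+ z. ennreal (\<bar>z\<bar> powr q) * indicator (far 1) z \<partial>\<nu>)"
  proof (intro nn_integral_mono)
    fix z
    show "ennreal \<bar>z\<bar> * indicator (far 1) z \<le> ennreal (\<bar>z\<bar> powr q) * indicator (far 1) z"
    proof (cases "z \<in> far 1")
      case True
      then have "\<bar>z\<bar> powr 1 \<le> \<bar>z\<bar> powr q" using q(1) by (intro powr_mono) (auto simp: far_def)
      then have "\<bar>z\<bar> \<le> \<bar>z\<bar> powr q" using True by (simp add: far_def)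
      then show ?thesis using True by (simp add: ennreal_leI)
    qed simp
  qed
  also have "\<dots> < \<infinity>" by (rule q(3))
  finally show "(\<integral>\<^sup>+ z. ennreal \<bar>z\<bar> * indicator (far 1) z \<partial>\<nu>) < \<infinity>" .
qed

context heavy_tails
begin

definition moment :: real where
  "moment = enn2real (\<integral>\<^sup>+ z. ennreal (min 1 (z\<^sup>2)) \<partial>\<nu>) + enn2real (\<integral>\<^sup>+ z. ennreal (\<bar>z\<bar> powr q) * indicator (far 1) z \<partial>\<nu>)"

lemma moment_nonneg: "0 \<le> moment" by (simp add: moment_def)

lemma powr_measurable: "(\<lambda>z. ennreal (\<bar>z\<bar> powr q) * indicator (far 1) z) \<in> borel_measurable \<nu>"
  using far_sets[of 1] by (intro borel_measurable_times_ennreal borel_measurable_indicator borel_measurable_nu) auto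

lemma second_moment_le:
  assumes T: "1 \<le> T"
  shows "(\<integral>\<^sup>+ z. ennreal (z\<^sup>2) * indicator (band 0 T) z \<partial>\<nu>) \<le> ennreal (moment * T powr (2 - q))"
proof -
  let ?k = "ennreal (T powr (2 - q))"
  have k1: "1 \<le> T powr (2 - q)" using T q by (simp add: ge_one_powr_ge_zero)
  have sm: "(\<lambda>z. ennreal (min 1 (z\<^sup>2))) \<in> borel_measurable \<nu>" by (rule borel_measurable_nu) simp
  have "(\<integral>\<^sup>+ z. ennreal (z\<^sup>2) * indicator (band 0 T) z \<partial>\<nu>)
    \<le> (\<integral>\<^sup>+ z. ?k * (ennreal (min 1 (z\<^sup>2)) + ennreal (\<bar>z\<bar> powr q) * indicator (far 1) z) \<partial>\<nu>)"
  proof (intro nn_integral_mono)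
    fix z
    show "ennreal (z\<^sup>2) * indicator (band 0 T) z \<le> ?k * (ennreal (min 1 (z\<^sup>2)) + ennreal (\<bar>z\<bar> powr q) * indicator (far 1) z)"
    proof (cases "z \<in> band 0 T")
      case True
      then have z: "0 < \<bar>z\<bar>" "\<bar>z\<bar> \<le> T" by (auto simp: band_def)
      show ?thesis
      proof (cases "z \<in> far 1")
        case far: True
        have "z\<^sup>2 = \<bar>z\<bar> powr 2" using z by (simp add: powr_numeral)
        also have "\<dots> = \<bar>z\<bar> powr (2 - q) * \<bar>z\<bar> powr q" by (simp add: powr_add[symmetric])
        also have "\<dots> \<le> T powr (2 - q) * \<bar>z\<bar> powr q" using z q by (intro mult_right_mono powr_mono2) auto
        finally have "ennreal (z\<^sup>2) \<le> ?k * ennreal (\<bar>z\<bar> powr q)" by (simp add: ennreal_mult'[symmetric] ennreal_leI)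
        also have "\<dots> \<le> ?k * (ennreal (min 1 (z\<^sup>2)) + ennreal (\<bar>z\<bar> powr q))" by (intro mult_left_mono) auto
        finally show ?thesis using True far by simp
      next
        case near: False
        then have "\<bar>z\<bar> \<le> 1" by (simp add: far_def)
        then have "z\<^sup>2 \<le> 1" by (simp add: abs_square_le_1)
        then have "min 1 (z\<^sup>2) = z\<^sup>2" by (rule min_absorb2)
        moreover have "1 * z\<^sup>2 \<le> T powr (2 - q) * z\<^sup>2" using k1 by (intro mult_right_mono) auto
        ultimately show ?thesis using True near by (simp add: ennreal_mult'[symmetric] ennreal_leI)
      qed
    qed simp
  qed
  also have "\<dots> = ?k * ((\<integral>\<^sup>+ z. ennreal (min 1 (z\<^sup>2)) \<partial>\<nu>) + (\<integral>\<^sup>+ z. ennreal (\<bar>z\<bar> powr q) * indicator (far 1) z \<partial>\<nu>))"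
    using sm powr_measurable by (simp add: nn_integral_cmult nn_integral_add)
  also have "\<dots> = ?k * ennreal moment"
  proof -
    have "(\<integral>\<^sup>+ z. ennreal (min 1 (z\<^sup>2)) \<partial>\<nu>) < \<infinity>" using levy0 by (simp add: levy_measure_def)
    then show ?thesis using q(3) unfolding moment_def by (simp add: ennreal_plus)
  qed
  finally show ?thesis by (simp add: ennreal_mult'[symmetric] mult.commute moment_nonneg)
qed

lemma first_moment_le:
  assumes T: "1 \<le> T"
  shows "enn2real (\<integral>\<^sup>+ z. ennreal \<bar>z\<bar> * indicator (far T) z \<partial>\<nu>) \<le> moment * T powr (1 - q)"
proof -
  let ?k = "ennreal (T powr (1 - q))"
  have "(\<integral>\<^sup>+ z. ennreal \<bar>z\<bar> * indicator (far T) z \<partial>\<nu>) \<le> (\<integral>\<^sup>+ z. ?k * (ennreal (\<bar>z\<bar> powr q) * indicator (far 1) z) \<partial>\<nu>)"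
  proof (intro nn_integral_mono)
    fix z
    show "ennreal \<bar>z\<bar> * indicator (far T) z \<le> ?k * (ennreal (\<bar>z\<bar> powr q) * indicator (far 1) z)"
    proof (cases "z \<in> far T")
      case True
      then have z: "T < \<bar>z\<bar>" "z \<in> far 1" using T by (auto simp: far_def)
      have "\<bar>z\<bar> = \<bar>z\<bar> powr (1 - q) * \<bar>z\<bar> powr q" using z T by (simp add: powr_add[symmetric])
      also have "\<dots> \<le> T powr (1 - q) * \<bar>z\<bar> powr q" using z T q by (intro mult_right_mono powr_mono2') auto
      finally show ?thesis using True z by (simp add: ennreal_mult'[symmetric] ennreal_leI)
    qed simp
  qed
  also have "\<dots> = ?k * (\<integral>\<^sup>+ z. ennreal (\<bar>z\<bar> powr q) * indicator (far 1) z \<partial>\<nu>)"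
    by (rule nn_integral_cmult[OF powr_measurable])
  also have "\<dots> = ennreal (T powr (1 - q) * enn2real (\<integral>\<^sup>+ z. ennreal (\<bar>z\<bar> powr q) * indicator (far 1) z \<partial>\<nu>))"
    using q(3) by (simp add: ennreal_mult')
  also have "\<dots> \<le> ennreal (moment * T powr (1 - q))"
    unfolding moment_def mult.commute[of _ "T powr (1 - q)"] by (intro ennreal_leI mult_left_mono) auto
  finally show ?thesis by (intro enn2real_leI) (simp_all add: moment_nonneg)
qed

end

section \<open>The noise is close to its large jumps\<close>

text \<open>The scaled noise \<open>Z\<close>, normalised to start at \<open>0\<close>.\<close>

locale small_noise = prob_space M + heavy_tails \<nu> \<alpha> \<beta>
  for M :: "'w measure" and \<nu> \<alpha> \<beta> +
  fixes B :: "real \<Rightarrow> 'w \<Rightarrow> real" and N :: "real \<Rightarrow> 'w \<Rightarrow> (real \<times> real) measure"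
    and J Z :: "real \<Rightarrow> 'w \<Rightarrow> skorokhod"
  assumes bm: "brownian_motion M B"
    and prm: "\<And>\<epsilon>. 0 < \<epsilon> \<Longrightarrow> poisson_random_measure M (N \<epsilon>) (jump_compensator (1 / \<epsilon>) \<nu>)"
    and comp: "\<And>\<epsilon>. 0 < \<epsilon> \<Longrightarrow> compensated_jump_integral M (N \<epsilon>) (jump_compensator (1 / \<epsilon>) \<nu>) (J \<epsilon>)"
    and Z_eq: "\<And>\<epsilon>. 0 < \<epsilon> \<Longrightarrow> AE \<omega> in M. \<forall>t\<in>{0..1}. sk_fun (Z \<epsilon> \<omega>) t =
        (sqrt \<epsilon> * B t \<omega> + \<epsilon> * sk_fun (J \<epsilon> \<omega>) t) - (sqrt \<epsilon> * B 0 \<omega> + \<epsilon> * sk_fun (J \<epsilon> \<omega>) 0)"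
begin

lemma jumps: "0 < \<epsilon> \<Longrightarrow> compensated_jumps M (N \<epsilon>) (1 / \<epsilon>) \<nu> (J \<epsilon>)"
  by unfold_locales (use prm comp in auto)

text \<open>
  Finitely many jumps are larger than \<open>\<theta>\<close> after scaling, and \<open>Z\<close> stays within \<open>\<eta>\<close> of their sum. The sum
  is not compensated: the compensator of the large jumps is among the negligible terms.
\<close>

definition good :: "real \<Rightarrow> real \<Rightarrow> real \<Rightarrow> 'w \<Rightarrow> bool" where
  "good \<epsilon> \<theta> \<eta> \<omega> \<longleftrightarrow> emeasure (N \<epsilon> \<omega>) ({0<..1} \<times> far (\<theta> / \<epsilon>)) < \<infinity> \<and>
     set_integrable (N \<epsilon> \<omega>) ({0<..1} \<times> far (\<theta> / \<epsilon>)) snd \<and>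
     (\<forall>t\<in>{0..1}. \<bar>sk_fun (Z \<epsilon> \<omega>) t - \<epsilon> * (LINT p : {0<..t} \<times> far (\<theta> / \<epsilon>) | N \<epsilon> \<omega>. snd p)\<bar> \<le> \<eta>)"

text \<open>
  The error has three parts. The compensated jumps below \<open>\<theta>\<close> and the Brownian motion are bounded outside
  exceptional events by \<open>small_jumps\<close> and \<open>brownian_sup\<close>; the compensator of the jumps above \<open>\<theta>\<close> is
  deterministic and small by the first moment bound.
\<close>

lemma good_event_fixed:
  assumes e: "0 < \<epsilon>" "\<epsilon> < 1" and \<theta>: "0 < \<theta>" "1 \<le> \<theta> / \<epsilon>" and \<eta>: "0 < \<eta>" and \<kappa>: "\<kappa> = (q - 1) / 2"
    and drift: "moment * (\<theta> / \<epsilon>) powr (1 - q) \<le> \<eta> / 4"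
    and small: "(\<kappa> / \<theta>)\<^sup>2 * moment * \<theta> powr (2 - q) * (ln (1 / \<epsilon>))\<^sup>2 * \<epsilon> powr \<kappa> \<le> 1"
  shows "\<exists>Bad\<in>events. prob Bad \<le> 2 * exp (1 - \<kappa> * \<eta> / (32 * \<theta>) * ln (1 / \<epsilon>)) + 2 * exp (- (\<eta>\<^sup>2 / (128 * \<epsilon>))) \<and>
    (\<forall>\<omega>\<in>space M - Bad. good \<epsilon> \<theta> \<eta> \<omega>)"
proof -
  interpret jp: compensated_jumps M "N \<epsilon>" "1 / \<epsilon>" \<nu> "J \<epsilon>" by (rule jumps[OF e(1)])
  define T where "T = \<theta> / \<epsilon>"
  define ell where "ell = ln (1 / \<epsilon>)"
  \<comment> \<open>With this exponent \<open>exp (u * T) = \<epsilon> powr - \<kappa>\<close> uses up half of the power \<open>\<epsilon> powr (q - 1)\<close> that the second moment provides, so the variance term stays bounded.\<close>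
  define u where "u = \<kappa> / \<theta> * \<epsilon> * ell"
  define h where "h = \<eta> / (32 * \<epsilon>)"
  have ell: "0 < ell" using e by (simp add: ell_def)
  have k: "0 < \<kappa>" using q \<kappa> by simp
  have T: "1 \<le> T" "0 < T" using \<theta> by (auto simp: T_def)
  have u: "0 < u" using k \<theta> e ell by (simp add: u_def)
  have h: "0 < h" using \<eta> e by (simp add: h_def)
  have s0: "0 \<le> moment * T powr (2 - q)" using moment_nonneg by simp
  have uT: "exp (u * T) = \<epsilon> powr - \<kappa>"
  proof -
    have "u * T = \<kappa> * ell" using e \<theta> by (simp add: u_def T_def)
    also have "\<dots> = - \<kappa> * ln \<epsilon>" using e by (simp add: ell_def ln_div)
    finally show ?thesis using e by (simp add: powr_def)
  qed
  have ex: "u\<^sup>2 * exp (u * T) * (1 / \<epsilon> * (moment * T powr (2 - q))) \<le> 1"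
  proof -
    have "T powr (2 - q) = \<theta> powr (2 - q) * \<epsilon> powr (q - 2)"
      using e \<theta> by (simp add: T_def powr_divide powr_diff powr_minus field_simps)
    moreover have u2: "u\<^sup>2 = (\<kappa> / \<theta>)\<^sup>2 * ell\<^sup>2 * \<epsilon>\<^sup>2"
      unfolding u_def power_mult_distrib by (simp only: mult_ac)
    ultimately have "u\<^sup>2 * exp (u * T) * (1 / \<epsilon> * (moment * T powr (2 - q))) =
        (\<kappa> / \<theta>)\<^sup>2 * moment * \<theta> powr (2 - q) * ell\<^sup>2 * (\<epsilon>\<^sup>2 * \<epsilon> powr - \<kappa> * (1 / \<epsilon>) * \<epsilon> powr (q - 2))"
      unfolding uT u2 by (simp only: mult_ac)
    also have "\<epsilon>\<^sup>2 * \<epsilon> powr - \<kappa> * (1 / \<epsilon>) * \<epsilon> powr (q - 2) = \<epsilon> powr (2 + - \<kappa> + - 1 + (q - 2))"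
      unfolding powr_add using e by (simp add: powr_minus powr_numeral divide_inverse)
    also have "2 + - \<kappa> + - 1 + (q - 2) = \<kappa>" using \<kappa> by (simp add: field_simps)
    finally show ?thesis using small by (simp add: ell_def)
  qed
  obtain Bad1 where B1: "Bad1 \<in> events"
    "prob Bad1 \<le> 2 * exp (u\<^sup>2 * exp (u * T) * (1 / \<epsilon> * (moment * T powr (2 - q))) - u * h)"
    and G1: "\<forall>\<omega>\<in>space M - Bad1. emeasure (N \<epsilon> \<omega>) ({0<..1} \<times> far T) < \<infinity> \<and> set_integrable (N \<epsilon> \<omega>) ({0<..1} \<times> far T) snd \<and>
      (\<forall>t\<in>{0..1}. \<bar>sk_fun (J \<epsilon> \<omega>) t - ((LINT p : {0<..t} \<times> far T | N \<epsilon> \<omega>. snd p) - (LINT p : {0<..t} \<times> far T | jump_compensator (1 / \<epsilon>) \<nu>. snd p))\<bar> \<le> 4 * h)"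
    using jp.small_jumps[OF T(2) u h s0 second_moment_le[OF T(1)]] by (elim bexE conjE) (rule that)
  \<comment> \<open>the minimiser of \<open>u\<^sup>2 / 2 - u * hB\<close> is \<open>u = hB\<close>\<close>
  define hB where "hB = \<eta> / (8 * sqrt \<epsilon>)"
  have hB: "0 < hB" using \<eta> e by (simp add: hB_def)
  obtain Bad2 where B2: "Bad2 \<in> events" "prob Bad2 \<le> 2 * exp (hB\<^sup>2 / 2 - hB * hB)"
    and G2: "\<forall>\<omega>\<in>space M - Bad2. \<forall>t\<in>{0..1}. \<bar>B t \<omega> - B 0 \<omega>\<bar> \<le> hB"
    using brownian_sup[OF bm hB, of hB] by (elim bexE conjE) (rule that)
  obtain Bad3 where B3: "{\<omega> \<in> space M. \<not> (\<forall>t\<in>{0..1}. sk_fun (Z \<epsilon> \<omega>) t =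
        (sqrt \<epsilon> * B t \<omega> + \<epsilon> * sk_fun (J \<epsilon> \<omega>) t) - (sqrt \<epsilon> * B 0 \<omega> + \<epsilon> * sk_fun (J \<epsilon> \<omega>) 0))} \<subseteq> Bad3"
    "emeasure M Bad3 = 0" "Bad3 \<in> events"
    by (rule AE_E[OF Z_eq[OF e(1)]]) (rule that)
  have B12: "Bad1 \<union> Bad2 \<in> events" by (rule sets.Un[OF B1(1) B2(1)])
  show ?thesis
  proof (intro bexI[of _ "Bad1 \<union> Bad2 \<union> Bad3"] conjI ballI)
    show "Bad1 \<union> Bad2 \<union> Bad3 \<in> events" by (rule sets.Un[OF B12 B3(3)])
    have "prob (Bad1 \<union> Bad2 \<union> Bad3) \<le> prob (Bad1 \<union> Bad2) + prob Bad3" by (rule measure_Un_le[OF B12 B3(3)])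
    also have "prob Bad3 = 0" using B3(2) by (simp add: measure_def)
    also have "prob (Bad1 \<union> Bad2) \<le> prob Bad1 + prob Bad2" by (rule measure_Un_le[OF B1(1) B2(1)])
    also have "prob Bad1 \<le> 2 * exp (1 - \<kappa> * \<eta> / (32 * \<theta>) * ln (1 / \<epsilon>))"
    proof -
      have "u * h = \<kappa> * \<eta> / (32 * \<theta>) * ell" using e by (simp add: u_def h_def mult_ac)
      then have "u\<^sup>2 * exp (u * T) * (1 / \<epsilon> * (moment * T powr (2 - q))) - u * h \<le> 1 - \<kappa> * \<eta> / (32 * \<theta>) * ell"
        using ex by linarith
      then have "exp (u\<^sup>2 * exp (u * T) * (1 / \<epsilon> * (moment * T powr (2 - q))) - u * h) \<le> exp (1 - \<kappa> * \<eta> / (32 * \<theta>) * ell)"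
        by (simp only: exp_le_cancel_iff)
      then show ?thesis using B1(2) unfolding ell_def by linarith
    qed
    also have "prob Bad2 \<le> 2 * exp (- (\<eta>\<^sup>2 / (128 * \<epsilon>)))"
    proof -
      have sq: "hB\<^sup>2 / 2 = \<eta>\<^sup>2 / (128 * \<epsilon>)" using e by (simp add: hB_def power_divide power_mult_distrib)
      have "hB\<^sup>2 / 2 - hB * hB = - (hB\<^sup>2 / 2)" by (simp add: power2_eq_square)
      also have "\<dots> = - (\<eta>\<^sup>2 / (128 * \<epsilon>))" unfolding sq ..
      finally have "hB\<^sup>2 / 2 - hB * hB = - (\<eta>\<^sup>2 / (128 * \<epsilon>))" .
      with B2(2) show ?thesis by (simp only:)
    qed
    finally show "prob (Bad1 \<union> Bad2 \<union> Bad3) \<le> 2 * exp (1 - \<kappa> * \<eta> / (32 * \<theta>) * ln (1 / \<epsilon>)) + 2 * exp (- (\<eta>\<^sup>2 / (128 * \<epsilon>)))" by simp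
    fix \<omega> assume w: "\<omega> \<in> space M - (Bad1 \<union> Bad2 \<union> Bad3)"
    have w1: "\<omega> \<in> space M - Bad1" and w2: "\<omega> \<in> space M - Bad2" using w by blast+
    have z: "\<forall>t\<in>{0..1}. sk_fun (Z \<epsilon> \<omega>) t =
        (sqrt \<epsilon> * B t \<omega> + \<epsilon> * sk_fun (J \<epsilon> \<omega>) t) - (sqrt \<epsilon> * B 0 \<omega> + \<epsilon> * sk_fun (J \<epsilon> \<omega>) 0)"
      using w B3(1) by blast
    note g1 = bspec[OF G1 w1]
    show "good \<epsilon> \<theta> \<eta> \<omega>"
      unfolding good_def T_def[symmetric]
    proof (intro conjI ballI)
      show "emeasure (N \<epsilon> \<omega>) ({0<..1} \<times> far T) < \<infinity>" "set_integrable (N \<epsilon> \<omega>) ({0<..1} \<times> far T) snd"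
        by (rule conjunct1[OF g1], rule conjunct1[OF conjunct2[OF g1]])
      fix t :: real assume t: "t \<in> {0..1}"
      have J: "\<bar>sk_fun (J \<epsilon> \<omega>) s - ((LINT p : {0<..s} \<times> far T | N \<epsilon> \<omega>. snd p) - (LINT p : {0<..s} \<times> far T | jump_compensator (1 / \<epsilon>) \<nu>. snd p))\<bar> \<le> 4 * h"
        if "s \<in> {0..1}" for s
        using g1 that by blast
      define X where "X = (LINT p : {0<..t} \<times> far T | N \<epsilon> \<omega>. snd p)"
      define C where "C = (LINT p : {0<..t} \<times> far T | jump_compensator (1 / \<epsilon>) \<nu>. snd p)"
      have j1: "\<bar>sk_fun (J \<epsilon> \<omega>) t - (X - C)\<bar> \<le> 4 * h" using J[OF t] by (simp only: X_def C_def)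
      have j0: "\<bar>sk_fun (J \<epsilon> \<omega>) 0\<bar> \<le> 4 * h" using J[of 0] by (simp add: set_lebesgue_integral_def)
      have c: "\<epsilon> * \<bar>C\<bar> \<le> \<eta> / 4"
      proof -
        have "\<bar>C\<bar> \<le> 1 / \<epsilon> * enn2real (\<integral>\<^sup>+ z. ennreal \<bar>z\<bar> * indicator (far T) z \<partial>\<nu>)"
          unfolding C_def using t T by (intro jp.snd_integrable_mu(2)) auto
        also have "\<dots> \<le> 1 / \<epsilon> * (moment * T powr (1 - q))" using e by (intro mult_left_mono first_moment_le T) auto
        also have "\<dots> \<le> 1 / \<epsilon> * (\<eta> / 4)" using e drift by (intro mult_left_mono) (auto simp: T_def)
        finally show ?thesis using e by (simp add: field_simps)
      qed
      have b: "\<bar>sqrt \<epsilon> * (B t \<omega> - B 0 \<omega>)\<bar> \<le> \<eta> / 8"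
      proof -
        have "\<bar>B t \<omega> - B 0 \<omega>\<bar> \<le> hB" using G2 w2 t by blast
        then have "sqrt \<epsilon> * \<bar>B t \<omega> - B 0 \<omega>\<bar> \<le> sqrt \<epsilon> * hB" using e by (intro mult_left_mono) auto
        also have "\<dots> = \<eta> / 8" using e by (simp add: hB_def)
        finally show ?thesis using e by (simp add: abs_mult)
      qed
      have e4: "\<epsilon> * (4 * h) = \<eta> / 8" using e by (simp add: h_def)
      have j1': "\<bar>\<epsilon> * (sk_fun (J \<epsilon> \<omega>) t - (X - C))\<bar> \<le> \<eta> / 8"
        using mult_left_mono[OF j1, of \<epsilon>] e unfolding e4 by (simp add: abs_mult)
      have j0': "\<bar>\<epsilon> * sk_fun (J \<epsilon> \<omega>) 0\<bar> \<le> \<eta> / 8"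
        using mult_left_mono[OF j0, of \<epsilon>] e unfolding e4 by (simp add: abs_mult)
      have c': "\<bar>\<epsilon> * C\<bar> \<le> \<eta> / 4" using c e by (simp add: abs_mult)
      have "sk_fun (Z \<epsilon> \<omega>) t - \<epsilon> * X = sqrt \<epsilon> * (B t \<omega> - B 0 \<omega>) + \<epsilon> * (sk_fun (J \<epsilon> \<omega>) t - (X - C)) - \<epsilon> * sk_fun (J \<epsilon> \<omega>) 0 - \<epsilon> * C"
        using bspec[OF z t] by (simp add: algebra_simps)
      then show "\<bar>sk_fun (Z \<epsilon> \<omega>) t - \<epsilon> * X\<bar> \<le> \<eta>"
        using b j1' j0' c' \<eta> by linarith
    qed
  qed
qed

text \<open>
  The probability that small jumps matter is of order \<open>\<epsilon>\<close> to the power \<open>\<kappa> * \<eta> / (32 * \<theta>)\<close>, which beats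
  any prescribed power once \<open>\<theta>\<close> is small.
\<close>

lemma good_event:
  assumes a: "0 < a" and \<eta>: "0 < \<eta>"
  shows "\<exists>\<theta>0>0. \<forall>\<theta>. 0 < \<theta> \<longrightarrow> \<theta> \<le> \<theta>0 \<longrightarrow>
    (\<forall>\<^sub>F \<epsilon> in at_right 0. \<exists>Bad\<in>events. prob Bad \<le> \<epsilon> powr a \<and> (\<forall>\<omega>\<in>space M - Bad. good \<epsilon> \<theta> \<eta> \<omega>))"
proof -
  define \<kappa> where "\<kappa> = (q - 1) / 2"
  have k: "0 < \<kappa>" using q by (simp add: \<kappa>_def)
  \<comment> \<open>a power \<open>a + 2\<close> leaves room for the constants\<close>
  define \<theta>0 where "\<theta>0 = \<kappa> * \<eta> / (32 * (a + 2))"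
  have \<theta>0: "0 < \<theta>0" using k \<eta> a by (simp add: \<theta>0_def)
  have "\<forall>\<^sub>F \<epsilon> in at_right 0. \<exists>Bad\<in>events. prob Bad \<le> \<epsilon> powr a \<and> (\<forall>\<omega>\<in>space M - Bad. good \<epsilon> \<theta> \<eta> \<omega>)"
    if \<theta>: "0 < \<theta>" "\<theta> \<le> \<theta>0" for \<theta>
  proof -
    define K where "K = (\<kappa> / \<theta>)\<^sup>2 * moment * \<theta> powr (2 - q)"
    have ev_lt: "\<forall>\<^sub>F \<epsilon> in at_right (0::real). f \<epsilon> \<le> c" if "(f \<longlongrightarrow> 0) (at_right 0)" "0 < c" for f :: "real \<Rightarrow> real" and c
      using order_tendstoD(2)[OF that] by eventually_elim simp
    have 1: "\<forall>\<^sub>F \<epsilon> in at_right (0::real). \<epsilon> \<in> {0<..<1}" by (rule eventually_at_right_real) simp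
    have 2: "\<forall>\<^sub>F \<epsilon> in at_right (0::real). 1 \<le> \<theta> / \<epsilon>"
      using regular_tail.scaled_filterlim[OF up \<theta>(1)] by (simp add: filterlim_at_top)
    have 3: "\<forall>\<^sub>F \<epsilon> in at_right (0::real). moment * (\<theta> / \<epsilon>) powr (1 - q) \<le> \<eta> / 4"
    proof (rule ev_lt)
      have "((\<lambda>\<epsilon>::real. (\<theta> / \<epsilon>) powr (1 - q)) \<longlongrightarrow> 0) (at_right 0)"
        using q \<theta>(1) by real_asymp
      from tendsto_mult_right_zero[OF this, of moment]
      show "((\<lambda>\<epsilon>::real. moment * (\<theta> / \<epsilon>) powr (1 - q)) \<longlongrightarrow> 0) (at_right 0)" .
    qed (use \<eta> in simp)
    have 4: "\<forall>\<^sub>F \<epsilon> in at_right (0::real). K * ((ln (1 / \<epsilon>))\<^sup>2 * \<epsilon> powr \<kappa>) \<le> 1"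
    proof (rule ev_lt)
      have "((\<lambda>\<epsilon>::real. (ln (1 / \<epsilon>))\<^sup>2 * \<epsilon> powr \<kappa>) \<longlongrightarrow> 0) (at_right 0)"
        using k by real_asymp
      from tendsto_mult_right_zero[OF this, of K]
      show "((\<lambda>\<epsilon>::real. K * ((ln (1 / \<epsilon>))\<^sup>2 * \<epsilon> powr \<kappa>)) \<longlongrightarrow> 0) (at_right 0)" .
    qed simp
    have 5: "\<forall>\<^sub>F \<epsilon> in at_right (0::real). 2 * exp 1 * \<epsilon> powr 2 \<le> 1 / 2"
      by (rule ev_lt) (real_asymp, simp)
    have 6: "\<forall>\<^sub>F \<epsilon> in at_right (0::real). 2 * exp (- (\<eta>\<^sup>2 / (128 * \<epsilon>))) * \<epsilon> powr - a \<le> 1 / 2"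
    proof (rule ev_lt)
      define c where "c = \<eta>\<^sup>2 / 128"
      have c: "0 < c" using \<eta> by (simp add: c_def)
      have "((\<lambda>\<epsilon>::real. 2 * exp (- (c / \<epsilon>)) * \<epsilon> powr - a) \<longlongrightarrow> 0) (at_right 0)"
        using c a by real_asymp
      then show "((\<lambda>\<epsilon>::real. 2 * exp (- (\<eta>\<^sup>2 / (128 * \<epsilon>))) * \<epsilon> powr - a) \<longlongrightarrow> 0) (at_right 0)" by (simp add: c_def)
    qed simp
    from 1 2 3 4 5 6 show ?thesis
    proof eventually_elim
      case (elim \<epsilon>)
      have e: "0 < \<epsilon>" "\<epsilon> < 1" using elim by auto
      have ell: "0 \<le> ln (1 / \<epsilon>)" using e by simp
      have "(\<kappa> / \<theta>)\<^sup>2 * moment * \<theta> powr (2 - q) * (ln (1 / \<epsilon>))\<^sup>2 * \<epsilon> powr \<kappa> \<le> 1"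
        using elim(4) by (simp add: K_def mult.assoc)
      from good_event_fixed[OF e \<theta>(1) elim(2) \<eta> \<kappa>_def elim(3) this]
      obtain Bad where Bad: "Bad \<in> events"
        "prob Bad \<le> 2 * exp (1 - \<kappa> * \<eta> / (32 * \<theta>) * ln (1 / \<epsilon>)) + 2 * exp (- (\<eta>\<^sup>2 / (128 * \<epsilon>)))"
        "\<forall>\<omega>\<in>space M - Bad. good \<epsilon> \<theta> \<eta> \<omega>" by (elim bexE conjE) (rule that)
      have "a + 2 \<le> \<kappa> * \<eta> / (32 * \<theta>)"
        using \<theta> a by (simp add: \<theta>0_def field_simps)
      then have "(a + 2) * ln (1 / \<epsilon>) \<le> \<kappa> * \<eta> / (32 * \<theta>) * ln (1 / \<epsilon>)" using ell by (rule mult_right_mono)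
      then have "2 * exp (1 - \<kappa> * \<eta> / (32 * \<theta>) * ln (1 / \<epsilon>)) \<le> 2 * exp (1 - (a + 2) * ln (1 / \<epsilon>))" by simp
      also have "exp (1 - (a + 2) * ln (1 / \<epsilon>)) = exp 1 * \<epsilon> powr (a + 2)"
      proof -
        have "1 - (a + 2) * ln (1 / \<epsilon>) = 1 + (a + 2) * ln \<epsilon>" using e by (simp add: ln_div)
        then show ?thesis using e by (simp only: exp_add powr_def) simp
      qed
      also have "2 * (exp 1 * \<epsilon> powr (a + 2)) = (2 * exp 1 * \<epsilon> powr 2) * \<epsilon> powr a"
        by (simp only: powr_add mult_ac)
      also have "\<dots> \<le> 1 / 2 * \<epsilon> powr a" using elim(5) by (intro mult_right_mono) auto
      finally have p1: "2 * exp (1 - \<kappa> * \<eta> / (32 * \<theta>) * ln (1 / \<epsilon>)) \<le> 1 / 2 * \<epsilon> powr a" .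
      have "2 * exp (- (\<eta>\<^sup>2 / (128 * \<epsilon>))) = (2 * exp (- (\<eta>\<^sup>2 / (128 * \<epsilon>))) * \<epsilon> powr - a) * \<epsilon> powr a"
        using e by (simp add: powr_minus)
      also have "\<dots> \<le> 1 / 2 * \<epsilon> powr a" using elim(6) by (intro mult_right_mono) auto
      finally have "prob Bad \<le> \<epsilon> powr a" using p1 Bad(2) by linarith
      then show ?case using Bad(1,3) by blast
    qed
  qed
  then show ?thesis using \<theta>0 by blast
qed

end

section \<open>The local upper bound\<close>

lemma powr_absorb:
  assumes "a < b"
  shows "\<forall>\<^sub>F \<epsilon> in at_right (0::real). k * \<epsilon> powr b \<le> \<epsilon> powr a"
proof -
  have "((\<lambda>\<epsilon>::real. \<epsilon> powr (b - a)) \<longlongrightarrow> 0) (at_right 0)" using assms by real_asymp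
  from tendsto_mult_right_zero[OF this, of k]
  have "\<forall>\<^sub>F \<epsilon> in at_right (0::real). k * \<epsilon> powr (b - a) < 1" by (rule order_tendstoD) simp
  then show ?thesis
  proof eventually_elim
    case (elim \<epsilon>)
    have "k * \<epsilon> powr b = (k * \<epsilon> powr (b - a)) * \<epsilon> powr a" by (simp add: powr_add[symmetric])
    also have "\<dots> \<le> 1 * \<epsilon> powr a" using elim by (intro mult_right_mono) auto
    finally show ?case by simp
  qed
qed

context small_noise
begin

lemma window_sets:
  assumes "0 < \<epsilon>" "\<omega> \<in> space M" "I \<in> sets borel" "I \<subseteq> {0..1}" "A \<in> sets borel" "0 \<notin> A"
  shows "I \<times> A \<in> sets (N \<epsilon> \<omega>)" and "I \<times> A \<in> sets (jump_compensator (1 / \<epsilon>) \<nu>)"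
proof -
  interpret jp: compensated_jumps M "N \<epsilon>" "1 / \<epsilon>" \<nu> "J \<epsilon>" by (rule jumps[OF assms(1)])
  have "A \<in> sets \<nu>" by (rule borel_sets_nu[OF assms(5,6)])
  from jp.slab_sets[OF assms(3,4) this] show "I \<times> A \<in> sets (jump_compensator (1 / \<epsilon>) \<nu>)" .
  then show "I \<times> A \<in> sets (N \<epsilon> \<omega>)" using jp.sets_N[OF assms(2)] by simp
qed

lemma window_nonempty:
  assumes e: "0 < \<epsilon>" and w: "\<omega> \<in> space M" and S: "S \<in> sets (jump_compensator (1 / \<epsilon>) \<nu>)"
    and ne: "emeasure (N \<epsilon> \<omega>) S \<noteq> 0"
  shows "1 \<le> emeasure (N \<epsilon> \<omega>) S"
proof -
  interpret jp: compensated_jumps M "N \<epsilon>" "1 / \<epsilon>" \<nu> "J \<epsilon>" by (rule jumps[OF e])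
  show ?thesis
  proof (cases "emeasure (N \<epsilon> \<omega>) S = \<infinity>")
    case True then show ?thesis by simp
  next
    case False
    then obtain n :: nat where n: "emeasure (N \<epsilon> \<omega>) S = of_nat n" using jp.N_values[OF w S] by blast
    then have "1 \<le> n" using ne by (cases n) auto
    then have "(of_nat 1 :: ennreal) \<le> of_nat n" by (simp only: of_nat_le_iff)
    then show ?thesis unfolding n by simp
  qed
qed

text \<open>
  On the good event an increment larger than \<open>2 * \<eta>\<close> cannot come from the error, which is at most \<open>\<eta>\<close> at
  either end. If all large jumps in between had the wrong sign, so would their sum.
\<close>

lemma increment_forces_jump:
  assumes e: "0 < \<epsilon>" and w: "\<omega> \<in> space M" and \<theta>: "0 < \<theta>" and g: "good \<epsilon> \<theta> \<eta> \<omega>"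
    and st: "0 \<le> s" "s < t" "t \<le> 1"
  shows "2 * \<eta> < sk_fun (Z \<epsilon> \<omega>) t - sk_fun (Z \<epsilon> \<omega>) s \<Longrightarrow> 1 \<le> emeasure (N \<epsilon> \<omega>) ({s<..t} \<times> {\<theta> / \<epsilon><..})"
    and "2 * \<eta> < sk_fun (Z \<epsilon> \<omega>) s - sk_fun (Z \<epsilon> \<omega>) t \<Longrightarrow> 1 \<le> emeasure (N \<epsilon> \<omega>) ({s<..t} \<times> {..<- (\<theta> / \<epsilon>)})"
proof -
  interpret jp: compensated_jumps M "N \<epsilon>" "1 / \<epsilon>" \<nu> "J \<epsilon>" by (rule jumps[OF e])
  define T where "T = \<theta> / \<epsilon>"
  have T: "0 < T" using \<theta> e by (simp add: T_def)
  let ?m = "N \<epsilon> \<omega>"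
  let ?W = "{s<..t} \<times> far T"
  have farb: "far T \<in> sets borel" "0 \<notin> far T" using T by (auto simp: far_def)
  have i1: "set_integrable ?m ({0<..1} \<times> far T) snd" using g unfolding good_def T_def by blast
  have it: "set_integrable ?m ({0<..r} \<times> far T) snd" if "r \<le> 1" for r by (rule jp.integrable_upto[OF w T i1 that])
  have WS: "?W \<in> sets ?m" using st by (intro window_sets(1)[OF e w] farb) auto
  have iW: "set_integrable ?m ?W snd" by (rule set_integrable_subset[OF i1 WS]) (use st in auto)
  have un: "{0<..t} \<times> far T = ({0<..s} \<times> far T) \<union> ?W" using st by auto
  have split: "(LINT p : {0<..t} \<times> far T | ?m. snd p) = (LINT p : {0<..s} \<times> far T | ?m. snd p) + (LINT p : ?W | ?m. snd p)"
    unfolding un using st by (intro set_integral_Un it iW) auto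
  have b: "\<bar>sk_fun (Z \<epsilon> \<omega>) r - \<epsilon> * (LINT p : {0<..r} \<times> far T | ?m. snd p)\<bar> \<le> \<eta>" if "r \<in> {0..1}" for r
    using g that unfolding good_def T_def[symmetric] by blast
  have d: "\<bar>(sk_fun (Z \<epsilon> \<omega>) t - sk_fun (Z \<epsilon> \<omega>) s) - \<epsilon> * (LINT p : ?W | ?m. snd p)\<bar> \<le> 2 * \<eta>"
  proof -
    have "sk_fun (Z \<epsilon> \<omega>) t - sk_fun (Z \<epsilon> \<omega>) s - \<epsilon> * (LINT p : ?W | ?m. snd p) =
        (sk_fun (Z \<epsilon> \<omega>) t - \<epsilon> * (LINT p : {0<..t} \<times> far T | ?m. snd p)) -
        (sk_fun (Z \<epsilon> \<omega>) s - \<epsilon> * (LINT p : {0<..s} \<times> far T | ?m. snd p))"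
      unfolding split by (simp add: distrib_left)
    moreover have "t \<in> {0..1}" "s \<in> {0..1}" using st by auto
    ultimately show ?thesis using b[of t] b[of s] by linarith
  qed
  show "1 \<le> emeasure ?m ({s<..t} \<times> {\<theta> / \<epsilon><..})" if lt: "2 * \<eta> < sk_fun (Z \<epsilon> \<omega>) t - sk_fun (Z \<epsilon> \<omega>) s"
  proof (rule window_nonempty[OF e w])
    show S: "{s<..t} \<times> {\<theta> / \<epsilon><..} \<in> sets (jump_compensator (1 / \<epsilon>) \<nu>)"
      using st T by (intro window_sets(2)[OF e w]) (auto simp: T_def)
    have pos: "0 < \<epsilon> * (LINT p : ?W | ?m. snd p)" using d lt by linarith
    show "emeasure ?m ({s<..t} \<times> {\<theta> / \<epsilon><..}) \<noteq> 0"
    proof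
      assume z: "emeasure ?m ({s<..t} \<times> {\<theta> / \<epsilon><..}) = 0"
      have "{s<..t} \<times> {\<theta> / \<epsilon><..} \<in> sets ?m" using S jp.sets_N[OF w] by simp
      then have "AE p in ?m. p \<notin> {s<..t} \<times> {\<theta> / \<epsilon><..}" using z by (intro AE_not_in null_setsI)
      then have "AE p in ?m. indicator ?W p *\<^sub>R snd p \<le> 0"
        by eventually_elim (use T in \<open>auto simp: indicator_def far_def T_def[symmetric] mem_Times_iff\<close>)
      then have "(LINT p : ?W | ?m. snd p) \<le> (LINT p | ?m. 0)"
        unfolding set_lebesgue_integral_def using iW unfolding set_integrable_def by (intro integral_mono_AE) auto
      then have "\<epsilon> * (LINT p : ?W | ?m. snd p) \<le> 0" using e by (simp add: mult_le_0_iff)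
      then show False using pos by linarith
    qed
  qed
  show "1 \<le> emeasure ?m ({s<..t} \<times> {..<- (\<theta> / \<epsilon>)})" if lt: "2 * \<eta> < sk_fun (Z \<epsilon> \<omega>) s - sk_fun (Z \<epsilon> \<omega>) t"
  proof (rule window_nonempty[OF e w])
    show S: "{s<..t} \<times> {..<- (\<theta> / \<epsilon>)} \<in> sets (jump_compensator (1 / \<epsilon>) \<nu>)"
      using st T by (intro window_sets(2)[OF e w]) (auto simp: T_def)
    have neg: "\<epsilon> * (LINT p : ?W | ?m. snd p) < 0" using d lt by linarith
    show "emeasure ?m ({s<..t} \<times> {..<- (\<theta> / \<epsilon>)}) \<noteq> 0"
    proof
      assume z: "emeasure ?m ({s<..t} \<times> {..<- (\<theta> / \<epsilon>)}) = 0"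
      have "{s<..t} \<times> {..<- (\<theta> / \<epsilon>)} \<in> sets ?m" using S jp.sets_N[OF w] by simp
      then have "AE p in ?m. p \<notin> {s<..t} \<times> {..<- (\<theta> / \<epsilon>)}" using z by (intro AE_not_in null_setsI)
      then have "AE p in ?m. 0 \<le> indicator ?W p *\<^sub>R snd p"
        by eventually_elim (use T in \<open>auto simp: indicator_def far_def T_def[symmetric] mem_Times_iff\<close>)
      then have "(LINT p | ?m. 0) \<le> (LINT p : ?W | ?m. snd p)"
        unfolding set_lebesgue_integral_def using iW unfolding set_integrable_def by (intro integral_mono_AE) auto
      then have "0 \<le> \<epsilon> * (LINT p : ?W | ?m. snd p)" using e by simp
      then show False using neg by linarith
    qed
  qed
qed

lemma many_windows:
  assumes e: "0 < \<epsilon>" and w: "\<omega> \<in> space M" and A: "A \<in> sets borel" "0 \<notin> A"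
    and v: "v ` {..m} \<subseteq> {0..1}" "strict_mono_on {..m::nat} v" and I: "I \<subseteq> {..<m}"
    and pts: "\<And>i. i \<in> I \<Longrightarrow> 1 \<le> emeasure (N \<epsilon> \<omega>) ({v i<..v (Suc i)} \<times> A)"
  shows "of_nat (card I) \<le> emeasure (N \<epsilon> \<omega>) ({0<..1} \<times> A)"
proof -
  let ?m = "N \<epsilon> \<omega>"
  have fin: "finite I" using I finite_subset by blast
  have v01: "0 \<le> v i" "v i \<le> 1" if "i \<le> m" for i using v(1) that by force+
  have vmono: "v i \<le> v j" if "i \<le> j" "j \<le> m" for i j
    using strict_mono_onD[OF v(2), of i j] that by (cases "i = j") auto
  have sub: "{v i<..v (Suc i)} \<subseteq> {0<..1}" if "i \<in> I" for i
    using that I v01[of i] v01[of "Suc i"] by fastforce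
  have S: "{v i<..v (Suc i)} \<times> A \<in> sets ?m" if "i \<in> I" for i
    using sub[OF that] by (intro window_sets(1)[OF e w] A) auto
  have dj: "disjoint_family_on (\<lambda>i. {v i<..v (Suc i)} \<times> A) I"
  proof (unfold disjoint_family_on_def, intro ballI impI)
    fix i j assume ij: "i \<in> I" "j \<in> I" "i \<noteq> j"
    have *: "({v i<..v (Suc i)} \<times> A) \<inter> ({v j<..v (Suc j)} \<times> A) = {}" if "i \<in> I" "j \<in> I" "i < j" for i j
    proof -
      have "v (Suc i) \<le> v j" using that I by (intro vmono) auto
      then show ?thesis by auto
    qed
    show "({v i<..v (Suc i)} \<times> A) \<inter> ({v j<..v (Suc j)} \<times> A) = {}"
      using *[of i j] *[of j i] ij by (cases "i < j") (auto simp: Int_commute)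
  qed
  have "of_nat (card I) = (\<Sum>i\<in>I. 1 :: ennreal)" by simp
  also have "\<dots> \<le> (\<Sum>i\<in>I. emeasure ?m ({v i<..v (Suc i)} \<times> A))" using pts by (intro sum_mono)
  also have "\<dots> = emeasure ?m (\<Union>i\<in>I. {v i<..v (Suc i)} \<times> A)"
    using S dj fin by (intro sum_emeasure) auto
  also have "\<dots> \<le> emeasure ?m ({0<..1} \<times> A)"
  proof (rule emeasure_mono)
    show "(\<Union>i\<in>I. {v i<..v (Suc i)} \<times> A) \<subseteq> {0<..1} \<times> A" using sub by blast
    show "{0<..1} \<times> A \<in> sets ?m" by (intro window_sets(1)[OF e w] A) auto
  qed
  finally show ?thesis .
qed

lemma ball_time_change:
  assumes "dist g (Z \<epsilon> \<omega>) < r"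
  shows "\<exists>l\<in>time_changes. \<forall>t\<in>{0..1}. \<bar>l t - t\<bar> < r \<and> \<bar>sk_fun (Z \<epsilon> \<omega>) (l t) - sk_fun g t\<bar> < r"
  using sk_dist_lessD[of "Z \<epsilon> \<omega>" g r] assms by (simp add: dist_commute)

text \<open>
  A path in the ball follows the chain along a time change, so each step of the chain forces a large
  jump of the same sign in a time window of its own.
\<close>

lemma chain_increments:
  assumes e: "0 < \<epsilon>" and w: "\<omega> \<in> space M" and \<theta>: "0 < \<theta>" and g: "good \<epsilon> \<theta> (h / 8) \<omega>" and h: "0 < h"
    and ch: "chain x m u" and gap: "\<And>i. i < m \<Longrightarrow> h \<le> \<bar>sk_fun x (u (Suc i)) - sk_fun x (u i)\<bar>"
    and d: "dist x (Z \<epsilon> \<omega>) < h / 8"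
  shows "of_nat (ups x m u) \<le> emeasure (N \<epsilon> \<omega>) ({0<..1} \<times> {\<theta> / \<epsilon><..})"
    and "of_nat (downs x m u) \<le> emeasure (N \<epsilon> \<omega>) ({0<..1} \<times> {..<- (\<theta> / \<epsilon>)})"
proof -
  obtain l where l: "l \<in> time_changes" "\<forall>t\<in>{0..1}. \<bar>l t - t\<bar> < h / 8 \<and> \<bar>sk_fun (Z \<epsilon> \<omega>) (l t) - sk_fun x t\<bar> < h / 8"
    using ball_time_change[OF d] by blast
  define v where "v i = l (u i)" for i
  have u01: "u i \<in> {0..1}" if "i \<le> m" for i using ch that by (auto simp: chain_def)
  have um: "strict_mono_on {..m} u" using ch by (simp add: chain_def)
  have v: "v ` {..m} \<subseteq> {0..1}" using u01 time_changesD(3)[OF l(1)] by (auto simp: v_def)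
  have vm: "strict_mono_on {..m} v"
  proof (rule strict_mono_onI)
    fix i j assume ij: "i \<in> {..m}" "j \<in> {..m}" "i < j"
    then have "u i < u j" using strict_mono_onD[OF um] by blast
    then show "v i < v j" using time_change_less_iff[OF l(1) u01 u01] ij by (simp add: v_def)
  qed
  have near: "\<bar>sk_fun (Z \<epsilon> \<omega>) (v i) - sk_fun x (u i)\<bar> < h / 8" if "i \<le> m" for i
    using l(2) u01[OF that] by (simp add: v_def)
  have vi: "0 \<le> v i" "v i < v (Suc i)" "v (Suc i) \<le> 1" if "i < m" for i
  proof -
    have "i \<in> {..m}" "Suc i \<in> {..m}" using that by auto
    then have "v i \<in> {0..1}" "v (Suc i) \<in> {0..1}" using v by blast+
    then show "0 \<le> v i" "v (Suc i) \<le> 1" by auto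
    show "v i < v (Suc i)" using strict_mono_onD[OF vm, of i "Suc i"] that by simp
  qed
  note jump = increment_forces_jump[OF e w \<theta> g]
  have Tpos: "0 < \<theta> / \<epsilon>" using e \<theta> by simp
  show "of_nat (ups x m u) \<le> emeasure (N \<epsilon> \<omega>) ({0<..1} \<times> {\<theta> / \<epsilon><..})"
    unfolding ups_def
  proof (rule many_windows[OF e w _ _ v vm])
    fix i assume "i \<in> {i. i < m \<and> sk_fun x (u i) < sk_fun x (u (Suc i))}"
    then have i: "i < m" "sk_fun x (u i) < sk_fun x (u (Suc i))" by auto
    show "1 \<le> emeasure (N \<epsilon> \<omega>) ({v i<..v (Suc i)} \<times> {\<theta> / \<epsilon><..})"
    proof (rule jump(1)[OF vi[OF i(1)]])
      have "h \<le> sk_fun x (u (Suc i)) - sk_fun x (u i)" using gap[OF i(1)] i(2) by simp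
      then show "2 * (h / 8) < sk_fun (Z \<epsilon> \<omega>) (v (Suc i)) - sk_fun (Z \<epsilon> \<omega>) (v i)"
        using near[of i, OF less_imp_le[OF i(1)]] near[of "Suc i", OF Suc_leI[OF i(1)]] h by linarith
    qed
  qed (use Tpos in auto)
  show "of_nat (downs x m u) \<le> emeasure (N \<epsilon> \<omega>) ({0<..1} \<times> {..<- (\<theta> / \<epsilon>)})"
    unfolding downs_def
  proof (rule many_windows[OF e w _ _ v vm])
    fix i assume "i \<in> {i. i < m \<and> sk_fun x (u (Suc i)) < sk_fun x (u i)}"
    then have i: "i < m" "sk_fun x (u (Suc i)) < sk_fun x (u i)" by auto
    show "1 \<le> emeasure (N \<epsilon> \<omega>) ({v i<..v (Suc i)} \<times> {..<- (\<theta> / \<epsilon>)})"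
    proof (rule jump(2)[OF vi[OF i(1)]])
      have "h \<le> sk_fun x (u i) - sk_fun x (u (Suc i))" using gap[OF i(1)] i(2) by simp
      then show "2 * (h / 8) < sk_fun (Z \<epsilon> \<omega>) (v i) - sk_fun (Z \<epsilon> \<omega>) (v (Suc i))"
        using near[of i, OF less_imp_le[OF i(1)]] near[of "Suc i", OF Suc_leI[OF i(1)]] h by linarith
    qed
  qed (use Tpos in auto)
qed

lemma many_jumps_probability:
  assumes \<theta>: "0 < \<theta>" and d: "0 < d"
  shows "\<forall>\<^sub>F \<epsilon> in at_right 0.
    {\<omega> \<in> space M. of_nat p \<le> emeasure (N \<epsilon> \<omega>) ({0<..1} \<times> {\<theta> / \<epsilon><..}) \<and> of_nat k \<le> emeasure (N \<epsilon> \<omega>) ({0<..1} \<times> {..<- (\<theta> / \<epsilon>)})} \<in> events \<and>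
    prob {\<omega> \<in> space M. of_nat p \<le> emeasure (N \<epsilon> \<omega>) ({0<..1} \<times> {\<theta> / \<epsilon><..}) \<and> of_nat k \<le> emeasure (N \<epsilon> \<omega>) ({0<..1} \<times> {..<- (\<theta> / \<epsilon>)})}
      \<le> \<epsilon> powr ((\<alpha> - 1 - d) * real p + (\<beta> - 1 - d) * real k)"
proof -
  have "\<forall>\<^sub>F \<epsilon> in at_right (0::real). 0 < \<epsilon>" by (rule eventually_at_right_less)
  from this regular_tail.scaled_tail_upper[OF up \<theta> d] regular_tail.scaled_tail_upper[OF down \<theta> d] show ?thesis
  proof eventually_elim
    case (elim \<epsilon>)
    interpret jp: compensated_jumps M "N \<epsilon>" "1 / \<epsilon>" \<nu> "J \<epsilon>" by (rule jumps[OF elim(1)])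
    let ?P = "{\<theta> / \<epsilon><..}" and ?Q = "{..<- (\<theta> / \<epsilon>)}"
    let ?I = "{0<..1::real}"
    have T: "0 < \<theta> / \<epsilon>" using elim \<theta> by simp
    have sP: "?P \<in> sets \<nu>" "?Q \<in> sets \<nu>" using T by (auto intro!: borel_sets_nu)
    have sub: "?P \<subseteq> {\<theta> / \<epsilon>..}" "?Q \<subseteq> {..- (\<theta> / \<epsilon>)}" by auto
    have sT: "{\<theta> / \<epsilon>..} \<in> sets \<nu>" "{..- (\<theta> / \<epsilon>)} \<in> sets \<nu>" using T by (auto intro!: borel_sets_nu)
    have fP: "emeasure \<nu> ?P < \<infinity>" by (rule le_less_trans[OF emeasure_mono[OF sub(1) sT(1)] up_finite[OF T]])
    have fQ: "emeasure \<nu> ?Q < \<infinity>" by (rule le_less_trans[OF emeasure_mono[OF sub(2) sT(2)] down_finite[OF T]])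
    have mP: "measure jp.\<mu> (?I \<times> ?P) \<le> \<epsilon> powr (\<alpha> - 1 - d)"
    proof -
      have "measure jp.\<mu> (?I \<times> ?P) = 1 / \<epsilon> * (measure lborel ?I * measure \<nu> ?P)" using sP by (intro jp.slab_measure) auto
      also have "measure lborel ?I = 1" by simp
      also have "measure \<nu> ?P \<le> measure \<nu> {\<theta> / \<epsilon>..}"
        using sub sP sT up_finite[OF T] by (intro measure_mono_fmeasurable) (auto simp: fmeasurable_def)
      finally show ?thesis using elim by (simp add: divide_right_mono)
    qed
    have mQ: "measure jp.\<mu> (?I \<times> ?Q) \<le> \<epsilon> powr (\<beta> - 1 - d)"
    proof -
      have "measure jp.\<mu> (?I \<times> ?Q) = 1 / \<epsilon> * (measure lborel ?I * measure \<nu> ?Q)" using sP by (intro jp.slab_measure) auto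
      also have "measure lborel ?I = 1" by simp
      also have "measure \<nu> ?Q \<le> measure \<nu> {..- (\<theta> / \<epsilon>)}"
        using sub sP sT down_finite[OF T] by (intro measure_mono_fmeasurable) (auto simp: fmeasurable_def)
      finally show ?thesis using elim by (simp add: divide_right_mono)
    qed
    have S: "?I \<times> ?P \<in> sets jp.\<mu>" "?I \<times> ?Q \<in> sets jp.\<mu>" using sP by (auto intro!: jp.slab_sets)
    have dj: "(?I \<times> ?P) \<inter> (?I \<times> ?Q) = {}" using T by auto
    have F: "emeasure jp.\<mu> (?I \<times> ?P) < \<infinity>" "emeasure jp.\<mu> (?I \<times> ?Q) < \<infinity>" 
      by (rule jp.slab_finite[OF _ _ sP(1) fP], simp, simp add: subset_iff, rule jp.slab_finite[OF _ _ sP(2) fQ], simp, simp add: subset_iff)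
    note two = jp.two_tails[OF S dj F, of p k]
    have "measure jp.\<mu> (?I \<times> ?P) ^ p * measure jp.\<mu> (?I \<times> ?Q) ^ k \<le> (\<epsilon> powr (\<alpha> - 1 - d)) ^ p * (\<epsilon> powr (\<beta> - 1 - d)) ^ k"
      using mP mQ by (intro mult_mono power_mono) auto
    also have "\<dots> = \<epsilon> powr ((\<alpha> - 1 - d) * real p + (\<beta> - 1 - d) * real k)"
      using elim by (simp add: powr_add powr_powr[symmetric] powr_realpow)
    finally show ?case using two by (intro conjI) (assumption, linarith)
  qed
qed

lemma some_good_event:
  assumes "0 < \<eta>"
  shows "\<exists>\<theta>>0. \<forall>\<^sub>F \<epsilon> in at_right 0. \<exists>Bad\<in>events. prob Bad \<le> \<epsilon> powr (\<bar>a\<bar> + 1) \<and> (\<forall>\<omega>\<in>space M - Bad. good \<epsilon> \<theta> \<eta> \<omega>)"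
proof -
  have "0 < \<bar>a\<bar> + 1" by simp
  from good_event[OF this assms] obtain \<theta> where \<theta>: "0 < \<theta>" "\<forall>\<theta>'. 0 < \<theta>' \<longrightarrow> \<theta>' \<le> \<theta> \<longrightarrow>
    (\<forall>\<^sub>F \<epsilon> in at_right 0. \<exists>Bad\<in>events. prob Bad \<le> \<epsilon> powr (\<bar>a\<bar> + 1) \<and> (\<forall>\<omega>\<in>space M - Bad. good \<epsilon> \<theta>' \<eta> \<omega>))"
    by (elim exE conjE) (rule that)
  show ?thesis by (rule exI[of _ \<theta>], rule conjI[OF \<theta>(1)]) (use \<theta>(2)[rule_format, OF \<theta>(1) order.refl] in simp)
qed

lemma upper_bound_start:
  assumes "sk_fun g 0 \<noteq> 0"
  shows "\<exists>r>0. \<forall>\<^sub>F \<epsilon> in at_right 0. \<exists>A\<in>events. {\<omega> \<in> space M. dist g (Z \<epsilon> \<omega>) < r} \<subseteq> A \<and> prob A \<le> \<epsilon> powr a"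
proof -
  define h where "h = \<bar>sk_fun g 0\<bar> / 4"
  have h: "0 < h" using assms by (simp add: h_def)
  obtain \<theta> where \<theta>: "0 < \<theta>" and ev: "\<forall>\<^sub>F \<epsilon> in at_right 0. \<exists>Bad\<in>events. prob Bad \<le> \<epsilon> powr (\<bar>a\<bar> + 1) \<and> (\<forall>\<omega>\<in>space M - Bad. good \<epsilon> \<theta> h \<omega>)"
    using some_good_event[OF h, of a] by blast
  have pa: "\<forall>\<^sub>F \<epsilon> in at_right (0::real). 1 * \<epsilon> powr (\<bar>a\<bar> + 1) \<le> \<epsilon> powr a" by (rule powr_absorb) simp
  have "\<forall>\<^sub>F \<epsilon> in at_right 0. \<exists>A\<in>events. {\<omega> \<in> space M. dist g (Z \<epsilon> \<omega>) < h} \<subseteq> A \<and> prob A \<le> \<epsilon> powr a"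
    using ev pa
  proof eventually_elim
    case (elim \<epsilon>)
    then obtain Bad where B: "Bad \<in> events" "prob Bad \<le> \<epsilon> powr (\<bar>a\<bar> + 1)" "\<forall>\<omega>\<in>space M - Bad. good \<epsilon> \<theta> h \<omega>" by blast
    have "{\<omega> \<in> space M. dist g (Z \<epsilon> \<omega>) < h} \<subseteq> Bad"
    proof (rule subsetI, rule ccontr)
      fix \<omega> assume w: "\<omega> \<in> {\<omega> \<in> space M. dist g (Z \<epsilon> \<omega>) < h}" "\<omega> \<notin> Bad"
      then have "good \<epsilon> \<theta> h \<omega>" using B(3) by blast
      then have "\<forall>t\<in>{0..1}. \<bar>sk_fun (Z \<epsilon> \<omega>) t - \<epsilon> * (LINT p : {0<..t} \<times> far (\<theta> / \<epsilon>) | N \<epsilon> \<omega>. snd p)\<bar> \<le> h"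
        unfolding good_def by blast
      then have z: "\<bar>sk_fun (Z \<epsilon> \<omega>) 0\<bar> \<le> h" by (auto simp: set_lebesgue_integral_def dest!: bspec[of _ _ 0])
      obtain l where l: "l \<in> time_changes" "\<forall>t\<in>{0..1}. \<bar>l t - t\<bar> < h \<and> \<bar>sk_fun (Z \<epsilon> \<omega>) (l t) - sk_fun g t\<bar> < h"
        using ball_time_change w by blast
      have "\<bar>sk_fun (Z \<epsilon> \<omega>) 0 - sk_fun g 0\<bar> < h" using bspec[OF l(2), of 0] time_change_zero[OF l(1)] by simp
      moreover have "\<bar>sk_fun g 0\<bar> = 4 * h" by (simp add: h_def)
      ultimately show False using z h by linarith
    qed
    moreover have "prob Bad \<le> \<epsilon> powr a" using B(2) elim(2) by linarith
    ultimately show ?case using B(1) by blast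
  qed
  then show ?thesis using h by blast
qed

lemma no_point_at_one:
  assumes e: "0 < \<epsilon>" and \<theta>: "0 < \<theta>"
  shows "{\<omega> \<in> space M. emeasure (N \<epsilon> \<omega>) ({1} \<times> far (\<theta> / \<epsilon>)) \<noteq> 0} \<in> events"
    and "prob {\<omega> \<in> space M. emeasure (N \<epsilon> \<omega>) ({1} \<times> far (\<theta> / \<epsilon>)) \<noteq> 0} = 0"
proof -
  interpret jp: compensated_jumps M "N \<epsilon>" "1 / \<epsilon>" \<nu> "J \<epsilon>" by (rule jumps[OF e])
  have T: "0 < \<theta> / \<epsilon>" using e \<theta> by simp
  let ?S = "{1::real} \<times> far (\<theta> / \<epsilon>)"
  have S: "?S \<in> sets jp.\<mu>" using T by (intro jp.slab_sets far_sets) auto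
  have z: "emeasure jp.\<mu> ?S = 0" using T by (subst jp.emeasure_slab) (auto intro!: far_sets)
  have m0: "measure jp.\<mu> ?S = 0" using z by (simp add: measure_def)
  let ?E = "{\<omega> \<in> space M. emeasure (N \<epsilon> \<omega>) ?S = 0}"
  have E: "?E \<in> events" using jp.N_meas[OF S] by measurable
  have c: "{\<omega> \<in> space M. emeasure (N \<epsilon> \<omega>) ?S \<noteq> 0} = space M - ?E" by auto
  show "{\<omega> \<in> space M. emeasure (N \<epsilon> \<omega>) ?S \<noteq> 0} \<in> events" unfolding c by (rule sets.compl_sets[OF E])
  have "prob ?E = 1" using jp.prob_no_points[OF S] z m0 by simp
  then show "prob {\<omega> \<in> space M. emeasure (N \<epsilon> \<omega>) ?S \<noteq> 0} = 0" unfolding c using prob_compl[OF E] by simp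
qed

text \<open>
  A path near \<open>g\<close> has a large jump in every window \<open>(s,1]\<close> with \<open>s\<close> close to \<open>1\<close>, hence a point at time
  \<open>1\<close> exactly, which is a null event.
\<close>

lemma upper_bound_jump_at_one:
  assumes "jump_at_one g"
  shows "\<exists>r>0. \<forall>\<^sub>F \<epsilon> in at_right 0. \<exists>A\<in>events. {\<omega> \<in> space M. dist g (Z \<epsilon> \<omega>) < r} \<subseteq> A \<and> prob A \<le> \<epsilon> powr a"
proof -
  obtain h c where h: "0 < h" and c: "c < 1" "0 < c" and gap: "\<forall>t. c < t \<and> t < 1 \<longrightarrow> h \<le> \<bar>sk_fun g 1 - sk_fun g t\<bar>"
    using assms unfolding jump_at_one_def by blast
  define r where "r = min (h / 4) ((1 - c) / 2)"
  have r: "0 < r" "r \<le> h / 4" "c + r < 1" using h c by (auto simp: r_def min_def field_simps)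
  obtain \<theta> where \<theta>: "0 < \<theta>" and ev: "\<forall>\<^sub>F \<epsilon> in at_right 0. \<exists>Bad\<in>events. prob Bad \<le> \<epsilon> powr (\<bar>a\<bar> + 1) \<and> (\<forall>\<omega>\<in>space M - Bad. good \<epsilon> \<theta> (h / 8) \<omega>)"
    using some_good_event[of "h / 8" a] h by auto
  have "\<forall>\<^sub>F \<epsilon> in at_right (0::real). 0 < \<epsilon>" by (rule eventually_at_right_less)
  moreover have "\<forall>\<^sub>F \<epsilon> in at_right (0::real). 1 * \<epsilon> powr (\<bar>a\<bar> + 1) \<le> \<epsilon> powr a" by (rule powr_absorb) simp
  ultimately have "\<forall>\<^sub>F \<epsilon> in at_right 0. \<exists>A\<in>events. {\<omega> \<in> space M. dist g (Z \<epsilon> \<omega>) < r} \<subseteq> A \<and> prob A \<le> \<epsilon> powr a"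
    using ev
  proof eventually_elim
    case (elim \<epsilon>)
    then obtain Bad where B: "Bad \<in> events" "prob Bad \<le> \<epsilon> powr (\<bar>a\<bar> + 1)" "\<forall>\<omega>\<in>space M - Bad. good \<epsilon> \<theta> (h / 8) \<omega>" by blast
    let ?F = "far (\<theta> / \<epsilon>)"
    define Q where "Q = {\<omega> \<in> space M. emeasure (N \<epsilon> \<omega>) ({1} \<times> ?F) \<noteq> 0}"
    have Q: "Q \<in> events" "prob Q = 0" unfolding Q_def by (rule no_point_at_one[OF elim(1) \<theta>])+
    have T: "0 < \<theta> / \<epsilon>" using elim \<theta> by simp
    have Fb: "?F \<in> sets borel" "0 \<notin> ?F" using T by (auto simp: far_def)
    have "{\<omega> \<in> space M. dist g (Z \<epsilon> \<omega>) < r} \<subseteq> Bad \<union> Q"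
    proof (rule subsetI, rule ccontr)
      fix \<omega> assume w: "\<omega> \<in> {\<omega> \<in> space M. dist g (Z \<epsilon> \<omega>) < r}" "\<omega> \<notin> Bad \<union> Q"
      have ws: "\<omega> \<in> space M" using w by blast
      have gd: "good \<epsilon> \<theta> (h / 8) \<omega>" using B(3) w by blast
      obtain l where l: "l \<in> time_changes" "\<forall>t\<in>{0..1}. \<bar>l t - t\<bar> < r \<and> \<bar>sk_fun (Z \<epsilon> \<omega>) (l t) - sk_fun g t\<bar> < r"
        using ball_time_change w by blast
      let ?m = "N \<epsilon> \<omega>"
      have one: "1 \<le> emeasure ?m ({s<..1} \<times> ?F)" if s: "c + r < s" "s < 1" for s
      proof -
        have s01: "s \<in> {0..1}" using s c r by simp
        obtain t where t: "t \<in> {0..1}" "l t = s" using time_changesD(2)[OF l(1)] s01 by (metis imageE)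
        have lt: "\<bar>l t - t\<bar> < r" "\<bar>sk_fun (Z \<epsilon> \<omega>) s - sk_fun g t\<bar> < r" using l(2) t by auto
        have ct: "c < t" using lt t s by simp
        have "t < 1" using time_change_less_iff[OF l(1) t(1), of 1] time_change_one[OF l(1)] t(2) s by simp
        then have gp: "h \<le> \<bar>sk_fun g 1 - sk_fun g t\<bar>" using gap ct by blast
        have z1: "\<bar>sk_fun (Z \<epsilon> \<omega>) 1 - sk_fun g 1\<bar> < r" using bspec[OF l(2), of 1] time_change_one[OF l(1)] by simp
        have big: "h / 2 < \<bar>sk_fun (Z \<epsilon> \<omega>) 1 - sk_fun (Z \<epsilon> \<omega>) s\<bar>"
          using gp lt(2) z1 r(2) by linarith
        have s0: "0 \<le> s" using s01 by simp
        note jump = increment_forces_jump[OF elim(1) ws \<theta> gd s0 s(2) order.refl]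
        have FS: "{s<..1} \<times> ?F \<in> sets ?m" using s0 by (intro window_sets(1)[OF elim(1) ws] Fb) auto
        consider "2 * (h / 8) < sk_fun (Z \<epsilon> \<omega>) 1 - sk_fun (Z \<epsilon> \<omega>) s" | "2 * (h / 8) < sk_fun (Z \<epsilon> \<omega>) s - sk_fun (Z \<epsilon> \<omega>) 1"
          using big h by linarith
        then show ?thesis
        proof cases
          case 1
          have "1 \<le> emeasure ?m ({s<..1} \<times> {\<theta> / \<epsilon><..})" by (rule jump(1)[OF 1])
          also have "\<dots> \<le> emeasure ?m ({s<..1} \<times> ?F)" by (rule emeasure_mono[OF _ FS]) (auto simp: far_def)
          finally show ?thesis .
        next
          case 2
          have "1 \<le> emeasure ?m ({s<..1} \<times> {..<- (\<theta> / \<epsilon>)})" by (rule jump(2)[OF 2])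
          also have "\<dots> \<le> emeasure ?m ({s<..1} \<times> ?F)" by (rule emeasure_mono[OF _ FS]) (auto simp: far_def)
          finally show ?thesis .
        qed
      qed
      \<comment> \<open>\<open>s n\<close> increases to \<open>1\<close> inside \<open>(c + r, 1)\<close>\<close>
      define k where "k = 1 - (c + r)"
      have k: "0 < k" "k < 1" using r c by (simp_all add: k_def)
      define s where "s n = 1 - k / real (n + 2)" for n :: nat
      have s: "c + r < s n" "s n < 1" for n
      proof -
        have "k / real (n + 2) < k / 1" using k by (intro divide_strict_left_mono) auto
        then show "c + r < s n" by (simp add: s_def k_def)
        show "s n < 1" using k by (simp add: s_def)
      qed
      let ?E = "\<lambda>n. {s n<..1} \<times> ?F"
      have dec: "decseq ?E"
      proof (rule decseq_SucI)
        fix n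
        have "k / real (Suc n + 2) \<le> k / real (n + 2)" using k by (intro divide_left_mono) auto
        then have "s n \<le> s (Suc n)" by (simp add: s_def)
        then show "?E (Suc n) \<subseteq> ?E n" by auto
      qed
      have SE: "?E n \<in> sets ?m" for n using s[of n] c r by (intro window_sets(1)[OF elim(1) ws] Fb) auto
      have fin: "emeasure ?m (?E n) \<noteq> \<infinity>" for n
      proof -
        have "emeasure ?m (?E n) \<le> emeasure ?m ({0<..1} \<times> ?F)"
          by (rule emeasure_mono) (use s[of n] c r in \<open>auto intro!: window_sets(1)[OF elim(1) ws] Fb\<close>)
        also have "\<dots> < \<infinity>" using gd unfolding good_def by blast
        finally show ?thesis by simp
      qed
      have int: "(\<Inter>n. ?E n) = {1} \<times> ?F"
      proof (rule set_eqI, rule iffI)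
        fix p :: "real \<times> real" assume p: "p \<in> (\<Inter>n. ?E n)"
        have le: "fst p \<le> 1" "snd p \<in> ?F" using p by auto
        have "fst p = 1"
        proof (rule ccontr)
          assume "fst p \<noteq> 1"
          then have q: "0 < (1 - fst p) / k" using le k by simp
          then obtain n where "1 / real (Suc n) < (1 - fst p) / k" using nat_approx_posE by blast
          then have n: "k / real (Suc n) < 1 - fst p" using k by (simp add: field_simps)
          have "k / real (n + 2) \<le> k / real (Suc n)" using k by (intro divide_left_mono) auto
          then have "fst p < s n" using n by (simp add: s_def)
          moreover have "s n < fst p" using p by auto
          ultimately show False by simp
        qed
        then show "p \<in> {1} \<times> ?F" using le by (simp add: mem_Times_iff)
      next
        fix p :: "real \<times> real" assume "p \<in> {1} \<times> ?F"
        then show "p \<in> (\<Inter>n. ?E n)" using s(2) by (auto simp: mem_Times_iff)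
      qed
      have "(\<lambda>n. emeasure ?m (?E n)) \<longlonglongrightarrow> emeasure ?m (\<Inter>n. ?E n)"
        using SE by (intro Lim_emeasure_decseq dec fin) blast
      then have "1 \<le> emeasure ?m (\<Inter>n. ?E n)"
        by (rule LIMSEQ_le_const) (use one[OF s] in blast)
      then have "emeasure ?m ({1} \<times> ?F) \<noteq> 0" unfolding int by auto
      then have "\<omega> \<in> Q" using ws by (simp add: Q_def)
      then show False using w by blast
    qed
    moreover have "prob (Bad \<union> Q) \<le> \<epsilon> powr a"
      using measure_Un_le[OF B(1) Q(1)] Q(2) B(2) elim(2) by linarith
    ultimately show ?case using sets.Un[OF B(1) Q(1)] by blast
  qed
  then show ?thesis using r by blast
qed

lemma upper_bound_chain:
  assumes ch: "chain g m u" and a: "a < (\<alpha> - 1) * real (ups g m u) + (\<beta> - 1) * real (downs g m u)"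
  shows "\<exists>r>0. \<forall>\<^sub>F \<epsilon> in at_right 0. \<exists>A\<in>events. {\<omega> \<in> space M. dist g (Z \<epsilon> \<omega>) < r} \<subseteq> A \<and> prob A \<le> \<epsilon> powr a"
proof -
  define D where "D = insert 1 ((\<lambda>i. \<bar>sk_fun g (u (Suc i)) - sk_fun g (u i)\<bar>) ` {..<m})"
  define h where "h = Min D"
  have D: "finite D" "D \<noteq> {}" by (auto simp: D_def)
  have "0 < d" if "d \<in> D" for d using that ch by (auto simp: D_def chain_def)
  then have h: "0 < h" unfolding h_def using D by (subst Min_gr_iff) auto
  have gap: "h \<le> \<bar>sk_fun g (u (Suc i)) - sk_fun g (u i)\<bar>" if "i < m" for i
    unfolding h_def using that by (intro Min_le D(1)) (auto simp: D_def)
  define w where "w = (\<alpha> - 1) * real (ups g m u) + (\<beta> - 1) * real (downs g m u)"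
  \<comment> \<open>the loss \<open>d\<close> per step of the chain leaves \<open>a < b\<close>\<close>
  define d where "d = (w - a) / (2 * (real m + 1))"
  define b where "b = w - d * real m"
  have wa: "a < w" using a by (simp add: w_def)
  have d: "0 < d" using wa by (simp add: d_def)
  have b: "a < b"
  proof -
    have "d * (real m + 1) = (w - a) / 2" unfolding d_def by (simp add: field_simps)
    then have "d * real m \<le> (w - a) / 2" using d by (simp add: distrib_left)
    then show ?thesis using wa by (simp add: b_def)
  qed
  have bsum: "(\<alpha> - 1 - d) * real (ups g m u) + (\<beta> - 1 - d) * real (downs g m u) = b"
  proof -
    have "real m = real (ups g m u) + real (downs g m u)" using ups_plus_downs[OF ch] by linarith
    then show ?thesis by (simp add: b_def w_def algebra_simps)
  qed
  obtain \<theta> where \<theta>: "0 < \<theta>" and ev: "\<forall>\<^sub>F \<epsilon> in at_right 0. \<exists>Bad\<in>events. prob Bad \<le> \<epsilon> powr (\<bar>b\<bar> + 1) \<and> (\<forall>\<omega>\<in>space M - Bad. good \<epsilon> \<theta> (h / 8) \<omega>)"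
    using some_good_event[of "h / 8" b] h by auto
  have pa: "\<forall>\<^sub>F \<epsilon> in at_right (0::real). 1 * \<epsilon> powr (\<bar>b\<bar> + 1) \<le> \<epsilon> powr b" by (rule powr_absorb) simp
  have "\<forall>\<^sub>F \<epsilon> in at_right (0::real). 0 < \<epsilon>" by (rule eventually_at_right_less)
  from this ev pa powr_absorb[OF b, of 2] many_jumps_probability[OF \<theta> d, of "ups g m u" "downs g m u"]
  have "\<forall>\<^sub>F \<epsilon> in at_right 0. \<exists>A\<in>events. {\<omega> \<in> space M. dist g (Z \<epsilon> \<omega>) < h / 8} \<subseteq> A \<and> prob A \<le> \<epsilon> powr a"
  proof eventually_elim
    case (elim \<epsilon>)
    then obtain Bad where B: "Bad \<in> events" "prob Bad \<le> \<epsilon> powr (\<bar>b\<bar> + 1)" "\<forall>\<omega>\<in>space M - Bad. good \<epsilon> \<theta> (h / 8) \<omega>" by blast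
    define Q where "Q = {\<omega> \<in> space M. of_nat (ups g m u) \<le> emeasure (N \<epsilon> \<omega>) ({0<..1} \<times> {\<theta> / \<epsilon><..}) \<and>
      of_nat (downs g m u) \<le> emeasure (N \<epsilon> \<omega>) ({0<..1} \<times> {..<- (\<theta> / \<epsilon>)})}"
    have Q: "Q \<in> events" "prob Q \<le> \<epsilon> powr b" using elim(5) unfolding Q_def[symmetric] bsum by blast+
    have "{\<omega> \<in> space M. dist g (Z \<epsilon> \<omega>) < h / 8} \<subseteq> Bad \<union> Q"
    proof
      fix \<omega> assume w: "\<omega> \<in> {\<omega> \<in> space M. dist g (Z \<epsilon> \<omega>) < h / 8}"
      show "\<omega> \<in> Bad \<union> Q"
      proof (cases "\<omega> \<in> Bad")
        case False
        then have gd: "good \<epsilon> \<theta> (h / 8) \<omega>" using B(3) w by blast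
        have "\<omega> \<in> space M" "dist g (Z \<epsilon> \<omega>) < h / 8" using w by auto
        from chain_increments[OF elim(1) this(1) \<theta> gd h ch gap this(2)]
        have "\<omega> \<in> Q" using w unfolding Q_def by blast
        then show ?thesis by blast
      qed simp
    qed
    moreover have "prob (Bad \<union> Q) \<le> \<epsilon> powr a"
      using measure_Un_le[OF B(1) Q(1)] Q(2) B(2) elim(3,4) by linarith
    ultimately show ?case using sets.Un[OF B(1) Q(1)] by blast
  qed
  then show ?thesis using h by (intro exI[of _ "h / 8"]) simp
qed

lemma local_upper_bound:
  assumes "ereal a < step_rate \<alpha> \<beta> g"
  shows "\<exists>r>0. \<forall>\<^sub>F \<epsilon> in at_right 0. \<exists>A\<in>events. {\<omega> \<in> space M. dist g (Z \<epsilon> \<omega>) < r} \<subseteq> A \<and> prob A \<le> \<epsilon> powr a"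
proof -
  have ab: "1 < \<alpha>" "1 < \<beta>" using up down by (auto simp: regular_tail_def)
  from step_rate_obstruction[OF ab assms] show ?thesis
  proof (elim disjE exE conjE)
    assume "sk_fun g 0 \<noteq> 0" then show ?thesis by (rule upper_bound_start)
  next
    assume "jump_at_one g" then show ?thesis by (rule upper_bound_jump_at_one)
  next
    fix m u assume "chain g m u" "a < (\<alpha> - 1) * real (ups g m u) + (\<beta> - 1) * real (downs g m u)"
    then show ?thesis by (rule upper_bound_chain)
  qed
qed

end

section \<open>The local lower bound\<close>

text \<open>
  The number of points up to time \<open>s\<close> is \<open>0\<close> or \<open>1\<close> and right-continuous in \<open>s\<close>; the point sits at the time \<open>\<sigma>\<close>
  where it becomes \<open>1\<close>, and its size is the integral over the whole box.
\<close>

lemma single_point_box: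
  fixes m :: "(real \<times> real) measure"
  assumes ab: "a < b" and S: "\<And>s. a \<le> s \<Longrightarrow> s \<le> b \<Longrightarrow> {a<..s} \<times> W \<in> sets m"
    and one: "emeasure m ({a<..b} \<times> W) = 1"
    and int: "\<And>s. a \<le> s \<Longrightarrow> s \<le> b \<Longrightarrow> \<exists>k::nat. emeasure m ({a<..s} \<times> W) = of_nat k"
    and sm: "snd \<in> borel_measurable m" and W: "\<And>z. z \<in> W \<Longrightarrow> w1 \<le> z \<and> z \<le> w2"
  shows "\<exists>\<sigma> w. a < \<sigma> \<and> \<sigma> \<le> b \<and> w1 \<le> w \<and> w \<le> w2 \<and>
    (\<forall>t. (LINT p : {a<..min t b} \<times> W | m. snd p) = (if \<sigma> \<le> t then w else 0))"
proof -
  define G where "G s = emeasure m ({a<..s} \<times> W)" for s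
  have Gmono: "G s \<le> G s'" if "s \<le> s'" "a \<le> s'" "s' \<le> b" for s s'
    unfolding G_def using that by (intro emeasure_mono S) auto
  have G01: "G s = 0 \<or> G s = 1" if s: "a \<le> s" "s \<le> b" for s
  proof -
    obtain k :: nat where k: "G s = of_nat k" using int[OF s] by (auto simp: G_def)
    have "G s \<le> 1" using Gmono[of s b] s one by (simp add: G_def)
    then have "(of_nat k :: ennreal) \<le> of_nat 1" unfolding k by simp
    then have "k \<le> 1" by (simp only: of_nat_le_iff)
    then show ?thesis using k by (cases k) auto
  qed
  \<comment> \<open>the times by which the point has arrived\<close>
  define D where "D = {s. a < s \<and> s \<le> b \<and> G s = 1}"
  have bD: "b \<in> D" using ab one by (simp add: D_def G_def)
  have bd: "bdd_below D" by (auto simp: D_def intro!: bdd_belowI[of _ a])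
  define \<sigma> where "\<sigma> = Inf D"
  have \<sigma>b: "\<sigma> \<le> b" unfolding \<sigma>_def by (rule cInf_lower[OF bD bd])
  have a\<sigma>: "a \<le> \<sigma>" unfolding \<sigma>_def using bD by (intro cInf_greatest) (auto simp: D_def)
  have above: "G s = 1" if s: "\<sigma> < s" "s \<le> b" for s
  proof -
    obtain s' where s': "s' \<in> D" "s' < s" using cInf_lessD[of D s] bD s(1) unfolding \<sigma>_def by blast
    have "1 \<le> G s" using Gmono[of s' s] s' s by (auto simp: D_def)
    then show ?thesis using G01[of s] s a\<sigma> by auto
  qed
  have G\<sigma>: "G \<sigma> = 1"
  proof (cases "\<sigma> = b")
    case True
    then show ?thesis using one by (simp add: G_def)
  next
    case False
    then have lt: "\<sigma> < b" using \<sigma>b by simp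
    define s where "s n = \<sigma> + (b - \<sigma>) / real (Suc n)" for n
    have s: "\<sigma> < s n" "s n \<le> b" for n
    proof -
      show "\<sigma> < s n" using lt by (simp add: s_def)
      have "(b - \<sigma>) / real (Suc n) \<le> (b - \<sigma>) / 1" using lt by (intro divide_left_mono) auto
      then show "s n \<le> b" by (simp add: s_def)
    qed
    have dec: "decseq (\<lambda>n. {a<..s n} \<times> W)"
    proof (rule decseq_SucI)
      fix n
      have "(b - \<sigma>) / real (Suc (Suc n)) \<le> (b - \<sigma>) / real (Suc n)" using lt by (intro divide_left_mono) auto
      then have "s (Suc n) \<le> s n" by (simp add: s_def)
      then show "{a<..s (Suc n)} \<times> W \<subseteq> {a<..s n} \<times> W" by auto
    qed
    have lims: "s \<longlonglongrightarrow> \<sigma>"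
    proof -
      have "(\<lambda>n. \<sigma> + (b - \<sigma>) * (1 / real (Suc n))) \<longlonglongrightarrow> \<sigma> + (b - \<sigma>) * 0"
        by (intro tendsto_add tendsto_mult tendsto_const LIMSEQ_inverse_real_of_nat[unfolded inverse_eq_divide])
      then show ?thesis by (simp add: s_def[abs_def])
    qed
    have inter: "(\<Inter>n. {a<..s n} \<times> W) = {a<..\<sigma>} \<times> W"
    proof (rule set_eqI, rule iffI)
      fix p :: "real \<times> real" assume p: "p \<in> (\<Inter>n. {a<..s n} \<times> W)"
      have "fst p \<le> s n" for n using p by (auto simp: mem_Times_iff)
      then have "fst p \<le> \<sigma>" using LIMSEQ_le_const[OF lims, of "fst p"] by blast
      then show "p \<in> {a<..\<sigma>} \<times> W" using p by (auto simp: mem_Times_iff)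
    next
      fix p :: "real \<times> real" assume "p \<in> {a<..\<sigma>} \<times> W"
      then show "p \<in> (\<Inter>n. {a<..s n} \<times> W)" using s(1) by (auto simp: mem_Times_iff intro: order_trans less_imp_le)
    qed
    have Gs: "G (s n) = 1" for n by (rule above[OF s])
    have "(\<lambda>n. emeasure m ({a<..s n} \<times> W)) \<longlonglongrightarrow> emeasure m (\<Inter>n. {a<..s n} \<times> W)"
    proof (rule Lim_emeasure_decseq[OF _ dec])
      show "range (\<lambda>n. {a<..s n} \<times> W) \<subseteq> sets m" 
      proof (rule image_subsetI)
        fix n show "{a<..s n} \<times> W \<in> sets m" using s[of n] a\<sigma> by (intro S) auto
      qed
      show "emeasure m ({a<..s n} \<times> W) \<noteq> \<infinity>" for n using Gs[of n] by (simp add: G_def)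
    qed
    then have "(\<lambda>n::nat. 1) \<longlonglongrightarrow> G \<sigma>" unfolding inter using Gs unfolding G_def by simp
    then show ?thesis using LIMSEQ_unique[OF _ tendsto_const] by metis
  qed
  have a\<sigma>': "a < \<sigma>"
  proof (rule ccontr)
    assume "\<not> a < \<sigma>"
    then have "\<sigma> = a" using a\<sigma> by simp
    then show False using G\<sigma> by (simp add: G_def)
  qed
  have below: "G s = 0" if "a \<le> s" "s < \<sigma>" for s
  proof (cases "s = a")
    case False
    have "s \<notin> D" using that cInf_lower[OF _ bd, of s] unfolding \<sigma>_def by force
    then show ?thesis using G01[of s] that \<sigma>b False by (auto simp: D_def)
  qed (simp add: G_def)
  define w where "w = (LINT p : {a<..b} \<times> W | m. snd p)"
  let ?B = "{a<..b} \<times> W"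
  have SB: "?B \<in> sets m" using S ab by simp
  have ik: "set_integrable m ?B (\<lambda>_. k)" for k :: real
    unfolding set_integrable_def using SB one by (intro integrable_scaleR_left) auto
  have sb: "set_borel_measurable m ?B snd" unfolding set_borel_measurable_def
    using SB sm by (intro borel_measurable_scaleR borel_measurable_indicator)
  have iB: "set_integrable m ?B snd"
  proof -
    have ib: "integrable m (\<lambda>p. indicator ?B p *\<^sub>R (max \<bar>w1\<bar> \<bar>w2\<bar>))" using ik unfolding set_integrable_def .
    show ?thesis unfolding set_integrable_def
    proof (rule Bochner_Integration.integrable_bound[OF ib])
      show "(\<lambda>p. indicator ?B p *\<^sub>R snd p) \<in> borel_measurable m" using sb by (simp add: set_borel_measurable_def)
      show "AE p in m. norm (indicator ?B p *\<^sub>R snd p) \<le> norm (indicator ?B p *\<^sub>R (max \<bar>w1\<bar> \<bar>w2\<bar>))"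
      proof (intro always_eventually allI)
        fix p show "norm (indicator ?B p *\<^sub>R snd p) \<le> norm (indicator ?B p *\<^sub>R (max \<bar>w1\<bar> \<bar>w2\<bar>))"
          using W[of "snd p"] by (cases "p \<in> ?B") (auto simp: max_def)
      qed
    qed
  qed
  have vol: "(LINT p : ?B | m. k) = k" for k :: real
  proof -
    have "?B \<inter> space m = ?B" using sets.sets_into_space[OF SB] by auto
    then show ?thesis unfolding set_lebesgue_integral_def using one by (simp add: measure_def)
  qed
  have mono: "(LINT p : ?B | m. f p) \<le> (LINT p : ?B | m. h p)" if "set_integrable m ?B f" "set_integrable m ?B h" "\<And>p. p \<in> ?B \<Longrightarrow> f p \<le> h p" for f h :: "real \<times> real \<Rightarrow> real"
    by (rule set_integral_mono[OF that])
  have w1: "w1 \<le> w" using mono[OF ik iB, of w1] W vol[of w1] unfolding w_def by auto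
  have w2: "w \<le> w2" using mono[OF iB ik, of w2] W vol[of w2] unfolding w_def by auto
  have "(LINT p : {a<..min t b} \<times> W | m. snd p) = (if \<sigma> \<le> t then w else 0)" for t
  proof (cases "\<sigma> \<le> t")
    case True
    let ?C = "{a<..min t b} \<times> W" and ?R = "{min t b<..b} \<times> W"
    have at: "a \<le> min t b" using True a\<sigma> ab by simp
    have SC: "?C \<in> sets m" by (rule S[OF at]) simp
    have R: "?R = ?B - ?C" using at by auto
    have SR: "?R \<in> sets m" unfolding R by (rule sets.Diff[OF SB SC])
    have "G \<sigma> \<le> G (min t b)" using True \<sigma>b by (intro Gmono at) auto
    moreover have "G (min t b) = 0 \<or> G (min t b) = 1" by (rule G01[OF at]) simp
    ultimately have "G (min t b) = 1" using G\<sigma> by auto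
    then have "emeasure m ?R = 0" unfolding R using one SB SC by (subst emeasure_Diff) (auto simp: G_def)
    then have "AE p in m. p \<notin> ?R" using SR by (intro AE_not_in null_setsI)
    then have "AE p in m. indicator ?C p *\<^sub>R snd p = indicator ?B p *\<^sub>R snd p"
      by eventually_elim (auto simp: indicator_def)
    then have "(LINT p : ?C | m. snd p) = w"
      unfolding w_def set_lebesgue_integral_def using sm SB SC
      by (intro integral_cong_AE borel_measurable_scaleR borel_measurable_indicator) auto
    then show ?thesis using True by simp
  next
    case False
    show ?thesis
    proof (cases "a \<le> t")
      case True
      have m: "min t b = t" using False \<sigma>b by simp
      have SC: "{a<..t} \<times> W \<in> sets m" using S True False \<sigma>b by simp
      have "emeasure m ({a<..t} \<times> W) = 0" using below[OF True] False by (simp add: G_def)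
      then have "AE p in m. p \<notin> {a<..t} \<times> W" using SC by (intro AE_not_in null_setsI)
      then have "AE p in m. indicator ({a<..t} \<times> W) p *\<^sub>R snd p = 0" by eventually_elim (simp add: indicator_def)
      then have "(LINT p : {a<..t} \<times> W | m. snd p) = (LINT p | m. 0)"
        unfolding set_lebesgue_integral_def using sm SC
        by (intro integral_cong_AE borel_measurable_scaleR borel_measurable_indicator) auto
      then show ?thesis using False m by simp
    next
      case out: False
      then have "{a<..min t b} \<times> W = {}" by auto
      then show ?thesis using False by (simp only: set_lebesgue_integral_def) simp
    qed
  qed
  then show ?thesis using a\<sigma>' \<sigma>b w1 w2 by blast
qed

context poisson_points
begin

text \<open>
  The counts are independent since the sets are disjoint, and each of them contributes an exponential
  factor that is at least \<open>exp (- measure \<mu> U)\<close>.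
\<close>

lemma box_event_probability:
  fixes E :: "'i set" and box :: "'i \<Rightarrow> 'e set"
  assumes E: "finite E" and box: "\<And>\<tau>. \<tau> \<in> E \<Longrightarrow> box \<tau> \<in> sets \<mu>" "\<And>\<tau>. \<tau> \<in> E \<Longrightarrow> box \<tau> \<subseteq> U"
    and dj: "disjoint_family_on box E" and U: "U \<in> sets \<mu>" "emeasure \<mu> U < \<infinity>"
  defines "Ev \<equiv> {\<omega> \<in> space M. (\<forall>\<tau>\<in>E. emeasure (N \<omega>) (box \<tau>) = 1) \<and> emeasure (N \<omega>) (U - (\<Union>\<tau>\<in>E. box \<tau>)) = 0}"
  shows "Ev \<in> events" and "exp (- measure \<mu> U) ^ Suc (card E) * (\<Prod>\<tau>\<in>E. measure \<mu> (box \<tau>)) \<le> prob Ev"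
proof -
  define n where "n = card E"
  obtain e where e: "bij_betw e {0..<n} E" using ex_bij_betw_nat_finite[OF E] by (auto simp: n_def)
  have eE: "e i \<in> E" if "i < n" for i using e that by (auto simp: bij_betw_def)
  let ?R = "U - (\<Union>\<tau>\<in>E. box \<tau>)"
  define A where "A i = (if i < n then box (e i) else ?R)" for i
  have R: "?R \<in> sets \<mu>" using box(1) U(1) E by (intro sets.Diff sets.finite_UN) auto
  have As: "A i \<in> sets \<mu>" for i unfolding A_def using R box(1) eE by auto
  have AU: "A i \<subseteq> U" for i unfolding A_def using box(2) eE by auto
  have Af: "emeasure \<mu> (A i) < \<infinity>" for i by (rule le_less_trans[OF emeasure_mono[OF AU U(1)] U(2)])
  have Am: "measure \<mu> (A i) \<le> measure \<mu> U" for i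
    using AU As U by (intro measure_mono_fmeasurable) (auto simp: fmeasurable_def)
  have Adj: "disjoint_family_on A {..<Suc n}"
  proof (unfold disjoint_family_on_def, intro ballI impI)
    fix i j assume ij: "i \<in> {..<Suc n}" "j \<in> {..<Suc n}" "i \<noteq> j"
    consider "i < n" "j < n" | "i < n" "j = n" | "i = n" "j < n" using ij by fastforce
    then show "A i \<inter> A j = {}"
    proof cases
      case 1
      then have "e i \<noteq> e j" using e ij by (auto simp: bij_betw_def inj_on_def)
      then have "box (e i) \<inter> box (e j) = {}" using dj eE 1 unfolding disjoint_family_on_def by blast
      then show ?thesis using 1 by (simp add: A_def)
    next
      case 2 then show ?thesis using eE[of i] by (auto simp: A_def)
    next
      case 3 then show ?thesis using eE[of j] by (auto simp: A_def)
    qed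
  qed
  define V where "V i = (if i < n then {1} else {0 :: ennreal})" for i
  have iv: "indep_vars (\<lambda>_. borel) (\<lambda>i \<omega>. emeasure (N \<omega>) (A i)) {..<Suc n}"
    by (rule N_indep[OF As Adj])
  have EvI: "Ev = (\<Inter>i\<in>{..<Suc n}. (\<lambda>\<omega>. emeasure (N \<omega>) (A i)) -` V i \<inter> space M)"
  proof (rule set_eqI)
    fix \<omega>
    have all: "(\<forall>\<tau>\<in>E. P \<tau>) \<longleftrightarrow> (\<forall>i<n. P (e i))" for P
      using e by (auto simp: bij_betw_def)
    have box1: "emeasure (N \<omega>) (A i) = emeasure (N \<omega>) (box (e i))" "V i = {1}" if "i < n" for i
      using that by (simp_all add: A_def V_def)
    have rest1: "A n = ?R" "V n = {0}" by (simp_all add: A_def V_def)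
    have "\<omega> \<in> (\<Inter>i\<in>{..<Suc n}. (\<lambda>\<omega>. emeasure (N \<omega>) (A i)) -` V i \<inter> space M) \<longleftrightarrow>
        \<omega> \<in> space M \<and> (\<forall>i<n. emeasure (N \<omega>) (A i) \<in> V i) \<and> emeasure (N \<omega>) (A n) \<in> V n"
      by (simp only: INT_iff Int_iff vimage_eq lessThan_Suc) blast
    also have "\<dots> \<longleftrightarrow> \<omega> \<in> space M \<and> (\<forall>i<n. emeasure (N \<omega>) (box (e i)) = 1) \<and> emeasure (N \<omega>) ?R = 0"
      unfolding rest1 using box1 by simp
    also have "\<dots> \<longleftrightarrow> \<omega> \<in> Ev" unfolding Ev_def mem_Collect_eq all[of "\<lambda>\<tau>. emeasure (N \<omega>) (box \<tau>) = 1"] ..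
    finally show "\<omega> \<in> Ev \<longleftrightarrow> \<omega> \<in> (\<Inter>i\<in>{..<Suc n}. (\<lambda>\<omega>. emeasure (N \<omega>) (A i)) -` V i \<inter> space M)" by simp
  qed
  have pv: "(\<lambda>\<omega>. emeasure (N \<omega>) (A i)) -` V i \<inter> space M = {\<omega> \<in> space M. emeasure (N \<omega>) (A i) = (if i < n then 1 else 0)}" for i
    by (auto simp: V_def)
  show "Ev \<in> events"
  proof -
    have "(\<lambda>\<omega>. emeasure (N \<omega>) (A i)) -` V i \<inter> space M \<in> events" for i
      by (rule measurable_sets[OF N_meas[OF As[of i]]]) (simp add: V_def)
    then show ?thesis unfolding EvI by (rule sets.finite_INT[OF finite_lessThan, rotated]) (simp add: lessThan_Suc)
  qed
  have "prob Ev = (\<Prod>i\<in>{..<Suc n}. prob ((\<lambda>\<omega>. emeasure (N \<omega>) (A i)) -` V i \<inter> space M))"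
    unfolding EvI by (rule indep_varsD[OF iv]) (auto simp: V_def)
  also have "\<dots> = (\<Prod>i<n. exp (- measure \<mu> (A i)) * measure \<mu> (A i)) * exp (- measure \<mu> (A n))"
    unfolding pv lessThan_Suc using prob_one_point[OF As Af] prob_no_points[OF As Af] by (simp add: mult.commute)
  finally have eq: "prob Ev = (\<Prod>i<n. exp (- measure \<mu> (A i)) * measure \<mu> (A i)) * exp (- measure \<mu> (A n))" .
  have le: "(\<Prod>i<n. exp (- measure \<mu> U) * measure \<mu> (A i)) * exp (- measure \<mu> U) \<le> prob Ev"
    unfolding eq using Am by (intro mult_mono prod_mono prod_nonneg conjI) (auto intro!: mult_right_mono)
  have "exp (- measure \<mu> U) ^ Suc n * (\<Prod>i<n. measure \<mu> (A i)) =
      (\<Prod>i<n. exp (- measure \<mu> U) * measure \<mu> (A i)) * exp (- measure \<mu> U)"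
    by (simp only: prod.distrib prod_constant card_lessThan power_Suc mult_ac)
  also note le
  also have "(\<Prod>i<n. measure \<mu> (A i)) = (\<Prod>i\<in>{0..<n}. measure \<mu> (box (e i)))"
    by (intro prod.cong) (auto simp: A_def)
  also have "\<dots> = (\<Prod>\<tau>\<in>E. measure \<mu> (box \<tau>))" by (rule prod.reindex_bij_betw[OF e])
  finally show "exp (- measure \<mu> U) ^ Suc (card E) * (\<Prod>\<tau>\<in>E. measure \<mu> (box \<tau>)) \<le> prob Ev" by (simp add: n_def)
qed

end

context small_noise
begin

text \<open>
  Closed at the end nearer to \<open>0\<close> and open at the other one, so that its measure is a difference of
  tails of closed half-lines.
\<close>

definition window :: "real \<Rightarrow> real \<Rightarrow> real \<Rightarrow> real set" where
  "window \<epsilon> \<rho> z = (if 0 < z then {(z - \<rho>) / \<epsilon>..<(z + \<rho>) / \<epsilon>} else {(z - \<rho>) / \<epsilon><..(z + \<rho>) / \<epsilon>})"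

text \<open>
  The large jumps of \<open>Z\<close> are then those of \<open>g\<close>, displaced by at most \<open>\<rho>\<close> in time and in size. A time change
  through the displaced jump times aligns the two paths.
\<close>

lemma boxes_near_path:
  assumes e: "0 < \<epsilon>" and w: "\<omega> \<in> space M" and gd: "good \<epsilon> \<theta> \<eta> \<omega>"
    and E: "finite E" "E \<subseteq> {0<..<1}" and \<theta>: "0 < \<theta>"
    and times: "\<And>\<tau>. \<tau> \<in> E \<Longrightarrow> \<rho> < \<tau> \<and> \<tau> + \<rho> \<le> 1" and \<rho>: "0 < \<rho>"
    and sizes: "\<And>\<tau>. \<tau> \<in> E \<Longrightarrow> \<theta> + \<rho> < \<bar>z \<tau>\<bar>"
    and sep: "\<And>s t. s \<in> E \<Longrightarrow> t \<in> E \<Longrightarrow> s \<noteq> t \<Longrightarrow> 2 * \<rho> < \<bar>s - t\<bar>"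
    and tc: "\<And>\<sigma>. (\<And>t. t \<in> E \<Longrightarrow> \<bar>\<sigma> t - t\<bar> \<le> \<rho>) \<Longrightarrow> \<exists>l\<in>time_changes. (\<forall>t\<in>E. l t = \<sigma> t) \<and> (\<forall>t\<in>{0..1}. \<bar>l t - t\<bar> \<le> r)"
    and g: "\<And>t. t \<in> {0..1} \<Longrightarrow> sk_fun g t = (\<Sum>s\<in>E. if s \<le> t then z s else 0)"
    and one: "\<forall>\<tau>\<in>E. emeasure (N \<epsilon> \<omega>) ({\<tau> - \<rho><..\<tau> + \<rho>} \<times> window \<epsilon> \<rho> (z \<tau>)) = 1"
    and rest: "emeasure (N \<epsilon> \<omega>) ({0<..1} \<times> far (\<theta> / \<epsilon>) - (\<Union>\<tau>\<in>E. {\<tau> - \<rho><..\<tau> + \<rho>} \<times> window \<epsilon> \<rho> (z \<tau>))) = 0"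
    and small: "\<eta> + real (card E) * \<rho> \<le> r"
  shows "dist g (Z \<epsilon> \<omega>) \<le> r"
proof -
  interpret jp: compensated_jumps M "N \<epsilon>" "1 / \<epsilon>" \<nu> "J \<epsilon>" by (rule jumps[OF e])
  let ?m = "N \<epsilon> \<omega>" and ?F = "far (\<theta> / \<epsilon>)"
  let ?W = "\<lambda>\<tau>. window \<epsilon> \<rho> (z \<tau>)"
  let ?box = "\<lambda>\<tau>. {\<tau> - \<rho><..\<tau> + \<rho>} \<times> ?W \<tau>"
  have T: "0 < \<theta> / \<epsilon>" using e \<theta> by simp
  have Wb: "?W \<tau> \<in> sets borel" for \<tau> by (simp add: window_def)
  have Wr: "(z \<tau> - \<rho>) / \<epsilon> \<le> x \<and> x \<le> (z \<tau> + \<rho>) / \<epsilon>" if "x \<in> ?W \<tau>" for x \<tau>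
    using that by (auto simp: window_def split: if_splits)
  have WF: "?W \<tau> \<subseteq> ?F" if \<tau>: "\<tau> \<in> E" for \<tau>
  proof
    fix x assume x: "x \<in> ?W \<tau>"
    have x': "z \<tau> - \<rho> \<le> \<epsilon> * x" "\<epsilon> * x \<le> z \<tau> + \<rho>" using Wr[OF x] e by (auto simp: field_simps)
    have "\<theta> < \<bar>\<epsilon> * x\<bar>" using sizes[OF \<tau>] x' by linarith
    then have "\<theta> / \<epsilon> < \<bar>x\<bar>" using e by (simp add: abs_mult field_simps)
    then show "x \<in> ?F" by (simp add: far_def)
  qed
  have W0: "0 \<notin> ?W \<tau>" if "\<tau> \<in> E" for \<tau> using WF[OF that] T by (auto simp: far_def)
  have sm: "snd \<in> borel_measurable ?m" by (rule jp.snd_measurable_N[OF w])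
  have bx: "\<exists>\<sigma> v. \<tau> - \<rho> < \<sigma> \<and> \<sigma> \<le> \<tau> + \<rho> \<and> (z \<tau> - \<rho>) / \<epsilon> \<le> v \<and> v \<le> (z \<tau> + \<rho>) / \<epsilon> \<and>
      (\<forall>t. (LINT p : {\<tau> - \<rho><..min t (\<tau> + \<rho>)} \<times> ?W \<tau> | ?m. snd p) = (if \<sigma> \<le> t then v else 0))" if \<tau>: "\<tau> \<in> E" for \<tau>
  proof (rule single_point_box)
    show "\<tau> - \<rho> < \<tau> + \<rho>" using \<rho> by simp
    fix s assume s: "\<tau> - \<rho> \<le> s" "s \<le> \<tau> + \<rho>"
    have sub: "{\<tau> - \<rho><..s} \<subseteq> {0..1}" using times[OF \<tau>] s by auto
    show "{\<tau> - \<rho><..s} \<times> ?W \<tau> \<in> sets ?m" using sub by (intro window_sets(1)[OF e w] Wb W0 \<tau>) auto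
    have S: "{\<tau> - \<rho><..s} \<times> ?W \<tau> \<in> sets jp.\<mu>" using sub by (intro window_sets(2)[OF e w] Wb W0 \<tau>) auto
    have "emeasure ?m ({\<tau> - \<rho><..s} \<times> ?W \<tau>) \<le> emeasure ?m (?box \<tau>)"
      using s times[OF \<tau>] by (intro emeasure_mono window_sets(1)[OF e w] Wb W0 \<tau>) auto
    then have "emeasure ?m ({\<tau> - \<rho><..s} \<times> ?W \<tau>) \<noteq> \<infinity>" using one \<tau> by (auto simp: top_unique)
    then show "\<exists>k::nat. emeasure ?m ({\<tau> - \<rho><..s} \<times> ?W \<tau>) = of_nat k" by (rule jp.N_values[OF w S])
  next
    show "emeasure ?m (?box \<tau>) = 1" using one \<tau> by blast
    show "snd \<in> borel_measurable ?m" by (rule sm)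
    fix x assume "x \<in> ?W \<tau>" then show "(z \<tau> - \<rho>) / \<epsilon> \<le> x \<and> x \<le> (z \<tau> + \<rho>) / \<epsilon>" by (rule Wr)
  qed
  have "\<forall>\<tau>\<in>E. \<exists>\<sigma> v. \<tau> - \<rho> < \<sigma> \<and> \<sigma> \<le> \<tau> + \<rho> \<and> (z \<tau> - \<rho>) / \<epsilon> \<le> v \<and> v \<le> (z \<tau> + \<rho>) / \<epsilon> \<and>
      (\<forall>t. (LINT p : {\<tau> - \<rho><..min t (\<tau> + \<rho>)} \<times> ?W \<tau> | ?m. snd p) = (if \<sigma> \<le> t then v else 0))" using bx by blast
  then obtain \<sigma> v where sv: "\<forall>\<tau>\<in>E. \<tau> - \<rho> < \<sigma> \<tau> \<and> \<sigma> \<tau> \<le> \<tau> + \<rho> \<and> (z \<tau> - \<rho>) / \<epsilon> \<le> v \<tau> \<and> v \<tau> \<le> (z \<tau> + \<rho>) / \<epsilon> \<and>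
      (\<forall>t. (LINT p : {\<tau> - \<rho><..min t (\<tau> + \<rho>)} \<times> ?W \<tau> | ?m. snd p) = (if \<sigma> \<tau> \<le> t then v \<tau> else 0))"
    unfolding bchoice_iff by (elim exE) (rule that)
  have S\<tau>: "\<bar>\<sigma> \<tau> - \<tau>\<bar> \<le> \<rho>" "\<bar>\<epsilon> * v \<tau> - z \<tau>\<bar> \<le> \<rho>"
    "(LINT p : {\<tau> - \<rho><..min t (\<tau> + \<rho>)} \<times> ?W \<tau> | ?m. snd p) = (if \<sigma> \<tau> \<le> t then v \<tau> else 0)" if "\<tau> \<in> E" for \<tau> t
  proof -
    note b = bspec[OF sv that]
    show "\<bar>\<sigma> \<tau> - \<tau>\<bar> \<le> \<rho>" using b by (simp add: abs_le_iff)
    have "z \<tau> - \<rho> \<le> \<epsilon> * v \<tau>" "\<epsilon> * v \<tau> \<le> z \<tau> + \<rho>" using b e by (auto simp: field_simps)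
    then show "\<bar>\<epsilon> * v \<tau> - z \<tau>\<bar> \<le> \<rho>" by (simp add: abs_le_iff)
    show "(LINT p : {\<tau> - \<rho><..min t (\<tau> + \<rho>)} \<times> ?W \<tau> | ?m. snd p) = (if \<sigma> \<tau> \<le> t then v \<tau> else 0)" using b by blast
  qed
  obtain l where l: "l \<in> time_changes" "\<forall>t\<in>E. l t = \<sigma> t" "\<forall>t\<in>{0..1}. \<bar>l t - t\<bar> \<le> r"
    using tc[of \<sigma>] S\<tau>(1) by blast
  have i1: "set_integrable ?m ({0<..1} \<times> ?F) snd" using gd unfolding good_def by blast
  have Fb: "?F \<in> sets borel" "0 \<notin> ?F" using T by (auto simp: far_def)
  have big: "(LINT p : {0<..t} \<times> ?F | ?m. snd p) = (\<Sum>\<tau>\<in>E. if \<sigma> \<tau> \<le> t then v \<tau> else 0)" if t: "t \<in> {0..1}" for t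
  proof -
    let ?R = "{0<..1} \<times> ?F - (\<Union>\<tau>\<in>E. ?box \<tau>)"
    let ?C = "\<lambda>\<tau>. {\<tau> - \<rho><..min t (\<tau> + \<rho>)} \<times> ?W \<tau>"
    have bS: "?box \<tau> \<in> sets ?m" if "\<tau> \<in> E" for \<tau>
      using times[OF that] by (intro window_sets(1)[OF e w] Wb W0 that) auto
    have FS: "{0<..1} \<times> ?F \<in> sets ?m" by (intro window_sets(1)[OF e w] Fb) auto
    have RS: "?R \<in> sets ?m" using bS E(1) FS by (intro sets.Diff sets.finite_UN) auto
    have CS: "?C \<tau> \<in> sets ?m" if "\<tau> \<in> E" for \<tau>
      using times[OF that] by (intro window_sets(1)[OF e w] Wb W0 that) auto
    have CI: "set_integrable ?m (?C \<tau>) snd" if "\<tau> \<in> E" for \<tau>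
      by (rule set_integrable_subset[OF i1 CS[OF that]]) (use times[OF that] WF[OF that] in auto)
    have tS: "{0<..t} \<times> ?F \<in> sets ?m" using t by (intro window_sets(1)[OF e w] Fb) auto
    have "AE p in ?m. p \<notin> ?R" using rest RS by (intro AE_not_in null_setsI)
    then have "AE p in ?m. indicator ({0<..t} \<times> ?F) p *\<^sub>R snd p = (\<Sum>\<tau>\<in>E. indicator (?C \<tau>) p *\<^sub>R snd p)"
    proof eventually_elim
      case (elim p)
      show ?case
      proof (cases "\<exists>\<tau>\<in>E. p \<in> ?box \<tau>")
        case True
        then obtain \<tau> where \<tau>: "\<tau> \<in> E" "p \<in> ?box \<tau>" by blast
        have other: "p \<notin> ?C s" if "s \<in> E" "s \<noteq> \<tau>" for s
          using sep[OF that(1) \<tau>(1) that(2)] \<tau>(2) by (auto simp: mem_Times_iff)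
        have "(\<Sum>s\<in>E. indicator (?C s) p *\<^sub>R snd p) = (\<Sum>s\<in>E. if s = \<tau> then indicator (?C \<tau>) p *\<^sub>R snd p else 0)"
          using other by (intro sum.cong refl) (auto simp: indicator_def)
        also have "\<dots> = indicator (?C \<tau>) p *\<^sub>R snd p" using \<tau>(1) E(1) by simp
        also have "\<dots> = indicator ({0<..t} \<times> ?F) p *\<^sub>R snd p"
          using \<tau> WF[OF \<tau>(1)] times[OF \<tau>(1)] by (auto simp: indicator_def mem_Times_iff)
        finally show ?thesis by simp
      next
        case False
        then have "p \<notin> ?C \<tau>" if "\<tau> \<in> E" for \<tau> using that by (auto simp: mem_Times_iff)
        moreover have "p \<notin> {0<..t} \<times> ?F" using False elim t by auto
        ultimately show ?thesis by (simp add: indicator_def)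
      qed
    qed
    then have "(LINT p : {0<..t} \<times> ?F | ?m. snd p) = (LINT p | ?m. (\<Sum>\<tau>\<in>E. indicator (?C \<tau>) p *\<^sub>R snd p))"
      unfolding set_lebesgue_integral_def using sm tS CS
      by (intro integral_cong_AE borel_measurable_sum borel_measurable_scaleR borel_measurable_indicator) auto
    also have "\<dots> = (\<Sum>\<tau>\<in>E. LINT p : ?C \<tau> | ?m. snd p)"
      unfolding set_lebesgue_integral_def using CI unfolding set_integrable_def by (intro Bochner_Integration.integral_sum) auto
    also have "\<dots> = (\<Sum>\<tau>\<in>E. if \<sigma> \<tau> \<le> t then v \<tau> else 0)" using S\<tau>(3) by (intro sum.cong refl) auto
    finally show ?thesis .
  qed
  have "dist (Z \<epsilon> \<omega>) g \<le> r"
  proof (rule sk_dist_leI[OF l(1)])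
    fix t :: real assume t: "t \<in> {0..1}"
    show "\<bar>l t - t\<bar> \<le> r" using l(3) t by blast
    have lt: "l t \<in> {0..1}" by (rule time_changesD(3)[OF l(1) t])
    have iff: "\<sigma> s \<le> l t \<longleftrightarrow> s \<le> t" if s: "s \<in> E" for s
    proof -
      have s01: "s \<in> {0..1}" using s E(2) by force
      have "\<sigma> s = l s" using l(2) s by simp
      then show ?thesis using time_change_less_iff[OF l(1) t s01] by (simp add: not_less[symmetric])
    qed
    have b: "\<bar>sk_fun (Z \<epsilon> \<omega>) (l t) - \<epsilon> * (LINT p : {0<..l t} \<times> ?F | ?m. snd p)\<bar> \<le> \<eta>"
      using gd lt unfolding good_def by blast
    have "\<epsilon> * (LINT p : {0<..l t} \<times> ?F | ?m. snd p) = (\<Sum>s\<in>E. if s \<le> t then \<epsilon> * v s else 0)"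
      unfolding big[OF lt] sum_distrib_left using iff by (intro sum.cong refl) auto
    then have "\<epsilon> * (LINT p : {0<..l t} \<times> ?F | ?m. snd p) - sk_fun g t = (\<Sum>s\<in>E. if s \<le> t then \<epsilon> * v s - z s else 0)"
      unfolding g[OF t] by (simp add: sum_subtractf[symmetric] if_distrib cong: if_cong)
    moreover have "\<bar>\<Sum>s\<in>E. if s \<le> t then \<epsilon> * v s - z s else 0\<bar> \<le> (\<Sum>s\<in>E. \<rho>)"
      using S\<tau>(2) \<rho> by (intro order_trans[OF sum_abs] sum_mono) auto
    ultimately have "\<bar>\<epsilon> * (LINT p : {0<..l t} \<times> ?F | ?m. snd p) - sk_fun g t\<bar> \<le> real (card E) * \<rho>" by simp
    then show "\<bar>sk_fun (Z \<epsilon> \<omega>) (l t) - sk_fun g t\<bar> \<le> r" using b small by linarith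
  qed
  then show ?thesis by (simp add: dist_commute)
qed

end

context small_noise
begin

lemma window_measure:
  assumes "0 < \<epsilon>" "0 < \<rho>" "\<rho> < \<bar>z\<bar>"
  shows "measure \<nu> (window \<epsilon> \<rho> z) = (if 0 < z
    then measure \<nu> {(\<bar>z\<bar> - \<rho>) / \<epsilon>..} - measure \<nu> {(\<bar>z\<bar> + \<rho>) / \<epsilon>..}
    else measure \<nu> {..- ((\<bar>z\<bar> - \<rho>) / \<epsilon>)} - measure \<nu> {..- ((\<bar>z\<bar> + \<rho>) / \<epsilon>)})"
proof -
  define c1 where "c1 = (\<bar>z\<bar> - \<rho>) / \<epsilon>"
  define c2 where "c2 = (\<bar>z\<bar> + \<rho>) / \<epsilon>"
  have c: "0 < c1" "c1 \<le> c2" using assms by (auto simp: c1_def c2_def divide_right_mono)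
  have S: "{c1..} \<in> sets \<nu>" "{c2..} \<in> sets \<nu>" "{..- c1} \<in> sets \<nu>" "{..- c2} \<in> sets \<nu>"
    using c by (auto intro!: borel_sets_nu)
  show ?thesis
  proof (cases "0 < z")
    case True
    then have "window \<epsilon> \<rho> z = {c1..} - {c2..}" by (auto simp: window_def c1_def c2_def)
    moreover have "measure \<nu> ({c1..} - {c2..}) = measure \<nu> {c1..} - measure \<nu> {c2..}"
      using c S up_finite[of c1] by (intro measure_Diff) (auto simp: less_top)
    ultimately show ?thesis using True by (simp add: c1_def c2_def)
  next
    case False
    then have z: "\<bar>z\<bar> = - z" by simp
    have "- c1 = (z + \<rho>) / \<epsilon>" "- c2 = (z - \<rho>) / \<epsilon>" unfolding c1_def c2_def z by (simp_all add: minus_divide_left)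
    then have "window \<epsilon> \<rho> z = {..- c1} - {..- c2}" using False by (auto simp: window_def)
    moreover have "measure \<nu> ({..- c1} - {..- c2}) = measure \<nu> {..- c1} - measure \<nu> {..- c2}"
      using c S down_finite[of c1] by (intro measure_Diff) (auto simp: less_top)
    ultimately show ?thesis using False by (simp add: c1_def c2_def)
  qed
qed

text \<open>
  The mean number of large jumps tends to \<open>0\<close>, so requiring that there are no further ones costs only a
  factor close to \<open>1\<close>.
\<close>

lemma far_void_factor_lower:
  assumes \<theta>: "0 < \<theta>" and p: "p < 1"
  shows "\<forall>\<^sub>F \<epsilon> in at_right 0. p \<le> exp (- measure (jump_compensator (1 / \<epsilon>) \<nu>) ({0<..1} \<times> far (\<theta> / \<epsilon>))) ^ k"
proof -
  let ?u = "\<lambda>\<epsilon>. measure \<nu> {\<theta> / \<epsilon>..} / \<epsilon>" and ?d = "\<lambda>\<epsilon>. measure \<nu> {..- (\<theta> / \<epsilon>)} / \<epsilon>"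
  have "((\<lambda>\<epsilon>. exp (- (?u \<epsilon> + ?d \<epsilon>)) ^ k) \<longlongrightarrow> exp (- (0 + 0)) ^ k) (at_right 0)"
    by (intro tendsto_power tendsto_exp tendsto_minus tendsto_add
        regular_tail.scaled_tail_tendsto_0[OF up \<theta>] regular_tail.scaled_tail_tendsto_0[OF down \<theta>])
  then have "\<forall>\<^sub>F \<epsilon> in at_right 0. p < exp (- (?u \<epsilon> + ?d \<epsilon>)) ^ k"
    using p by (intro order_tendstoD) auto
  moreover have "\<forall>\<^sub>F \<epsilon> in at_right (0::real). 0 < \<epsilon>" by (rule eventually_at_right_less)
  ultimately show ?thesis
  proof eventually_elim
    case (elim \<epsilon>)
    interpret jp: compensated_jumps M "N \<epsilon>" "1 / \<epsilon>" \<nu> "J \<epsilon>" by (rule jumps[OF elim(2)])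
    have T: "0 < \<theta> / \<epsilon>" using elim \<theta> by simp
    have S: "{\<theta> / \<epsilon>..} \<in> sets \<nu>" "{..- (\<theta> / \<epsilon>)} \<in> sets \<nu>" using T by (auto intro!: borel_sets_nu)
    have "measure \<nu> (far (\<theta> / \<epsilon>)) \<le> measure \<nu> ({\<theta> / \<epsilon>..} \<union> {..- (\<theta> / \<epsilon>)})"
    proof (rule measure_mono_fmeasurable)
      show "{\<theta> / \<epsilon>..} \<union> {..- (\<theta> / \<epsilon>)} \<in> fmeasurable \<nu>"
        using S up_finite[OF T] down_finite[OF T] by (intro fmeasurable.Un) (auto simp: fmeasurable_def)
      show "far (\<theta> / \<epsilon>) \<in> sets \<nu>" using T by (intro far_sets) simp
    qed (use T in \<open>auto simp: far_def\<close>)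
    also have "\<dots> \<le> measure \<nu> {\<theta> / \<epsilon>..} + measure \<nu> {..- (\<theta> / \<epsilon>)}" by (rule measure_Un_le[OF S])
    finally have "1 / \<epsilon> * measure \<nu> (far (\<theta> / \<epsilon>)) \<le> ?u \<epsilon> + ?d \<epsilon>"
      using elim by (simp add: add_divide_distrib[symmetric] divide_right_mono)
    moreover have "measure jp.\<mu> ({0<..1} \<times> far (\<theta> / \<epsilon>)) = 1 / \<epsilon> * measure \<nu> (far (\<theta> / \<epsilon>))"
      using T by (subst jp.slab_measure) (auto intro!: far_sets)
    ultimately have "exp (- (?u \<epsilon> + ?d \<epsilon>)) ^ k \<le> exp (- measure jp.\<mu> ({0<..1} \<times> far (\<theta> / \<epsilon>))) ^ k"
      by (intro power_mono) auto
    then show ?case using elim(1) by linarith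
  qed
qed

text \<open>
  By \<open>scaled_gap_lower\<close> the box around an upward jump has mass at least of order
  \<open>\<epsilon> powr (\<alpha> - 1 + dd)\<close>, with \<open>\<beta>\<close> for a downward one. The product of these masses
  dominates \<open>\<epsilon> powr a\<close> and the probability of leaving the good event.
\<close>

lemma local_lower_bound:
  assumes Ia: "step_rate \<alpha> \<beta> g < ereal a" and r: "0 < r"
  shows "\<forall>\<^sub>F \<epsilon> in at_right 0. \<exists>A\<in>events. A \<subseteq> {\<omega> \<in> space M. dist g (Z \<epsilon> \<omega>) < r} \<and> \<epsilon> powr a \<le> prob A"
proof -
  have sp: "step_path g" "sk_fun g 0 = 0" using Ia by (auto simp: step_rate_def split: if_splits)
  then obtain S where "steps g S" using step_path_steps by blast
  then interpret steps g S .
  define E where "E = jump_times"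
  define z where "z = jump"
  define n where "n = card E"
  define I where "I = (\<alpha> - 1) * real (up_jumps g) + (\<beta> - 1) * real (down_jumps g)"
  have E: "finite E" "E \<subseteq> {0<..<1}" using jump_times by (simp_all add: E_def)
  have Ia: "I < a" using Ia sp by (simp add: step_rate_def I_def)
  \<comment> \<open>the cost of the jump at \<open>\<tau>\<close>\<close>
  define w where "w \<tau> = (if 0 < z \<tau> then \<alpha> - 1 else \<beta> - 1)" for \<tau>
  have wsum: "(\<Sum>\<tau>\<in>E. w \<tau>) = I"
  proof -
    have "E \<inter> {\<tau>. 0 < z \<tau>} = {t\<in>jump_times. 0 < jump t}" "E \<inter> - {\<tau>. 0 < z \<tau>} = {t\<in>jump_times. jump t < 0}"
      by (auto simp: E_def z_def jump_times_def)
    then show ?thesis unfolding w_def I_def jump_counts using E(1) by (simp add: sum.If_cases mult.commute)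
  qed
  \<comment> \<open>the loss \<open>dd\<close> per jump leaves \<open>b < a\<close>\<close>
  define dd where "dd = (a - I) / (2 * (real n + 1))"
  define b where "b = I + dd * real n"
  have dd: "0 < dd" using Ia by (simp add: dd_def)
  have ba: "b < a"
  proof -
    have "dd * (real n + 1) = (a - I) / 2" unfolding dd_def by (simp add: field_simps)
    then have "dd * real n \<le> (a - I) / 2" using dd by (simp add: distrib_left)
    then show ?thesis using Ia by (simp add: b_def)
  qed
  obtain R where R: "0 < R" "\<forall>s\<in>insert 0 (insert 1 E). \<forall>t\<in>insert 0 (insert 1 E). s \<noteq> t \<longrightarrow> R \<le> \<bar>s - t\<bar>"
    using finite_separation[of "insert 0 (insert 1 E)"] E(1) by auto
  define H where "H = insert 1 ((\<lambda>\<tau>. \<bar>z \<tau>\<bar>) ` E)"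
  define h where "h = Min H"
  have H: "finite H" "H \<noteq> {}" using E by (auto simp: H_def)
  have "0 < x" if "x \<in> H" for x using that by (auto simp: H_def E_def z_def jump_times_def)
  then have h: "0 < h" unfolding h_def using H by (subst Min_gr_iff) auto
  have hz: "h \<le> \<bar>z \<tau>\<bar>" if "\<tau> \<in> E" for \<tau> unfolding h_def using that by (intro Min_le H(1)) (auto simp: H_def)
  have r2: "0 < r / 2" using r by simp
  obtain \<rho>1 where \<rho>1: "0 < \<rho>1" and tc: "\<forall>\<sigma>. (\<forall>t\<in>E. \<bar>\<sigma> t - t\<bar> \<le> \<rho>1) \<longrightarrow>
      (\<exists>l\<in>time_changes. (\<forall>t\<in>E. l t = \<sigma> t) \<and> (\<forall>t\<in>{0..1}. \<bar>l t - t\<bar> \<le> r / 2))"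
    using time_change_interpolating[OF E r2] by (elim exE conjE) (rule that)
  define \<rho> where "\<rho> = min (min \<rho>1 (R / 3)) (min (h / 2) (r / (8 * (real n + 1))))"
  have \<rho>: "0 < \<rho>" "\<rho> \<le> \<rho>1" "\<rho> \<le> R / 3" "\<rho> \<le> h / 2" "\<rho> \<le> r / (8 * (real n + 1))"
  proof -
    show "0 < \<rho>" using \<rho>1 R(1) h r by (simp add: \<rho>_def)
    show "\<rho> \<le> \<rho>1" unfolding \<rho>_def by (rule min.coboundedI1[OF min.cobounded1])
    show "\<rho> \<le> R / 3" unfolding \<rho>_def by (rule min.coboundedI1[OF min.cobounded2])
    show "\<rho> \<le> h / 2" unfolding \<rho>_def by (rule min.coboundedI2[OF min.cobounded1])
    show "\<rho> \<le> r / (8 * (real n + 1))" unfolding \<rho>_def by (rule min.coboundedI2[OF min.cobounded2])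
  qed
  have n\<rho>: "real n * \<rho> \<le> r / 8"
  proof -
    have "real n * \<rho> \<le> (real n + 1) * (r / (8 * (real n + 1)))" using \<rho> by (intro mult_mono) auto
    also have "\<dots> = r / 8" by (simp add: field_simps)
    finally show ?thesis .
  qed
  have r4: "0 < r / 4" using r by simp
  have "0 < \<bar>a\<bar> + 1" by simp
  from good_event[OF this r4] obtain \<theta>0 where \<theta>0: "0 < \<theta>0" and ge: "\<forall>\<theta>. 0 < \<theta> \<longrightarrow> \<theta> \<le> \<theta>0 \<longrightarrow>
    (\<forall>\<^sub>F \<epsilon> in at_right 0. \<exists>Bad\<in>events. prob Bad \<le> \<epsilon> powr (\<bar>a\<bar> + 1) \<and> (\<forall>\<omega>\<in>space M - Bad. good \<epsilon> \<theta> (r / 4) \<omega>))"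
    by (elim exE conjE) (rule that)
  define \<theta> where "\<theta> = min \<theta>0 (h / 4)"
  have \<theta>: "0 < \<theta>" "\<theta> \<le> \<theta>0" "\<theta> \<le> h / 4" using \<theta>0 h by (auto simp: \<theta>_def)
  note ev_good = ge[rule_format, OF \<theta>(1,2)]
  have times: "\<rho> < \<tau> \<and> \<tau> + \<rho> \<le> 1" if \<tau>: "\<tau> \<in> E" for \<tau>
  proof -
    have t01: "0 < \<tau>" "\<tau> < 1" using E(2) \<tau> by force+
    have "R \<le> \<bar>0 - \<tau>\<bar>" "R \<le> \<bar>1 - \<tau>\<bar>" using R(2) \<tau> t01 by auto
    then show ?thesis using \<rho> R(1) t01 by auto
  qed
  have sizes: "\<theta> + \<rho> < \<bar>z \<tau>\<bar>" if "\<tau> \<in> E" for \<tau> using hz[OF that] \<theta> \<rho> h by linarith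
  have sep: "2 * \<rho> < \<bar>s - t\<bar>" if "s \<in> E" "t \<in> E" "s \<noteq> t" for s t
  proof -
    have "R \<le> \<bar>s - t\<bar>" using R(2) that by auto
    then show ?thesis using \<rho> R(1) by linarith
  qed
  have tc': "\<exists>l\<in>time_changes. (\<forall>t\<in>E. l t = \<sigma> t) \<and> (\<forall>t\<in>{0..1}. \<bar>l t - t\<bar> \<le> r / 2)" if "\<And>t. t \<in> E \<Longrightarrow> \<bar>\<sigma> t - t\<bar> \<le> \<rho>" for \<sigma>
  proof -
    have "\<forall>t\<in>E. \<bar>\<sigma> t - t\<bar> \<le> \<rho>1" using that \<rho>(2) by (auto intro: order_trans)
    then show ?thesis using tc by blast
  qed
  have gval: "sk_fun g t = (\<Sum>s\<in>E. if s \<le> t then z s else 0)" if "t \<in> {0..1}" for t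
    using value_jump_times[OF that] unfolding sp(2) E_def z_def by simp
  have gap: "\<forall>\<^sub>F \<epsilon> in at_right 0. \<forall>\<tau>\<in>E. \<epsilon> powr (w \<tau> + dd) \<le> measure \<nu> (window \<epsilon> \<rho> (z \<tau>)) / \<epsilon>"
  proof (rule eventually_ball_finite[OF E(1)], rule ballI)
    fix \<tau> assume \<tau>: "\<tau> \<in> E"
    have c: "0 < \<bar>z \<tau>\<bar> - \<rho>" "\<bar>z \<tau>\<bar> - \<rho> < \<bar>z \<tau>\<bar> + \<rho>" using sizes[OF \<tau>] \<theta> \<rho> by linarith+
    have pos: "\<forall>\<^sub>F \<epsilon> in at_right (0::real). 0 < \<epsilon>" by (rule eventually_at_right_less)
    show "\<forall>\<^sub>F \<epsilon> in at_right 0. \<epsilon> powr (w \<tau> + dd) \<le> measure \<nu> (window \<epsilon> \<rho> (z \<tau>)) / \<epsilon>"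
    proof (cases "0 < z \<tau>")
      case True
      from pos regular_tail.scaled_gap_lower[OF up c dd] show ?thesis
      proof eventually_elim
        case (elim \<epsilon>)
        then show ?case using window_measure[OF elim(1) \<rho>(1), of "z \<tau>"] c(1) True by (simp add: w_def)
      qed
    next
      case False
      from pos regular_tail.scaled_gap_lower[OF down c dd] show ?thesis
      proof eventually_elim
        case (elim \<epsilon>)
        then show ?case using window_measure[OF elim(1) \<rho>(1), of "z \<tau>"] c(1) False by (simp add: w_def)
      qed
    qed
  qed
  have pos: "\<forall>\<^sub>F \<epsilon> in at_right (0::real). 0 < \<epsilon>" by (rule eventually_at_right_less)
  have ex: "\<forall>\<^sub>F \<epsilon> in at_right 0. 1 / 2 \<le> exp (- measure (jump_compensator (1 / \<epsilon>) \<nu>) ({0<..1} \<times> far (\<theta> / \<epsilon>))) ^ Suc n"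
    by (rule far_void_factor_lower[OF \<theta>(1)]) simp
  have pa: "\<forall>\<^sub>F \<epsilon> in at_right (0::real). 1 * \<epsilon> powr (\<bar>a\<bar> + 1) \<le> \<epsilon> powr a" by (rule powr_absorb) simp
  have pb: "\<forall>\<^sub>F \<epsilon> in at_right (0::real). (4 / (2 * \<rho>) ^ n) * \<epsilon> powr a \<le> \<epsilon> powr b" by (rule powr_absorb[OF ba])
  from pos ev_good gap ex pa pb show ?thesis
  proof eventually_elim
    case (elim \<epsilon>)
    interpret jp: compensated_jumps M "N \<epsilon>" "1 / \<epsilon>" \<nu> "J \<epsilon>" by (rule jumps[OF elim(1)])
    obtain Bad where B: "Bad \<in> events" "prob Bad \<le> \<epsilon> powr (\<bar>a\<bar> + 1)" "\<forall>\<omega>\<in>space M - Bad. good \<epsilon> \<theta> (r / 4) \<omega>"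
      using elim(2) by blast
    have T: "0 < \<theta> / \<epsilon>" using elim(1) \<theta> by simp
    let ?U = "{0<..1} \<times> far (\<theta> / \<epsilon>)"
    let ?box = "\<lambda>\<tau>. {\<tau> - \<rho><..\<tau> + \<rho>} \<times> window \<epsilon> \<rho> (z \<tau>)"
    have Wb: "window \<epsilon> \<rho> (z \<tau>) \<in> sets borel" for \<tau> by (simp add: window_def)
    have WF: "window \<epsilon> \<rho> (z \<tau>) \<subseteq> far (\<theta> / \<epsilon>)" if \<tau>: "\<tau> \<in> E" for \<tau>
    proof
      fix x assume x: "x \<in> window \<epsilon> \<rho> (z \<tau>)"
      have "(z \<tau> - \<rho>) / \<epsilon> \<le> x \<and> x \<le> (z \<tau> + \<rho>) / \<epsilon>" using x by (auto simp: window_def split: if_splits)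
      then have x': "z \<tau> - \<rho> \<le> \<epsilon> * x" "\<epsilon> * x \<le> z \<tau> + \<rho>" using elim(1) by (auto simp: field_simps)
      have "\<theta> < \<bar>\<epsilon> * x\<bar>" using sizes[OF \<tau>] x' by linarith
      then have "\<theta> / \<epsilon> < \<bar>x\<bar>" using elim(1) by (simp add: abs_mult field_simps)
      then show "x \<in> far (\<theta> / \<epsilon>)" by (simp add: far_def)
    qed
    have Ws: "window \<epsilon> \<rho> (z \<tau>) \<in> sets \<nu>" if "\<tau> \<in> E" for \<tau>
      using WF[OF that] T by (intro borel_sets_nu Wb) (auto simp: far_def)
    have I01: "{\<tau> - \<rho><..\<tau> + \<rho>} \<subseteq> {0<..1}" if "\<tau> \<in> E" for \<tau> using times[OF that] by auto
    have I01': "{\<tau> - \<rho><..\<tau> + \<rho>} \<subseteq> {0..1}" if "\<tau> \<in> E" for \<tau> using times[OF that] by auto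
    have boxS: "?box \<tau> \<in> sets jp.\<mu>" if "\<tau> \<in> E" for \<tau> by (rule jp.slab_sets[OF _ I01'[OF that] Ws[OF that]]) simp
    have boxU: "?box \<tau> \<subseteq> ?U" if "\<tau> \<in> E" for \<tau> using I01[OF that] WF[OF that] by blast
    have dj: "disjoint_family_on ?box E"
    proof (unfold disjoint_family_on_def, intro ballI impI)
      fix s t assume st: "s \<in> E" "t \<in> E" "s \<noteq> t"
      have "{s - \<rho><..s + \<rho>} \<inter> {t - \<rho><..t + \<rho>} = {}" using sep[OF st] by auto
      then show "?box s \<inter> ?box t = {}" by blast
    qed
    have US: "?U \<in> sets jp.\<mu>" using T by (intro jp.slab_sets far_sets) auto
    have UF: "emeasure jp.\<mu> ?U < \<infinity>" using T by (intro jp.slab_finite far_sets far_finite) auto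
    define Ev where "Ev = {\<omega> \<in> space M. (\<forall>\<tau>\<in>E. emeasure (N \<epsilon> \<omega>) (?box \<tau>) = 1) \<and> emeasure (N \<epsilon> \<omega>) (?U - (\<Union>\<tau>\<in>E. ?box \<tau>)) = 0}"
    have Ev: "Ev \<in> events" "exp (- measure jp.\<mu> ?U) ^ Suc (card E) * (\<Prod>\<tau>\<in>E. measure jp.\<mu> (?box \<tau>)) \<le> prob Ev"
      unfolding Ev_def by (rule jp.box_event_probability[OF E(1) boxS boxU dj US UF], assumption+)+
    have "(2 * \<rho>) ^ n * \<epsilon> powr b = (\<Prod>\<tau>\<in>E. 2 * \<rho> * \<epsilon> powr (w \<tau> + dd))"
    proof -
      have "b = (\<Sum>\<tau>\<in>E. w \<tau> + dd)" by (simp add: b_def sum.distrib wsum n_def)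
      then have "\<epsilon> powr b = (\<Prod>\<tau>\<in>E. \<epsilon> powr (w \<tau> + dd))" using elim(1) E(1) by (simp add: powr_sum)
      then show ?thesis by (simp add: prod.distrib n_def)
    qed
    also have "\<dots> \<le> (\<Prod>\<tau>\<in>E. measure jp.\<mu> (?box \<tau>))"
    proof (rule prod_mono, rule conjI)
      fix \<tau> assume \<tau>: "\<tau> \<in> E"
      show "0 \<le> 2 * \<rho> * \<epsilon> powr (w \<tau> + dd)" using \<rho>(1) by simp
      have "measure lborel {\<tau> - \<rho><..\<tau> + \<rho>} = 2 * \<rho>" using \<rho>(1) by simp
      moreover have "measure jp.\<mu> (?box \<tau>) = 1 / \<epsilon> * (measure lborel {\<tau> - \<rho><..\<tau> + \<rho>} * measure \<nu> (window \<epsilon> \<rho> (z \<tau>)))"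
        by (rule jp.slab_measure[OF _ I01'[OF \<tau>] Ws[OF \<tau>]]) simp
      ultimately have "measure jp.\<mu> (?box \<tau>) = 2 * \<rho> * (measure \<nu> (window \<epsilon> \<rho> (z \<tau>)) / \<epsilon>)" by simp
      then show "2 * \<rho> * \<epsilon> powr (w \<tau> + dd) \<le> measure jp.\<mu> (?box \<tau>)"
        using elim(3) \<tau> \<rho>(1) by (simp only:) (intro mult_left_mono, auto)
    qed
    finally have prod: "(2 * \<rho>) ^ n * \<epsilon> powr b \<le> (\<Prod>\<tau>\<in>E. measure jp.\<mu> (?box \<tau>))" .
    have "1 / 2 * ((2 * \<rho>) ^ n * \<epsilon> powr b) \<le> exp (- measure jp.\<mu> ?U) ^ Suc n * (\<Prod>\<tau>\<in>E. measure jp.\<mu> (?box \<tau>))"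
      using elim(4) prod \<rho>(1) by (intro mult_mono) auto
    also have "\<dots> \<le> prob Ev" using Ev(2) by (simp add: n_def)
    finally have pE: "1 / 2 * ((2 * \<rho>) ^ n * \<epsilon> powr b) \<le> prob Ev" .
    have k0: "0 < (2 * \<rho>) ^ n" using \<rho>(1) by simp
    have "(2 * \<rho>) ^ n * ((4 / (2 * \<rho>) ^ n) * \<epsilon> powr a) \<le> (2 * \<rho>) ^ n * \<epsilon> powr b"
      using elim(6) k0 by (intro mult_left_mono) auto
    moreover have "(2 * \<rho>) ^ n * ((4 / (2 * \<rho>) ^ n) * \<epsilon> powr a) = 4 * \<epsilon> powr a"
    proof -
      have "c * ((4 / c) * x) = 4 * x" if "0 < c" for c x :: real using that by simp
      then show ?thesis using k0 by blast
    qed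
    ultimately have pE2: "2 * \<epsilon> powr a \<le> prob Ev" using pE by linarith
    have D: "Ev - Bad \<in> events" by (rule sets.Diff[OF Ev(1) B(1)])
    have "prob Ev \<le> prob ((Ev - Bad) \<union> Bad)" by (rule finite_measure_mono) (use sets.Un[OF D B(1)] in auto)
    also have "\<dots> \<le> prob (Ev - Bad) + prob Bad" by (rule measure_Un_le[OF D B(1)])
    finally have pD: "\<epsilon> powr a \<le> prob (Ev - Bad)" using pE2 B(2) elim(5) by linarith
    have "Ev - Bad \<subseteq> {\<omega> \<in> space M. dist g (Z \<epsilon> \<omega>) < r}"
    proof
      fix \<omega> assume w: "\<omega> \<in> Ev - Bad"
      have ws: "\<omega> \<in> space M" using w by (simp add: Ev_def)
      have gd: "good \<epsilon> \<theta> (r / 4) \<omega>" using B(3) w ws by blast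
      have "\<forall>\<tau>\<in>E. emeasure (N \<epsilon> \<omega>) (?box \<tau>) = 1" "emeasure (N \<epsilon> \<omega>) (?U - (\<Union>\<tau>\<in>E. ?box \<tau>)) = 0"
        using w by (auto simp: Ev_def)
      note path = boxes_near_path[OF elim(1) ws gd E \<theta>(1) times \<rho>(1) sizes sep tc' gval this]
      have le: "r / 4 + real (card E) * \<rho> \<le> r / 2" using n\<rho> r by (simp add: n_def)
      have "dist g (Z \<epsilon> \<omega>) \<le> r / 2" by (rule path; (assumption | rule le | blast))
      then show "\<omega> \<in> {\<omega> \<in> space M. dist g (Z \<epsilon> \<omega>) < r}" using ws r by simp
    qed
    then show ?case using D pD by blast
  qed
qed

end

section \<open>From local bounds to the weak large deviation principle\<close>

lemma log_prob_upper:
  assumes e: "0 < \<epsilon>" "\<epsilon> < 1" and p: "measure M A \<le> \<epsilon> powr a"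
  shows "log_prob M A / ereal (ln (1 / \<epsilon>)) \<le> ereal (- a)"
proof -
  have v: "0 < ln (1 / \<epsilon>)" using e by simp
  show ?thesis
  proof (cases "measure M A = 0")
    case True
    then show ?thesis using v by (simp add: log_prob_def divide_ereal_def)
  next
    case False
    then have "ln (measure M A) \<le> ln (\<epsilon> powr a)" using p by (intro ln_mono) (auto simp: zero_less_measure_iff)
    also have "\<dots> = - a * ln (1 / \<epsilon>)" using e by (simp add: ln_powr ln_div)
    finally have "ln (measure M A) / ln (1 / \<epsilon>) \<le> - a" using v by (simp only: pos_divide_le_eq)
    then show ?thesis using False v by (simp add: log_prob_def)
  qed
qed

lemma log_prob_lower:
  assumes e: "0 < \<epsilon>" "\<epsilon> < 1" and p: "\<epsilon> powr a \<le> measure M A"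
  shows "ereal (- a) \<le> log_prob M A / ereal (ln (1 / \<epsilon>))"
proof -
  have v: "0 < ln (1 / \<epsilon>)" using e by simp
  have pos: "0 < measure M A" using p e powr_gt_zero[of \<epsilon> a] by linarith
  have "- a * ln (1 / \<epsilon>) = ln (\<epsilon> powr a)" using e by (simp add: ln_powr ln_div)
  also have "\<dots> \<le> ln (measure M A)" using p e by (intro ln_mono) auto
  finally have "- a \<le> ln (measure M A) / ln (1 / \<epsilon>)" using v by (simp only: pos_le_divide_eq)
  then show ?thesis using pos v by (simp add: log_prob_def)
qed

text \<open>
  For closed sublevel sets, let \<open>c < I x\<close>. If \<open>y\<close> is close to \<open>x\<close> and \<open>I y \<le> c\<close>, then a small ball around \<open>y\<close> has a
  probability larger than the upper bound for the ball around \<open>x\<close> that contains it. The number of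
  balls that cover a compact set is absorbed by a small loss in the exponent.
\<close>

lemma (in prob_space) weak_LDP_from_local:
  fixes Y :: "real \<Rightarrow> 'a \<Rightarrow> 'x :: metric_space" and I :: "'x \<Rightarrow> ereal"
  assumes nonneg: "\<And>x. 0 \<le> I x"
    and meas: "\<And>\<epsilon> G. 0 < \<epsilon> \<Longrightarrow> open G \<Longrightarrow> {\<omega> \<in> space M. Y \<epsilon> \<omega> \<in> G} \<in> events"
    and upper: "\<And>x a. ereal a < I x \<Longrightarrow> \<exists>r>0. \<forall>\<^sub>F \<epsilon> in at_right 0. \<exists>A\<in>events.
      {\<omega> \<in> space M. dist x (Y \<epsilon> \<omega>) < r} \<subseteq> A \<and> prob A \<le> \<epsilon> powr a"
    and lower: "\<And>x a r. I x < ereal a \<Longrightarrow> 0 < r \<Longrightarrow> \<forall>\<^sub>F \<epsilon> in at_right 0. \<exists>A\<in>events.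
      A \<subseteq> {\<omega> \<in> space M. dist x (Y \<epsilon> \<omega>) < r} \<and> \<epsilon> powr a \<le> prob A"
  shows "weak_LDP M Y I (\<lambda>\<epsilon>. ln (1 / \<epsilon>))"
  unfolding weak_LDP_def rate_function_def
proof (intro conjI allI impI)
  have small: "\<forall>\<^sub>F \<epsilon> in at_right (0::real). 0 < \<epsilon> \<and> \<epsilon> < 1"
    using eventually_at_right_real[of 0 1] by simp
  show "0 \<le> I x" for x by (rule nonneg)
  show "closed {x. I x \<le> c}" for c
  proof -
    have "\<exists>r>0. ball x r \<subseteq> {x. c < I x}" if x: "c < I x" for x
    proof -
      \<comment> \<open>two exponents strictly between \<open>c\<close> and \<open>I x\<close>: the upper bound at \<open>x\<close> with the larger one beats the lower bound at \<open>y\<close> with the smaller one\<close>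
      obtain a2 where a2: "c < ereal a2" "ereal a2 < I x" using ereal_dense2[OF x] by blast
      obtain a1 where a1: "c < ereal a1" "ereal a1 < ereal a2" using ereal_dense2[OF a2(1)] by blast
      from upper[OF a2(2)] obtain r where r: "0 < r" and ub: "\<forall>\<^sub>F \<epsilon> in at_right 0. \<exists>A\<in>events.
        {\<omega> \<in> space M. dist x (Y \<epsilon> \<omega>) < r} \<subseteq> A \<and> prob A \<le> \<epsilon> powr a2" by (elim exE conjE) (rule that)
      have "c < I y" if y: "dist x y < r" for y
      proof (rule ccontr)
        assume "\<not> c < I y"
        then have Iy: "I y < ereal a1" using a1(1) by (simp add: not_less)
        have "0 < r - dist x y" using y by simp
        from lower[OF Iy this] ub small have "\<forall>\<^sub>F \<epsilon> in at_right (0::real). False"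
        proof eventually_elim
          case (elim \<epsilon>)
          obtain A where A: "A \<in> events" "A \<subseteq> {\<omega> \<in> space M. dist y (Y \<epsilon> \<omega>) < r - dist x y}" "\<epsilon> powr a1 \<le> prob A"
            using elim(1) by blast
          obtain A' where A': "A' \<in> events" "{\<omega> \<in> space M. dist x (Y \<epsilon> \<omega>) < r} \<subseteq> A'" "prob A' \<le> \<epsilon> powr a2"
            using elim(2) by blast
          have "A \<subseteq> {\<omega> \<in> space M. dist x (Y \<epsilon> \<omega>) < r}"
          proof
            fix \<omega> assume "\<omega> \<in> A"
            then have "\<omega> \<in> space M" "dist y (Y \<epsilon> \<omega>) < r - dist x y" using A(2) by blast+
            then show "\<omega> \<in> {\<omega> \<in> space M. dist x (Y \<epsilon> \<omega>) < r}"
              using dist_triangle[of x "Y \<epsilon> \<omega>" y] by simp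
          qed
          then have "prob A \<le> prob A'" using A'(1,2) by (intro finite_measure_mono) auto
          then have "\<epsilon> powr a1 \<le> \<epsilon> powr a2" using A(3) A'(3) by linarith
          moreover have "\<epsilon> powr a2 < \<epsilon> powr a1" using elim(3) a1(2) by (intro powr_less_mono') auto
          ultimately show False by simp
        qed
        then show False by (simp add: trivial_limit_def[symmetric])
      qed
      then show ?thesis using r by (intro exI[of _ r]) auto
    qed
    then have "open {x. c < I x}" unfolding open_contains_ball by blast
    moreover have "{x. I x \<le> c} = - {x. c < I x}" by auto
    ultimately show ?thesis by (simp add: closed_def)
  qed
  show "- (INF x\<in>G. I x) \<le> Liminf (at_right 0) (\<lambda>\<epsilon>. log_prob M {\<omega> \<in> space M. Y \<epsilon> \<omega> \<in> G} / ereal (ln (1 / \<epsilon>)))"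
    (is "_ \<le> ?L") if G: "open G" for G
  proof -
    have "- ?L \<le> I x" if x: "x \<in> G" for x
    proof (rule dense_ge)
      fix c assume c: "I x < c"
      obtain a where a: "I x < ereal a" "ereal a < c" using ereal_dense2[OF c] by blast
      obtain r where r: "0 < r" "ball x r \<subseteq> G" using G x unfolding open_contains_ball by blast
      from lower[OF a(1) r(1)] small
      have "\<forall>\<^sub>F \<epsilon> in at_right 0. ereal (- a) \<le> log_prob M {\<omega> \<in> space M. Y \<epsilon> \<omega> \<in> G} / ereal (ln (1 / \<epsilon>))"
      proof eventually_elim
        case (elim \<epsilon>)
        obtain A where A: "A \<in> events" "A \<subseteq> {\<omega> \<in> space M. dist x (Y \<epsilon> \<omega>) < r}" "\<epsilon> powr a \<le> prob A"
          using elim(1) by blast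
        have "A \<subseteq> {\<omega> \<in> space M. Y \<epsilon> \<omega> \<in> G}" using A(2) r(2) by (auto simp: subset_iff)
        then have "prob A \<le> prob {\<omega> \<in> space M. Y \<epsilon> \<omega> \<in> G}" using elim(2) G by (intro finite_measure_mono meas) auto
        then show ?case using A(3) elim(2) by (intro log_prob_lower) auto
      qed
      then have "ereal (- a) \<le> ?L" by (rule Liminf_bounded)
      then have "- ?L \<le> ereal a" by (simp add: ereal_uminus_le_reorder)
      then show "- ?L \<le> c" using a(2) by simp
    qed
    then have "- ?L \<le> (INF x\<in>G. I x)" by (rule INF_greatest)
    then show ?thesis by (simp add: ereal_uminus_le_reorder)
  qed
  show "Limsup (at_right 0) (\<lambda>\<epsilon>. log_prob M {\<omega> \<in> space M. Y \<epsilon> \<omega> \<in> K} / ereal (ln (1 / \<epsilon>))) \<le> - (INF x\<in>K. I x)"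
    (is "?L \<le> _") if K: "compact K" for K
  proof -
    have "c \<le> - ?L" if c: "c < (INF x\<in>K. I x)" for c
    proof -
      obtain a where a: "c < ereal a" "ereal a < (INF x\<in>K. I x)" using ereal_dense2[OF c] by blast
      obtain a' where a': "ereal a < ereal a'" "ereal a' < (INF x\<in>K. I x)" using ereal_dense2[OF a(2)] by blast
      have "\<forall>x\<in>K. \<exists>r>0. \<forall>\<^sub>F \<epsilon> in at_right 0. \<exists>A\<in>events.
          {\<omega> \<in> space M. dist x (Y \<epsilon> \<omega>) < r} \<subseteq> A \<and> prob A \<le> \<epsilon> powr a'"
        using a'(2) by (auto intro!: upper dest: less_INF_D)
      then obtain r where r: "\<forall>x\<in>K. 0 < r x \<and> (\<forall>\<^sub>F \<epsilon> in at_right 0. \<exists>A\<in>events.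
          {\<omega> \<in> space M. dist x (Y \<epsilon> \<omega>) < r x} \<subseteq> A \<and> prob A \<le> \<epsilon> powr a')"
        unfolding bchoice_iff by (elim exE) (rule that)
      have cover: "K \<subseteq> (\<Union>x\<in>K. ball x (r x))" using r by (auto intro!: bexI)
      obtain D where D: "D \<subseteq> K" "finite D" "K \<subseteq> (\<Union>x\<in>D. ball x (r x))"
        by (rule compactE_image[OF K _ cover]) auto
      have "\<forall>\<^sub>F \<epsilon> in at_right 0. \<forall>x\<in>D. \<exists>A\<in>events.
          {\<omega> \<in> space M. dist x (Y \<epsilon> \<omega>) < r x} \<subseteq> A \<and> prob A \<le> \<epsilon> powr a'"
        using D(1) r by (intro eventually_ball_finite D(2)) blast
      moreover have "\<forall>\<^sub>F \<epsilon> in at_right 0. real (card D) * \<epsilon> powr a' \<le> \<epsilon> powr a"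
        using a'(1) by (intro powr_absorb) simp
      ultimately have "\<forall>\<^sub>F \<epsilon> in at_right 0. log_prob M {\<omega> \<in> space M. Y \<epsilon> \<omega> \<in> K} / ereal (ln (1 / \<epsilon>)) \<le> ereal (- a)"
        using small
      proof eventually_elim
        case (elim \<epsilon>)
        obtain A where A: "\<forall>x\<in>D. A x \<in> events \<and> {\<omega> \<in> space M. dist x (Y \<epsilon> \<omega>) < r x} \<subseteq> A x \<and> prob (A x) \<le> \<epsilon> powr a'"
          using elim(1) unfolding Bex_def bchoice_iff by (elim exE) (rule that)
        have "{\<omega> \<in> space M. Y \<epsilon> \<omega> \<in> K} \<subseteq> (\<Union>x\<in>D. A x)"
        proof
          fix \<omega> assume w: "\<omega> \<in> {\<omega> \<in> space M. Y \<epsilon> \<omega> \<in> K}"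
          then obtain x where x: "x \<in> D" "dist x (Y \<epsilon> \<omega>) < r x" using D(3) by force
          then show "\<omega> \<in> (\<Union>x\<in>D. A x)" using A w by blast
        qed
        then have "prob {\<omega> \<in> space M. Y \<epsilon> \<omega> \<in> K} \<le> prob (\<Union>x\<in>D. A x)"
          using A D(2) by (intro finite_measure_mono sets.finite_UN) auto
        also have "\<dots> \<le> (\<Sum>x\<in>D. prob (A x))" using A D(2) by (intro measure_UNION_le) auto
        also have "\<dots> \<le> (\<Sum>x\<in>D. \<epsilon> powr a')" using A by (intro sum_mono) auto
        also have "\<dots> \<le> \<epsilon> powr a" using elim(2) by simp
        finally show ?case using elim(3) by (intro log_prob_upper) auto
      qed
      then have "?L \<le> ereal (- a)" by (rule Limsup_bounded)
      then have "- ereal (- a) \<le> - ?L" unfolding ereal_minus_le_minus .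
      then show ?thesis using a(1) by simp
    qed
    then have "(INF x\<in>K. I x) \<le> - ?L" by (rule dense_le)
    then have "- (- ?L) \<le> - (INF x\<in>K. I x)" unfolding ereal_minus_le_minus .
    then show ?thesis by simp
  qed
qed

text \<open>The rate of a solution is the rate of the path that drives it.\<close>

lemma (in additive_drift) jump_rate_eq: "jump_rate \<alpha> \<beta> b x = step_rate \<alpha> \<beta> (remove_drift x)"
proof -
  have "(\<exists>g. step_path g \<and> sk_fun g 0 = 0 \<and> x = solution_map b g) \<longleftrightarrow>
      step_path (remove_drift x) \<and> sk_fun (remove_drift x) 0 = 0"
    unfolding solution_map_iff by auto
  then show ?thesis unfolding jump_rate_def step_rate_def jumps_remove_drift by simp
qed

lemma (in additive_drift) drift_LINT:
  assumes "t \<in> {0..1}"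
  shows "(LINT s : {0..t} | lborel. b (sk_fun x s)) = drift (sk_fun x) t"
  using drift_integrable(2)[OF unit_borel_sk, of 0 t x] assms by (simp add: drift_def)

section \<open>The stochastic differential equation\<close>

theorem theorem3p7:
  fixes P :: "'w measure" and \<alpha> \<beta> :: real and \<nu> :: "real measure"
    and L\<^sub>p L\<^sub>m b :: "real \<Rightarrow> real"
    and B :: "real \<Rightarrow> 'w \<Rightarrow> real" and N :: "real \<Rightarrow> 'w \<Rightarrow> (real \<times> real) measure"
    and J :: "real \<Rightarrow> 'w \<Rightarrow> skorokhod" and L :: "real \<Rightarrow> real \<Rightarrow> 'w \<Rightarrow> real"
    and Y :: "real \<Rightarrow> 'w \<Rightarrow> skorokhod"
  assumes "prob_space P" and "complete_measure P"
    and "\<alpha> > 1" and "\<beta> > 1"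
    and "levy_measure \<nu>"
    and "\<And>x. x > 0 \<Longrightarrow> emeasure \<nu> {x..} = ennreal (L\<^sub>p x * x powr - \<alpha>)"
    and "\<And>x. x > 0 \<Longrightarrow> emeasure \<nu> {..- x} = ennreal (L\<^sub>m x * x powr - \<beta>)"
    and "slowly_varying L\<^sub>p" and "slowly_varying L\<^sub>m"
    and "brownian_motion P B"
    and "\<And>\<epsilon>. \<epsilon> > 0 \<Longrightarrow> poisson_random_measure P (N \<epsilon>) (jump_compensator (1 / \<epsilon>) \<nu>)"
    and "\<And>\<epsilon>. \<epsilon> > 0 \<Longrightarrow> indep_process_random_measure P B (N \<epsilon>) (jump_compensator (1 / \<epsilon>) \<nu>)"
    and "\<And>\<epsilon>. \<epsilon> > 0 \<Longrightarrow> compensated_jump_integral P (N \<epsilon>) (jump_compensator (1 / \<epsilon>) \<nu>) (J \<epsilon>)"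
    and "\<And>\<epsilon>. \<epsilon> > 0 \<Longrightarrow>
      AE \<omega> in P. \<forall>t\<in>{0..1}. \<epsilon> * L \<epsilon> t \<omega> = sqrt \<epsilon> * B t \<omega> + \<epsilon> * sk_fun (J \<epsilon> \<omega>) t"
    and "bounded (range b)" and "\<exists>C. C-lipschitz_on UNIV b"
    and "\<And>\<epsilon>. \<epsilon> > 0 \<Longrightarrow> additive_sde_solution P b (\<lambda>t \<omega>. \<epsilon> * L \<epsilon> t \<omega>) (Y \<epsilon>)"
  shows "weak_LDP P Y (jump_rate \<alpha> \<beta> b) (\<lambda>\<epsilon>. ln (1 / \<epsilon>))"
proof -
  have Lp: "0 < L\<^sub>p x" and Lm: "0 < L\<^sub>m x" if "0 < x" for x
    using assms(8,9) that by (auto simp: slowly_varying_def)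
  have pos: "measure \<nu> {x..} = L\<^sub>p x * x powr - \<alpha>" and neg: "measure \<nu> {..- x} = L\<^sub>m x * x powr - \<beta>"
    if "0 < x" for x
    using assms(6,7)[OF that] Lp[OF that] Lm[OF that] by (simp_all add: measure_def)
  have sets: "A \<in> sets \<nu>" if "A \<in> sets borel" "0 \<notin> A" for A
    using assms(5) that unfolding levy_measure_def by (auto simp: sets_restrict_space_iff)
  have up: "regular_tail (\<lambda>x. measure \<nu> {x..}) \<alpha>"
  proof (rule regular_tailI[OF pos assms(8,3)])
    fix x y :: real assume xy: "0 < x" "x \<le> y"
    show "measure \<nu> {y..} \<le> measure \<nu> {x..}"
      unfolding measure_def
    proof (rule enn2real_mono[OF emeasure_mono])
      show "{y..} \<subseteq> {x..}" "{x..} \<in> sets \<nu>" using xy by (auto intro: sets)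
      show "emeasure \<nu> {x..} < top" using assms(6)[OF xy(1)] by simp
    qed
  qed
  have down: "regular_tail (\<lambda>x. measure \<nu> {..- x}) \<beta>"
  proof (rule regular_tailI[OF neg assms(9,4)])
    fix x y :: real assume xy: "0 < x" "x \<le> y"
    show "measure \<nu> {..- y} \<le> measure \<nu> {..- x}"
      unfolding measure_def
    proof (rule enn2real_mono[OF emeasure_mono])
      show "{..- y} \<subseteq> {..- x}" "{..- x} \<in> sets \<nu>" using xy by (auto intro: sets)
      show "emeasure \<nu> {..- x} < top" using assms(7)[OF xy(1)] by simp
    qed
  qed
  have tails: "heavy_tails \<nu> \<alpha> \<beta>"
    by (rule heavy_tails.intro[OF assms(5) up down]) (simp_all add: assms(6,7))
  obtain C0 where C0: "C0-lipschitz_on UNIV b" using assms(16) by blast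
  obtain K where K: "\<forall>u. \<bar>b u\<bar> \<le> K" using assms(15) by (auto simp: bounded_iff)
  have lip: "\<bar>b u - b v\<bar> \<le> (C0 + 1) * \<bar>u - v\<bar>" for u v
  proof -
    have "\<bar>b u - b v\<bar> \<le> C0 * \<bar>u - v\<bar>" using lipschitz_onD[OF C0, of u v] by (simp add: dist_real_def)
    then show ?thesis by (simp add: distrib_right)
  qed
  interpret additive_drift b K "C0 + 1"
    by unfold_locales (use K lip lipschitz_on_nonneg[OF C0] in auto)
  \<comment> \<open>the noise is recovered from the solution, so \<open>Z\<close> has paths in the Skorokhod space everywhere and not only almost surely\<close>
  define Z where "Z \<epsilon> \<omega> = remove_drift (Y \<epsilon> \<omega>)" for \<epsilon> \<omega>
  have Z_eq: "AE \<omega> in P. \<forall>t\<in>{0..1}. sk_fun (Z \<epsilon> \<omega>) t =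
      (sqrt \<epsilon> * B t \<omega> + \<epsilon> * sk_fun (J \<epsilon> \<omega>) t) - (sqrt \<epsilon> * B 0 \<omega> + \<epsilon> * sk_fun (J \<epsilon> \<omega>) 0)"
    if e: "0 < \<epsilon>" for \<epsilon>
  proof -
    have "AE \<omega> in P. \<forall>t\<in>{0..1}. sk_fun (Y \<epsilon> \<omega>) t =
           (LINT s : {0..t} | lborel. b (sk_fun (Y \<epsilon> \<omega>) s)) + (\<epsilon> * L \<epsilon> t \<omega> - \<epsilon> * L \<epsilon> 0 \<omega>)"
      using assms(17)[OF e] unfolding additive_sde_solution_def by auto
    then show ?thesis using assms(14)[OF e]
    proof eventually_elim
      case (elim \<omega>)
      show ?case
      proof
        fix t :: real assume t: "t \<in> {0..1}"
        have "\<epsilon> * L \<epsilon> t \<omega> = sqrt \<epsilon> * B t \<omega> + \<epsilon> * sk_fun (J \<epsilon> \<omega>) t"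
          "\<epsilon> * L \<epsilon> 0 \<omega> = sqrt \<epsilon> * B 0 \<omega> + \<epsilon> * sk_fun (J \<epsilon> \<omega>) 0" using elim(2) t by auto
        moreover have "sk_fun (Y \<epsilon> \<omega>) t = drift (sk_fun (Y \<epsilon> \<omega>)) t + (\<epsilon> * L \<epsilon> t \<omega> - \<epsilon> * L \<epsilon> 0 \<omega>)"
          using elim(1) t unfolding drift_LINT[OF t, symmetric] by blast
        ultimately show "sk_fun (Z \<epsilon> \<omega>) t =
          (sqrt \<epsilon> * B t \<omega> + \<epsilon> * sk_fun (J \<epsilon> \<omega>) t) - (sqrt \<epsilon> * B 0 \<omega> + \<epsilon> * sk_fun (J \<epsilon> \<omega>) 0)"
          unfolding Z_def remove_drift[OF t] by linarith
      qed
    qed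
  qed
  interpret prob_space P by fact
  interpret heavy_tails \<nu> \<alpha> \<beta> by fact
  interpret small_noise P \<nu> \<alpha> \<beta> B N J Z
    by unfold_locales (use assms(10,11,13) Z_eq in auto)
  show ?thesis
  proof (rule weak_LDP_from_local)
    show "0 \<le> jump_rate \<alpha> \<beta> b x" for x using assms(3,4) by (simp add: jump_rate_def)
    show "{\<omega> \<in> space P. Y \<epsilon> \<omega> \<in> G} \<in> events" if "0 < \<epsilon>" "open G" for \<epsilon> G
    proof -
      have "Y \<epsilon> \<in> borel_measurable P"
        using assms(17)[OF that(1)] unfolding additive_sde_solution_def by (intro measurable_skorokhod) auto
      from measurable_sets[OF this borel_open[OF that(2)]] show ?thesis by (simp add: vimage_def Int_def conj_commute)
    qed
    show "\<exists>r>0. \<forall>\<^sub>F \<epsilon> in at_right 0. \<exists>A\<in>events. {\<omega> \<in> space P. dist x (Y \<epsilon> \<omega>) < r} \<subseteq> A \<and> prob A \<le> \<epsilon> powr a"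
      if a: "ereal a < jump_rate \<alpha> \<beta> b x" for x a
    proof -
      from local_upper_bound[OF a[unfolded jump_rate_eq]] obtain r where r: "0 < r" and
        ub: "\<forall>\<^sub>F \<epsilon> in at_right 0. \<exists>A\<in>events. {\<omega> \<in> space P. dist (remove_drift x) (Z \<epsilon> \<omega>) < r} \<subseteq> A \<and> prob A \<le> \<epsilon> powr a"
        by (elim exE conjE) (rule that)
      have "\<exists>d>0. \<forall>y. dist y x < d \<longrightarrow> dist (remove_drift y) (remove_drift x) < r"
        using remove_drift_continuous r unfolding continuous_on_iff by simp
      then obtain d where d: "0 < d" "\<forall>y. dist y x < d \<longrightarrow> dist (remove_drift y) (remove_drift x) < r" by blast
      have "{\<omega> \<in> space P. dist x (Y \<epsilon> \<omega>) < d} \<subseteq> {\<omega> \<in> space P. dist (remove_drift x) (Z \<epsilon> \<omega>) < r}" for \<epsilon>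
        using d(2) by (auto simp: Z_def dist_commute)
      from order_trans[OF this] ub have "\<forall>\<^sub>F \<epsilon> in at_right 0. \<exists>A\<in>events. {\<omega> \<in> space P. dist x (Y \<epsilon> \<omega>) < d} \<subseteq> A \<and> prob A \<le> \<epsilon> powr a"
        by (elim eventually_mono) blast
      then show ?thesis using d(1) by blast
    qed
    show "\<forall>\<^sub>F \<epsilon> in at_right 0. \<exists>A\<in>events. A \<subseteq> {\<omega> \<in> space P. dist x (Y \<epsilon> \<omega>) < r} \<and> \<epsilon> powr a \<le> prob A"
      if a: "jump_rate \<alpha> \<beta> b x < ereal a" and r: "0 < r" for x a r
    proof -
      have "\<exists>d>0. \<forall>y. dist y (remove_drift x) < d \<longrightarrow> dist (solution_map b y) (solution_map b (remove_drift x)) < r"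
        using solution_map_continuous r unfolding continuous_on_iff by blast
      then obtain d where d: "0 < d" "\<forall>y. dist y (remove_drift x) < d \<longrightarrow> dist (solution_map b y) x < r" by auto
      have "{\<omega> \<in> space P. dist (remove_drift x) (Z \<epsilon> \<omega>) < d} \<subseteq> {\<omega> \<in> space P. dist x (Y \<epsilon> \<omega>) < r}" for \<epsilon>
      proof (intro subsetI CollectI conjI)
        fix \<omega> assume w: "\<omega> \<in> {\<omega> \<in> space P. dist (remove_drift x) (Z \<epsilon> \<omega>) < d}"
        then show "\<omega> \<in> space P" by simp
        show "dist x (Y \<epsilon> \<omega>) < r" using d(2)[rule_format, of "Z \<epsilon> \<omega>"] w by (simp add: Z_def dist_commute)
      qed
      note sub = this
      from local_lower_bound[OF a[unfolded jump_rate_eq] d(1)] show ?thesis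
        by (rule eventually_mono) (use sub in blast)
    qed
  qed
qed

end
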